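(* Fix $\alpha>0$. Let $u_0\in H^1(\Omega)$ with $u_0(x)>0$ and $f\in L^{\frac{\alpha+1}{\alpha}}((0,\infty)\times\Omega)\cap L^1((0,\infty)\times\Omega)$ satisfy $$\|u_{0,x}\|_2<|\Omega|^{-\frac12}\,\bar u_0\qquad\text{and}\qquad \|f_x(t,\cdot)\|_2\le|\Omega|^{-\frac32}\int_\Omega f(t,x)\,dx\quad\text{for all }t>0 .$$ Let $u$ be a (global) positive weak solution of $$\begin{cases}u_t+\left(u^{\alpha+2}|u_{xxx}|^{\alpha-1}u_{xxx}\right)_x=f(t,x),&(t,x)\in(0,\infty)\times\Omega,\\ u_x(t,x)=u_{xxx}(t,x)=0,&(t,x)\in(0,\infty)\times\partial\Omega,\\ u(0,x)=u_0(x),&x\in\Omega.\end{cases}$$ Then there exists a constant $C>0$, independent of $t$, such that for $t>0$ $$\int_{\frac t2}^tD[u](s)\,ds\le\frac Ct\int_{\frac t4}^{\frac t2}E[u](s)\,ds+C\left(\int_{\frac t4}^t\|f_x(s,\cdot)\|_2^2\,ds\right)^{\frac12}\left(\int_{\frac t4}^tE[u](s)\,ds\right)^{\frac12}.$$ More specifically, with $0<M_0:=\|u_{0,x}\|_2+\int_0^\infty\|f_x(s,\cdot)\|_2\,ds<+\infty$: (1) If $1<\alpha<\infty$, then $$\begin{aligned}\int_{\frac t2}^tD[u](s)\,ds\le{}&CM_0^2\left(1+CM_0^{\alpha-1}t\right)^{\frac2{1-\alpha}}+C\left(\int_{\frac t2}^t\|f_x(s,\cdot)\|_2\,ds\right)^2\\&+CM_0\left(1+CM_0^{\alpha-1}t\right)^{\frac{3-\alpha}{1-\alpha}}\left(\int_{\frac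 t4}^t\|f_x(s,\cdot)\|_2^2\,ds\right)^{\frac12}\\&+C\left(\int_{\frac t4}^t\|f_x(s,\cdot)\|_2^2\,ds\right)^{\frac12}\left(\int_{\frac t4}^t\left(\int_{\frac s2}^s\|f_x(\tau,\cdot)\|_2\,d\tau\right)^2ds\right)^{\frac12}.\end{aligned}$$ (2) If $0<\alpha\le1$, then $$\begin{aligned}\int_{\frac t2}^tD[u](s)\,ds\le{}&CM_0^2e^{-CM_0^{\alpha-1}t}+C\left(\int_{\frac t2}^t\|f_x(s,\cdot)\|_2\,e^{-CM_0^{\alpha-1}(t-s)}\,ds\right)^2\\&+CM_0e^{-CM_0^{\alpha-1}t}\left(\int_{\frac t4}^t\|f_x(s,\cdot)\|_2^2\,ds\right)^{\frac12}\\&+C\left(\int_{\frac t4}^t\|f_x(s,\cdot)\|_2^2\,ds\right)^{\frac12}\left(\int_{\frac t4}^t\left(\int_{\frac s2}^s\|f_x(\tau,\cdot)\|_2\,e^{-CM_0^{\alpha-1}(s-\tau)}\,d\tau\right)^2ds\right)^{\frac12}.\end{aligned}$$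
   Context: $\Omega=(0,L)$ is a bounded interval, $|\Omega|=L$, $\|\cdot\|_r$ is the norm of $L^r(\Omega)$, subscripts $x,t$ denote (weak) partial derivatives, $u_{0,x}$ is the derivative of $u_0$, and $\bar u_0=\frac1{|\Omega|}\int_\Omega u_0(x)\,dx$. $C$ denotes a generic positive constant, independent of $t$, which may differ at each appearance. Energy functional: $E[u](t)=\frac12\int_\Omega|u_x(t,x)|^2\,dx$. Dissipation functional: $D[u](t)=\int_\Omega u^{\alpha+2}|u_{xxx}|^{\alpha+1}\,dx$ (evaluated at time $t$). For $p\in[1,\infty)$: $W^{k,p}_B(\Omega)=\{v\in W^{k,p}(\Omega): v_x=v_{xxx}=0\text{ on }\partial\Omega\}$ if $3+\frac1p<k\le4$; $W^{k,p}_B(\Omega)=\{v\in W^{k,p}(\Omega): v_x=0\text{ on }\partial\Omega\}$ if $1+\frac1p<k\le3+\frac1p$; $W^{k,p}_B(\Omega)=W^{k,p}(\Omega)$ if $0\le k\le1+\frac1p$. A prime denotes the dual space. Weak solution: for $T>0$, $u_0\in H^1(\Omega)$ and $f\in L^{\frac{\alpha+1}\alpha}((0,T);(W^{1,\alpha+1}_B(\Omega))')$, a function $u\in C([0,T];H^1(\Omega))\cap L^{\alpha+1}((0,T);W^{3,\alpha+1}_B(\Omega))$ with $u_t\in L^{\frac{\alpha+1}\alpha}((0,T);(W^{1,\alpha+1}_B(\Omega))')$ is a weak solution of the problem on $[0,T]\times\Omega$ if (i) for all $\varphi\in L^{\alpha+1}((0,T);W^{1,\alpha+1}_B(\Omega))$,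 $$\int_0^T\!\int_\Omega u_t\varphi\,dx\,dt=\int_0^T\!\int_\Omega u^{\alpha+2}|u_{xxx}|^{\alpha-1}u_{xxx}\varphi_x\,dx\,dt+\int_0^T\!\int_\Omega f\varphi\,dx\,dt$$ (integrals against $u_t$ and $f$ being understood as duality pairings), and (ii) $u$ satisfies $u_x=0$ on $\partial\Omega$ and $u(0,\cdot)=u_0$ pointwise. A global weak solution is one that is a weak solution on $[0,T]\times\Omega$ for every $T>0$; it is positive if $u(t,x)>0$ for all $t\ge0$ and $x\in\bar\Omega$. *)

theory Defs
  imports "HOL-Analysis.Analysis"
begin

text \<open>
  The spatial domain is \<open>\<Omega> = (0, L)\<close>. Elements of Lebesgue and Sobolev spaces are represented
  by functions; only the values on the underlying set matter, and only up to null sets, except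
  where a continuous representative is asked for explicitly.
\<close>

definition Lp :: "real \<Rightarrow> 'a::euclidean_space set \<Rightarrow> ('a \<Rightarrow> real) set" where
  "Lp p S = {g. set_borel_measurable lebesgue S g \<and>
                set_integrable lebesgue S (\<lambda>x. \<bar>g x\<bar> powr p)}"

definition Lp_norm :: "real \<Rightarrow> 'a::euclidean_space set \<Rightarrow> ('a \<Rightarrow> real) \<Rightarrow> real" where
  "Lp_norm p S g = (LINT x:S|lebesgue. \<bar>g x\<bar> powr p) powr (1 / p)"

definition test_function :: "real \<Rightarrow> real \<Rightarrow> (real \<Rightarrow> real) \<Rightarrow> bool" where
  "test_function a b \<phi> \<longleftrightarrow>
     (\<forall>k x. (deriv ^^ k) \<phi> differentiable (at x)) \<and>
     (\<exists>c d. a < c \<and> d < b \<and> (\<forall>x. x \<notin> {c..d} \<longrightarrow> \<phi> x = 0))"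

definition locally_integrable :: "real \<Rightarrow> (real \<Rightarrow> real) \<Rightarrow> bool" where
  "locally_integrable L g \<longleftrightarrow> (\<forall>a b. 0 < a \<and> b < L \<longrightarrow> set_integrable lebesgue {a..b} g)"

definition has_weak_deriv :: "real \<Rightarrow> nat \<Rightarrow> (real \<Rightarrow> real) \<Rightarrow> (real \<Rightarrow> real) \<Rightarrow> bool" where
  "has_weak_deriv L j g h \<longleftrightarrow>
     locally_integrable L g \<and> locally_integrable L h \<and>
     (\<forall>\<phi>. test_function 0 L \<phi> \<longrightarrow>
        (LINT x:{0<..<L}|lebesgue. g x * (deriv ^^ j) \<phi> x) =
        (- 1) ^ j * (LINT x:{0<..<L}|lebesgue. h x * \<phi> x))"

text \<open>
  Weak derivatives are unique only up to null sets; everything below depends only on the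
  equivalence class of the chosen one.
\<close>

definition wderiv :: "real \<Rightarrow> nat \<Rightarrow> (real \<Rightarrow> real) \<Rightarrow> real \<Rightarrow> real" where
  "wderiv L j g = (SOME h. has_weak_deriv L j g h)"

definition sobolev :: "real \<Rightarrow> nat \<Rightarrow> real \<Rightarrow> (real \<Rightarrow> real) set" where
  "sobolev L k p = {g. \<forall>j\<le>k. \<exists>h. has_weak_deriv L j g h \<and> h \<in> Lp p {0<..<L}}"

definition sobolev_norm :: "real \<Rightarrow> nat \<Rightarrow> real \<Rightarrow> (real \<Rightarrow> real) \<Rightarrow> real" where
  "sobolev_norm L k p g =
     (\<Sum>j\<le>k. LINT x:{0<..<L}|lebesgue. \<bar>wderiv L j g x\<bar> powr p) powr (1 / p)"

text \<open>Boundary values are those of the continuous representative on \<open>[0, L]\<close>.\<close>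

definition vanishes_on_boundary :: "real \<Rightarrow> (real \<Rightarrow> real) \<Rightarrow> bool" where
  "vanishes_on_boundary L g \<longleftrightarrow>
     (\<exists>w. continuous_on {0..L} w \<and> (AE x in lebesgue. x \<in> {0<..<L} \<longrightarrow> g x = w x) \<and>
          w 0 = 0 \<and> w L = 0)"

text \<open>The space \<open>W\<^sup>k\<^sup>,\<^sup>p\<^sub>B\<close>, for integers \<open>k \<le> 4\<close>.\<close>

definition sobolev_B :: "real \<Rightarrow> nat \<Rightarrow> real \<Rightarrow> (real \<Rightarrow> real) set" where
  "sobolev_B L k p =
     {v \<in> sobolev L k p.
        (1 + 1 / p < real k \<longrightarrow> vanishes_on_boundary L (wderiv L 1 v)) \<and>
        (3 + 1 / p < real k \<longrightarrow> vanishes_on_boundary L (wderiv L 3 v))}"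

text \<open>
  \<open>H\<^sup>1(0, L)\<close>, whose elements are identified with their representatives that are continuous on
  \<open>[0, L]\<close>. This makes pointwise conditions such as positivity meaningful.
\<close>

definition H1 :: "real \<Rightarrow> (real \<Rightarrow> real) set" where
  "H1 L = {g \<in> sobolev L 1 2. continuous_on {0..L} g}"

text \<open>
  A (semi)normed space is given by a carrier \<open>X\<close> and a function \<open>N\<close> that is a norm on \<open>X\<close> modulo
  equality almost everywhere. Functionals are total functions of which only the restriction to
  \<open>X\<close> matters.
\<close>

definition dual_space ::
  "(real \<Rightarrow> real) set \<Rightarrow> ((real \<Rightarrow> real) \<Rightarrow> real) \<Rightarrow> ((real \<Rightarrow> real) \<Rightarrow> real) set" where
  "dual_space X N = {l.
     (\<forall>v\<in>X. \<forall>w\<in>X. \<forall>a b. l (\<lambda>x. a * v x + b * w x) = a * l v + b * l w) \<and>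
     (\<exists>K. \<forall>v\<in>X. \<bar>l v\<bar> \<le> K * N v)}"

definition dual_norm ::
  "(real \<Rightarrow> real) set \<Rightarrow> ((real \<Rightarrow> real) \<Rightarrow> real) \<Rightarrow> ((real \<Rightarrow> real) \<Rightarrow> real) \<Rightarrow> real" where
  "dual_norm X N l = Sup {\<bar>l v\<bar> | v. v \<in> X \<and> N v \<le> 1}"

text \<open>
  Bochner measurability (almost everywhere limit of simple functions) and the spaces
  \<open>L\<^sup>q(S; X)\<close>. Subtraction is pointwise subtraction of functions or functionals.
\<close>

definition strongly_measurable ::
  "'v::minus set \<Rightarrow> ('v \<Rightarrow> real) \<Rightarrow> real set \<Rightarrow> (real \<Rightarrow> 'v) \<Rightarrow> bool" where
  "strongly_measurable X N S g \<longleftrightarrow>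
     (\<exists>s :: nat \<Rightarrow> real \<Rightarrow> 'v.
        (\<forall>n. s n ` S \<subseteq> X \<and> finite (s n ` S) \<and> (\<forall>v. {t \<in> S. s n t = v} \<in> sets lebesgue)) \<and>
        (AE t in lebesgue. t \<in> S \<longrightarrow> g t \<in> X \<and> (\<lambda>n. N (s n t - g t)) \<longlonglongrightarrow> 0))"

definition bochner_Lp ::
  "real \<Rightarrow> real set \<Rightarrow> 'v::minus set \<Rightarrow> ('v \<Rightarrow> real) \<Rightarrow> (real \<Rightarrow> 'v) set" where
  "bochner_Lp q S X N =
     {g. strongly_measurable X N S g \<and> set_integrable lebesgue S (\<lambda>t. N (g t) powr q)}"

abbreviation Lp_sobolev_B ::
  "real \<Rightarrow> real \<Rightarrow> real \<Rightarrow> nat \<Rightarrow> real \<Rightarrow> (real \<Rightarrow> real \<Rightarrow> real) set" where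
  "Lp_sobolev_B q T L k p \<equiv> bochner_Lp q {0<..<T} (sobolev_B L k p) (sobolev_norm L k p)"

abbreviation Lp_dual_sobolev_B ::
  "real \<Rightarrow> real \<Rightarrow> real \<Rightarrow> nat \<Rightarrow> real \<Rightarrow> (real \<Rightarrow> (real \<Rightarrow> real) \<Rightarrow> real) set" where
  "Lp_dual_sobolev_B q T L k p \<equiv>
     bochner_Lp q {0<..<T}
       (dual_space (sobolev_B L k p) (sobolev_norm L k p))
       (dual_norm (sobolev_B L k p) (sobolev_norm L k p))"

definition C_H1 :: "real \<Rightarrow> real \<Rightarrow> (real \<Rightarrow> real \<Rightarrow> real) set" where
  "C_H1 T L = {u. \<forall>t\<in>{0..T}. u t \<in> H1 L \<and>
     ((\<lambda>s. sobolev_norm L 1 2 (u s - u t)) \<longlongrightarrow> 0) (at t within {0..T})}"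

text \<open>The functional on functions of \<open>x\<close> induced by a function through the \<open>L\<^sup>2\<close> pairing.\<close>

definition functional_of :: "real \<Rightarrow> (real \<Rightarrow> real) \<Rightarrow> (real \<Rightarrow> real) \<Rightarrow> real" where
  "functional_of L g = (\<lambda>v. LINT x:{0<..<L}|lebesgue. g x * v x)"

text \<open>
  \<open>w\<close> is the distributional time derivative of \<open>u\<close> with values in the dual of \<open>X\<close>: the identity
  \<open>\<integral> u \<psi>' dt = - \<integral> w \<psi> dt\<close> in that dual space, evaluated at an arbitrary element of \<open>X\<close>.
\<close>

definition has_weak_time_deriv ::
  "real \<Rightarrow> real \<Rightarrow> (real \<Rightarrow> real) set \<Rightarrow> (real \<Rightarrow> real \<Rightarrow> real) \<Rightarrow>
   (real \<Rightarrow> (real \<Rightarrow> real) \<Rightarrow> real) \<Rightarrow> bool" where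
  "has_weak_time_deriv T L X u w \<longleftrightarrow>
     (\<forall>\<psi> v. test_function 0 T \<psi> \<and> v \<in> X \<longrightarrow>
        (LINT t:{0<..<T}|lebesgue. deriv \<psi> t * functional_of L (u t) v) =
        - (LINT t:{0<..<T}|lebesgue. \<psi> t * w t v))"

text \<open>
  The source is an element \<open>F\<close> of a space of functionals. The condition \<open>u\<^sub>x\<^sub>x\<^sub>x = 0\<close> on the
  boundary is natural: it is encoded in the integral identity, whose test functions are not
  required to vanish on the boundary. The power \<open>u\<^sup>\<alpha>\<^sup>+\<^sup>2\<close> is rendered by \<open>powr\<close>, which is
  meaningful for nonnegative \<open>u\<close>, the only case of interest.
\<close>

definition weak_solution ::
  "real \<Rightarrow> real \<Rightarrow> real \<Rightarrow> (real \<Rightarrow> real) \<Rightarrow> (real \<Rightarrow> (real \<Rightarrow> real) \<Rightarrow> real) \<Rightarrow>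
   (real \<Rightarrow> real \<Rightarrow> real) \<Rightarrow> bool" where
  "weak_solution \<alpha> L T u0 F u \<longleftrightarrow>
     0 < T \<and> u0 \<in> H1 L \<and> F \<in> Lp_dual_sobolev_B ((\<alpha> + 1) / \<alpha>) T L 1 (\<alpha> + 1) \<and>
     u \<in> C_H1 T L \<and> u \<in> Lp_sobolev_B (\<alpha> + 1) T L 3 (\<alpha> + 1) \<and>
     (\<exists>ut \<in> Lp_dual_sobolev_B ((\<alpha> + 1) / \<alpha>) T L 1 (\<alpha> + 1).
        has_weak_time_deriv T L (sobolev_B L 1 (\<alpha> + 1)) u ut \<and>
        (\<forall>\<phi> \<in> Lp_sobolev_B (\<alpha> + 1) T L 1 (\<alpha> + 1).
           (LINT t:{0<..<T}|lebesgue. ut t (\<phi> t)) =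
           (LINT t:{0<..<T}|lebesgue. LINT x:{0<..<L}|lebesgue.
              u t x powr (\<alpha> + 2) * \<bar>wderiv L 3 (u t) x\<bar> powr (\<alpha> - 1) * wderiv L 3 (u t) x *
              wderiv L 1 (\<phi> t) x) +
           (LINT t:{0<..<T}|lebesgue. F t (\<phi> t)))) \<and>
     (AE t in lebesgue. t \<in> {0<..<T} \<longrightarrow> vanishes_on_boundary L (wderiv L 1 (u t))) \<and>
     (\<forall>x\<in>{0..L}. u 0 x = u0 x)"

definition global_weak_solution ::
  "real \<Rightarrow> real \<Rightarrow> (real \<Rightarrow> real) \<Rightarrow> (real \<Rightarrow> (real \<Rightarrow> real) \<Rightarrow> real) \<Rightarrow>
   (real \<Rightarrow> real \<Rightarrow> real) \<Rightarrow> bool" where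
  "global_weak_solution \<alpha> L u0 F u \<longleftrightarrow> (\<forall>T>0. weak_solution \<alpha> L T u0 F u)"

definition positive_on :: "real \<Rightarrow> (real \<Rightarrow> real \<Rightarrow> real) \<Rightarrow> bool" where
  "positive_on L u \<longleftrightarrow> (\<forall>t\<ge>0. \<forall>x\<in>{0..L}. 0 < u t x)"

text \<open>
  Energy and dissipation of a single profile \<open>v = u(t, \<cdot>)\<close>, with values in \<open>[0, \<infinity>]\<close> because the
  dissipation of \<open>u(t, \<cdot>)\<close> is known to be finite only for almost every \<open>t\<close>.
\<close>

definition energy :: "real \<Rightarrow> (real \<Rightarrow> real) \<Rightarrow> ennreal" where
  "energy L v = ennreal (1 / 2) * (\<integral>\<^sup>+x\<in>{0<..<L}. ennreal (\<bar>wderiv L 1 v x\<bar>\<^sup>2) \<partial>lebesgue)"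

definition dissipation :: "real \<Rightarrow> real \<Rightarrow> (real \<Rightarrow> real) \<Rightarrow> ennreal" where
  "dissipation L \<alpha> v =
     (\<integral>\<^sup>+x\<in>{0<..<L}. ennreal (v x powr (\<alpha> + 2) * \<bar>wderiv L 3 v x\<bar> powr (\<alpha> + 1)) \<partial>lebesgue)"

definition mean_value :: "real \<Rightarrow> (real \<Rightarrow> real) \<Rightarrow> real" where
  "mean_value L v = (1 / L) * (LINT x:{0<..<L}|lebesgue. v x)"

definition deriv_norm2 :: "real \<Rightarrow> (real \<Rightarrow> real) \<Rightarrow> real" where
  "deriv_norm2 L v = Lp_norm 2 {0<..<L} (wderiv L 1 v)"

definition M0 :: "real \<Rightarrow> (real \<Rightarrow> real) \<Rightarrow> (real \<Rightarrow> real \<Rightarrow> real) \<Rightarrow> real" where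
  "M0 L u0 f = deriv_norm2 L u0 + (LINT s:{0<..}|lebesgue. deriv_norm2 L (f s))"

definition ennsqrt :: "ennreal \<Rightarrow> ennreal" where
  "ennsqrt a = (if a = \<infinity> then \<infinity> else ennreal (sqrt (enn2real a)))"

end

theory Submission
  imports Defs
begin

text \<open>
  Write \<open>y(t) = \<parallel>u\<^sub>x(t)\<parallel>\<close>, \<open>g(t) = \<parallel>f\<^sub>x(t)\<parallel>\<close> for the \<open>L\<^sup>2\<close>-norms, so that \<open>E = y\<^sup>2 / 2\<close>, and \<open>D\<close> for the
  dissipation. Formally, testing the equation with \<open>-u\<^sub>x\<^sub>x\<close> gives
  \<open>E' + D = \<integral> f\<^sub>x u\<^sub>x \<le> y g\<close>, and testing it with \<open>1\<close> gives \<open>(\<integral> u)' = \<integral> f\<close>. Everything follows from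
  the integrated forms of these two facts, \<open>energy_inequality\<close> and \<open>mass_identity\<close>.

  First estimate. Integrate the energy inequality from \<open>s\<close> to \<open>t\<close> and average over
  \<open>s \<in> (t/4, t/2)\<close> (\<open>averaged_dissipation\<close>); the Cauchy-Schwarz inequality in time turns \<open>\<integral> y g\<close> into
  the second term.

  Decay. The energy inequality implies \<open>y(t) \<le> y(s) + \<integral> g\<close> (\<open>norm_bound\<close>), hence \<open>y \<le> M\<^sub>0\<close>. The
  hypothesis \<open>g \<le> L\<^sup>-\<^sup>3\<^sup>/\<^sup>2 \<integral> f\<close> says that any growth of \<open>\<surd>L y\<close> is compensated by the growth of the mean
  value of \<open>u\<close>, and \<open>|u - mean| \<le> \<surd>L y\<close>; hence \<open>u\<close> stays above the positive constant
  \<open>mean(u\<^sub>0) - \<surd>L \<parallel>u\<^sub>0\<^sub>,\<^sub>x\<parallel>\<close> (\<open>positive_floor_le\<close>). With this lower bound and the Poincare inequality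
  \<open>poincare_third_derivative\<close>, the dissipation controls the energy: \<open>D \<ge> \<kappa> y\<^sup>\<alpha>\<^sup>+\<^sup>1\<close> (\<open>coercive\<close>).
  Dividing \<open>y y' + D \<le> y g\<close> by \<open>y\<close> gives \<open>y' + \<kappa> y\<^sup>\<alpha> \<le> g\<close> (\<open>norm_inequality\<close>). For \<open>\<alpha> > 1\<close> comparison with the
  equation \<open>z' = -\<kappa> z\<^sup>\<alpha>\<close> gives algebraic decay up to \<open>\<integral> g\<close> (\<open>gronwall_power\<close>). For \<open>\<alpha> \<le> 1\<close> the bound
  \<open>y \<le> M\<^sub>0\<close> gives \<open>\<kappa> y\<^sup>\<alpha> \<ge> l y\<close> with \<open>l = \<kappa> M\<^sub>0\<^sup>\<alpha>\<^sup>-\<^sup>1\<close>, hence exponential decay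
  (\<open>gronwall_exponential\<close>). In both cases \<open>y(r) \<le> a + m(r)\<close> on \<open>(t/2, t)\<close>, where \<open>a\<close> is the decayed
  initial size and \<open>m(r)\<close> is the possibly damped integral of \<open>g\<close> over \<open>(r/2, r)\<close>. Inserting this in the
  energy inequality on \<open>(t/2, t)\<close> yields \<open>a\<^sup>2 + a \<integral> g + 2 \<integral> g m\<close> (\<open>dissipation_split\<close>), from which the
  stated terms arise: \<open>\<integral> g m\<close> by the Cauchy-Schwarz inequality, and \<open>a \<integral> g\<close> by Young's inequality if
  \<open>\<alpha> > 1\<close> and by the Cauchy-Schwarz inequality if \<open>\<alpha> \<le> 1\<close>, where the exponential in \<open>a\<close> absorbs the length of the interval. The square of \<open>y(t/2)\<close> is handled by
  \<open>source_squared_le_memory\<close>, which bounds the square of an integral of \<open>g\<close> by the same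
  product integral \<open>\<integral> g m\<close>.

  The analytic difficulty is that a weak solution is too irregular for the formal computation: \<open>u\<^sub>t\<close>
  is only a functional, paired with the function \<open>-u\<^sub>x\<^sub>x\<close>, which is merely integrable in time. Since \<open>E\<close> is convex,
  \<open>E(u(t)) - E(u(r)) \<le> \<langle>u(t) - u(r), -u\<^sub>x\<^sub>x(t)\<rangle>\<close> (\<open>energy_convexity\<close>). Dividing by \<open>t - r = h\<close>, integrating
  in time and letting \<open>h \<rightarrow> 0\<close> gives \<open>E(t) - E(s) \<le> \<integral> \<langle>u\<^sub>t, -u\<^sub>x\<^sub>x\<rangle>\<close> (\<open>chain_rule_pairing\<close>). One
  inequality is all that the argument uses, which avoids mollification in time.
\<close>

section \<open>Smooth test functions\<close>

definition smooth :: "(real \<Rightarrow> real) \<Rightarrow> bool" where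
  "smooth f \<longleftrightarrow> (\<forall>k x. (deriv ^^ k) f differentiable (at x))"

text \<open>
  Coinduction: a class of functions closed under differentiation consists of smooth functions. All
  smoothness proofs below exhibit such a class instead of computing higher derivatives.
\<close>

lemma smooth_coinduct:
  assumes "f \<in> S"
    and step: "\<And>f. f \<in> S \<Longrightarrow> \<exists>f'\<in>S. \<forall>x. (f has_real_derivative f' x) (at x)"
  shows "smooth f"
proof -
  have "(deriv ^^ k) f \<in> S" for k
  proof (induction k)
    case (Suc k)
    obtain f' where f': "f' \<in> S" "\<And>x. ((deriv ^^ k) f has_real_derivative f' x) (at x)"
      using step[OF Suc] by blast
    have "deriv ((deriv ^^ k) f) = f'"
      using f'(2) by (auto intro!: ext DERIV_imp_deriv)
    then show ?case using f' by simp
  qed (use assms in simp)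
  then show ?thesis
    unfolding smooth_def using step real_differentiable_def by metis
qed

lemma smooth_deriv: "smooth f \<Longrightarrow> smooth (deriv f)"
  unfolding smooth_def
proof (intro allI)
  fix k x assume "\<forall>k x. (deriv ^^ k) f differentiable at x"
  then have "(deriv ^^ Suc k) f differentiable at x" by blast
  then show "(deriv ^^ k) (deriv f) differentiable at x"
    by (simp add: funpow_swap1)
qed

lemma smooth_has_derivative:
  assumes "smooth f"
  shows "(f has_real_derivative deriv f x) (at x)"
  using assms[unfolded smooth_def, rule_format, of 0 x]
  by (simp add: DERIV_deriv_iff_real_differentiable)

lemma smooth_continuous: "smooth f \<Longrightarrow> continuous_on A f"
  by (meson DERIV_isCont continuous_at_imp_continuous_on smooth_has_derivative)

lemma smooth_antiderivative:
  assumes "smooth f" "\<And>x. (F has_real_derivative f x) (at x)"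
  shows "smooth F"
  by (rule smooth_coinduct[where S = "insert F {f. smooth f}"])
     (use assms smooth_has_derivative smooth_deriv in blast)+

lemma smooth_affine:
  assumes "smooth f"
  shows "smooth (\<lambda>x. f (a * x + b))"
proof (rule smooth_coinduct[where S = "{\<lambda>x. c * f (a * x + b) | c f. smooth f}"])
  show "(\<lambda>x. f (a * x + b)) \<in> {\<lambda>x. c * f (a * x + b) | c f. smooth f}"
    using assms by (intro CollectI exI[of _ 1] exI[of _ f]) auto
next
  fix g assume "g \<in> {\<lambda>x. c * f (a * x + b) | c f. smooth f}"
  then obtain c f where g: "g = (\<lambda>x. c * f (a * x + b))" and f: "smooth f" by blast
  have "(g has_real_derivative (c * a) * deriv f (a * x + b)) (at x)" for x
    unfolding g
    by (auto intro!: derivative_eq_intros DERIV_chain'[OF _ smooth_has_derivative[OF f]])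
  then show "\<exists>f'\<in>{\<lambda>x. c * f (a * x + b) | c f. smooth f}. \<forall>x. (g has_real_derivative f' x) (at x)"
    using smooth_deriv[OF f]
    by (intro bexI[of _ "\<lambda>x. (c * a) * deriv f (a * x + b)"]) auto
qed

text \<open>
  Finite sums of products of smooth functions: the class to which \<open>smooth_coinduct\<close> is applied
  for the product rule.
\<close>

inductive_set product_span :: "(real \<Rightarrow> real) set" where
  prod: "smooth f \<Longrightarrow> smooth g \<Longrightarrow> (\<lambda>x. f x * g x) \<in> product_span"
| add: "p \<in> product_span \<Longrightarrow> q \<in> product_span \<Longrightarrow> (\<lambda>x. p x + q x) \<in> product_span"

lemma product_span_deriv:
  "p \<in> product_span \<Longrightarrow> \<exists>p'\<in>product_span. \<forall>x. (p has_real_derivative p' x) (at x)"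
proof (induction rule: product_span.induct)
  case (prod f g)
  have "((\<lambda>x. f x * g x) has_real_derivative deriv f x * g x + f x * deriv g x) (at x)" for x
    using smooth_has_derivative[OF prod(1)] smooth_has_derivative[OF prod(2)]
    by (auto intro!: derivative_eq_intros)
  moreover have "(\<lambda>x. deriv f x * g x + f x * deriv g x) \<in> product_span"
    using prod smooth_deriv by (intro product_span.intros) auto
  ultimately show ?case by (intro bexI[of _ "\<lambda>x. deriv f x * g x + f x * deriv g x"]) auto
next
  case (add p q)
  then obtain p' q' where "p' \<in> product_span" "\<And>x. (p has_real_derivative p' x) (at x)"
    "q' \<in> product_span" "\<And>x. (q has_real_derivative q' x) (at x)" by blast
  then show ?case
    by (intro bexI[of _ "\<lambda>x. p' x + q' x"] product_span.add) (auto intro!: derivative_eq_intros)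
qed

lemma smooth_mult: "smooth f \<Longrightarrow> smooth g \<Longrightarrow> smooth (\<lambda>x. f x * g x)"
  by (rule smooth_coinduct[OF product_span.prod product_span_deriv])

lemma smooth_const: "smooth (\<lambda>x. c)"
  by (rule smooth_coinduct[where S = "range (\<lambda>c x. c)"]) (auto intro!: exI[of _ 0])

lemma smooth_lincomb: "smooth f \<Longrightarrow> smooth g \<Longrightarrow> smooth (\<lambda>x. f x + c * g x)"
proof (rule smooth_coinduct[OF _ product_span_deriv])
  assume f: "smooth f" and g: "smooth g"
  show "(\<lambda>x. f x + c * g x) \<in> product_span"
    using product_span.add[OF product_span.prod[OF smooth_const[of 1] f]
        product_span.prod[OF smooth_const[of c] g]] by simp
qed

text \<open>
  The family \<open>p(1/x) e\<^sup>-\<^sup>1\<^sup>/\<^sup>x\<close>, with a polynomial \<open>p\<close>, is closed under differentiation, which the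
  single function \<open>e\<^sup>-\<^sup>1\<^sup>/\<^sup>x\<close> is not.
\<close>

definition flat :: "real poly \<Rightarrow> real \<Rightarrow> real" where
  "flat p x = (if 0 < x then poly p (1 / x) * exp (- (1 / x)) else 0)"

lemma poly_exp_minus_tendsto_0:
  "((\<lambda>y::real. poly p y * exp (- y)) \<longlongrightarrow> 0) at_top"
proof -
  have "((\<lambda>y::real. (\<Sum>i\<le>degree p. coeff p i * (y ^ i / exp y))) \<longlongrightarrow> (\<Sum>i\<le>degree p. coeff p i * 0)) at_top"
    by (intro tendsto_sum tendsto_mult tendsto_const tendsto_power_div_exp_0)
  then show ?thesis
    by (simp add: poly_altdef sum_distrib_right exp_minus divide_inverse mult.assoc)
qed

lemma flat_has_derivative:
  "(flat p has_real_derivative flat (pCons 0 (pCons 0 (p - pderiv p))) x) (at x)"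
proof -
  consider "x > 0" | "x < 0" | "x = 0" by linarith
  then show ?thesis
  proof cases
    case 1
    have "((\<lambda>x. poly p (1 / x) * exp (- (1 / x))) has_real_derivative
        flat (pCons 0 (pCons 0 (p - pderiv p))) x) (at x)"
      using 1 unfolding flat_def
      by (auto intro!: derivative_eq_intros DERIV_chain'[OF _ poly_DERIV] simp: field_simps power2_eq_square)
    then show ?thesis
      by (rule DERIV_cong_ev[THEN iffD1, rotated -1])
         (use 1 in \<open>auto simp: flat_def intro!: eventually_mono[OF eventually_gt_at_top[of 0]]
            eventually_nhds[THEN iffD2] exI[of _ "{0<..}"]\<close>)
  next
    case 2
    have "((\<lambda>x. 0::real) has_real_derivative 0) (at x)" by simp
    then have "(flat p has_real_derivative 0) (at x)"
      by (rule DERIV_cong_ev[THEN iffD1, rotated -1])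
         (use 2 in \<open>auto simp: flat_def intro!: eventually_nhds[THEN iffD2] exI[of _ "{..<0}"]\<close>)
    then show ?thesis using 2 by (simp add: flat_def)
  next
    case 3
    have "((\<lambda>h. flat p h / h) \<longlongrightarrow> 0) (at 0)"
    proof (rule filterlim_split_at)
      have "((\<lambda>h. 0) \<longlongrightarrow> (0::real)) (at_left 0)" by simp
      then show "((\<lambda>h. flat p h / h) \<longlongrightarrow> 0) (at_left 0)"
        by (rule Lim_transform_eventually)
           (auto simp: flat_def eventually_at_filter)
      have "((\<lambda>h::real. poly (pCons 0 p) (inverse h) * exp (- inverse h)) \<longlongrightarrow> 0) (at_right 0)"
        by (rule filterlim_compose[OF poly_exp_minus_tendsto_0 filterlim_inverse_at_top_right])
      then show "((\<lambda>h. flat p h / h) \<longlongrightarrow> 0) (at_right 0)"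
        by (rule Lim_transform_eventually)
           (auto simp: flat_def eventually_at_filter field_simps)
    qed
    then show ?thesis
      using 3 by (simp add: has_field_derivative_iff flat_def)
  qed
qed

lemma smooth_flat: "smooth (flat p)"
  by (rule smooth_coinduct[where S = "range flat"]) (use flat_has_derivative in auto)

text \<open>
  The factor \<open>n + 1\<close> steepens the flanks, so that these functions increase to the indicator function of \<open>(a, b)\<close>.
\<close>

definition bump :: "real \<Rightarrow> real \<Rightarrow> nat \<Rightarrow> real \<Rightarrow> real" where
  "bump a b n x = flat 1 (real (Suc n) * (x - a)) * flat 1 (real (Suc n) * (b - x))"

lemma smooth_bump: "smooth (bump a b n)"
proof -
  have "smooth (\<lambda>x. flat 1 (real (Suc n) * x + (- real (Suc n) * a)) *
                    flat 1 ((- real (Suc n)) * x + real (Suc n) * b))"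
    by (intro smooth_mult smooth_affine smooth_flat)
  then show ?thesis
    by (rule back_subst[of smooth]) (auto simp: bump_def algebra_simps fun_eq_iff)
qed

lemma bump_bounds: "0 \<le> bump a b n x" "bump a b n x \<le> 1"
  by (auto simp: bump_def flat_def mult_le_one)

lemma bump_pos: "a < x \<Longrightarrow> x < b \<Longrightarrow> 0 < bump a b n x"
  by (auto simp: bump_def flat_def)

lemma bump_eq_0: "\<not> (a < x \<and> x < b) \<Longrightarrow> bump a b n x = 0"
  by (auto simp: bump_def flat_def zero_less_mult_iff simp del: of_nat_Suc)

lemma bump_tendsto: "(\<lambda>n. bump a b n x) \<longlonglongrightarrow> indicat_real {a<..<b} x"
proof (cases "a < x \<and> x < b")
  case True
  have *: "(\<lambda>n. exp (- (1 / (real (Suc n) * y)))) \<longlonglongrightarrow> exp (- (1 / y * 0))" if "y > 0" for y :: real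
  proof -
    have "(\<lambda>n. exp (- (1 / y * inverse (real (Suc n))))) \<longlonglongrightarrow> exp (- (1 / y * 0))"
      by (intro tendsto_intros LIMSEQ_inverse_real_of_nat)
    then show ?thesis by (simp add: field_simps)
  qed
  have "(\<lambda>n. exp (- (1 / (real (Suc n) * (x - a)))) * exp (- (1 / (real (Suc n) * (b - x))))) \<longlonglongrightarrow> 1"
    using tendsto_mult[OF *[of "x - a"] *[of "b - x"]] True by simp
  then show ?thesis using True by (simp add: bump_def flat_def)
qed (auto simp: bump_eq_0 indicator_def)

lemma test_function_iff:
  "test_function a b \<phi> \<longleftrightarrow> smooth \<phi> \<and> (\<exists>c d. a < c \<and> d < b \<and> (\<forall>x. x \<notin> {c..d} \<longrightarrow> \<phi> x = 0))"
  by (simp add: test_function_def smooth_def)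

lemma test_function_bump: "T0 < a \<Longrightarrow> b < T1 \<Longrightarrow> test_function T0 T1 (bump a b n)"
  unfolding test_function_iff using smooth_bump bump_eq_0[of a _ b n]
  by (intro conjI exI[of _ a] exI[of _ b]) (auto simp: not_le intro!: bump_eq_0)

lemma test_function_deriv: "test_function a b \<phi> \<Longrightarrow> test_function a b (deriv \<phi>)"
proof -
  assume "test_function a b \<phi>"
  then obtain c d where s: "smooth \<phi>" and cd: "a < c" "d < b" "\<And>x. x \<notin> {c..d} \<Longrightarrow> \<phi> x = 0"
    by (auto simp: test_function_iff)
  have "deriv \<phi> x = 0" if "x \<notin> {c..d}" for x
  proof (rule DERIV_imp_deriv)
    have "((\<lambda>x. 0::real) has_real_derivative 0) (at x)" by simp
    then show "(\<phi> has_real_derivative 0) (at x)"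
      by (rule DERIV_cong_ev[THEN iffD1, rotated -1])
         (use that cd(3) in \<open>auto intro!: eventually_nhds[THEN iffD2] exI[of _ "- {c..d}"]\<close>)
  qed
  then show ?thesis using cd s smooth_deriv by (auto simp: test_function_iff)
qed

lemma continuous_on_test_function: "test_function a b \<phi> \<Longrightarrow> continuous_on A \<phi>"
  by (simp add: test_function_iff smooth_continuous)

lemma test_function_lincomb:
  assumes "test_function a b \<phi>" "test_function a b \<eta>"
  shows "test_function a b (\<lambda>x. \<phi> x + c * \<eta> x)"
proof -
  obtain c1 d1 where 1: "smooth \<phi>" "a < c1" "d1 < b" "\<And>x. x \<notin> {c1..d1} \<Longrightarrow> \<phi> x = 0"
    using assms(1) by (auto simp: test_function_iff)
  obtain c2 d2 where 2: "smooth \<eta>" "a < c2" "d2 < b" "\<And>x. x \<notin> {c2..d2} \<Longrightarrow> \<eta> x = 0"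
    using assms(2) by (auto simp: test_function_iff)
  have "\<phi> x + c * \<eta> x = 0" if "x \<notin> {min c1 c2..max d1 d2}" for x
  proof -
    have "x \<notin> {c1..d1}" "x \<notin> {c2..d2}" using that by auto
    then show ?thesis using 1 2 by simp
  qed
  moreover have "a < min c1 c2" "max d1 d2 < b" using 1 2 by auto
  ultimately show ?thesis
    unfolding test_function_iff using smooth_lincomb[OF 1(1) 2(1)] by blast
qed

text \<open>
  The primitive of a test function vanishes to the left of the support, and to the right of it
  exactly because the total integral is zero.
\<close>

lemma test_function_antiderivative:
  assumes \<phi>: "test_function 0 L \<phi>" and zero: "integral {0..L} \<phi> = 0" and L: "0 < L"
  shows "\<exists>\<eta>. test_function 0 L \<eta> \<and> deriv \<eta> = \<phi>"
proof -
  obtain c d where s: "smooth \<phi>" and cd: "0 < c" "d < L" "\<And>x. x \<notin> {c..d} \<Longrightarrow> \<phi> x = 0"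
    using \<phi> by (auto simp: test_function_iff)
  define \<eta> where "\<eta> x = integral {0..x} \<phi>" for x
  have int: "\<phi> integrable_on {u..v}" for u v
    using continuous_on_test_function[OF \<phi>] by (rule integrable_continuous_real)
  have low: "\<eta> x = 0" if "x < c" for x
    unfolding \<eta>_def using that cd by (intro integral_unique has_integral_eq[OF _ has_integral_0]) auto
  have high: "\<eta> x = 0" if "x > d" for x
  proof (cases "x < c")
    case False
    have e0: "integral {min x L..max x L} \<phi> = 0"
    proof (intro integral_unique has_integral_eq[OF _ has_integral_0])
      show "0 = \<phi> y" if "y \<in> {min x L..max x L}" for y
      proof -
        have "d < y" using that \<open>x > d\<close> cd(2) by (auto simp: min_def split: if_splits)
        then show ?thesis using cd(3)[of y] by auto
      qed
    qed
    show ?thesis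
    proof (cases "x \<le> L")
      case True
      have "integral {0..x} \<phi> + integral {x..L} \<phi> = integral {0..L} \<phi>"
        using False True cd by (intro Henstock_Kurzweil_Integration.integral_combine int) auto
      then show ?thesis using e0 zero True by (simp add: \<eta>_def)
    next
      case F: False
      have "integral {0..L} \<phi> + integral {L..x} \<phi> = integral {0..x} \<phi>"
        using F L by (intro Henstock_Kurzweil_Integration.integral_combine int) auto
      then show ?thesis using e0 zero F by (simp add: \<eta>_def)
    qed
  qed (use low in simp)
  have der: "(\<eta> has_real_derivative \<phi> x) (at x)" for x
  proof (cases "x < c")
    case True
    have "((\<lambda>x. 0::real) has_real_derivative 0) (at x)" by simp
    then have "(\<eta> has_real_derivative 0) (at x)"
      by (rule DERIV_cong_ev[THEN iffD1, rotated -1])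
         (use True low in \<open>auto intro!: eventually_nhds[THEN iffD2] exI[of _ "{..<c}"]\<close>)
    then show ?thesis using True cd by simp
  next
    case False
    have "((\<lambda>u. integral {0..u} \<phi>) has_real_derivative \<phi> x) (at x within {0..x+1})"
      using False cd by (intro integral_has_real_derivative continuous_on_test_function[OF \<phi>]) auto
    moreover have "at x within {0..x+1} = at x"
      using False cd by (intro at_within_interior) auto
    ultimately show ?thesis by (simp add: \<eta>_def[abs_def])
  qed
  have "test_function 0 L \<eta>"
    unfolding test_function_iff using smooth_antiderivative[OF s der] cd low high
    by (intro conjI exI[of _ c] exI[of _ d]) (auto simp: not_le)
  moreover have "deriv \<eta> = \<phi>" using der by (auto intro!: ext DERIV_imp_deriv)
  ultimately show ?thesis by blast
qed

section \<open>Absolutely continuous functions\<close>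

lemma absolutely_integrable_AE_cong:
  fixes f g :: "real \<Rightarrow> real"
  assumes f: "f absolutely_integrable_on S" and ae: "AE x in lebesgue. x \<in> S \<longrightarrow> f x = g x"
  shows "g absolutely_integrable_on S" "integral S g = integral S f"
proof -
  define N where "N = {x. \<not> (x \<in> S \<longrightarrow> f x = g x)}"
  have n: "negligible N"
    using ae unfolding N_def by (simp add: completion.AE_iff_null_sets negligible_iff_null_sets)
  have N: "\<And>x. x \<notin> N \<Longrightarrow> x \<in> S \<longrightarrow> f x = g x" by (auto simp: N_def)
  show "g absolutely_integrable_on S"
    by (rule absolutely_integrable_spike[OF f n]) (use N in force)
  show "integral S g = integral S f"
    by (rule integral_spike[OF n]) (use N in force)
qed

lemma integral_lebesgue_on:
  fixes f :: "real \<Rightarrow> real"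
  assumes "f absolutely_integrable_on S" "S \<in> sets lebesgue"
  shows "integrable (lebesgue_on S) f" "integral\<^sup>L (lebesgue_on S) f = integral S f"
proof -
  show "integrable (lebesgue_on S) f"
    using assms absolutely_integrable_imp_integrable by blast
  have "integral\<^sup>L (lebesgue_on S) f = (LINT x:S|lebesgue. f x)"
    using assms(2) by (simp add: integral_restrict_space set_lebesgue_integral_def)
  then show "integral\<^sup>L (lebesgue_on S) f = integral S f"
    using set_lebesgue_integral_eq_integral[OF assms(1)] by simp
qed

lemma absolutely_integrable_iff_integrable:
  fixes f :: "real \<Rightarrow> real"
  assumes "S \<in> sets lebesgue"
  shows "f absolutely_integrable_on S \<longleftrightarrow> integrable (lebesgue_on S) f"
  using assms by (simp add: set_integrable_def integrable_restrict_space)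

lemma AE_lebesgue_on_iff:
  assumes "S \<in> sets lebesgue"
  shows "(AE x in lebesgue_on S. P x) \<longleftrightarrow> (AE x in lebesgue. x \<in> S \<longrightarrow> P x)"
  using assms by (subst AE_restrict_space_iff) auto

lemma AE_lebesgue_neq: "AE x in lebesgue. x \<noteq> (c::real)"
proof -
  have "{c} \<in> null_sets lebesgue"
    using negligible_finite[of "{c}"] unfolding negligible_iff_null_sets by simp
  from AE_not_in[OF this] show ?thesis by simp
qed

lemma integrable_const_Icc: "integrable (lebesgue_on {a..b::real}) (\<lambda>x. c::real)"
  using absolutely_integrable_continuous_real[OF continuous_on_const] by (intro integral_lebesgue_on) auto

text \<open>
  Truncate at height \<open>m\<close> first; then the continuous functions that converge almost everywhere can be
  truncated at the same height, and dominated convergence applies on the bounded interval.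
\<close>

lemma L1_approx_continuous:
  fixes f :: "real \<Rightarrow> real"
  assumes f: "f absolutely_integrable_on {a..b}" and e: "0 < e"
  obtains c where "continuous_on UNIV c" "integral {a..b} (\<lambda>x. \<bar>f x - c x\<bar>) < e"
proof -
  let ?M = "lebesgue_on {a..b}"
  define cl where "cl m y = max (- real m) (min (real m) y)" for m y
  have fi: "integrable ?M f" and fm[measurable]: "f \<in> borel_measurable ?M"
    using integral_lebesgue_on[OF f] by auto
  have clm[measurable]: "(\<lambda>x. cl m (f x)) \<in> borel_measurable ?M" for m
    unfolding cl_def by measurable
  have "(\<lambda>m. \<integral>x. \<bar>f x - cl m (f x)\<bar> \<partial>?M) \<longlonglongrightarrow> (\<integral>x. 0 \<partial>?M)"
  proof (rule integral_dominated_convergence[where w = "\<lambda>x. \<bar>f x\<bar>"])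
    show "AE x in ?M. (\<lambda>m. \<bar>f x - cl m (f x)\<bar>) \<longlonglongrightarrow> 0"
    proof (rule AE_I2)
      fix x
      have "eventually (\<lambda>m. \<bar>f x - cl m (f x)\<bar> = 0) sequentially"
        using eventually_ge_at_top[of "nat \<lceil>\<bar>f x\<bar>\<rceil>"]
        by eventually_elim (auto simp: cl_def nat_ceiling_le_eq)
      then show "(\<lambda>m. \<bar>f x - cl m (f x)\<bar>) \<longlonglongrightarrow> 0" by (rule tendsto_eventually)
    qed
  qed (use fi in \<open>auto simp: cl_def\<close>)
  then have "eventually (\<lambda>m. (\<integral>x. \<bar>f x - cl m (f x)\<bar> \<partial>?M) < e / 2) sequentially"
    using e by (intro order_tendstoD) auto
  then obtain m where m: "(\<integral>x. \<bar>f x - cl m (f x)\<bar> \<partial>?M) < e / 2"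
    using eventually_happens'[OF sequentially_bot] by blast
  have "f measurable_on {a..b}"
    using fm by (subst measurable_on_iff_borel_measurable) auto
  then obtain N g where N: "negligible N" and g: "\<And>n. continuous_on UNIV (g n)"
    and lim: "\<And>x. x \<notin> N \<Longrightarrow> (\<lambda>n. g n x) \<longlonglongrightarrow> (if x \<in> {a..b} then f x else 0)"
    unfolding measurable_on_def by blast
  have gc: "continuous_on UNIV (\<lambda>x. cl m (g n x))" for n
    unfolding cl_def using g by (intro continuous_intros) auto
  have gm[measurable]: "(\<lambda>x. cl m (g n x)) \<in> borel_measurable ?M" for n
    by (rule continuous_imp_measurable_on_sets_lebesgue[OF continuous_on_subset[OF gc]]) auto
  have "(\<lambda>n. \<integral>x. \<bar>cl m (f x) - cl m (g n x)\<bar> \<partial>?M) \<longlonglongrightarrow> (\<integral>x. 0 \<partial>?M)"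
  proof (rule integral_dominated_convergence[where w = "\<lambda>x. 2 * real m"])
    have "AE x in lebesgue. x \<notin> N"
      using N by (simp add: AE_not_in negligible_iff_null_sets)
    then have "AE x in ?M. x \<notin> N"
      by (subst AE_lebesgue_on_iff) auto
    then show "AE x in ?M. (\<lambda>n. \<bar>cl m (f x) - cl m (g n x)\<bar>) \<longlonglongrightarrow> 0"
    proof (rule AE_mp, intro AE_I2 impI)
      fix x assume "x \<in> space ?M" "x \<notin> N"
      then have "(\<lambda>n. g n x) \<longlonglongrightarrow> f x" using lim[of x] by auto
      then have "(\<lambda>n. \<bar>cl m (f x) - cl m (g n x)\<bar>) \<longlonglongrightarrow> \<bar>cl m (f x) - cl m (f x)\<bar>"
        unfolding cl_def by (intro tendsto_intros)
      then show "(\<lambda>n. \<bar>cl m (f x) - cl m (g n x)\<bar>) \<longlonglongrightarrow> 0" by simp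
    qed
    show "AE x in ?M. norm \<bar>cl m (f x) - cl m (g n x)\<bar> \<le> 2 * real m" for n
      by (intro AE_I2) (auto simp: cl_def)
      show "(\<lambda>x. 0) \<in> borel_measurable ?M" by simp
    show "(\<lambda>x. \<bar>cl m (f x) - cl m (g n x)\<bar>) \<in> borel_measurable ?M" for n by measurable
  qed (rule integrable_const_Icc)
  then have "eventually (\<lambda>n. (\<integral>x. \<bar>cl m (f x) - cl m (g n x)\<bar> \<partial>?M) < e / 2) sequentially"
    using e by (intro order_tendstoD) auto
  then obtain n where n: "(\<integral>x. \<bar>cl m (f x) - cl m (g n x)\<bar> \<partial>?M) < e / 2"
    using eventually_happens'[OF sequentially_bot] by blast
  let ?c = "\<lambda>x. cl m (g n x)"
  have i1: "integrable ?M (\<lambda>x. \<bar>f x - cl m (f x)\<bar>)"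
    by (rule Bochner_Integration.integrable_bound[OF integrable_abs[OF fi]]) (auto simp: cl_def)
  have i2: "integrable ?M (\<lambda>x. \<bar>cl m (f x) - ?c x\<bar>)"
    by (rule Bochner_Integration.integrable_bound[of _ "\<lambda>x. 2 * real m"])
      (use integrable_const_Icc in \<open>measurable, auto simp: cl_def\<close>)
  have ci: "?c absolutely_integrable_on {a..b}"
    using gc by (intro absolutely_integrable_continuous_real continuous_on_subset[OF gc]) auto
  have "(\<lambda>x. f x - ?c x) absolutely_integrable_on {a..b}"
    using f ci by (rule set_integral_diff(1))
  then have fc: "(\<lambda>x. \<bar>f x - ?c x\<bar>) absolutely_integrable_on {a..b}"
    by (rule set_integrable_abs)
  have "integral {a..b} (\<lambda>x. \<bar>f x - ?c x\<bar>) = (\<integral>x. \<bar>f x - ?c x\<bar> \<partial>?M)"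
    using integral_lebesgue_on[OF fc] by simp
  also have "\<dots> \<le> (\<integral>x. \<bar>f x - cl m (f x)\<bar> + \<bar>cl m (f x) - ?c x\<bar> \<partial>?M)"
    using integral_lebesgue_on[OF fc] by (intro integral_mono Bochner_Integration.integrable_add i1 i2) auto
  also have "\<dots> < e" using m n by (simp add: i1 i2)
  finally show ?thesis using that[OF gc] by blast
qed

lemma integral_shift_difference:
  fixes F :: "real \<Rightarrow> real"
  assumes F: "continuous_on {a..b} F" and h: "0 \<le> h" "a \<le> s - h" and st: "s \<le> t" "t \<le> b"
  shows "integral {s..t} (\<lambda>x. F x - F (x - h)) = integral {t - h..t} F - integral {s - h..s} F"
proof -
  have int: "F integrable_on {u..v}" if "a \<le> u" "v \<le> b" for u v
    using that by (intro integrable_continuous_real continuous_on_subset[OF F]) auto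
  have "((\<lambda>x. F (1 * x + (- h))) has_integral (integral {s-h..t-h} F /\<^sub>R \<bar>1\<bar> ^ DIM(real)))
      ((\<lambda>x. inverse 1 *\<^sub>R x - inverse 1 *\<^sub>R (- h)) ` cbox (s - h) (t - h))"
    using has_integral_affinity[of F "integral {s-h..t-h} F" "s-h" "t-h" 1 "-h"]
      integrable_integral[OF int[of "s-h" "t-h"]] h st by simp
  moreover have "(\<lambda>x. inverse 1 *\<^sub>R x - inverse 1 *\<^sub>R (- h)) ` cbox (s - h) (t - h) = {s..t}"
    by (auto simp: image_iff intro!: bexI[of _ "_ - h"])
  ultimately have sh: "((\<lambda>x. F (x - h)) has_integral integral {s-h..t-h} F) {s..t}"
    by simp
  have "integral {s-h..s} F + integral {s..t} F = integral {s-h..t} F"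
    "integral {s-h..t-h} F + integral {t-h..t} F = integral {s-h..t} F"
    using h st by (auto intro!: Henstock_Kurzweil_Integration.integral_combine int)
  moreover have "integral {s..t} (\<lambda>x. F x - F (x - h)) = integral {s..t} F - integral {s-h..t-h} F"
    using sh int[of s t] h st by (auto simp: has_integral_iff integral_diff)
  ultimately show ?thesis by simp
qed

text \<open>
  \<open>F\<close> is absolutely continuous with density \<open>f\<close>. Keeping \<open>f\<close> as an argument avoids any appeal
  to differentiation almost everywhere: all statements are about increments of \<open>F\<close>.
\<close>

definition AC :: "real \<Rightarrow> real \<Rightarrow> (real \<Rightarrow> real) \<Rightarrow> (real \<Rightarrow> real) \<Rightarrow> bool" where
  "AC a b F f \<longleftrightarrow> f absolutely_integrable_on {a..b} \<and> (\<forall>x\<in>{a..b}. F x - F a = integral {a..x} f)"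

lemma AC_integrable:
  assumes "AC a b F f" "a \<le> u" "v \<le> b"
  shows "f absolutely_integrable_on {u..v}"
  by (rule absolutely_integrable_on_subinterval[where S = "{a..b}"]) (use assms in \<open>auto simp: AC_def\<close>)

lemma AC_diff:
  assumes F: "AC a b F f" and "a \<le> u" "u \<le> v" "v \<le> b"
  shows "F v - F u = integral {u..v} f"
proof -
  have "integral {a..u} f + integral {u..v} f = integral {a..v} f"
    using assms(2-4) AC_integrable[OF F, of a v]
    by (intro Henstock_Kurzweil_Integration.integral_combine)
      (auto simp: absolutely_integrable_on_def)
  moreover have "F u - F a = integral {a..u} f" "F v - F a = integral {a..v} f"
    using assms unfolding AC_def by auto
  ultimately show ?thesis by simp
qed

lemma AC_I:
  assumes "f absolutely_integrable_on {a..b}"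
    and "\<And>x. a \<le> x \<Longrightarrow> x \<le> b \<Longrightarrow> F x - F a = integral {a..x} f"
  shows "AC a b F f"
  unfolding AC_def using assms by auto

lemma AC_primitive:
  assumes "f absolutely_integrable_on {a..b}"
  shows "AC a b (\<lambda>x. integral {a..x} f) f"
  using assms by (intro AC_I) auto

lemma AC_continuous_on: "AC a b F f \<Longrightarrow> continuous_on {a..b} F"
proof -
  assume F: "AC a b F f"
  have "continuous_on {a..b} (\<lambda>x. F a + integral {a..x} f)"
    using AC_integrable[OF F, of a b] absolutely_integrable_on_def
    by (intro continuous_intros indefinite_integral_continuous_1) auto
  then show ?thesis by (rule continuous_on_eq) (use AC_def F in force)
qed

lemma AC_abs_bound:
  assumes F: "AC a b F f" and "a \<le> u" "u \<le> v" "v \<le> b"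
  shows "\<bar>F v - F u\<bar> \<le> integral {u..v} (\<lambda>x. \<bar>f x\<bar>)"
  unfolding AC_diff[OF assms]
  using AC_integrable[OF F assms(2,4)]
  
  by (subst real_norm_def[symmetric], intro integral_norm_bound_integral) (auto simp: absolutely_integrable_on_def)

lemma AC_of_derivative:
  assumes "\<And>x. x \<in> {a..b} \<Longrightarrow> (F has_real_derivative f x) (at x)" "continuous_on {a..b} f"
  shows "AC a b F f"
proof (rule AC_I)
  show "f absolutely_integrable_on {a..b}" using assms(2) by (rule absolutely_integrable_continuous_real)
  fix x assume x: "a \<le> x" "x \<le> b"
  have "(f has_integral (F x - F a)) {a..x}"
    using x assms(1) by (intro fundamental_theorem_of_calculus)
      (auto simp: has_real_derivative_iff_has_vector_derivative[symmetric] intro: has_field_derivative_at_within)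
  then show "F x - F a = integral {a..x} f" by (simp add: integral_unique)
qed

lemma AC_lincomb:
  assumes F: "AC a b F f" and G: "AC a b G g"
  shows "AC a b (\<lambda>x. c * F x + d * G x) (\<lambda>x. c * f x + d * g x)"
proof (rule AC_I)
  show "(\<lambda>x. c * f x + d * g x) absolutely_integrable_on {a..b}"
    using F G by (auto simp: AC_def)
  fix x assume x: "a \<le> x" "x \<le> b"
  have "f integrable_on {a..x}" "g integrable_on {a..x}"
    using AC_integrable[OF F, of a x] AC_integrable[OF G, of a x] x
    by (auto simp: absolutely_integrable_on_def)
  then have "integral {a..x} (\<lambda>x. c * f x + d * g x) = c * integral {a..x} f + d * integral {a..x} g"
    by (subst integral_add) (auto intro!: integrable_on_mult_right)
  then show "c * F x + d * G x - (c * F a + d * G a) = integral {a..x} (\<lambda>x. c * f x + d * g x)"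
    using AC_diff[OF F, of a x] AC_diff[OF G, of a x] x by (simp add: algebra_simps)
qed

text \<open>
  Bisection turns an inequality between increments that holds up to an error \<open>\<epsilon> \<integral> \<mu>\<close> near every
  point into one on the whole interval. It replaces, for increments and integrable densities, the argument that
  a function is determined by its derivative. The product rule, the chain rule and the linear
  Gronwall inequality below are all instances.
\<close>

lemma local_to_global_inequality:
  fixes Q :: "real \<Rightarrow> real"
  assumes ab: "a \<le> b" and m: "m integrable_on {a..b}" and mu: "\<mu> integrable_on {a..b}"
    and loc: "\<And>\<epsilon> x. 0 < \<epsilon> \<Longrightarrow> x \<in> {a..b} \<Longrightarrow> \<exists>d>0. \<forall>u v. a \<le> u \<and> u \<le> x \<and> x \<le> v \<and> v \<le> b \<and> v - u < d \<longrightarrow>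
       Q v - Q u \<le> integral {u..v} m + \<epsilon> * integral {u..v} \<mu>"
  shows "Q b - Q a \<le> integral {a..b} m"
proof -
  have *: "Q b - Q a \<le> integral {a..b} m + \<epsilon> * integral {a..b} \<mu>" if e: "0 < \<epsilon>" for \<epsilon>
  proof -
    define P where "P u v \<longleftrightarrow> (a \<le> u \<and> v \<le> b \<longrightarrow> Q v - Q u \<le> integral {u..v} m + \<epsilon> * integral {u..v} \<mu>)" for u v
    \<comment> \<open>bisection: the property is additive in the interval and holds for short intervals around every point\<close>
    have "P a b"
    proof (rule Bolzano[OF ab])
      fix u v w assume 1: "P u v" "P v w" "u \<le> v" "v \<le> w"
      show "P u w" unfolding P_def
      proof
        assume uw: "a \<le> u \<and> w \<le> b"
        have i: "f integrable_on {u..w}" if "f integrable_on {a..b}" for f :: "real \<Rightarrow> real"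
          using that uw by (auto intro: integrable_on_subinterval)
        have "integral {u..v} f + integral {v..w} f = integral {u..w} f"
          if "f integrable_on {a..b}" for f :: "real \<Rightarrow> real"
          using 1 i[OF that] by (intro Henstock_Kurzweil_Integration.integral_combine) auto
        from this[OF m] this[OF mu]
        have e1: "integral {u..w} m = integral {u..v} m + integral {v..w} m"
          and e2: "integral {u..w} \<mu> = integral {u..v} \<mu> + integral {v..w} \<mu>" by simp_all
        have "Q v - Q u \<le> integral {u..v} m + \<epsilon> * integral {u..v} \<mu>"
          "Q w - Q v \<le> integral {v..w} m + \<epsilon> * integral {v..w} \<mu>" using 1 uw by (auto simp: P_def)
        then show "Q w - Q u \<le> integral {u..w} m + \<epsilon> * integral {u..w} \<mu>"
          unfolding e1 e2 distrib_left by linarith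
      qed
    next
      fix x assume \<open>a \<le> x\<close> \<open>x \<le> b\<close>
      show "\<exists>d>0. \<forall>u v. u \<le> x \<and> x \<le> v \<and> v - u < d \<longrightarrow> P u v"
      proof -
        obtain d where "d > 0" and d: "\<And>u v. a \<le> u \<and> u \<le> x \<and> x \<le> v \<and> v \<le> b \<and> v - u < d \<Longrightarrow>
            Q v - Q u \<le> integral {u..v} m + \<epsilon> * integral {u..v} \<mu>"
          using loc[OF e, of x] \<open>a \<le> x\<close> \<open>x \<le> b\<close> by auto
        then show ?thesis unfolding P_def by blast
      qed
    qed
    then show ?thesis by (simp add: P_def)
  qed
  have "((\<lambda>\<epsilon>. integral {a..b} m + \<epsilon> * integral {a..b} \<mu>) \<longlongrightarrow> integral {a..b} m + 0 * integral {a..b} \<mu>) (at_right 0)"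
    by (intro tendsto_intros)
  then show ?thesis
  proof -
    assume lim: "((\<lambda>\<epsilon>. integral {a..b} m + \<epsilon> * integral {a..b} \<mu>) \<longlongrightarrow> integral {a..b} m + 0 * integral {a..b} \<mu>) (at_right 0)"
    have "eventually (\<lambda>\<epsilon>. Q b - Q a \<le> integral {a..b} m + \<epsilon> * integral {a..b} \<mu>) (at_right (0::real))"
      using eventually_at_right_less by eventually_elim (rule *)
    from tendsto_lowerbound[OF lim this] show ?thesis by simp
  qed
qed

lemma mult_le_bound_abs: "\<bar>a\<bar> \<le> e \<Longrightarrow> a * b \<le> e * \<bar>b\<bar>" for a b e :: real
proof -
  assume "\<bar>a\<bar> \<le> e"
  then have "\<bar>a * b\<bar> \<le> e * \<bar>b\<bar>" unfolding abs_mult by (rule mult_right_mono) simp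
  then show "a * b \<le> e * \<bar>b\<bar>" by linarith
qed

text \<open>
  Freezing a factor at an end point of a short interval costs its oscillation there times the
  integral of the density of the other factor.
\<close>

lemma AC_product_le:
  assumes ab: "a \<le> b" and F: "AC a b F f" and G: "AC a b G g"
  shows "F b * G b - F a * G a \<le> integral {a..b} (\<lambda>x. F x * g x + f x * G x)"
proof (rule local_to_global_inequality[OF ab, where \<mu> = "\<lambda>x. \<bar>f x\<bar> + \<bar>g x\<bar>"])
  have cF: "continuous_on {a..b} F" and cG: "continuous_on {a..b} G"
    using F G AC_continuous_on by auto
  have bm: "(\<lambda>x. k x * H x) absolutely_integrable_on {u..v}"
    if "continuous_on {a..b} H" "k absolutely_integrable_on {a..b}" "a \<le> u" "v \<le> b" for H k :: "real \<Rightarrow> real" and u v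
  proof -
    have "(\<lambda>x. H x * k x) absolutely_integrable_on {a..b}"
      using that by (intro absolutely_integrable_bounded_measurable_product_real
          continuous_imp_measurable_on_sets_lebesgue compact_imp_bounded compact_continuous_image) auto
    then show ?thesis
      using that by (auto simp: mult.commute intro: absolutely_integrable_on_subinterval)
  qed
  have fi: "f absolutely_integrable_on {a..b}" and gi: "g absolutely_integrable_on {a..b}"
    using F G by (auto simp: AC_def)
  have pi: "(\<lambda>x. F x * g x + f x * G x) integrable_on {u..v}" if "a \<le> u" "v \<le> b" for u v
    using bm[OF cF gi that] bm[OF cG fi that]
    by (auto intro!: integrable_add simp: absolutely_integrable_on_def mult.commute)
  then show "(\<lambda>x. F x * g x + f x * G x) integrable_on {a..b}" by simp
  have ab_int: "(\<lambda>x. \<bar>f x\<bar>) integrable_on {u..v}" "(\<lambda>x. \<bar>g x\<bar>) integrable_on {u..v}"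
    "f integrable_on {u..v}" "g integrable_on {u..v}"
    if "a \<le> u" "v \<le> b" for u v
    using AC_integrable[OF F that] AC_integrable[OF G that]
    by (auto simp: absolutely_integrable_on_def)
  then show "(\<lambda>x. \<bar>f x\<bar> + \<bar>g x\<bar>) integrable_on {a..b}" by (auto intro!: integrable_add)
  fix e x :: real assume e: "0 < e" and x: "x \<in> {a..b}"
  obtain d1 where d1: "d1 > 0" "\<And>y. y \<in> {a..b} \<Longrightarrow> dist y x < d1 \<Longrightarrow> dist (F y) (F x) < e / 2"
    using cF x e unfolding continuous_on_iff by (metis half_gt_zero)
  obtain d2 where d2: "d2 > 0" "\<And>y. y \<in> {a..b} \<Longrightarrow> dist y x < d2 \<Longrightarrow> dist (G y) (G x) < e / 2"
    using cG x e unfolding continuous_on_iff by (metis half_gt_zero)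
  show "\<exists>d>0. \<forall>u v. a \<le> u \<and> u \<le> x \<and> x \<le> v \<and> v \<le> b \<and> v - u < d \<longrightarrow>
     F v * G v - F u * G u \<le> integral {u..v} (\<lambda>x. F x * g x + f x * G x) +
       e * integral {u..v} (\<lambda>x. \<bar>f x\<bar> + \<bar>g x\<bar>)"
  proof (intro exI[of _ "min d1 d2"] conjI allI impI, goal_cases)
    case (2 u v)
    then have uv: "a \<le> u" "u \<le> x" "x \<le> v" "v \<le> b" "v - u < min d1 d2" by auto
    have "dist (F y) (F x) < e / 2" "dist (G y) (G x) < e / 2" if "y \<in> {u..v}" for y
      using that uv d1(2)[of y] d2(2)[of y] unfolding dist_real_def
      by (auto simp: abs_less_iff simp del: less_divide_eq_numeral1)
    then have Fc: "\<bar>F y - F z\<bar> \<le> e" and Gc: "\<bar>G y - G z\<bar> \<le> e" if "y \<in> {u..v}" "z \<in> {u..v}" for y z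
      using dist_triangle_half_l[of "F y" "F x" e "F z"] dist_triangle_half_l[of "G y" "G x" e "G z"] that
      by (simp_all flip: dist_real_def add: less_imp_le)
    have "F v * G v - F u * G u = F v * (G v - G u) + (F v - F u) * G u"
      by (simp add: algebra_simps)
    also have "\<dots> = integral {u..v} (\<lambda>x. F v * g x + f x * G u)"
      using uv AC_diff[OF F, of u v] AC_diff[OF G, of u v] ab_int[of u v] by (subst integral_add) (auto intro!: integrable_on_mult_right integrable_on_mult_left)
    also have "\<dots> \<le> integral {u..v} (\<lambda>x. (F x * g x + f x * G x) + e * (\<bar>f x\<bar> + \<bar>g x\<bar>))"
    proof (rule integral_le)
      show "(\<lambda>x. F v * g x + f x * G u) integrable_on {u..v}"
        using uv ab_int[of u v] by (auto intro!: integrable_add integrable_on_mult_right integrable_on_mult_left)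
      show "(\<lambda>x. (F x * g x + f x * G x) + e * (\<bar>f x\<bar> + \<bar>g x\<bar>)) integrable_on {u..v}"
        using uv by (intro integrable_add[OF pi] integrable_on_mult_right integrable_add ab_int) auto
      fix y assume y: "y \<in> {u..v}"
      have "(F v - F y) * g y \<le> e * \<bar>g y\<bar>"
        using Fc[of v y] y uv by (intro mult_le_bound_abs) auto
      moreover have "(G u - G y) * f y \<le> e * \<bar>f y\<bar>"
        using Gc[of u y] y uv by (intro mult_le_bound_abs) auto
      ultimately show "F v * g y + f y * G u \<le> (F y * g y + f y * G y) + e * (\<bar>f y\<bar> + \<bar>g y\<bar>)"
        by (simp add: algebra_simps)
    qed
    also have "\<dots> = integral {u..v} (\<lambda>x. F x * g x + f x * G x) + e * integral {u..v} (\<lambda>x. \<bar>f x\<bar> + \<bar>g x\<bar>)"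
      using integral_add[OF pi[of u v] integrable_on_mult_right[OF integrable_add[OF ab_int(1,2)[of u v]], of e]] uv
      by simp
    finally show ?case .
  qed (use d1 d2 in simp)
qed

lemma absolutely_integrable_continuous_mult:
  fixes H k :: "real \<Rightarrow> real"
  assumes "continuous_on {a..b} H" "k absolutely_integrable_on {a..b}"
  shows "(\<lambda>x. H x * k x) absolutely_integrable_on {a..b}"
  using assms by (intro absolutely_integrable_bounded_measurable_product_real
          continuous_imp_measurable_on_sets_lebesgue compact_imp_bounded compact_continuous_image) auto

text \<open>
  The product rule is an inequality for \<open>F G\<close>; applied also to \<open>(-F) G\<close> it becomes an equality.
\<close>

lemma AC_integration_by_parts:
  assumes ab: "a \<le> b" and F: "AC a b F f" and G: "AC a b G g"
  shows "integral {a..b} (\<lambda>x. F x * g x) = F b * G b - F a * G a - integral {a..b} (\<lambda>x. f x * G x)"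
proof -
  have i1: "(\<lambda>x. F x * g x) integrable_on {a..b}"
    using absolutely_integrable_continuous_mult[OF AC_continuous_on[OF F]] G
    by (auto simp: AC_def absolutely_integrable_on_def)
  have i2: "(\<lambda>x. f x * G x) integrable_on {a..b}"
    using absolutely_integrable_continuous_mult[OF AC_continuous_on[OF G], of f] F
    by (auto simp: AC_def absolutely_integrable_on_def mult.commute)
  have 1: "F b * G b - F a * G a \<le> integral {a..b} (\<lambda>x. F x * g x + f x * G x)"
    by (rule AC_product_le[OF assms])
  have "AC a b (\<lambda>x. - F x) (\<lambda>x. - f x)"
    using AC_lincomb[OF F F, of "-1" 0] by simp
  from AC_product_le[OF ab this G]
  have "- (F b * G b) + F a * G a \<le> integral {a..b} (\<lambda>x. - (F x * g x + f x * G x))"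
    by (simp add: algebra_simps)
  then have 2: "- (F b * G b) + F a * G a \<le> - integral {a..b} (\<lambda>x. F x * g x + f x * G x)"
    by (simp only: integral_neg)
  show ?thesis using 1 2 integral_add[OF i1 i2] by linarith
qed

text \<open>
  Only an upper bound for the increments of \<open>F\<close> is given, so a nondecreasing \<open>\<phi>\<close> is required and the
  result is again an upper bound. This is the form in which the energy inequality is transformed:
  \<open>\<phi>\<close> is a square root in one case and \<open>-w\<^sup>1\<^sup>-\<^sup>\<alpha>\<close> in the other.
\<close>

lemma chain_rule_inequality:
  fixes F \<phi> :: "real \<Rightarrow> real"
  assumes ab: "a \<le> b" and F: "continuous_on {a..b} F" and k: "k absolutely_integrable_on {a..b}"
    and Fk: "\<And>u v. a \<le> u \<Longrightarrow> u \<le> v \<Longrightarrow> v \<le> b \<Longrightarrow> F v - F u \<le> integral {u..v} k"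
    and \<phi>: "\<And>y. y \<in> I \<Longrightarrow> (\<phi> has_real_derivative \<phi>' y) (at y)" and c\<phi>: "continuous_on I \<phi>'"
    and pos: "\<And>y. y \<in> I \<Longrightarrow> 0 \<le> \<phi>' y" and I: "\<And>x. x \<in> {a..b} \<Longrightarrow> F x \<in> I" "is_interval I"
  shows "\<phi> (F b) - \<phi> (F a) \<le> integral {a..b} (\<lambda>x. \<phi>' (F x) * k x)"
proof (rule local_to_global_inequality[OF ab, where \<mu> = "\<lambda>x. \<bar>k x\<bar>"])
  have cc: "continuous_on {a..b} (\<lambda>x. \<phi>' (F x))"
    by (rule continuous_on_compose2[OF c\<phi> F image_subsetI[OF I(1)]])
  have ki: "k absolutely_integrable_on {u..v}" if "a \<le> u" "v \<le> b" for u v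
    using k that by (auto intro: absolutely_integrable_on_subinterval)
  have ci: "(\<lambda>x. \<phi>' (F x) * k x) integrable_on {u..v}" if "a \<le> u" "v \<le> b" for u v
    using absolutely_integrable_continuous_mult[OF continuous_on_subset[OF cc] ki[OF that]] that
    by (auto simp: absolutely_integrable_on_def)
  show "(\<lambda>x. \<phi>' (F x) * k x) integrable_on {a..b}" using ci by simp
  show "(\<lambda>x. \<bar>k x\<bar>) integrable_on {a..b}" using k by (auto simp: absolutely_integrable_on_def)
  fix e x :: real assume e: "0 < e" and x: "x \<in> {a..b}"
  obtain d' where d': "d' > 0" "\<And>y. y \<in> I \<Longrightarrow> dist y (F x) < d' \<Longrightarrow> dist (\<phi>' y) (\<phi>' (F x)) < e / 2"
    using c\<phi> I(1)[OF x] e unfolding continuous_on_iff by (metis half_gt_zero)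
  obtain d where d: "d > 0" "\<And>y. y \<in> {a..b} \<Longrightarrow> dist y x < d \<Longrightarrow> dist (F y) (F x) < d'"
    using F x d'(1) unfolding continuous_on_iff by metis
  show "\<exists>d>0. \<forall>u v. a \<le> u \<and> u \<le> x \<and> x \<le> v \<and> v \<le> b \<and> v - u < d \<longrightarrow>
     \<phi> (F v) - \<phi> (F u) \<le> integral {u..v} (\<lambda>x. \<phi>' (F x) * k x) + e * integral {u..v} (\<lambda>x. \<bar>k x\<bar>)"
  proof (intro exI[of _ d] conjI allI impI, goal_cases)
    case (2 u v)
    then have uv: "a \<le> u" "u \<le> x" "x \<le> v" "v \<le> b" "v - u < d" by auto
    have near: "dist (F y) (F x) < d'" if "y \<in> {u..v}" for y
      using d(2)[of y] that uv by (auto simp: dist_real_def)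
    have seg: "\<exists>\<xi>. \<xi> \<in> I \<and> dist \<xi> (F x) < d' \<and> \<phi> (F v) - \<phi> (F u) = (F v - F u) * \<phi>' \<xi>"
    proof -
      consider "F u = F v" | "F u < F v" | "F v < F u" by linarith
      then show ?thesis
      proof cases
        case 1 then show ?thesis using I(1)[OF x] d'(1) by (intro exI[of _ "F x"]) auto
      next
        case 2
        have sub: "y \<in> I" if "F u \<le> y" "y \<le> F v" for y
          using mem_is_interval_1_I[OF I(2) I(1)[of u] I(1)[of v]] that uv by auto
        obtain z where z: "F u < z" "z < F v" "\<phi> (F v) - \<phi> (F u) = (F v - F u) * \<phi>' z"
          using MVT2[OF 2, of \<phi> \<phi>'] \<phi> sub by blast
        then show ?thesis using sub near[of u] near[of v] uv
          by (intro exI[of _ z]) (auto simp: dist_real_def)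
      next
        case 3
        have sub: "y \<in> I" if "F v \<le> y" "y \<le> F u" for y
          using mem_is_interval_1_I[OF I(2) I(1)[of v] I(1)[of u]] that uv by auto
        obtain z where z: "F v < z" "z < F u" "\<phi> (F u) - \<phi> (F v) = (F u - F v) * \<phi>' z"
          using MVT2[OF 3, of \<phi> \<phi>'] \<phi> sub by blast
        then show ?thesis using sub near[of u] near[of v] uv
          by (intro exI[of _ z]) (auto simp: dist_real_def algebra_simps)
      qed
    qed
    then obtain \<xi> where \<xi>: "\<xi> \<in> I" "dist \<xi> (F x) < d'" "\<phi> (F v) - \<phi> (F u) = (F v - F u) * \<phi>' \<xi>" by blast
    have kk: "k integrable_on {u..v}" "(\<lambda>x. \<bar>k x\<bar>) integrable_on {u..v}"
      using ki[of u v] uv by (auto simp: absolutely_integrable_on_def)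
    have "\<phi> (F v) - \<phi> (F u) \<le> integral {u..v} k * \<phi>' \<xi>"
      unfolding \<xi>(3) using Fk[of u v] uv pos[OF \<xi>(1)] by (intro mult_right_mono) auto
    also have "\<dots> = integral {u..v} (\<lambda>y. k y * \<phi>' \<xi>)" by simp
    also have "\<dots> \<le> integral {u..v} (\<lambda>y. \<phi>' (F y) * k y + e * \<bar>k y\<bar>)"
    proof (rule integral_le)
      show "(\<lambda>y. k y * \<phi>' \<xi>) integrable_on {u..v}" using kk by (intro integrable_on_mult_left)
      show "(\<lambda>y. \<phi>' (F y) * k y + e * \<bar>k y\<bar>) integrable_on {u..v}"
        using kk ci[of u v] uv by (intro integrable_add integrable_on_mult_right) auto
      fix y assume y: "y \<in> {u..v}"
      have "dist (\<phi>' \<xi>) (\<phi>' (F x)) < e / 2" "dist (\<phi>' (F y)) (\<phi>' (F x)) < e / 2"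
        using d'(2)[OF \<xi>(1,2)] d'(2)[OF I(1) near[OF y]] y uv by auto
      from dist_triangle_half_l[OF this]
      have "\<bar>\<phi>' \<xi> - \<phi>' (F y)\<bar> \<le> e" by (simp add: dist_real_def)
      then have "\<bar>k y * (\<phi>' \<xi> - \<phi>' (F y))\<bar> \<le> \<bar>k y\<bar> * e"
        by (auto simp: abs_mult intro!: mult_left_mono)
      from order_trans[OF abs_ge_self this]
      show "k y * \<phi>' \<xi> \<le> \<phi>' (F y) * k y + e * \<bar>k y\<bar>" by (simp add: algebra_simps)
    qed
    also have "\<dots> = integral {u..v} (\<lambda>x. \<phi>' (F x) * k x) + e * integral {u..v} (\<lambda>x. \<bar>k x\<bar>)"
      using integral_add[OF ci[of u v] integrable_on_mult_right[OF kk(2), of e]] uv by simp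
    finally show ?case .
  qed (use d in simp)
qed

section \<open>Steklov averages and the fundamental lemma\<close>

lemma eventually_at_right_0_less: "0 < (\<delta>::real) \<Longrightarrow> eventually (\<lambda>h. 0 < h \<and> h < \<delta>) (at_right 0)"
  using eventually_at_right_real[of 0 \<delta>] by (auto elim: eventually_mono)

lemma small_window_average:
  fixes F :: "real \<Rightarrow> real"
  assumes F: "continuous_on {a..b} F" and t: "a < t" "t \<le> b"
  shows "((\<lambda>h. integral {t - h..t} F / h) \<longlongrightarrow> F t) (at_right 0)"
proof (rule tendstoI)
  fix e :: real assume e: "0 < e"
  obtain d where d: "d > 0" "\<And>y. y \<in> {a..b} \<Longrightarrow> dist y t < d \<Longrightarrow> dist (F y) (F t) < e / 2"
    using F t e unfolding continuous_on_iff by (metis atLeastAtMost_iff half_gt_zero less_imp_le)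
  have "eventually (\<lambda>h::real. 0 < h \<and> h < min d (t - a)) (at_right 0)"
    using d t by (intro eventually_at_right_0_less) auto
  then show "eventually (\<lambda>h. dist (integral {t - h..t} F / h) (F t) < e) (at_right 0)"
  proof eventually_elim
    case (elim h)
    have int: "F integrable_on {t-h..t}"
      using elim t by (intro integrable_continuous_real continuous_on_subset[OF F]) auto
    have "integral {t-h..t} (\<lambda>x. F x - F t) = integral {t-h..t} F - h * F t"
      using elim by (subst integral_diff[OF int]) auto
    moreover have "norm (integral {t-h..t} (\<lambda>x. F x - F t)) \<le> integral {t-h..t} (\<lambda>x. e / 2)"
    proof (rule integral_norm_bound_integral)
      fix x assume "x \<in> {t-h..t}"
      then have "dist (F x) (F t) < e / 2" using elim t by (intro d(2)) (auto simp: dist_real_def)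
      then show "norm (F x - F t) \<le> e / 2" by (simp add: dist_real_def)
    qed (use int in \<open>auto intro!: integrable_diff\<close>)
    ultimately have "\<bar>integral {t-h..t} F - h * F t\<bar> \<le> h * (e / 2)" using elim by simp
    then have "\<bar>integral {t-h..t} F - h * F t\<bar> / h \<le> e / 2" using elim by (simp add: field_simps)
    moreover have "\<bar>integral {t-h..t} F - h * F t\<bar> / h = \<bar>integral {t-h..t} F / h - F t\<bar>"
      using elim abs_divide[of "integral {t-h..t} F - h * F t" h] by (simp add: diff_divide_distrib)
    ultimately show ?case using e by (simp add: dist_real_def)
  qed
qed

text \<open>
  The integral of a difference quotient telescopes to two averages of \<open>F\<close> over windows of length \<open>h\<close>.
\<close>

lemma steklov_average_continuous:
  fixes F :: "real \<Rightarrow> real"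
  assumes F: "continuous_on {a..b} F" and st: "a < s" "s \<le> t" "t \<le> b"
  shows "((\<lambda>h. integral {s..t} (\<lambda>x. (F x - F (x - h)) / h)) \<longlongrightarrow> F t - F s) (at_right 0)"
proof -
  have "((\<lambda>h. integral {t - h..t} F / h - integral {s - h..s} F / h) \<longlongrightarrow> F t - F s) (at_right 0)"
    using st by (intro tendsto_diff small_window_average[OF F]) auto
  moreover have "eventually (\<lambda>h::real. 0 < h \<and> h < s - a) (at_right 0)"
    using st by (intro eventually_at_right_0_less) auto
  then have "eventually (\<lambda>h. integral {t - h..t} F / h - integral {s - h..s} F / h =
      integral {s..t} (\<lambda>x. (F x - F (x - h)) / h)) (at_right 0)"
  proof eventually_elim
    case (elim h)
    have "integral {s..t} (\<lambda>x. (F x - F (x - h)) / h) = integral {s..t} (\<lambda>x. F x - F (x - h)) / h" by simp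
    also have "\<dots> = (integral {t - h..t} F - integral {s - h..s} F) / h"
      using integral_shift_difference[OF F, of h s t] st elim by simp
    finally show ?case by (simp only: diff_divide_distrib)
  qed
  ultimately show ?thesis by (rule Lim_transform_eventually)
qed

text \<open>
  For a monotone function the windows at the two ends are controlled by the total increment; the
  bound is uniform in \<open>h\<close>.
\<close>

lemma steklov_average_L1_bound:
  assumes R: "AC a b R r" and pos: "\<And>x. x \<in> {a..b} \<Longrightarrow> 0 \<le> r x"
    and st: "s \<le> t" "t \<le> b" and h: "0 < h" "h \<le> s - a"
  shows "integral {s..t} (\<lambda>x. (R x - R (x - h)) / h) \<le> integral {a..b} r"
proof -
  have mono: "R x \<le> R y" if "a \<le> x" "x \<le> y" "y \<le> b" for x y
    using AC_diff[OF R that] AC_integrable[OF R, of x y] that pos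
      integral_nonneg[of r "{x..y}"] by (auto simp: absolutely_integrable_on_def)
  have cR: "R integrable_on {u..v}" if "a \<le> u" "v \<le> b" for u v
    using that by (intro integrable_continuous_real continuous_on_subset[OF AC_continuous_on[OF R]]) auto
  have "integral {t - h..t} R \<le> integral {t-h..t} (\<lambda>x. R b)"
    using st h mono by (intro integral_le cR) auto
  moreover have "integral {s-h..s} (\<lambda>x. R a) \<le> integral {s-h..s} R"
    using st h mono by (intro integral_le cR) auto
  ultimately have "integral {s..t} (\<lambda>x. R x - R (x - h)) \<le> h * (R b - R a)"
    using integral_shift_difference[OF AC_continuous_on[OF R], of h s t] st h
    by (simp add: algebra_simps)
  then show ?thesis
    using AC_diff[OF R, of a b] st h by (simp add: field_simps)
qed

text \<open>
  Difference quotients of an absolutely continuous function converge to its density in \<open>L\<^sup>1\<close>. For a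
  continuous density this is uniform continuity; the approximation error is
  controlled uniformly in \<open>h\<close> by \<open>steklov_average_L1_bound\<close>. This takes the place of Lebesgue's differentiation theorem.
\<close>

lemma steklov_average_L1:
  assumes K: "AC a b K k" and st: "a < s" "s \<le> t" "t \<le> b"
  shows "((\<lambda>h. integral {s..t} (\<lambda>x. \<bar>(K x - K (x - h)) / h - k x\<bar>)) \<longlongrightarrow> 0) (at_right 0)"
proof (rule tendstoI)
  fix e :: real assume e: "0 < e"
  have k: "k absolutely_integrable_on {a..b}" using K by (simp add: AC_def)
  have "0 < e / 4" using e by simp
  from L1_approx_continuous[OF k this]
  obtain c where c: "continuous_on UNIV c" and ck: "integral {a..b} (\<lambda>x. \<bar>k x - c x\<bar>) < e / 4" by blast
  define r where "r x = \<bar>k x - c x\<bar>" for x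
  have cc: "continuous_on S c" for S using c continuous_on_subset by blast
  have r: "r absolutely_integrable_on {a..b}"
    unfolding r_def using k absolutely_integrable_continuous_real[OF cc]
    by (intro set_integrable_abs set_integral_diff(1)) auto
  define R where "R x = integral {a..x} r" for x
  have R: "AC a b R r" unfolding R_def[abs_def] by (rule AC_primitive[OF r])
  define \<eta> where "\<eta> = e / (4 * (t - s + 1))"
  have \<eta>: "\<eta> > 0" using e st by (simp add: \<eta>_def)
  have "uniformly_continuous_on {a..b} c" using cc by (intro compact_uniformly_continuous) auto
  then obtain d where d: "d > 0" "\<And>x y. x \<in> {a..b} \<Longrightarrow> y \<in> {a..b} \<Longrightarrow> dist y x < d \<Longrightarrow> dist (c y) (c x) < \<eta>"
    using \<eta> unfolding uniformly_continuous_on_def by metis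
  have "eventually (\<lambda>h::real. 0 < h \<and> h < min d (s - a)) (at_right 0)"
    using d st by (intro eventually_at_right_0_less) auto
  then show "eventually (\<lambda>h. dist (integral {s..t} (\<lambda>x. \<bar>(K x - K (x - h)) / h - k x\<bar>)) 0 < e) (at_right 0)"
  proof eventually_elim
    case (elim h)
    then have h: "0 < h" "h < d" "h < s - a" by auto
    have ai: "q absolutely_integrable_on {u..v}" if "q absolutely_integrable_on {a..b}" "a \<le> u" "v \<le> b" for q :: "real \<Rightarrow> real" and u v
      using that(1) by (rule absolutely_integrable_on_subinterval) (use that in auto)
    have ii: "q integrable_on {u..v}" if "q absolutely_integrable_on {a..b}" "a \<le> u" "v \<le> b" for q :: "real \<Rightarrow> real" and u v
      using ai[OF that] by (simp add: absolutely_integrable_on_def)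
    have pointwise: "\<bar>(K x - K (x - h)) / h - k x\<bar> \<le> (R x - R (x - h)) / h + \<eta> + r x"
      if x: "x \<in> {s..t}" for x
    proof -
      have bd: "a \<le> x - h" "x \<le> b" "x - h \<le> x" using x st h by auto
      have ci: "c absolutely_integrable_on {a..b}" by (rule absolutely_integrable_continuous_real[OF cc])
      have e1: "K x - K (x - h) = integral {x-h..x} k" using AC_diff[OF K] bd by auto
      have "integral {x-h..x} (\<lambda>y. k y - c y) = integral {x-h..x} k - integral {x-h..x} c"
        using bd by (intro integral_diff ii k ci) auto
      moreover have "integral {x-h..x} (\<lambda>y. c y - c x) = integral {x-h..x} c - h * c x"
        using h by (subst integral_diff[OF ii[OF ci bd(1,2)]]) auto
      ultimately have e2: "K x - K (x - h) = integral {x-h..x} (\<lambda>y. k y - c y) + integral {x-h..x} (\<lambda>y. c y - c x) + h * c x"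
        using e1 by simp
      have "norm (integral {x-h..x} (\<lambda>y. k y - c y)) \<le> integral {x-h..x} r"
        using bd by (intro integral_norm_bound_integral integrable_diff ii k ci r) (auto simp: r_def)
      then have b1: "\<bar>integral {x-h..x} (\<lambda>y. k y - c y)\<bar> \<le> R x - R (x - h)"
        using AC_diff[OF R] bd by auto
      have "norm (integral {x-h..x} (\<lambda>y. c y - c x)) \<le> integral {x-h..x} (\<lambda>y. \<eta>)"
      proof (intro integral_norm_bound_integral)
        fix y assume "y \<in> {x-h..x}"
        then have "dist (c y) (c x) < \<eta>" using bd h by (intro d(2)) (auto simp: dist_real_def)
        then show "norm (c y - c x) \<le> \<eta>" by (simp add: dist_real_def)
      qed (use bd ii[OF ci] in \<open>auto intro!: integrable_diff\<close>)
      then have b2: "\<bar>integral {x-h..x} (\<lambda>y. c y - c x)\<bar> \<le> h * \<eta>" using h by simp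
      have "\<bar>K x - K (x - h) - h * c x\<bar> \<le> (R x - R (x - h)) + h * \<eta>"
        unfolding e2 using b1 b2 by linarith
      then have "\<bar>K x - K (x - h) - h * c x\<bar> / h \<le> ((R x - R (x - h)) + h * \<eta>) / h"
        using h by (intro divide_right_mono) auto
      moreover have "\<bar>K x - K (x - h) - h * c x\<bar> / h = \<bar>(K x - K (x - h)) / h - c x\<bar>"
        using h abs_divide[of "K x - K (x - h) - h * c x" h] by (simp add: diff_divide_distrib)
      ultimately have "\<bar>(K x - K (x - h)) / h - c x\<bar> \<le> (R x - R (x - h)) / h + \<eta>"
        using h by (simp add: add_divide_distrib)
      then show ?thesis unfolding r_def by linarith
    qed
    have cK: "continuous_on {s..t} (\<lambda>x. (Q x - Q (x - h)) / h)" if "continuous_on {a..b} Q" for Q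
      using h st by (intro continuous_intros continuous_on_subset[OF that] continuous_on_compose2[OF that]) auto
    have i1: "(\<lambda>x. (R x - R (x - h)) / h) integrable_on {s..t}"
      by (intro integrable_continuous_real cK AC_continuous_on[OF R])
    have i2: "(\<lambda>x. \<bar>(K x - K (x - h)) / h - k x\<bar>) absolutely_integrable_on {s..t}"
      using st by (intro set_integrable_abs set_integral_diff(1) ai[OF k]
          absolutely_integrable_continuous_real cK AC_continuous_on[OF K]) auto
    have ri: "r integrable_on {s..t}" using st by (intro ii r) auto
    have "integral {s..t} (\<lambda>x. \<bar>(K x - K (x - h)) / h - k x\<bar>)
        \<le> integral {s..t} (\<lambda>x. (R x - R (x - h)) / h + \<eta> + r x)"
      using pointwise i2 by (intro integral_le integrable_add i1 ri) (auto simp: absolutely_integrable_on_def)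
    also have "\<dots> = integral {s..t} (\<lambda>x. (R x - R (x - h)) / h + \<eta>) + integral {s..t} r"
      by (intro integral_add integrable_add i1 ri integrable_const_ivl)
    also have "\<dots> = integral {s..t} (\<lambda>x. (R x - R (x - h)) / h) + (t - s) * \<eta> + integral {s..t} r"
      using st by (subst integral_add[OF i1]) auto
    also have "\<dots> \<le> integral {a..b} r + e / 4 + integral {a..b} r"
    proof (intro add_mono)
      show "integral {s..t} (\<lambda>x. (R x - R (x - h)) / h) \<le> integral {a..b} r"
        using st h by (intro steklov_average_L1_bound[OF R]) (auto simp: r_def)
      show "(t - s) * \<eta> \<le> e / 4" using st e by (simp add: \<eta>_def field_simps)
      show "integral {s..t} r \<le> integral {a..b} r"
        using st ii[OF r] by (intro integral_subset_le) (auto simp: r_def)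
    qed
    also have "\<dots> < e" using ck e by (simp add: r_def[abs_def])
    finally have "integral {s..t} (\<lambda>x. \<bar>(K x - K (x - h)) / h - k x\<bar>) < e" .
    moreover have "0 \<le> integral {s..t} (\<lambda>x. \<bar>(K x - K (x - h)) / h - k x\<bar>)"
      using i2 by (intro integral_nonneg) (auto simp: absolutely_integrable_on_def)
    ultimately show ?case by simp
  qed
qed

lemma AE_eq_0_of_integral_abs:
  fixes g :: "real \<Rightarrow> real"
  assumes "g absolutely_integrable_on {a..b}" "integral {a..b} (\<lambda>x. \<bar>g x\<bar>) = 0"
  shows "AE x in lebesgue. x \<in> {a..b} \<longrightarrow> g x = 0"
proof -
  have "(\<lambda>x. \<bar>g x\<bar>) absolutely_integrable_on {a..b}" using assms(1) by (rule set_integrable_abs)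
  from integral_lebesgue_on[OF this] have "integrable (lebesgue_on {a..b}) (\<lambda>x. \<bar>g x\<bar>)"
    "integral\<^sup>L (lebesgue_on {a..b}) (\<lambda>x. \<bar>g x\<bar>) = 0" using assms(2) by auto
  then have "AE x in lebesgue_on {a..b}. \<bar>g x\<bar> = 0"
    by (subst (asm) integral_nonneg_eq_0_iff_AE) auto
  then show ?thesis by (subst (asm) AE_lebesgue_on_iff) auto
qed

lemma LINT_supported:
  fixes g \<phi> :: "real \<Rightarrow> real"
  assumes g: "g absolutely_integrable_on {c..d}" and \<phi>: "continuous_on {c..d} \<phi>"
    "\<And>x. x \<notin> {c..d} \<Longrightarrow> \<phi> x = 0" and sub: "{c..d} \<subseteq> S"
  shows "(LINT x:S|lebesgue. g x * \<phi> x) = integral {c..d} (\<lambda>x. g x * \<phi> x)"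
proof -
  have "(LINT x:S|lebesgue. g x * \<phi> x) = (LINT x:{c..d}|lebesgue. g x * \<phi> x)"
    unfolding set_lebesgue_integral_def
    using \<phi>(2) sub by (intro Bochner_Integration.integral_cong) (auto simp: indicator_def)
  also have "\<dots> = integral {c..d} (\<lambda>x. g x * \<phi> x)"
    using absolutely_integrable_continuous_mult[OF \<phi>(1) g]
    by (intro set_lebesgue_integral_eq_integral) (simp add: mult.commute)
  finally show ?thesis .
qed

lemma bump_outside: "x \<notin> {a..b} \<Longrightarrow> bump a b n x = 0"
  by (rule bump_eq_0) auto

text \<open>
  Bump functions show that all integrals of \<open>g\<close> over compact intervals vanish, so that \<open>0\<close> is a
  primitive of \<open>g\<close>; by \<open>steklov_average_L1\<close> its difference quotients converge to \<open>g\<close> in \<open>L\<^sup>1\<close>.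
\<close>

lemma fundamental_lemma:
  fixes g :: "real \<Rightarrow> real"
  assumes loc: "\<And>a b. 0 < a \<Longrightarrow> b < T \<Longrightarrow> g absolutely_integrable_on {a..b}"
    and zero: "\<And>\<phi>. test_function 0 T \<phi> \<Longrightarrow> (LINT x:{0<..<T}|lebesgue. g x * \<phi> x) = 0"
  shows "AE x in lebesgue. x \<in> {0<..<T} \<longrightarrow> g x = 0"
proof -
  have z: "integral {a..b} g = 0" if ab: "0 < a" "a \<le> b" "b < T" for a b
  proof -
    have g: "g absolutely_integrable_on {a..b}" using loc ab by auto
    have "(\<lambda>n. integral {a..b} (\<lambda>x. g x * bump a b n x)) \<longlonglongrightarrow> integral {a..b} (\<lambda>x. g x * indicat_real {a<..<b} x)"
    proof (rule dominated_convergence(2)[where h = "\<lambda>x. \<bar>g x\<bar>"])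
      show "(\<lambda>x. g x * bump a b n x) integrable_on {a..b}" for n
        using absolutely_integrable_continuous_mult[OF smooth_continuous[OF smooth_bump] g]
        by (simp add: absolutely_integrable_on_def mult.commute)
      show "(\<lambda>x. \<bar>g x\<bar>) integrable_on {a..b}" using g by (simp add: absolutely_integrable_on_def)
      show "norm (g x * bump a b n x) \<le> \<bar>g x\<bar>" for n x
        using bump_bounds[of a b n x] by (simp add: abs_mult mult_left_le)
      show "(\<lambda>n. g x * bump a b n x) \<longlonglongrightarrow> g x * indicat_real {a<..<b} x" for x
        by (intro tendsto_intros bump_tendsto)
    qed
    moreover have "integral {a..b} (\<lambda>x. g x * bump a b n x) = 0" for n
    proof -
      have "(LINT x:{0<..<T}|lebesgue. g x * bump a b n x) = integral {a..b} (\<lambda>x. g x * bump a b n x)"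
        using ab by (intro LINT_supported[OF g] smooth_continuous[OF smooth_bump] bump_outside) auto
      then show ?thesis using zero[OF test_function_bump[of 0 a b T n]] ab by simp
    qed
    ultimately have "integral {a..b} (\<lambda>x. g x * indicat_real {a<..<b} x) = 0"
      by (simp add: LIMSEQ_const_iff)
    moreover have "integral {a..b} (\<lambda>x. g x * indicat_real {a<..<b} x) = integral {a..b} g"
      by (rule integral_spike[of "{a, b}"]) auto
    ultimately show ?thesis by simp
  qed
  have "AE x in lebesgue. x \<in> {s..b} \<longrightarrow> g x = 0" if sb: "0 < s" "s \<le> b" "b < T" for s b
  proof -
    have g: "g absolutely_integrable_on {s/2..b}" using loc sb by auto
    \<comment> \<open>the left end is moved to \<open>s/2\<close> because difference quotients on \<open>(s, b)\<close> look back beyond \<open>s\<close>\<close>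
    have K: "AC (s/2) b (\<lambda>x. 0) g"
      using z sb by (intro AC_I g) auto
    have "((\<lambda>h. integral {s..b} (\<lambda>x. \<bar>g x\<bar>)) \<longlongrightarrow> 0) (at_right (0::real))"
      using steklov_average_L1[OF K, of s b] sb by simp
    then have "integral {s..b} (\<lambda>x. \<bar>g x\<bar>) = 0"
      by (simp add: tendsto_const_iff)
    then show ?thesis
      using loc[of s b] sb by (intro AE_eq_0_of_integral_abs) auto
  qed
  note * = this
  have "AE x in lebesgue. x \<in> {1 / real (Suc n)..T - 1 / real (Suc n)} \<longrightarrow> g x = 0" for n
  proof (cases "1 / real (Suc n) \<le> T - 1 / real (Suc n)")
    case True
    then show ?thesis by (intro *) auto
  next
    case False
    then have "{1 / real (Suc n)..T - 1 / real (Suc n)} = {}" by auto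
    then show ?thesis by simp
  qed
  then have "AE x in lebesgue. \<forall>n::nat. x \<in> {1 / real (Suc n)..T - 1 / real (Suc n)} \<longrightarrow> g x = 0"
    by (subst AE_all_countable) blast
  then show ?thesis
  proof (rule AE_mp, intro AE_I2 impI)
    fix x assume *: "\<forall>n::nat. x \<in> {1 / real (Suc n)..T - 1 / real (Suc n)} \<longrightarrow> g x = 0" and x: "x \<in> {0<..<T}"
    then have "0 < min x (T - x)" by auto
    from nat_approx_posE[OF this] obtain n where "1 / real (Suc n) < min x (T - x)" by blast
    then show "g x = 0" using *[rule_format, of n] by auto
  qed
qed

text \<open>
  The argument of du Bois-Reymond: \<open>g\<close> minus the primitive of \<open>h\<close> annihilates all derivatives of
  test functions, that is, all test functions with vanishing integral, and is therefore constant.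
\<close>

lemma weak_derivative_AC:
  assumes L: "0 < L" and g: "g absolutely_integrable_on {0..L}" and h: "h absolutely_integrable_on {0..L}"
    and weak: "\<And>\<phi>. test_function 0 L \<phi> \<Longrightarrow>
       integral {0..L} (\<lambda>x. g x * deriv \<phi> x) = - integral {0..L} (\<lambda>x. h x * \<phi> x)"
  obtains G where "AC 0 L G h" "AE x in lebesgue. x \<in> {0<..<L} \<longrightarrow> g x = G x"
proof -
  define H where "H x = integral {0..x} h" for x
  have H: "AC 0 L H h" unfolding H_def[abs_def] by (rule AC_primitive[OF h])
  have Hi: "H absolutely_integrable_on {0..L}"
    by (rule absolutely_integrable_continuous_real[OF AC_continuous_on[OF H]])
  define q where "q x = g x - H x" for x
  have q: "q absolutely_integrable_on {0..L}"
    unfolding q_def using g Hi by (rule set_integral_diff(1))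
  have mi: "(\<lambda>x. k x * \<phi> x) integrable_on {0..L}"
    if "k absolutely_integrable_on {0..L}" "continuous_on {0..L} \<phi>" for k \<phi> :: "real \<Rightarrow> real"
    using absolutely_integrable_continuous_mult[OF that(2,1)] by (simp add: absolutely_integrable_on_def mult.commute)
  have ends: "\<phi> 0 = 0 \<and> \<phi> L = 0" if "test_function 0 L \<phi>" for \<phi>
    using that unfolding test_function_iff by force
  have q0: "integral {0..L} (\<lambda>x. q x * deriv \<phi> x) = 0" if \<phi>: "test_function 0 L \<phi>" for \<phi>
  proof -
    have cd: "continuous_on {0..L} (deriv \<phi>)"
      by (rule continuous_on_test_function[OF test_function_deriv[OF \<phi>]])
    have "AC 0 L \<phi> (deriv \<phi>)"
      using \<phi> cd by (intro AC_of_derivative smooth_has_derivative) (auto simp: test_function_iff)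
    from AC_integration_by_parts[OF _ H this]
    have "integral {0..L} (\<lambda>x. H x * deriv \<phi> x) = - integral {0..L} (\<lambda>x. h x * \<phi> x)"
      using ends[OF \<phi>] L by simp
    then show ?thesis
      using weak[OF \<phi>] integral_diff[OF mi[OF g cd] mi[OF Hi cd]]
      by (simp add: q_def left_diff_distrib)
  qed
  \<comment> \<open>a fixed test function of nonzero integral corrects an arbitrary one to have integral zero\<close>
  define \<phi>0 where "\<phi>0 = bump (L / 3) (2 * L / 3) 0"
  have t0: "test_function 0 L \<phi>0" unfolding \<phi>0_def using L by (intro test_function_bump) auto
  have c0: "continuous_on {0..L} \<phi>0" by (rule continuous_on_test_function[OF t0])
  define m where "m = integral {0..L} \<phi>0"
  have m: "m \<noteq> 0"
  proof
    assume "m = 0"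
    then have "\<forall>x\<in>{0..L}. \<phi>0 x = 0"
      using integral_eq_0_iff[OF c0 L] by (simp add: m_def \<phi>0_def bump_bounds)
    then have "\<phi>0 (L / 2) = 0" using L by auto
    then show False using bump_pos[of "L/3" "L/2" "2*L/3" 0] L by (simp add: \<phi>0_def)
  qed
  define C where "C = integral {0..L} (\<lambda>x. q x * \<phi>0 x) / m"
  have key: "integral {0..L} (\<lambda>x. (q x - C) * \<phi> x) = 0" if \<phi>: "test_function 0 L \<phi>" for \<phi>
  proof -
    define c where "c = integral {0..L} \<phi> / m"
    have c\<phi>: "continuous_on {0..L} \<phi>" by (rule continuous_on_test_function[OF \<phi>])
    have t: "test_function 0 L (\<lambda>x. \<phi> x + (- c) * \<phi>0 x)"
      by (rule test_function_lincomb[OF \<phi> t0])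
    have "integral {0..L} (\<lambda>x. \<phi> x + (- c) * \<phi>0 x) = integral {0..L} \<phi> + (- c) * m"
      using c\<phi> c0 by (subst integral_add) (auto simp: m_def intro!: integrable_continuous_real continuous_intros)
    then have "integral {0..L} (\<lambda>x. \<phi> x + (- c) * \<phi>0 x) = 0" using m by (simp add: c_def)
    from test_function_antiderivative[OF t this L]
    obtain \<eta> where \<eta>: "test_function 0 L \<eta>" "deriv \<eta> = (\<lambda>x. \<phi> x + (- c) * \<phi>0 x)" by blast
    have "integral {0..L} (\<lambda>x. q x * \<phi> x + (- c) * (q x * \<phi>0 x)) = 0"
      using q0[OF \<eta>(1)] unfolding \<eta>(2) by (simp add: algebra_simps)
    then have "integral {0..L} (\<lambda>x. q x * \<phi> x) = c * integral {0..L} (\<lambda>x. q x * \<phi>0 x)"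
      using integral_add[OF mi[OF q c\<phi>] integrable_on_mult_right[OF mi[OF q c0], of "- c"]] by simp
    also have "\<dots> = C * integral {0..L} \<phi>" using m by (simp add: C_def c_def)
    also have "\<dots> = integral {0..L} (\<lambda>x. C * \<phi> x)" by simp
    finally show ?thesis
      using integral_diff[OF mi[OF q c\<phi>], of "\<lambda>x. C * \<phi> x"] c\<phi>
      by (simp add: left_diff_distrib integrable_continuous_real continuous_intros)
  qed
  have qC: "(\<lambda>x. q x - C) absolutely_integrable_on {0..L}"
    by (intro set_integral_diff(1)[OF q] absolutely_integrable_continuous_real) auto
  have "AE x in lebesgue. x \<in> {0<..<L} \<longrightarrow> q x - C = 0"
  proof (rule fundamental_lemma)
    show "(\<lambda>x. q x - C) absolutely_integrable_on {a..b}" if "0 < a" "b < L" for a b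
      using qC by (rule absolutely_integrable_on_subinterval) (use that in auto)
    show "(LINT x:{0<..<L}|lebesgue. (q x - C) * \<phi> x) = 0" if \<phi>: "test_function 0 L \<phi>" for \<phi>
    proof -
      have "(LINT x:{0<..<L}|lebesgue. (q x - C) * \<phi> x) = integral {0<..<L} (\<lambda>x. (q x - C) * \<phi> x)"
        using absolutely_integrable_continuous_mult[OF continuous_on_test_function[OF \<phi>] qC]
        by (intro set_lebesgue_integral_eq_integral) (simp add: mult.commute flip: absolutely_integrable_on_Icc_iff_Ioo)
      then show ?thesis using key[OF \<phi>] by (simp add: integral_open_interval_real)
    qed
  qed
  then have "AE x in lebesgue. x \<in> {0<..<L} \<longrightarrow> g x = H x + C"
    by (rule AE_mp) (auto simp: q_def)
  moreover have "AC 0 L (\<lambda>x. H x + C) h"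
    using H by (simp add: AC_def)
  ultimately show ?thesis using that by blast
qed

lemma continuous_AE_eq:
  fixes f g :: "real \<Rightarrow> real"
  assumes L: "a < b" and f: "continuous_on {a..b} f" and g: "continuous_on {a..b} g"
    and ae: "AE x in lebesgue. x \<in> {a<..<b} \<longrightarrow> f x = g x" and x: "x \<in> {a..b}"
  shows "f x = g x"
proof -
  have c: "continuous_on {a..b} (\<lambda>x. \<bar>f x - g x\<bar>)" using f g by (intro continuous_intros)
  have "integral {a..b} (\<lambda>x. \<bar>f x - g x\<bar>) = integral {a<..<b} (\<lambda>x. \<bar>f x - g x\<bar>)"
    by (simp add: integral_open_interval_real)
  also have "\<dots> = integral {a<..<b} (\<lambda>x. 0)"
  proof (rule absolutely_integrable_AE_cong(2))
    show "AE x in lebesgue. x \<in> {a<..<b} \<longrightarrow> 0 = \<bar>f x - g x\<bar>"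
      using ae by (rule AE_mp) auto
  qed simp
  finally show ?thesis using integral_eq_0_iff[OF c L] x by simp
qed

section \<open>Lebesgue and Sobolev functions on an interval\<close>

text \<open>
  Membership in \<open>L\<^sup>p\<close> of an arbitrary measure. For the restriction of Lebesgue measure to \<open>(0, L)\<close> it
  coincides with \<open>Lp\<close> (see \<open>LpM_iff\<close>), but it gives access to the theory of the Bochner integral.
\<close>

definition LpM :: "'a measure \<Rightarrow> real \<Rightarrow> ('a \<Rightarrow> real) \<Rightarrow> bool" where
  "LpM M p f \<longleftrightarrow> f \<in> borel_measurable M \<and> integrable M (\<lambda>x. \<bar>f x\<bar> powr p)"

lemma powr_add_le:
  fixes a b p :: real
  assumes "0 \<le> p"
  shows "\<bar>a + b\<bar> powr p \<le> 2 powr p * (\<bar>a\<bar> powr p + \<bar>b\<bar> powr p)"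
proof -
  have "\<bar>a + b\<bar> powr p \<le> (2 * max \<bar>a\<bar> \<bar>b\<bar>) powr p" using assms by (intro powr_mono2) auto
  also have "\<dots> = 2 powr p * max \<bar>a\<bar> \<bar>b\<bar> powr p" by (simp add: powr_mult)
  also have "\<dots> \<le> 2 powr p * (\<bar>a\<bar> powr p + \<bar>b\<bar> powr p)"
    by (intro mult_left_mono) (auto simp: max_def)
  finally show ?thesis .
qed

lemma LpM_lincomb:
  assumes p: "0 \<le> p" and f: "LpM M p f" and g: "LpM M p g"
  shows "LpM M p (\<lambda>x. c * f x + d * g x)"
proof -
  have [measurable]: "f \<in> borel_measurable M" "g \<in> borel_measurable M"
    using f g by (auto simp: LpM_def)
  have "integrable M (\<lambda>x. \<bar>c * f x + d * g x\<bar> powr p)"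
  proof (rule Bochner_Integration.integrable_bound)
    show "integrable M (\<lambda>x. 2 powr p * (\<bar>c\<bar> powr p * \<bar>f x\<bar> powr p + \<bar>d\<bar> powr p * \<bar>g x\<bar> powr p))"
      using f g by (auto simp: LpM_def)
    show "AE x in M. norm (\<bar>c * f x + d * g x\<bar> powr p)
        \<le> norm (2 powr p * (\<bar>c\<bar> powr p * \<bar>f x\<bar> powr p + \<bar>d\<bar> powr p * \<bar>g x\<bar> powr p))"
      using powr_add_le[OF p, of "c * _" "d * _"] by (intro AE_I2) (auto simp: abs_mult powr_mult)
  qed measurable
  then show ?thesis by (simp add: LpM_def)
qed

lemma LpM_zero: "LpM M p (\<lambda>x. 0)" by (simp add: LpM_def)

lemma LpM_cmult: "0 \<le> p \<Longrightarrow> LpM M p f \<Longrightarrow> LpM M p (\<lambda>x. c * f x)"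
  using LpM_lincomb[of p M f f c 0] by simp

lemma LpM_diff: "0 \<le> p \<Longrightarrow> LpM M p f \<Longrightarrow> LpM M p g \<Longrightarrow> LpM M p (\<lambda>x. f x - g x)"
  using LpM_lincomb[of p M f g 1 "-1"] by simp

lemma (in finite_measure) LpM_integrable:
  assumes p: "1 \<le> p" and f: "LpM M p f"
  shows "integrable M f"
proof (rule Bochner_Integration.integrable_bound)
  show "integrable M (\<lambda>x. 1 + \<bar>f x\<bar> powr p)" using f by (auto simp: LpM_def)
  show "AE x in M. norm (f x) \<le> norm (1 + \<bar>f x\<bar> powr p)"
  proof (rule AE_I2)
    fix x
    have "\<bar>f x\<bar> \<le> 1 + \<bar>f x\<bar> powr p"
    proof (cases "\<bar>f x\<bar> \<le> 1")
      case False
      then have "\<bar>f x\<bar> powr 1 \<le> \<bar>f x\<bar> powr p" using p by (intro powr_mono) auto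
      then show ?thesis using False by simp
    qed (use powr_ge_zero[of "\<bar>f x\<bar>" p] in linarith)
    then show "norm (f x) \<le> norm (1 + \<bar>f x\<bar> powr p)" by simp
  qed
qed (use f in \<open>simp add: LpM_def\<close>)

lemma powr_convex_nonneg:
  fixes x y :: real
  assumes p: "1 \<le> p" and xy: "0 \<le> x" "0 \<le> y" and ab: "0 < a" "0 < b" "a + b = 1"
  shows "(a * x + b * y) powr p \<le> a * x powr p + b * y powr p"
proof -
  have small: "c powr p \<le> c" if "0 < c" "c \<le> 1" for c
    using powr_mono'[of 1 p c] that p by simp
  consider "x = 0" | "y = 0" | "0 < x" "0 < y" using xy by linarith
  then show ?thesis
  proof cases
    case 1
    have "b powr p * y powr p \<le> b * y powr p" using small[of b] ab by (intro mult_right_mono) auto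
    then show ?thesis using 1 ab xy by (simp add: powr_mult)
  next
    case 2
    have "a powr p * x powr p \<le> a * x powr p" using small[of a] ab by (intro mult_right_mono) auto
    then show ?thesis using 2 ab xy by (simp add: powr_mult)
  next
    case 3
    have "((1 - b) *\<^sub>R x + b *\<^sub>R y) powr p \<le> (1 - b) * x powr p + b * y powr p"
      using 3 ab by (intro convex_onD[OF powr_convex[OF p]]) auto
    moreover have "1 - b = a" using ab by simp
    ultimately show ?thesis by simp
  qed
qed

text \<open>
  Minkowski's inequality in the mixed space \<open>l\<^sup>p(L\<^sup>p)\<close>, which is the form of the Sobolev norm. The two
  functions are normalised by numbers slightly above their norms and combined by convexity of the \<open>p\<close>-th power.
\<close>

lemma minkowski_sum:
  fixes f g :: "'i \<Rightarrow> 'a \<Rightarrow> real"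
  assumes p: "1 \<le> p" and J: "finite J"
    and f: "\<And>j. j \<in> J \<Longrightarrow> LpM M p (f j)" and g: "\<And>j. j \<in> J \<Longrightarrow> LpM M p (g j)"
  shows "(\<Sum>j\<in>J. \<integral>x. \<bar>f j x + g j x\<bar> powr p \<partial>M) powr (1 / p)
    \<le> (\<Sum>j\<in>J. \<integral>x. \<bar>f j x\<bar> powr p \<partial>M) powr (1 / p) + (\<Sum>j\<in>J. \<integral>x. \<bar>g j x\<bar> powr p \<partial>M) powr (1 / p)"
    (is "?S powr _ \<le> ?F powr _ + ?G powr _")
proof (rule field_le_epsilon)
  fix e :: real assume e: "0 < e"
  define A where "A = ?F powr (1 / p) + e / 2"
  define B where "B = ?G powr (1 / p) + e / 2"
  have A: "0 < A" and B: "0 < B" using e by (auto simp: A_def B_def add_nonneg_pos)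
  have F0: "0 \<le> ?F" and G0: "0 \<le> ?G" and S0: "0 \<le> ?S"
    by (intro sum_nonneg Bochner_Integration.integral_nonneg; simp)+
  have "?F powr (1 / p) \<le> A" "?G powr (1 / p) \<le> B" using e by (auto simp: A_def B_def)
  then have "(?F powr (1 / p)) powr p \<le> A powr p" "(?G powr (1 / p)) powr p \<le> B powr p"
    using p by (auto intro!: powr_mono2)
  then have FA: "?F \<le> A powr p" and GB: "?G \<le> B powr p"
    using p F0 G0 by (auto simp: powr_powr)
  define K where "K = (A + B) powr p"
  have point: "\<bar>f j x + g j x\<bar> powr p \<le> K * (A / (A + B) / A powr p) * \<bar>f j x\<bar> powr p
      + K * (B / (A + B) / B powr p) * \<bar>g j x\<bar> powr p" for j x
  proof -
    have "\<bar>f j x + g j x\<bar> powr p \<le> (\<bar>f j x\<bar> + \<bar>g j x\<bar>) powr p"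
      using p by (intro powr_mono2) auto
    also have "\<bar>f j x\<bar> + \<bar>g j x\<bar> = (A + B) * (A / (A + B) * (\<bar>f j x\<bar> / A) + B / (A + B) * (\<bar>g j x\<bar> / B))"
    proof -
      have "(A + B) * (A / (A + B) * (\<bar>f j x\<bar> / A)) = \<bar>f j x\<bar>"
        "(A + B) * (B / (A + B) * (\<bar>g j x\<bar> / B)) = \<bar>g j x\<bar>" using A B by auto
      then show ?thesis by (simp only: distrib_left)
    qed
    also have "\<dots> powr p = K * (A / (A + B) * (\<bar>f j x\<bar> / A) + B / (A + B) * (\<bar>g j x\<bar> / B)) powr p"
      using A B by (simp add: K_def powr_mult)
    also have "\<dots> \<le> K * (A / (A + B) * (\<bar>f j x\<bar> / A) powr p + B / (A + B) * (\<bar>g j x\<bar> / B) powr p)"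
    proof (intro mult_left_mono powr_convex_nonneg p)
      show "A / (A + B) + B / (A + B) = 1" using A B by (simp flip: add_divide_distrib)
    qed (use A B in \<open>auto simp: K_def\<close>)
    also have "\<dots> = K * (A / (A + B) / A powr p) * \<bar>f j x\<bar> powr p
      + K * (B / (A + B) / B powr p) * \<bar>g j x\<bar> powr p"
      using A B by (simp add: powr_divide algebra_simps)
    finally show ?thesis .
  qed
  have int: "integrable M (\<lambda>x. \<bar>f j x + g j x\<bar> powr p)" if "j \<in> J" for j
    using LpM_lincomb[OF _ f[OF that] g[OF that], of 1 1] p by (simp add: LpM_def)
  have "?S \<le> (\<Sum>j\<in>J. \<integral>x. K * (A / (A + B) / A powr p) * \<bar>f j x\<bar> powr p
      + K * (B / (A + B) / B powr p) * \<bar>g j x\<bar> powr p \<partial>M)"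
    using f g int point by (intro sum_mono integral_mono) (auto simp: LpM_def)
  also have "\<dots> = K * (A / (A + B) / A powr p) * ?F + K * (B / (A + B) / B powr p) * ?G"
    using f g by (simp add: LpM_def sum.distrib sum_distrib_left)
  also have "\<dots> \<le> K * (A / (A + B) / A powr p) * A powr p + K * (B / (A + B) / B powr p) * B powr p"
    using FA GB A B by (intro add_mono mult_left_mono) (auto simp: K_def)
  also have "\<dots> = K * (A / (A + B) + B / (A + B))"
  proof -
    have "A / (A + B) / A powr p * A powr p = A / (A + B)" "B / (A + B) / B powr p * B powr p = B / (A + B)"
      using A B by auto
    then show ?thesis by (simp only: mult.assoc distrib_left)
  qed
  also have "\<dots> = K" using A B by (simp flip: add_divide_distrib)
  finally have "?S \<le> K" .
  then have "?S powr (1 / p) \<le> K powr (1 / p)" using S0 p by (intro powr_mono2) auto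
  also have "\<dots> = A + B" using A B p by (simp add: K_def powr_powr)
  finally show "?S powr (1 / p) \<le> ?F powr (1 / p) + ?G powr (1 / p) + e"
    by (simp add: A_def B_def)
qed

abbreviation Om :: "real \<Rightarrow> real measure" where
  "Om L \<equiv> lebesgue_on {0<..<L}"

lemma finite_measure_Om: "finite_measure (Om L)"
  by (rule finite_measureI, cases "0 \<le> L") (auto simp: emeasure_restrict_space)

lemma LINT_lebesgue_on:
  fixes f :: "real \<Rightarrow> real"
  shows "S \<in> sets lebesgue \<Longrightarrow> (LINT x:S|lebesgue. f x) = integral\<^sup>L (lebesgue_on S) f"
  by (simp add: integral_restrict_space set_lebesgue_integral_def)

lemma LpM_iff: "h \<in> Lp p {0<..<L} \<longleftrightarrow> LpM (Om L) p h"
  unfolding Lp_def LpM_def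
  by (simp add: set_borel_measurable_def borel_measurable_restrict_space_iff set_integrable_def integrable_restrict_space)

lemma LpM_absolutely_integrable:
  assumes "1 \<le> p" "LpM (Om L) p h"
  shows "h absolutely_integrable_on {0..L}"
  using finite_measure.LpM_integrable[OF finite_measure_Om assms]
  by (simp add: absolutely_integrable_on_Icc_iff_Ioo absolutely_integrable_iff_integrable)

lemma LpM_locally_integrable:
  assumes "1 \<le> p" "LpM (Om L) p h"
  shows "locally_integrable L h"
  unfolding locally_integrable_def
  using absolutely_integrable_on_subinterval[OF LpM_absolutely_integrable[OF assms]] by auto

lemma LpM_AE_cong:
  assumes f: "LpM (Om L) p f" and ae: "AE x in lebesgue. x \<in> {0<..<L} \<longrightarrow> f x = g x"
  shows "LpM (Om L) p g" "(\<integral>x. \<bar>g x\<bar> powr p \<partial>Om L) = (\<integral>x. \<bar>f x\<bar> powr p \<partial>Om L)"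
proof -
  have fm: "f \<in> borel_measurable (Om L)" and fi: "integrable (Om L) (\<lambda>x. \<bar>f x\<bar> powr p)"
    using f by (auto simp: LpM_def)
  have "(\<lambda>x. indicator {0<..<L} x *\<^sub>R f x) \<in> borel_measurable lebesgue"
    using fm by (subst (asm) borel_measurable_restrict_space_iff) auto
  moreover have "AE x in lebesgue. indicator {0<..<L} x *\<^sub>R f x = indicator {0<..<L} x *\<^sub>R g x"
    using ae by (rule AE_mp) (auto simp: indicator_def)
  ultimately have "(\<lambda>x. indicator {0<..<L} x *\<^sub>R g x) \<in> borel_measurable lebesgue"
    by (rule borel_measurable_AE)
  then have gm: "g \<in> borel_measurable (Om L)"
    by (subst borel_measurable_restrict_space_iff) auto
  have ae': "AE x in Om L. \<bar>f x\<bar> powr p = \<bar>g x\<bar> powr p"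
    using ae by (subst AE_lebesgue_on_iff) (auto elim: AE_mp)
  have m: "(\<lambda>x. \<bar>f x\<bar> powr p) \<in> borel_measurable (Om L)" "(\<lambda>x. \<bar>g x\<bar> powr p) \<in> borel_measurable (Om L)"
    using fm gm by measurable
  show "LpM (Om L) p g"
    unfolding LpM_def using integrable_cong_AE[OF m ae'] gm fi by simp
  show "(\<integral>x. \<bar>g x\<bar> powr p \<partial>Om L) = (\<integral>x. \<bar>f x\<bar> powr p \<partial>Om L)"
    using integral_cong_AE[OF m ae'] by simp
qed

lemma locally_integrable_lincomb:
  "locally_integrable L g \<Longrightarrow> locally_integrable L h \<Longrightarrow> locally_integrable L (\<lambda>x. a * g x + b * h x)"
  unfolding locally_integrable_def by (auto intro!: set_integral_add set_integrable_mult_right)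

lemma test_mult_integrable:
  assumes h: "locally_integrable L h" and \<phi>: "test_function 0 L \<phi>"
  shows "set_integrable lebesgue {0<..<L} (\<lambda>x. h x * \<phi> x)"
proof -
  obtain c d where cd: "0 < c" "d < L" "\<And>x. x \<notin> {c..d} \<Longrightarrow> \<phi> x = 0"
    using \<phi> by (auto simp: test_function_iff)
  have "h absolutely_integrable_on {c..d}" using h cd by (simp add: locally_integrable_def)
  from absolutely_integrable_continuous_mult[OF continuous_on_test_function[OF \<phi>] this]
  have "integrable lebesgue (\<lambda>x. indicator {c..d} x *\<^sub>R (\<phi> x * h x))"
    by (simp add: set_integrable_def)
  also have "(\<lambda>x. indicator {c..d} x *\<^sub>R (\<phi> x * h x)) = (\<lambda>x. indicator {0<..<L} x *\<^sub>R (h x * \<phi> x))"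
    using cd by (auto simp: fun_eq_iff indicator_def)
  finally show ?thesis by (simp add: set_integrable_def)
qed

lemma test_function_derivs: "test_function a b \<phi> \<Longrightarrow> test_function a b ((deriv ^^ j) \<phi>)"
  by (induction j) (auto intro: test_function_deriv)

lemma has_weak_deriv_AE_cong:
  assumes gh: "has_weak_deriv L j g h"
    and g: "AE x in lebesgue. x \<in> {0<..<L} \<longrightarrow> g x = g' x"
    and h: "AE x in lebesgue. x \<in> {0<..<L} \<longrightarrow> h x = h' x"
  shows "has_weak_deriv L j g' h'"
proof -
  have loc: "locally_integrable L k'" if k: "locally_integrable L k"
    and ae: "AE x in lebesgue. x \<in> {0<..<L} \<longrightarrow> k x = k' x" for k k' :: "real \<Rightarrow> real"
    unfolding locally_integrable_def
  proof (intro allI impI)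
    fix a b :: real assume ab: "0 < a \<and> b < L"
    show "k' absolutely_integrable_on {a..b}"
    proof (rule absolutely_integrable_AE_cong)
      show "k absolutely_integrable_on {a..b}" using k ab by (simp add: locally_integrable_def)
      show "AE x in lebesgue. x \<in> {a..b} \<longrightarrow> k x = k' x"
        using ae by (rule AE_mp) (use ab in auto)
    qed
  qed
  have eq: "(LINT x:{0<..<L}|lebesgue. k' x * \<phi> x) = (LINT x:{0<..<L}|lebesgue. k x * \<phi> x)"
    if k: "locally_integrable L k" and ae: "AE x in lebesgue. x \<in> {0<..<L} \<longrightarrow> k x = k' x"
      and \<phi>: "test_function 0 L \<phi>" for k k' \<phi>
  proof -
    have 1: "(\<lambda>x. k x * \<phi> x) absolutely_integrable_on {0<..<L}" by (rule test_mult_integrable[OF k \<phi>])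
    have 2: "AE x in lebesgue. x \<in> {0<..<L} \<longrightarrow> k x * \<phi> x = k' x * \<phi> x"
      using ae by (rule AE_mp) auto
    from absolutely_integrable_AE_cong[OF 1 2] show ?thesis
      using set_lebesgue_integral_eq_integral(2)[OF 1]
        set_lebesgue_integral_eq_integral(2)[of "{0<..<L}" "\<lambda>x. k' x * \<phi> x"] by simp
  qed
  have gl: "locally_integrable L g" and hl: "locally_integrable L h"
    using gh by (auto simp: has_weak_deriv_def)
  show ?thesis
    unfolding has_weak_deriv_def
  proof (intro conjI allI impI loc[OF gl g] loc[OF hl h])
    fix \<phi> assume \<phi>: "test_function 0 L \<phi>"
    have "(LINT x:{0<..<L}|lebesgue. g x * (deriv ^^ j) \<phi> x) = (- 1) ^ j * (LINT x:{0<..<L}|lebesgue. h x * \<phi> x)"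
      using gh \<phi> unfolding has_weak_deriv_def by blast
    then show "(LINT x:{0<..<L}|lebesgue. g' x * (deriv ^^ j) \<phi> x) = (- 1) ^ j * (LINT x:{0<..<L}|lebesgue. h' x * \<phi> x)"
      unfolding eq[OF gl g test_function_derivs[OF \<phi>]] eq[OF hl h \<phi>] .
  qed
qed

lemma has_weak_deriv_lincomb:
  assumes 1: "has_weak_deriv L j g1 h1" and 2: "has_weak_deriv L j g2 h2"
  shows "has_weak_deriv L j (\<lambda>x. a * g1 x + b * g2 x) (\<lambda>x. a * h1 x + b * h2 x)"
proof -
  have lin: "(LINT x:{0<..<L}|lebesgue. (a * k1 x + b * k2 x) * \<phi> x) =
      a * (LINT x:{0<..<L}|lebesgue. k1 x * \<phi> x) + b * (LINT x:{0<..<L}|lebesgue. k2 x * \<phi> x)"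
    if "locally_integrable L k1" "locally_integrable L k2" "test_function 0 L \<phi>" for k1 k2 \<phi>
  proof -
    note i = test_mult_integrable[OF that(1,3)] test_mult_integrable[OF that(2,3)]
    have "(LINT x:{0<..<L}|lebesgue. (a * k1 x + b * k2 x) * \<phi> x) =
      (LINT x:{0<..<L}|lebesgue. a * (k1 x * \<phi> x) + b * (k2 x * \<phi> x))"
      by (simp add: algebra_simps)
    also have "\<dots> = (LINT x:{0<..<L}|lebesgue. a * (k1 x * \<phi> x)) + (LINT x:{0<..<L}|lebesgue. b * (k2 x * \<phi> x))"
      using i by (intro set_integral_add set_integrable_mult_right) auto
    finally show ?thesis by simp
  qed
  have loc: "locally_integrable L g1" "locally_integrable L g2" "locally_integrable L h1" "locally_integrable L h2"
    using 1 2 by (auto simp: has_weak_deriv_def)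
  show ?thesis
    unfolding has_weak_deriv_def
  proof (intro conjI allI impI locally_integrable_lincomb loc)
    fix \<phi> assume \<phi>: "test_function 0 L \<phi>"
    have "(LINT x:{0<..<L}|lebesgue. g1 x * (deriv ^^ j) \<phi> x) = (- 1) ^ j * (LINT x:{0<..<L}|lebesgue. h1 x * \<phi> x)"
      "(LINT x:{0<..<L}|lebesgue. g2 x * (deriv ^^ j) \<phi> x) = (- 1) ^ j * (LINT x:{0<..<L}|lebesgue. h2 x * \<phi> x)"
      using 1 2 \<phi> unfolding has_weak_deriv_def by blast+
    then show "(LINT x:{0<..<L}|lebesgue. (a * g1 x + b * g2 x) * (deriv ^^ j) \<phi> x) =
        (- 1) ^ j * (LINT x:{0<..<L}|lebesgue. (a * h1 x + b * h2 x) * \<phi> x)"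
      unfolding lin[OF loc(1,2) test_function_derivs[OF \<phi>]] lin[OF loc(3,4) \<phi>]
      by (simp only: distrib_left mult.left_commute)
  qed
qed

lemma has_weak_deriv_unique:
  assumes 1: "has_weak_deriv L j g h1" and 2: "has_weak_deriv L j g h2"
  shows "AE x in lebesgue. x \<in> {0<..<L} \<longrightarrow> h1 x = h2 x"
proof -
  have "has_weak_deriv L j (\<lambda>x. 1 * g x + (- 1) * g x) (\<lambda>x. 1 * h1 x + (- 1) * h2 x)"
    by (rule has_weak_deriv_lincomb[OF 1 2])
  then have w: "has_weak_deriv L j (\<lambda>x. 0) (\<lambda>x. h1 x - h2 x)" by simp
  have "AE x in lebesgue. x \<in> {0<..<L} \<longrightarrow> h1 x - h2 x = 0"
  proof (rule fundamental_lemma)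
    show "(\<lambda>x. h1 x - h2 x) absolutely_integrable_on {a..b}" if "0 < a" "b < L" for a b
      using w that by (simp add: has_weak_deriv_def locally_integrable_def)
    show "(LINT x:{0<..<L}|lebesgue. (h1 x - h2 x) * \<phi> x) = 0" if "test_function 0 L \<phi>" for \<phi>
      using w that by (simp add: has_weak_deriv_def)
  qed
  then show ?thesis by (rule AE_mp) auto
qed

lemma wderiv_eq:
  assumes "has_weak_deriv L j g h"
  shows "has_weak_deriv L j g (wderiv L j g)" "AE x in lebesgue. x \<in> {0<..<L} \<longrightarrow> wderiv L j g x = h x"
proof -
  show 1: "has_weak_deriv L j g (wderiv L j g)"
    unfolding wderiv_def by (rule someI[of "has_weak_deriv L j g", OF assms])
  show "AE x in lebesgue. x \<in> {0<..<L} \<longrightarrow> wderiv L j g x = h x"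
    by (rule has_weak_deriv_unique[OF 1 assms])
qed

lemma wderiv_AE_cong:
  assumes "AE x in lebesgue. x \<in> {0<..<L} \<longrightarrow> g x = g' x"
  shows "wderiv L j g = wderiv L j g'"
proof -
  have "AE x in lebesgue. x \<in> {0<..<L} \<longrightarrow> g' x = g x" using assms by (rule AE_mp) auto
  then have "has_weak_deriv L j g h \<longleftrightarrow> has_weak_deriv L j g' h" for h
    using has_weak_deriv_AE_cong[of L j g h g' h] has_weak_deriv_AE_cong[of L j g' h g h] assms by auto
  then show ?thesis by (simp add: wderiv_def)
qed

lemma has_weak_deriv_0: "locally_integrable L g \<Longrightarrow> has_weak_deriv L 0 g g"
  by (simp add: has_weak_deriv_def)

text \<open>
  Testing the \<open>j\<close>-th weak derivative with the \<open>i\<close>-th derivative of a test function yields the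
  \<open>(j + i)\<close>-th one. Thus the weak derivatives that define a Sobolev space are successive ones.
\<close>

lemma has_weak_deriv_shift:
  assumes 1: "has_weak_deriv L j g a" and 2: "has_weak_deriv L (j + i) g b"
  shows "has_weak_deriv L i a b"
  unfolding has_weak_deriv_def
proof (intro conjI allI impI)
  show "locally_integrable L a" "locally_integrable L b"
    using 1 2 by (auto simp: has_weak_deriv_def)
  fix \<phi> assume \<phi>: "test_function 0 L \<phi>"
  have "(LINT x:{0<..<L}|lebesgue. g x * (deriv ^^ j) ((deriv ^^ i) \<phi>) x) =
      (- 1) ^ j * (LINT x:{0<..<L}|lebesgue. a x * (deriv ^^ i) \<phi> x)"
    using 1 test_function_derivs[OF \<phi>] by (simp add: has_weak_deriv_def)
  moreover have "(LINT x:{0<..<L}|lebesgue. g x * (deriv ^^ (j + i)) \<phi> x) =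
      (- 1) ^ (j + i) * (LINT x:{0<..<L}|lebesgue. b x * \<phi> x)"
    using 2 \<phi> unfolding has_weak_deriv_def by blast
  ultimately have "(- 1) ^ j * (LINT x:{0<..<L}|lebesgue. a x * (deriv ^^ i) \<phi> x) =
     (- 1) ^ j * ((- 1) ^ i * (LINT x:{0<..<L}|lebesgue. b x * \<phi> x))"
    by (simp add: funpow_add power_add)
  then show "(LINT x:{0<..<L}|lebesgue. a x * (deriv ^^ i) \<phi> x) =
     (- 1) ^ i * (LINT x:{0<..<L}|lebesgue. b x * \<phi> x)"
    by simp
qed

lemma sobolev_wderiv:
  assumes "g \<in> sobolev L k p" "j \<le> k"
  shows "has_weak_deriv L j g (wderiv L j g)" "LpM (Om L) p (wderiv L j g)"
proof -
  obtain h where h: "has_weak_deriv L j g h" "LpM (Om L) p h"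
    using assms by (auto simp: sobolev_def LpM_iff)
  show "has_weak_deriv L j g (wderiv L j g)" by (rule wderiv_eq(1)[OF h(1)])
  have "AE x in lebesgue. x \<in> {0<..<L} \<longrightarrow> h x = wderiv L j g x"
    using wderiv_eq(2)[OF h(1)] by (rule AE_mp) auto
  from LpM_AE_cong(1)[OF h(2) this] show "LpM (Om L) p (wderiv L j g)" .
qed

lemma sobolev_I:
  assumes "\<And>j. j \<le> k \<Longrightarrow> has_weak_deriv L j g (h j)" "\<And>j. j \<le> k \<Longrightarrow> LpM (Om L) p (h j)"
  shows "g \<in> sobolev L k p"
  using assms by (auto simp: sobolev_def LpM_iff)

lemma sobolev_locally_integrable: "g \<in> sobolev L k p \<Longrightarrow> locally_integrable L g"
  using sobolev_wderiv(1)[of g L k p 0] by (simp add: has_weak_deriv_def)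

lemma sobolev_wderiv_0:
  assumes "g \<in> sobolev L k p"
  shows "AE x in lebesgue. x \<in> {0<..<L} \<longrightarrow> wderiv L 0 g x = g x" "LpM (Om L) p g"
proof -
  show ae: "AE x in lebesgue. x \<in> {0<..<L} \<longrightarrow> wderiv L 0 g x = g x"
    by (rule wderiv_eq(2)[OF has_weak_deriv_0[OF sobolev_locally_integrable[OF assms]]])
  show "LpM (Om L) p g"
    by (rule LpM_AE_cong(1)[OF sobolev_wderiv(2)[OF assms, of 0] ae]) simp
qed

lemma sobolev_lincomb:
  assumes p: "0 \<le> p" and g: "g \<in> sobolev L k p" and h: "h \<in> sobolev L k p"
  shows "(\<lambda>x. a * g x + b * h x) \<in> sobolev L k p"
    and "j \<le> k \<Longrightarrow> AE x in lebesgue. x \<in> {0<..<L} \<longrightarrow>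
       wderiv L j (\<lambda>x. a * g x + b * h x) x = a * wderiv L j g x + b * wderiv L j h x"
proof -
  have w: "has_weak_deriv L j (\<lambda>x. a * g x + b * h x) (\<lambda>x. a * wderiv L j g x + b * wderiv L j h x)"
    if "j \<le> k" for j
    by (intro has_weak_deriv_lincomb sobolev_wderiv[OF g that] sobolev_wderiv[OF h that])
  then show "(\<lambda>x. a * g x + b * h x) \<in> sobolev L k p"
    by (rule sobolev_I[OF _ LpM_lincomb[OF p sobolev_wderiv(2)[OF g] sobolev_wderiv(2)[OF h]]])
  show "AE x in lebesgue. x \<in> {0<..<L} \<longrightarrow>
       wderiv L j (\<lambda>x. a * g x + b * h x) x = a * wderiv L j g x + b * wderiv L j h x" if "j \<le> k"
    by (rule wderiv_eq(2)[OF w[OF that]])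
qed

lemma sobolev_norm_eq:
  "sobolev_norm L k p g = (\<Sum>j\<le>k. \<integral>x. \<bar>wderiv L j g x\<bar> powr p \<partial>Om L) powr (1 / p)"
  by (simp add: sobolev_norm_def LINT_lebesgue_on)

lemma sobolev_norm_nonneg: "0 \<le> sobolev_norm L k p g"
  by (simp add: sobolev_norm_def)

lemma sobolev_norm_powr:
  assumes "0 < p"
  shows "sobolev_norm L k p g powr p = (\<Sum>j\<le>k. \<integral>x. \<bar>wderiv L j g x\<bar> powr p \<partial>Om L)"
proof -
  have "0 \<le> (\<Sum>j\<le>k. \<integral>x. \<bar>wderiv L j g x\<bar> powr p \<partial>Om L)"
    by (intro sum_nonneg Bochner_Integration.integral_nonneg) auto
  then show ?thesis using assms by (simp add: sobolev_norm_eq powr_powr)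
qed

lemma wderiv_Lp_le_sobolev_norm:
  assumes "0 < p" "j \<le> k"
  shows "(\<integral>x. \<bar>wderiv L j g x\<bar> powr p \<partial>Om L) \<le> sobolev_norm L k p g powr p"
  unfolding sobolev_norm_powr[OF assms(1)]
  using assms by (intro member_le_sum Bochner_Integration.integral_nonneg) auto

lemma sobolev_norm_triangle:
  assumes p: "1 \<le> p" and g: "g \<in> sobolev L k p" and h: "h \<in> sobolev L k p"
  shows "sobolev_norm L k p (\<lambda>x. a * g x + b * h x) \<le> \<bar>a\<bar> * sobolev_norm L k p g + \<bar>b\<bar> * sobolev_norm L k p h"
proof -
  let ?N = "\<lambda>f. (\<Sum>j\<le>k. \<integral>x. \<bar>f j x\<bar> powr p \<partial>Om L) powr (1 / p)"
  have hom: "?N (\<lambda>j x. c * wderiv L j v x) = \<bar>c\<bar> * sobolev_norm L k p v" for c v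
    using p by (simp add: sobolev_norm_eq abs_mult powr_mult sum_nonneg powr_powr flip: sum_distrib_left)
  have "sobolev_norm L k p (\<lambda>x. a * g x + b * h x) = ?N (\<lambda>j x. a * wderiv L j g x + b * wderiv L j h x)"
    unfolding sobolev_norm_eq
  proof (intro arg_cong2[where f = "(powr)"] sum.cong refl)
    fix j assume "j \<in> {..k}"
    then have j: "j \<le> k" by simp
    have p0: "0 \<le> p" using p by simp
    show "(\<integral>x. \<bar>wderiv L j (\<lambda>x. a * g x + b * h x) x\<bar> powr p \<partial>Om L) =
        (\<integral>x. \<bar>a * wderiv L j g x + b * wderiv L j h x\<bar> powr p \<partial>Om L)"
      by (rule LpM_AE_cong(2)[symmetric, OF sobolev_wderiv(2)[OF sobolev_lincomb(1)[OF p0 g h] j]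
            sobolev_lincomb(2)[OF p0 g h j]])
  qed
  also have "\<dots> \<le> ?N (\<lambda>j x. a * wderiv L j g x) + ?N (\<lambda>j x. b * wderiv L j h x)"
    using p by (intro minkowski_sum LpM_cmult sobolev_wderiv(2)[OF g] sobolev_wderiv(2)[OF h]) auto
  finally show ?thesis by (simp add: hom)
qed

lemma sobolev_norm_diff_bounds:
  assumes p: "1 \<le> p" and g: "g \<in> sobolev L k p" and h: "h \<in> sobolev L k p"
  shows "sobolev_norm L k p (g - h) \<le> sobolev_norm L k p g + sobolev_norm L k p h"
    "\<bar>sobolev_norm L k p g - sobolev_norm L k p h\<bar> \<le> sobolev_norm L k p (g - h)"
    "g - h \<in> sobolev L k p"
proof -
  have eq: "g - h = (\<lambda>x. 1 * g x + (- 1) * h x)" by (auto simp: fun_eq_iff)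
  show 1: "sobolev_norm L k p (g - h) \<le> sobolev_norm L k p g + sobolev_norm L k p h"
    unfolding eq using sobolev_norm_triangle[OF p g h, of 1 "-1"] by simp
  show d: "g - h \<in> sobolev L k p"
    unfolding eq using p by (intro sobolev_lincomb(1) g h) auto
  have e1: "(\<lambda>x. 1 * (g - h) x + 1 * h x) = g" and e2: "(\<lambda>x. (- 1) * (g - h) x + 1 * g x) = h" by auto
  have "sobolev_norm L k p g \<le> sobolev_norm L k p (g - h) + sobolev_norm L k p h"
    using sobolev_norm_triangle[OF p d h, of 1 1] unfolding e1 by simp
  moreover have "sobolev_norm L k p h \<le> sobolev_norm L k p (g - h) + sobolev_norm L k p g"
    using sobolev_norm_triangle[OF p d g, of "-1" 1] unfolding e2 by simp
  ultimately show "\<bar>sobolev_norm L k p g - sobolev_norm L k p h\<bar> \<le> sobolev_norm L k p (g - h)" by linarith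
qed

text \<open>
  The function \<open>-v\<^sub>x\<^sub>x\<close> is the test function that produces the energy inequality.
\<close>

lemma sobolev_minus_second_derivative:
  assumes p: "1 \<le> p" and v: "v \<in> sobolev L 3 p"
  shows "(\<lambda>x. - wderiv L 2 v x) \<in> sobolev L 1 p"
    and "AE x in lebesgue. x \<in> {0<..<L} \<longrightarrow> wderiv L 0 (\<lambda>x. - wderiv L 2 v x) x = - wderiv L 2 v x"
    and "AE x in lebesgue. x \<in> {0<..<L} \<longrightarrow> wderiv L 1 (\<lambda>x. - wderiv L 2 v x) x = - wderiv L 3 v x"
proof -
  note d2 = sobolev_wderiv[OF v, of 2] and d3 = sobolev_wderiv[OF v, of 3]
  have "has_weak_deriv L 1 (wderiv L 2 v) (wderiv L 3 v)"
    using has_weak_deriv_shift[of L 2 v "wderiv L 2 v" 1 "wderiv L 3 v"] d2(1) d3(1) by simp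
  from has_weak_deriv_lincomb[OF this this, of "-1" 0]
  have 1: "has_weak_deriv L 1 (\<lambda>x. - wderiv L 2 v x) (\<lambda>x. - wderiv L 3 v x)" by simp
  have m: "LpM (Om L) p (\<lambda>x. - wderiv L 2 v x)" "LpM (Om L) p (\<lambda>x. - wderiv L 3 v x)"
    using LpM_cmult[of p "Om L" "wderiv L 2 v" "-1"] LpM_cmult[of p "Om L" "wderiv L 3 v" "-1"] d2(2) d3(2) p by auto
  have 0: "has_weak_deriv L 0 (\<lambda>x. - wderiv L 2 v x) (\<lambda>x. - wderiv L 2 v x)"
    using LpM_locally_integrable[OF p m(1)] by (rule has_weak_deriv_0)
  show "(\<lambda>x. - wderiv L 2 v x) \<in> sobolev L 1 p"
    using 0 1 m by (intro sobolev_I[where h = "\<lambda>j. if j = 0 then (\<lambda>x. - wderiv L 2 v x) else (\<lambda>x. - wderiv L 3 v x)"])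
      (auto simp: le_Suc_eq)
  show "AE x in lebesgue. x \<in> {0<..<L} \<longrightarrow> wderiv L 0 (\<lambda>x. - wderiv L 2 v x) x = - wderiv L 2 v x"
    by (rule wderiv_eq(2)[OF 0])
  show "AE x in lebesgue. x \<in> {0<..<L} \<longrightarrow> wderiv L 1 (\<lambda>x. - wderiv L 2 v x) x = - wderiv L 3 v x"
    by (rule wderiv_eq(2)[OF 1])
qed

lemma weak_deriv_AC_representative:
  assumes L: "0 < L" and w: "has_weak_deriv L 1 g h"
    and g: "g absolutely_integrable_on {0..L}" and h: "h absolutely_integrable_on {0..L}"
  obtains G where "AC 0 L G h" "AE x in lebesgue. x \<in> {0<..<L} \<longrightarrow> g x = G x"
proof (rule weak_derivative_AC[OF L g h])
  fix \<phi> assume \<phi>: "test_function 0 L \<phi>"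
  have eq: "(LINT x:{0<..<L}|lebesgue. k x * \<psi> x) = integral {0..L} (\<lambda>x. k x * \<psi> x)"
    if "test_function 0 L \<psi>" "locally_integrable L k" for k \<psi>
    using set_lebesgue_integral_eq_integral(2)[OF test_mult_integrable[OF that(2,1)]]
    by (simp add: integral_open_interval_real)
  show "integral {0..L} (\<lambda>x. g x * deriv \<phi> x) = - integral {0..L} (\<lambda>x. h x * \<phi> x)"
    using w eq[OF \<phi>, of h] eq[OF test_function_deriv[OF \<phi>], of g] \<phi> by (simp add: has_weak_deriv_def)
qed (use that in blast)

lemma sobolev_AC:
  assumes L: "0 < L" and p: "1 \<le> p" and g: "g \<in> sobolev L 1 p"
  obtains G where "AC 0 L G (wderiv L 1 g)" "AE x in lebesgue. x \<in> {0<..<L} \<longrightarrow> g x = G x"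
  by (rule weak_deriv_AC_representative[OF L sobolev_wderiv(1)[OF g order_refl]
      LpM_absolutely_integrable[OF p sobolev_wderiv_0(2)[OF g]]
      LpM_absolutely_integrable[OF p sobolev_wderiv(2)[OF g order_refl]]]) (rule that)

lemma AC_cong: "AC a b F f \<Longrightarrow> (\<And>x. x \<in> {a..b} \<Longrightarrow> G x = F x) \<Longrightarrow> a \<le> b \<Longrightarrow> AC a b G f"
proof (rule AC_I)
  assume F: "AC a b F f" and eq: "\<And>x. x \<in> {a..b} \<Longrightarrow> G x = F x" and ab: "a \<le> b"
  show "f absolutely_integrable_on {a..b}" using F by (simp add: AC_def)
  show "G x - G a = integral {a..x} f" if "a \<le> x" "x \<le> b" for x
    using AC_diff[OF F, of a x] eq[of x] eq[of a] that by simp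
qed

lemma sobolev_continuous_AC:
  assumes L: "0 < L" and p: "1 \<le> p" and g: "g \<in> sobolev L 1 p" and c: "continuous_on {0..L} g"
  shows "AC 0 L g (wderiv L 1 g)"
proof -
  obtain G where G: "AC 0 L G (wderiv L 1 g)" "AE x in lebesgue. x \<in> {0<..<L} \<longrightarrow> g x = G x"
    using sobolev_AC[OF L p g] by blast
  show ?thesis
    by (rule AC_cong[OF G(1) continuous_AE_eq[OF L c AC_continuous_on[OF G(1)] G(2)]]) (use L in auto)
qed

lemma H1_AC:
  assumes "0 < L" "g \<in> H1 L"
  shows "AC 0 L g (wderiv L 1 g)"
  using assms sobolev_continuous_AC[of L 2 g] by (simp add: H1_def)

section \<open>Inequalities for the energy of a profile\<close>

lemma Cauchy_Schwarz_LpM: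
  assumes f: "LpM M 2 f" and g: "LpM M 2 g"
  shows "integrable M (\<lambda>x. f x * g x)"
    and "\<bar>\<integral>x. f x * g x \<partial>M\<bar> \<le> sqrt (\<integral>x. (f x)\<^sup>2 \<partial>M) * sqrt (\<integral>x. (g x)\<^sup>2 \<partial>M)"
proof -
  have [measurable]: "f \<in> borel_measurable M" "g \<in> borel_measurable M"
    using f g by (auto simp: LpM_def)
  have fi: "integrable M (\<lambda>x. (f x)\<^sup>2)" and gi: "integrable M (\<lambda>x. (g x)\<^sup>2)"
    using f g by (auto simp: LpM_def)
  have bound: "\<bar>f x * g x\<bar> \<le> (f x)\<^sup>2 + (g x)\<^sup>2" for x
  proof -
    have "0 \<le> (\<bar>f x\<bar> - \<bar>g x\<bar>)\<^sup>2" by simp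
    then have "2 * (\<bar>f x\<bar> * \<bar>g x\<bar>) \<le> (f x)\<^sup>2 + (g x)\<^sup>2" by (simp add: power2_diff)
    moreover have "0 \<le> \<bar>f x\<bar> * \<bar>g x\<bar>" by simp
    ultimately show ?thesis unfolding abs_mult by linarith
  qed
  show i: "integrable M (\<lambda>x. f x * g x)"
    by (rule Bochner_Integration.integrable_bound[of M "\<lambda>x. (f x)\<^sup>2 + (g x)\<^sup>2"])
      (use fi gi bound in \<open>auto simp: abs_mult\<close>)
  have "ennreal ((\<integral>x. \<bar>f x * g x\<bar> \<partial>M)\<^sup>2) = (\<integral>\<^sup>+x. ennreal \<bar>f x\<bar> * ennreal \<bar>g x\<bar> \<partial>M)\<^sup>2"
    using integrable_abs[OF i]
    by (subst ennreal_power[symmetric]) (auto simp: nn_integral_eq_integral abs_mult simp flip: ennreal_mult)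
  also have "\<dots> \<le> (\<integral>\<^sup>+x. ennreal \<bar>f x\<bar> ^ 2 \<partial>M) * (\<integral>\<^sup>+x. ennreal \<bar>g x\<bar> ^ 2 \<partial>M)"
    by (rule Cauchy_Schwarz_nn_integral) auto
  also have "\<dots> = ennreal (\<integral>x. (f x)\<^sup>2 \<partial>M) * ennreal (\<integral>x. (g x)\<^sup>2 \<partial>M)"
    using fi gi by (simp add: ennreal_power nn_integral_eq_integral)
  also have "\<dots> = ennreal ((\<integral>x. (f x)\<^sup>2 \<partial>M) * (\<integral>x. (g x)\<^sup>2 \<partial>M))"
    by (simp add: ennreal_mult)
  finally have "(\<integral>x. \<bar>f x * g x\<bar> \<partial>M)\<^sup>2 \<le> (\<integral>x. (f x)\<^sup>2 \<partial>M) * (\<integral>x. (g x)\<^sup>2 \<partial>M)"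
    by (simp add: ennreal_le_iff)
  then have "(\<integral>x. \<bar>f x * g x\<bar> \<partial>M) \<le> sqrt ((\<integral>x. (f x)\<^sup>2 \<partial>M) * (\<integral>x. (g x)\<^sup>2 \<partial>M))"
    by (rule real_le_rsqrt)
  then show "\<bar>\<integral>x. f x * g x \<partial>M\<bar> \<le> sqrt (\<integral>x. (f x)\<^sup>2 \<partial>M) * sqrt (\<integral>x. (g x)\<^sup>2 \<partial>M)"
    unfolding real_sqrt_mult[symmetric] using integral_abs_bound[of M "\<lambda>x. f x * g x"] by linarith
qed

text \<open>
  Young's inequality for \<open>|h|\<close> and the power \<open>A\<^sup>p\<^sup>-\<^sup>1\<close> of the mean value \<open>A\<close> of \<open>|h|\<close>, integrated.
\<close>

lemma (in finite_measure) jensen_powr: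
  assumes p: "1 < p" and h: "LpM M p h" and V: "measure M (space M) = V" "0 < V"
  shows "(\<integral>x. \<bar>h x\<bar> \<partial>M) powr p \<le> V powr (p - 1) * (\<integral>x. \<bar>h x\<bar> powr p \<partial>M)"
proof -
  define m where "m = (\<integral>x. \<bar>h x\<bar> \<partial>M)"
  define S where "S = (\<integral>x. \<bar>h x\<bar> powr p \<partial>M)"
  define A where "A = m / V"
  have hi: "integrable M h" and hp: "integrable M (\<lambda>x. \<bar>h x\<bar> powr p)"
    using LpM_integrable[OF less_imp_le[OF p] h] h unfolding LpM_def by blast+
  have m0: "0 \<le> m" by (simp add: m_def)
  then have A0: "0 \<le> A" using V by (simp add: A_def)
  define q where "q = p / (p - 1)"
  have q1: "1 < q" using p by (simp add: q_def)
  have q2: "1 / p + 1 / q = 1" using p by (simp add: q_def flip: add_divide_distrib)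
  have q3: "(p - 1) * q = p" using p by (simp add: q_def)
  note q = q1 q2 q3
  have "A powr (p - 1) * \<bar>h x\<bar> \<le> \<bar>h x\<bar> powr p / p + A powr p / q" for x
    using Youngs_inequality[OF p q(1,2), of "\<bar>h x\<bar>" "A powr (p - 1)"] q(3)
    by (simp add: powr_powr mult.commute)
  then have "(\<integral>x. A powr (p - 1) * \<bar>h x\<bar> \<partial>M) \<le> (\<integral>x. \<bar>h x\<bar> powr p / p + A powr p / q \<partial>M)"
    using hi hp by (intro integral_mono) auto
  then have "A powr (p - 1) * m \<le> S / p + V * (A powr p / q)"
    using hp by (simp add: m_def S_def V)
  moreover have "A powr (p - 1) * m = V * A powr p"
  proof -
    have "A powr (p - 1) * A = A powr p"
      using A0 p powr_mult_base[of A "p - 1"] by (simp add: mult.commute)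
    then show ?thesis using V by (simp add: A_def field_simps)
  qed
  ultimately have "V * A powr p * (1 - 1 / q) \<le> S / p" by (simp add: algebra_simps)
  moreover have "1 - 1 / q = 1 / p" using q by simp
  ultimately have "V * A powr p \<le> S" using p by (simp add: field_simps)
  moreover have "V * A powr p = m powr p * V powr (1 - p)"
    using m0 V by (simp add: A_def powr_divide powr_diff)
  ultimately have "V powr (p - 1) * (m powr p * V powr (1 - p)) \<le> V powr (p - 1) * S"
    by (intro mult_left_mono) auto
  moreover have "V powr (p - 1) * (m powr p * V powr (1 - p)) = m powr p"
    using V by (simp add: powr_diff)
  ultimately have "m powr p \<le> V powr (p - 1) * S" by (simp only:)
  then show ?thesis by (simp add: m_def S_def)
qed

lemma measure_Om: "0 < L \<Longrightarrow> measure (Om L) (space (Om L)) = L"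
  by (simp add: measure_restrict_space)

lemma integral_Om:
  fixes f :: "real \<Rightarrow> real"
  shows "f absolutely_integrable_on {0..L} \<Longrightarrow> integral\<^sup>L (Om L) f = integral {0..L} f"
  using integral_lebesgue_on[where f = f and S = "{0<..<L}"]
  by (simp add: absolutely_integrable_on_Icc_iff_Ioo integral_open_interval_real)

lemma integrable_Om:
  fixes f :: "real \<Rightarrow> real"
  shows "f absolutely_integrable_on {0..L} \<longleftrightarrow> integrable (Om L) f"
  by (simp add: absolutely_integrable_on_Icc_iff_Ioo absolutely_integrable_iff_integrable)

lemma deriv_norm2_eq: "deriv_norm2 L v = sqrt (\<integral>x. (wderiv L 1 v x)\<^sup>2 \<partial>Om L)"
  by (simp add: deriv_norm2_def Lp_norm_def LINT_lebesgue_on powr_half_sqrt)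

lemma deriv_norm2_nonneg: "0 \<le> deriv_norm2 L v"
  by (simp add: deriv_norm2_eq)

lemma deriv_norm2_squared: "(deriv_norm2 L v)\<^sup>2 = (\<integral>x. (wderiv L 1 v x)\<^sup>2 \<partial>Om L)"
  by (simp add: deriv_norm2_eq)

lemma LpM_2_Om_integral_abs:
  assumes L: "0 < L" and f: "LpM (Om L) 2 f"
  shows "f absolutely_integrable_on {0..L}"
    "integral {0..L} (\<lambda>x. \<bar>f x\<bar>) \<le> sqrt L * sqrt (\<integral>x. (f x)\<^sup>2 \<partial>Om L)"
proof -
  show ai: "f absolutely_integrable_on {0..L}" using LpM_absolutely_integrable[of 2, OF _ f] by simp
  have one: "LpM (Om L) 2 (\<lambda>x. 1)" and fa: "LpM (Om L) 2 (\<lambda>x. \<bar>f x\<bar>)"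
    using f finite_measure.integrable_const[OF finite_measure_Om] by (auto simp: LpM_def)
  have "integral {0..L} (\<lambda>x. \<bar>f x\<bar>) = (\<integral>x. 1 * \<bar>f x\<bar> \<partial>Om L)"
    using integral_Om[OF set_integrable_abs[OF ai]] by simp
  also have "\<dots> \<le> sqrt (\<integral>x. 1\<^sup>2 \<partial>Om L) * sqrt (\<integral>x. \<bar>f x\<bar>\<^sup>2 \<partial>Om L)"
    using Cauchy_Schwarz_LpM(2)[OF one fa] by simp
  also have "(\<integral>x. 1\<^sup>2 \<partial>Om L) = L" using measure_Om[OF L] by simp
  finally show "integral {0..L} (\<lambda>x. \<bar>f x\<bar>) \<le> sqrt L * sqrt (\<integral>x. (f x)\<^sup>2 \<partial>Om L)" by simp
qed

text \<open>
  The fundamental theorem of calculus and the Cauchy-Schwarz inequality on \<open>(0, L)\<close>.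
\<close>

lemma H1_oscillation:
  assumes L: "0 < L" and v: "v \<in> H1 L" and xy: "x \<in> {0..L}" "y \<in> {0..L}"
  shows "\<bar>v x - v y\<bar> \<le> sqrt L * deriv_norm2 L v"
proof -
  have AC: "AC 0 L v (wderiv L 1 v)" by (rule H1_AC[OF L v])
  have l: "LpM (Om L) 2 (wderiv L 1 v)" using v sobolev_wderiv(2)[of v L 1 2 1] by (simp add: H1_def)
  note i = LpM_2_Om_integral_abs[OF L l]
  have *: "\<bar>v b - v a\<bar> \<le> sqrt L * deriv_norm2 L v" if ab: "0 \<le> a" "a \<le> b" "b \<le> L" for a b
  proof -
    have "\<bar>v b - v a\<bar> \<le> integral {a..b} (\<lambda>x. \<bar>wderiv L 1 v x\<bar>)"
      by (rule AC_abs_bound[OF AC ab])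
    also have "\<dots> \<le> integral {0..L} (\<lambda>x. \<bar>wderiv L 1 v x\<bar>)"
      using ab AC_integrable[OF AC, of a b] AC_integrable[OF AC, of 0 L]
      by (intro integral_subset_le) (auto simp: absolutely_integrable_on_def)
    finally show ?thesis using i(2) by (simp add: deriv_norm2_eq)
  qed
  show ?thesis
  proof (cases "x \<le> y")
    case True then show ?thesis using *[of x y] xy by (simp add: abs_minus_commute)
  next
    case False then show ?thesis using *[of y x] xy by simp
  qed
qed

lemma mean_value_eq:
  assumes "continuous_on {0..L} v"
  shows "mean_value L v = integral {0..L} v / L"
  using integral_Om[OF absolutely_integrable_continuous_real[OF assms]]
  by (simp add: mean_value_def LINT_lebesgue_on)

text \<open>
  Averaging \<open>H1_oscillation\<close> over one of the two points. The constant \<open>\<surd>L\<close> matters: it is the one for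
  which the smallness hypothesis on \<open>u\<^sub>0\<close> makes the lower bound of the solution positive.
\<close>

lemma H1_mean_bound:
  assumes L: "0 < L" and v: "v \<in> H1 L" and x: "x \<in> {0..L}"
  shows "\<bar>v x - mean_value L v\<bar> \<le> sqrt L * deriv_norm2 L v"
proof -
  have c: "continuous_on {0..L} v" using v by (simp add: H1_def)
  have int: "v integrable_on {0..L}" using c by (rule integrable_continuous_real)
  have "norm (integral {0..L} (\<lambda>y. v x - v y)) \<le> integral {0..L} (\<lambda>y. sqrt L * deriv_norm2 L v)"
    using H1_oscillation[OF L v x] int by (intro integral_norm_bound_integral integrable_diff) auto
  moreover have "integral {0..L} (\<lambda>y. v x - v y) = L * v x - integral {0..L} v"
    using L int by (subst integral_diff) auto
  ultimately have "\<bar>L * v x - integral {0..L} v\<bar> \<le> L * (sqrt L * deriv_norm2 L v)"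
    using L by (simp add: mult_ac)
  moreover have "L * v x - integral {0..L} v = L * (v x - mean_value L v)"
    using L by (simp add: mean_value_eq[OF c] field_simps)
  ultimately show ?thesis using L by (simp add: abs_mult)
qed

lemma deriv_norm2_le_sobolev_norm:
  "deriv_norm2 L v \<le> sobolev_norm L 1 2 v"
proof -
  have "(\<integral>x. \<bar>wderiv L 1 v x\<bar> powr 2 \<partial>Om L) \<le> sobolev_norm L 1 2 v powr 2"
    by (rule wderiv_Lp_le_sobolev_norm) auto
  then show ?thesis
    by (simp add: deriv_norm2_eq sobolev_norm_nonneg real_le_lsqrt real_sqrt_le_iff)
qed

lemma H1_sup_bound:
  assumes L: "0 < L" and v: "v \<in> H1 L" and x: "x \<in> {0..L}"
  shows "\<bar>v x\<bar> \<le> (sqrt L + 1 / sqrt L) * sobolev_norm L 1 2 v"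
proof -
  have vs: "v \<in> sobolev L 1 2" and c: "continuous_on {0..L} v" using v by (auto simp: H1_def)
  have l: "LpM (Om L) 2 v" by (rule sobolev_wderiv_0(2)[OF vs])
  have "(\<integral>x. (v x)\<^sup>2 \<partial>Om L) = (\<integral>x. \<bar>wderiv L 0 v x\<bar> powr 2 \<partial>Om L)"
    using LpM_AE_cong(2)[OF sobolev_wderiv(2)[OF vs, of 0] sobolev_wderiv_0(1)[OF vs]] by simp
  also have "\<dots> \<le> sobolev_norm L 1 2 v powr 2"
    by (rule wderiv_Lp_le_sobolev_norm) auto
  finally have "sqrt (\<integral>x. (v x)\<^sup>2 \<partial>Om L) \<le> sobolev_norm L 1 2 v"
    by (simp add: sobolev_norm_nonneg real_le_lsqrt)
  then have "integral {0..L} (\<lambda>x. \<bar>v x\<bar>) \<le> sqrt L * sobolev_norm L 1 2 v"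
    using LpM_2_Om_integral_abs(2)[OF L l] L
    by (meson less_eq_real_def mult_left_mono order_trans real_sqrt_ge_zero)
  moreover have "\<bar>integral {0..L} v\<bar> \<le> integral {0..L} (\<lambda>x. \<bar>v x\<bar>)"
    using c by (subst real_norm_def[symmetric], intro integral_norm_bound_integral)
       (auto intro!: integrable_continuous_real continuous_intros)
  ultimately have "\<bar>mean_value L v\<bar> \<le> sqrt L * sobolev_norm L 1 2 v / L"
    using L by (simp add: mean_value_eq[OF c] abs_divide divide_right_mono)
  also have "\<dots> = 1 / sqrt L * sobolev_norm L 1 2 v"
    using L by (simp add: field_simps flip: power2_eq_square)
  finally have "\<bar>mean_value L v\<bar> \<le> 1 / sqrt L * sobolev_norm L 1 2 v" .
  moreover have "\<bar>v x - mean_value L v\<bar> \<le> sqrt L * sobolev_norm L 1 2 v"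
    using H1_mean_bound[OF L v x] deriv_norm2_le_sobolev_norm[of L v] L
    by (meson less_eq_real_def mult_left_mono order_trans real_sqrt_ge_zero)
  ultimately show ?thesis by (simp add: distrib_right)
qed

lemma deriv_norm2_diff:
  assumes g: "g \<in> sobolev L 1 2" and h: "h \<in> sobolev L 1 2"
  shows "\<bar>deriv_norm2 L g - deriv_norm2 L h\<bar> \<le> sobolev_norm L 1 2 (g - h)"
proof -
  have *: "deriv_norm2 L (\<lambda>x. a * v x + b * w x) \<le> \<bar>a\<bar> * deriv_norm2 L v + \<bar>b\<bar> * deriv_norm2 L w"
    if v: "v \<in> sobolev L 1 2" and w: "w \<in> sobolev L 1 2" for a b v w
  proof -
    let ?N = "\<lambda>f. (\<Sum>j\<in>{1::nat}. \<integral>x. \<bar>f x\<bar> powr 2 \<partial>Om L) powr (1 / 2)"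
    have hom: "?N (\<lambda>x. c * wderiv L 1 v x) = \<bar>c\<bar> * deriv_norm2 L v" for c v
      by (simp add: deriv_norm2_eq powr_half_sqrt power_mult_distrib real_sqrt_mult)
    have p: "(0::real) \<le> 2" by simp
    have "deriv_norm2 L (\<lambda>x. a * v x + b * w x) = ?N (\<lambda>x. a * wderiv L 1 v x + b * wderiv L 1 w x)"
      using LpM_AE_cong(2)[OF sobolev_wderiv(2)[OF sobolev_lincomb(1)[OF p v w] order_refl]
            sobolev_lincomb(2)[OF p v w order_refl]]
      by (simp add: deriv_norm2_eq powr_half_sqrt)
    also have "\<dots> \<le> ?N (\<lambda>x. a * wderiv L 1 v x) + ?N (\<lambda>x. b * wderiv L 1 w x)"
      by (intro minkowski_sum LpM_cmult sobolev_wderiv(2)[OF v] sobolev_wderiv(2)[OF w]) auto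
    finally show ?thesis unfolding hom .
  qed
  have d: "g - h \<in> sobolev L 1 2" by (rule sobolev_norm_diff_bounds(3)[OF _ g h]) simp
  have e1: "(\<lambda>x. 1 * (g - h) x + 1 * h x) = g" and e2: "(\<lambda>x. (- 1) * (g - h) x + 1 * g x) = h" by auto
  have "deriv_norm2 L g \<le> deriv_norm2 L (g - h) + deriv_norm2 L h"
    using *[OF d h, of 1 1] unfolding e1 by simp
  moreover have "deriv_norm2 L h \<le> deriv_norm2 L (g - h) + deriv_norm2 L g"
    using *[OF d g, of "-1" 1] unfolding e2 by simp
  ultimately show ?thesis using deriv_norm2_le_sobolev_norm[of L "g - h"] by linarith
qed

lemma C_H1_continuous:
  assumes L: "0 < L" and u: "u \<in> C_H1 T L"
  shows "continuous_on {0..T} (\<lambda>t. deriv_norm2 L (u t))"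
    and "\<And>t e. t \<in> {0..T} \<Longrightarrow> 0 < e \<Longrightarrow> eventually (\<lambda>s. \<forall>x\<in>{0..L}. \<bar>u s x - u t x\<bar> < e) (at t within {0..T})"
proof -
  have H: "u t \<in> H1 L" and lim: "((\<lambda>s. sobolev_norm L 1 2 (u s - u t)) \<longlongrightarrow> 0) (at t within {0..T})"
    if "t \<in> {0..T}" for t
    using u that by (auto simp: C_H1_def)
  show "continuous_on {0..T} (\<lambda>t. deriv_norm2 L (u t))"
    unfolding continuous_on_def
  proof
    fix t assume t: "t \<in> {0..T}"
    have "((\<lambda>s. deriv_norm2 L (u s) - deriv_norm2 L (u t)) \<longlongrightarrow> 0) (at t within {0..T})"
    proof (rule Lim_null_comparison[OF _ lim[OF t]])
      show "eventually (\<lambda>s. norm (deriv_norm2 L (u s) - deriv_norm2 L (u t)) \<le> sobolev_norm L 1 2 (u s - u t)) (at t within {0..T})"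
        using deriv_norm2_diff H t by (auto simp: eventually_at_filter H1_def)
    qed
    then show "((\<lambda>t. deriv_norm2 L (u t)) \<longlongrightarrow> deriv_norm2 L (u t)) (at t within {0..T})"
      by (simp add: LIM_zero_iff)
  qed
  fix t e :: real assume t: "t \<in> {0..T}" and e: "0 < e"
  define K where "K = sqrt L + 1 / sqrt L"
  have K: "K > 0" using L by (simp add: K_def add_pos_pos)
  have "eventually (\<lambda>s. sobolev_norm L 1 2 (u s - u t) < e / K) (at t within {0..T})"
    using lim[OF t] e K by (intro order_tendstoD) auto
  moreover have "eventually (\<lambda>s. s \<in> {0..T}) (at t within {0..T})"
    by (simp add: eventually_at_filter)
  ultimately show "eventually (\<lambda>s. \<forall>x\<in>{0..L}. \<bar>u s x - u t x\<bar> < e) (at t within {0..T})"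
  proof eventually_elim
    case (elim s)
    have s1: "u s - u t \<in> sobolev L 1 2"
      using H[OF elim(2)] H[OF t] by (intro sobolev_norm_diff_bounds(3)) (auto simp: H1_def)
    have "continuous_on {0..L} (\<lambda>x. u s x - u t x)"
      using H[OF elim(2)] H[OF t] by (intro continuous_intros) (auto simp: H1_def)
    then have "u s - u t \<in> H1 L" using s1 by (auto simp: H1_def fun_diff_def)
    then have "\<bar>(u s - u t) x\<bar> \<le> K * sobolev_norm L 1 2 (u s - u t)" if "x \<in> {0..L}" for x
      using H1_sup_bound[OF L \<open>u s - u t \<in> H1 L\<close> that] unfolding K_def by blast
    moreover have "K * sobolev_norm L 1 2 (u s - u t) < e" using elim(1) K by (simp add: field_simps)
    ultimately show ?case by fastforce
  qed
qed

text \<open>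
  The boundary condition on \<open>v\<^sub>x\<close> is stated for some continuous representative. It is transferred here to
  the absolutely continuous one, for which integration by parts is available.
\<close>

lemma sobolev_B_boundary:
  assumes L: "0 < L" and p: "1 \<le> p" and v: "v \<in> sobolev_B L 3 p"
  obtains w H where "AC 0 L w (wderiv L 2 v)" "w 0 = 0" "w L = 0"
    "AE x in lebesgue. x \<in> {0<..<L} \<longrightarrow> wderiv L 1 v x = w x"
    "AC 0 L H (wderiv L 3 v)" "AE x in lebesgue. x \<in> {0<..<L} \<longrightarrow> wderiv L 2 v x = H x"
proof -
  have vs: "v \<in> sobolev L 3 p" using v by (simp add: sobolev_B_def)
  have "1 / p \<le> 1" using p by simp
  then have "vanishes_on_boundary L (wderiv L 1 v)" using v by (auto simp: sobolev_B_def)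
  then obtain w where w: "continuous_on {0..L} w" "AE x in lebesgue. x \<in> {0<..<L} \<longrightarrow> wderiv L 1 v x = w x"
    "w 0 = 0" "w L = 0" by (auto simp: vanishes_on_boundary_def)
  note d = sobolev_wderiv[OF vs]
  have ai: "wderiv L j v absolutely_integrable_on {0..L}" if "j \<le> 3" for j
    using LpM_absolutely_integrable[OF p d(2)[OF that]] .
  have w12: "has_weak_deriv L 1 (wderiv L 1 v) (wderiv L 2 v)"
    using has_weak_deriv_shift[of L 1 v "wderiv L 1 v" 1 "wderiv L 2 v"] d(1)[of 1] d(1)[of 2]
    by (simp add: numeral_2_eq_2)
  have w23: "has_weak_deriv L 1 (wderiv L 2 v) (wderiv L 3 v)"
    using has_weak_deriv_shift[of L 2 v "wderiv L 2 v" 1 "wderiv L 3 v"] d(1)[of 2] d(1)[of 3] by simp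
  obtain G where G: "AC 0 L G (wderiv L 2 v)" "AE x in lebesgue. x \<in> {0<..<L} \<longrightarrow> wderiv L 1 v x = G x"
    using weak_deriv_AC_representative[OF L w12 ai ai] by auto
  have "AE x in lebesgue. x \<in> {0<..<L} \<longrightarrow> w x = G x"
    using w(2) G(2) by eventually_elim auto
  from continuous_AE_eq[OF L w(1) AC_continuous_on[OF G(1)] this]
  have 1: "AC 0 L w (wderiv L 2 v)" using L by (intro AC_cong[OF G(1)]) auto
  obtain H where "AC 0 L H (wderiv L 3 v)" "AE x in lebesgue. x \<in> {0<..<L} \<longrightarrow> wderiv L 2 v x = H x"
    using weak_deriv_AC_representative[OF L w23 ai ai] by auto
  then show ?thesis using that[OF 1 w(3,4,2)] by blast
qed

text \<open>
  Two applications of the fundamental theorem of calculus. As \<open>v\<^sub>x\<close> vanishes at both end points, \<open>v\<^sub>x\<^sub>x\<close> has mean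
  value zero, so \<open>|v\<^sub>x\<^sub>x| \<le> \<integral> |v\<^sub>x\<^sub>x\<^sub>x|\<close>; integrating from the end point \<open>0\<close> bounds \<open>v\<^sub>x\<close> by \<open>L\<close> times that integral. Jensen's
  inequality turns the \<open>L\<^sup>1\<close>-norm into the \<open>L\<^sup>p\<close>-norm.
\<close>

lemma poincare_third_derivative:
  assumes L: "0 < L" and p: "1 < p" and v: "v \<in> sobolev_B L 3 p"
  shows "deriv_norm2 L v powr p \<le> (L * sqrt L) powr p * L powr (p - 1) * (\<integral>x. \<bar>wderiv L 3 v x\<bar> powr p \<partial>Om L)"
proof -
  have p1: "1 \<le> p" using p by simp
  obtain w H where w: "AC 0 L w (wderiv L 2 v)" "w 0 = 0" "w L = 0"
    "AE x in lebesgue. x \<in> {0<..<L} \<longrightarrow> wderiv L 1 v x = w x"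
    and H: "AC 0 L H (wderiv L 3 v)" "AE x in lebesgue. x \<in> {0<..<L} \<longrightarrow> wderiv L 2 v x = H x"
    using sobolev_B_boundary[OF L p1 v] by blast
  have l3: "LpM (Om L) p (wderiv L 3 v)" using v by (intro sobolev_wderiv(2)) (auto simp: sobolev_B_def)
  define I where "I = integral {0..L} (\<lambda>x. \<bar>wderiv L 3 v x\<bar>)"
  have I: "I = (\<integral>x. \<bar>wderiv L 3 v x\<bar> \<partial>Om L)"
    unfolding I_def using integral_Om[OF set_integrable_abs[OF LpM_absolutely_integrable[OF p1 l3]]] by simp
  have cH: "H integrable_on {s..t}" if "0 \<le> s" "t \<le> L" for s t
    using that by (intro integrable_continuous_real continuous_on_subset[OF AC_continuous_on[OF H(1)]]) auto
  have eq: "integral {s..t} (wderiv L 2 v) = integral {s..t} H" if "0 \<le> s" "t \<le> L" for s t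
  proof -
    have ae: "AE x in lebesgue. x \<in> {s<..<t} \<longrightarrow> wderiv L 2 v x = H x"
      using H(2) by eventually_elim (use that in auto)
    have "wderiv L 2 v absolutely_integrable_on {s<..<t}"
      using AC_integrable[OF w(1) that] by (simp add: absolutely_integrable_on_Icc_iff_Ioo)
    from absolutely_integrable_AE_cong(2)[OF this ae] show ?thesis
      by (simp add: integral_open_interval_real)
  qed
  have "integral {0..L} H = 0" using AC_diff[OF w(1), of 0 L] w L eq[of 0 L] by simp
  have osc: "\<bar>H x - H y\<bar> \<le> I" if "x \<in> {0..L}" "y \<in> {0..L}" for x y
  proof -
    have *: "\<bar>H b - H a\<bar> \<le> I" if ab: "0 \<le> a" "a \<le> b" "b \<le> L" for a b
    proof -
      have "\<bar>H b - H a\<bar> \<le> integral {a..b} (\<lambda>x. \<bar>wderiv L 3 v x\<bar>)" by (rule AC_abs_bound[OF H(1) ab])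
      also have "\<dots> \<le> I" unfolding I_def
        using ab AC_integrable[OF H(1), of a b] AC_integrable[OF H(1), of 0 L]
        by (intro integral_subset_le) (auto simp: absolutely_integrable_on_def)
      finally show ?thesis .
    qed
    show ?thesis using *[of x y] *[of y x] that by (cases "x \<le> y") (auto simp: abs_minus_commute)
  qed
  have Hb: "\<bar>H x\<bar> \<le> I" if x: "x \<in> {0..L}" for x
  proof -
    have "norm (integral {0..L} (\<lambda>y. H x - H y)) \<le> integral {0..L} (\<lambda>y. I)"
      using osc[OF x] cH[of 0 L] by (intro integral_norm_bound_integral integrable_diff) auto
    moreover have "integral {0..L} (\<lambda>y. H x - H y) = L * H x - integral {0..L} H"
      using L cH[of 0 L] by (subst integral_diff) auto
    ultimately show ?thesis using \<open>integral {0..L} H = 0\<close> L by (simp add: abs_mult)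
  qed
  have wb: "\<bar>w x\<bar> \<le> L * I" if x: "x \<in> {0..L}" for x
  proof -
    have "w x = integral {0..x} H" using AC_diff[OF w(1), of 0 x] x w eq[of 0 x] by auto
    moreover have "norm (integral {0..x} H) \<le> integral {0..x} (\<lambda>y. I)"
      using Hb x cH[of 0 x] by (intro integral_norm_bound_integral) auto
    moreover have "x * I \<le> L * I" using x I by (intro mult_right_mono) auto
    ultimately show ?thesis using x by simp
  qed
  have I0: "0 \<le> I" by (simp add: I)
  have "(\<integral>x. (wderiv L 1 v x)\<^sup>2 \<partial>Om L) \<le> (\<integral>x. (L * I)\<^sup>2 \<partial>Om L)"
  proof (cases "integrable (Om L) (\<lambda>x. (wderiv L 1 v x)\<^sup>2)")
    case True
    have "AE x in Om L. (wderiv L 1 v x)\<^sup>2 \<le> (L * I)\<^sup>2"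
    proof (subst AE_lebesgue_on_iff)
      show "AE x in lebesgue. x \<in> {0<..<L} \<longrightarrow> (wderiv L 1 v x)\<^sup>2 \<le> (L * I)\<^sup>2"
        using w(4)
      proof eventually_elim
        case (elim x)
        show ?case
        proof
          assume x: "x \<in> {0<..<L}"
          then have "\<bar>wderiv L 1 v x\<bar> \<le> \<bar>L * I\<bar>" using elim wb[of x] by simp
          then show "(wderiv L 1 v x)\<^sup>2 \<le> (L * I)\<^sup>2" by (rule abs_le_square_iff[THEN iffD1])
        qed
      qed
    qed simp
    then show ?thesis using True finite_measure.integrable_const[OF finite_measure_Om] by (intro integral_mono_AE) auto
  next
    case False
    then show ?thesis by (simp add: not_integrable_integral_eq)
  qed
  also have "\<dots> = L * (L * I)\<^sup>2" using measure_Om[OF L] by simp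
  finally have "deriv_norm2 L v \<le> sqrt (L * (L * I)\<^sup>2)" unfolding deriv_norm2_eq by (rule real_sqrt_le_mono)
  also have "\<dots> = (L * sqrt L) * I" using L I0 by (simp add: real_sqrt_mult)
  finally have "deriv_norm2 L v powr p \<le> ((L * sqrt L) * I) powr p"
    using p by (intro powr_mono2 deriv_norm2_nonneg) auto
  also have "\<dots> = (L * sqrt L) powr p * I powr p" using L I0 by (simp add: powr_mult)
  also have "\<dots> \<le> (L * sqrt L) powr p * (L powr (p - 1) * (\<integral>x. \<bar>wderiv L 3 v x\<bar> powr p \<partial>Om L))"
    unfolding I using finite_measure.jensen_powr[OF finite_measure_Om p l3 measure_Om[OF L] L]
    by (intro mult_left_mono) auto
  finally show ?thesis by (simp add: mult.assoc)
qed

text \<open>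
  Integration by parts; the boundary terms vanish because of the boundary condition on \<open>v\<^sub>x\<close>, with
  no condition on \<open>g\<close>.
\<close>

lemma functional_of_minus_second_derivative:
  assumes L: "0 < L" and p: "1 \<le> p" and v: "v \<in> sobolev_B L 3 p" and g: "g \<in> sobolev L 1 2"
  shows "functional_of L g (\<lambda>x. - wderiv L 2 v x) = (\<integral>x. wderiv L 1 g x * wderiv L 1 v x \<partial>Om L)"
    and "LpM (Om L) 2 (wderiv L 1 v)"
proof -
  obtain w H where w: "AC 0 L w (wderiv L 2 v)" "w 0 = 0" "w L = 0"
    "AE x in lebesgue. x \<in> {0<..<L} \<longrightarrow> wderiv L 1 v x = w x"
    using sobolev_B_boundary[OF L p v] by blast
  obtain G where G: "AC 0 L G (wderiv L 1 g)" "AE x in lebesgue. x \<in> {0<..<L} \<longrightarrow> g x = G x"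
    using sobolev_AC[of L 2 g] L g by auto
  have i1: "(\<lambda>x. G x * wderiv L 2 v x) absolutely_integrable_on {0..L}"
    using absolutely_integrable_continuous_mult[OF AC_continuous_on[OF G(1)]] w(1) by (auto simp: AC_def)
  have i2: "(\<lambda>x. wderiv L 1 g x * w x) absolutely_integrable_on {0..L}"
    using absolutely_integrable_continuous_mult[OF AC_continuous_on[OF w(1)], of "wderiv L 1 g"] G(1)
    by (auto simp: AC_def mult.commute)
  have parts: "integral {0..L} (\<lambda>x. G x * wderiv L 2 v x) = - integral {0..L} (\<lambda>x. wderiv L 1 g x * w x)"
    using AC_integration_by_parts[OF _ G(1) w(1)] w L by simp
  have "(\<lambda>x. - (G x * wderiv L 2 v x)) absolutely_integrable_on {0<..<L}"
    using set_integrable_mult_right[OF i1, of "-1"] by (simp add: absolutely_integrable_on_Icc_iff_Ioo)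
  moreover have "AE x in lebesgue. x \<in> {0<..<L} \<longrightarrow> - (G x * wderiv L 2 v x) = g x * - wderiv L 2 v x"
    using G(2) by eventually_elim auto
  ultimately have "(\<lambda>x. g x * - wderiv L 2 v x) absolutely_integrable_on {0<..<L}"
    "integral {0<..<L} (\<lambda>x. g x * - wderiv L 2 v x) = integral {0<..<L} (\<lambda>x. - (G x * wderiv L 2 v x))"
    by (rule absolutely_integrable_AE_cong)+
  then have 1: "functional_of L g (\<lambda>x. - wderiv L 2 v x) = - integral {0..L} (\<lambda>x. G x * wderiv L 2 v x)"
    unfolding functional_of_def by (simp add: set_lebesgue_integral_eq_integral integral_open_interval_real)
  have "(\<lambda>x. wderiv L 1 g x * w x) absolutely_integrable_on {0<..<L}"
    using i2 by (simp add: absolutely_integrable_on_Icc_iff_Ioo)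
  moreover have "AE x in lebesgue. x \<in> {0<..<L} \<longrightarrow> wderiv L 1 g x * w x = wderiv L 1 g x * wderiv L 1 v x"
    using w(4) by eventually_elim auto
  ultimately have "(\<lambda>x. wderiv L 1 g x * wderiv L 1 v x) absolutely_integrable_on {0<..<L}"
    "integral {0<..<L} (\<lambda>x. wderiv L 1 g x * wderiv L 1 v x) = integral {0<..<L} (\<lambda>x. wderiv L 1 g x * w x)"
    by (rule absolutely_integrable_AE_cong)+
  then have "(\<integral>x. wderiv L 1 g x * wderiv L 1 v x \<partial>Om L) = integral {0..L} (\<lambda>x. wderiv L 1 g x * w x)"
    by (subst integral_Om) (auto simp: absolutely_integrable_on_Icc_iff_Ioo integral_open_interval_real)
  then show "functional_of L g (\<lambda>x. - wderiv L 2 v x) = (\<integral>x. wderiv L 1 g x * wderiv L 1 v x \<partial>Om L)"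
    using 1 parts by simp
  have cw: "continuous_on {0..L} w" by (rule AC_continuous_on[OF w(1)])
  have "LpM (Om L) 2 w"
    unfolding LpM_def
  proof
    have "w absolutely_integrable_on {0..L}" using cw by (rule absolutely_integrable_continuous_real)
    then show "w \<in> borel_measurable (Om L)" using integrable_Om by blast
    have "(\<lambda>x. (w x)\<^sup>2) absolutely_integrable_on {0..L}"
      using cw by (intro absolutely_integrable_continuous_real continuous_intros)
    then show "integrable (Om L) (\<lambda>x. \<bar>w x\<bar> powr 2)" using integrable_Om by simp
  qed
  moreover have "AE x in lebesgue. x \<in> {0<..<L} \<longrightarrow> w x = wderiv L 1 v x"
    using w(4) by eventually_elim auto
  ultimately show "LpM (Om L) 2 (wderiv L 1 v)" by (rule LpM_AE_cong(1))
qed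

text \<open>
  The tangent inequality for the convex functional \<open>v \<mapsto> \<parallel>v\<^sub>x\<parallel>\<^sup>2 / 2\<close>, whose gradient at \<open>b\<close> is
  \<open>-b\<^sub>x\<^sub>x\<close>. It is the expansion of \<open>\<parallel>b\<^sub>x - a\<^sub>x\<parallel>\<^sup>2 \<ge> 0\<close>.
\<close>

lemma energy_convexity:
  assumes L: "0 < L" and p: "1 \<le> p" and b: "b \<in> sobolev_B L 3 p" "b \<in> H1 L" and a: "a \<in> H1 L"
  shows "(deriv_norm2 L b)\<^sup>2 / 2 - (deriv_norm2 L a)\<^sup>2 / 2 \<le>
    functional_of L b (\<lambda>x. - wderiv L 2 b x) - functional_of L a (\<lambda>x. - wderiv L 2 b x)"
proof -
  have as: "a \<in> sobolev L 1 2" and bs: "b \<in> sobolev L 1 2" using a b by (auto simp: H1_def)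
  have la: "LpM (Om L) 2 (wderiv L 1 a)" and lb: "LpM (Om L) 2 (wderiv L 1 b)"
    using sobolev_wderiv(2)[OF as order_refl] sobolev_wderiv(2)[OF bs order_refl] by auto
  note ib = Cauchy_Schwarz_LpM(1)[OF lb lb] and ia = Cauchy_Schwarz_LpM(1)[OF la la]
    and iab = Cauchy_Schwarz_LpM(1)[OF la lb]
  have "0 \<le> (\<integral>x. (wderiv L 1 b x - wderiv L 1 a x)\<^sup>2 \<partial>Om L)" by simp
  also have "(\<lambda>x. (wderiv L 1 b x - wderiv L 1 a x)\<^sup>2) =
     (\<lambda>x. wderiv L 1 b x * wderiv L 1 b x + wderiv L 1 a x * wderiv L 1 a x - 2 * (wderiv L 1 a x * wderiv L 1 b x))"
    by (auto simp: fun_eq_iff power2_eq_square algebra_simps)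
  also have "(\<integral>x. \<dots> x \<partial>Om L) = (\<integral>x. wderiv L 1 b x * wderiv L 1 b x \<partial>Om L) +
      (\<integral>x. wderiv L 1 a x * wderiv L 1 a x \<partial>Om L) - 2 * (\<integral>x. wderiv L 1 a x * wderiv L 1 b x \<partial>Om L)"
    using ia ib iab by (subst Bochner_Integration.integral_diff) auto
  finally show ?thesis
    unfolding functional_of_minus_second_derivative(1)[OF L p b(1) as]
      functional_of_minus_second_derivative(1)[OF L p b(1) bs]
    unfolding deriv_norm2_squared unfolding power2_eq_square by linarith
qed

section \<open>Bochner spaces and dual pairings\<close>

lemma integral_le_AE:
  fixes f g :: "real \<Rightarrow> real"
  assumes S: "S \<in> sets lebesgue" and f: "f absolutely_integrable_on S" and g: "g absolutely_integrable_on S"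
    and ae: "AE t in lebesgue. t \<in> S \<longrightarrow> f t \<le> g t"
  shows "integral S f \<le> integral S g"
  using integral_mono_AE[OF integral_lebesgue_on(1)[OF f S] integral_lebesgue_on(1)[OF g S]] ae
  by (simp add: integral_lebesgue_on(2)[OF f S] integral_lebesgue_on(2)[OF g S] AE_lebesgue_on_iff[OF S])

lemma borel_measurable_AE_limit:
  fixes f :: "nat \<Rightarrow> real \<Rightarrow> real"
  assumes S: "S \<in> sets lebesgue" and f: "\<And>n. f n \<in> borel_measurable (lebesgue_on S)"
    and lim: "AE t in lebesgue. t \<in> S \<longrightarrow> (\<lambda>n. f n t) \<longlonglongrightarrow> g t"
  shows "g \<in> borel_measurable (lebesgue_on S)"
proof -
  have fm: "(\<lambda>t. indicator S t *\<^sub>R f n t) \<in> borel_measurable lebesgue" for n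
    using f[of n] S by (subst (asm) borel_measurable_restrict_space_iff) auto
  define Z where "Z = {t. \<not> (t \<in> S \<longrightarrow> (\<lambda>n. f n t) \<longlonglongrightarrow> g t)}"
  have Z: "Z \<in> null_sets lebesgue"
    using lim unfolding Z_def by (simp add: completion.AE_iff_null_sets)
  have "(\<lambda>t. indicator (- Z) t *\<^sub>R (indicator S t *\<^sub>R g t)) \<in> borel_measurable lebesgue"
  proof (rule borel_measurable_LIMSEQ_real)
    show "(\<lambda>t. indicator (- Z) t *\<^sub>R (indicator S t *\<^sub>R f n t)) \<in> borel_measurable lebesgue" for n
    proof (rule borel_measurable_scaleR[OF borel_measurable_indicator fm])
      show "- Z \<in> sets lebesgue" 
        using sets.Diff[OF sets.top[of lebesgue] null_setsD2[OF Z]] by (simp add: Compl_eq_Diff_UNIV)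
    qed
    show "(\<lambda>n. indicator (- Z) t *\<^sub>R (indicator S t *\<^sub>R f n t)) \<longlonglongrightarrow> indicator (- Z) t *\<^sub>R (indicator S t *\<^sub>R g t)" for t
      by (cases "t \<in> Z"; cases "t \<in> S") (auto simp: Z_def)
  qed
  moreover have "AE t in lebesgue. indicator (- Z) t *\<^sub>R (indicator S t *\<^sub>R g t) = indicator S t *\<^sub>R g t"
    using AE_not_in[OF Z] by eventually_elim auto
  ultimately have "(\<lambda>t. indicator S t *\<^sub>R g t) \<in> borel_measurable lebesgue"
    by (rule borel_measurable_AE)
  then show ?thesis using S by (subst borel_measurable_restrict_space_iff) auto
qed

text \<open>
  Simple functions in the sense of Bochner measurability.
\<close>

definition simple_on :: "real set \<Rightarrow> (real \<Rightarrow> 'v) \<Rightarrow> bool" where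
  "simple_on S s \<longleftrightarrow> finite (s ` S) \<and> (\<forall>v. {t \<in> S. s t = v} \<in> sets lebesgue)"

lemma simple_on_measurable:
  fixes G :: "real \<Rightarrow> 'v \<Rightarrow> real"
  assumes S: "S \<in> sets lebesgue" and s: "simple_on S s"
    and G: "\<And>v. v \<in> s ` S \<Longrightarrow> (\<lambda>t. G t v) \<in> borel_measurable (lebesgue_on S)"
  shows "(\<lambda>t. G t (s t)) \<in> borel_measurable (lebesgue_on S)"
proof -
  have "(\<lambda>t. \<Sum>v\<in>s ` S. indicator {t \<in> S. s t = v} t * G t v) \<in> borel_measurable (lebesgue_on S)"
  proof (intro borel_measurable_sum borel_measurable_times G)
    fix v
    have "{t \<in> S. s t = v} \<in> sets (lebesgue_on S)"
      using s S by (auto simp: sets_restrict_space_iff simple_on_def)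
    then show "(indicator {t \<in> S. s t = v} :: real \<Rightarrow> real) \<in> borel_measurable (lebesgue_on S)" by simp
  qed
  moreover have "(\<Sum>v\<in>s ` S. indicator {t \<in> S. s t = v} t * G t v) = G t (s t)" if "t \<in> S" for t
  proof -
    have "(\<Sum>v\<in>s ` S. indicator {t \<in> S. s t = v} t * G t v) = (\<Sum>v\<in>{s t}. indicator {t \<in> S. s t = v} t * G t v)"
      using s that by (intro sum.mono_neutral_right) (auto simp: simple_on_def)
    then show ?thesis using that by simp
  qed
  ultimately show ?thesis
    by (subst measurable_cong[where g = "\<lambda>t. \<Sum>v\<in>s ` S. indicator {t \<in> S. s t = v} t * G t v"]) auto
qed

lemma simple_on_map2:
  assumes S: "S \<in> sets lebesgue" and a: "simple_on S a" and b: "simple_on S b"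
  shows "simple_on S (\<lambda>t. h (a t) (b t))"
proof -
  have "(\<lambda>t. h (a t) (b t)) ` S \<subseteq> (\<lambda>(x, y). h x y) ` (a ` S \<times> b ` S)" by auto
  moreover have "finite ((\<lambda>(x, y). h x y) ` (a ` S \<times> b ` S))" using a b by (auto simp: simple_on_def)
  ultimately have "finite ((\<lambda>t. h (a t) (b t)) ` S)" by (rule finite_subset)
  moreover have "{t \<in> S. h (a t) (b t) = v} \<in> sets lebesgue" for v
  proof -
    have "{t \<in> S. h (a t) (b t) = v} = (\<Union>x\<in>a ` S. \<Union>y\<in>b ` S. if h x y = v then {t \<in> S. a t = x} \<inter> {t \<in> S. b t = y} else {})"
      by (auto split: if_splits)
    also have "\<dots> \<in> sets lebesgue"
      using a b by (intro sets.finite_UN) (auto simp: simple_on_def)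
    finally show ?thesis .
  qed
  ultimately show ?thesis by (simp add: simple_on_def)
qed

lemma simple_on_const: "S \<in> sets lebesgue \<Longrightarrow> simple_on S (\<lambda>t. c)"
proof -
  assume S: "S \<in> sets lebesgue"
  have "{t \<in> S. c = v} = (if c = v then S else {})" for v by auto
  then show ?thesis using S by (auto simp: simple_on_def intro: finite_subset[of _ "{c}"])
qed

lemma simple_on_if:
  assumes S: "S \<in> sets lebesgue" and a: "simple_on S a" and A: "A \<in> sets lebesgue"
  shows "simple_on S (\<lambda>t. if t \<in> A then a t else c)"
proof -
  have "simple_on S (\<lambda>t. t \<in> A)"
  proof -
    have "{t \<in> S. (t \<in> A) = v} = (if v then S \<inter> A else S - A)" for v by auto
    then show ?thesis using S A by (auto simp: simple_on_def intro: finite_subset[of _ UNIV])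
  qed
  from simple_on_map2[OF S this a, of "\<lambda>b x. if b then x else c"] show ?thesis .
qed

lemma strongly_measurable_iff:
  "strongly_measurable X N S g \<longleftrightarrow> (\<exists>s. (\<forall>n. s n ` S \<subseteq> X \<and> simple_on S (s n)) \<and>
     (AE t in lebesgue. t \<in> S \<longrightarrow> g t \<in> X \<and> (\<lambda>n. N (s n t - g t)) \<longlonglongrightarrow> 0))"
  by (simp add: strongly_measurable_def simple_on_def)

text \<open>
  The Sobolev spaces are instances. Only a seminorm is assumed, because functions are not
  identified when they agree almost everywhere.
\<close>

locale seminormed_space =
  fixes X :: "(real \<Rightarrow> real) set" and N :: "(real \<Rightarrow> real) \<Rightarrow> real"
  assumes zero_mem: "(\<lambda>x. 0) \<in> X"
    and lincomb: "v \<in> X \<Longrightarrow> w \<in> X \<Longrightarrow> (\<lambda>x. a * v x + b * w x) \<in> X"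
    and N_nonneg: "0 \<le> N v"
    and N_lincomb: "v \<in> X \<Longrightarrow> w \<in> X \<Longrightarrow> N (\<lambda>x. a * v x + b * w x) \<le> \<bar>a\<bar> * N v + \<bar>b\<bar> * N w"
begin

abbreviation "X' \<equiv> dual_space X N"
abbreviation "N' \<equiv> dual_norm X N"

lemma diff_eq_lincomb: "v - w = (\<lambda>x. 1 * v x + (- 1) * w x)" for v w :: "real \<Rightarrow> real"
  by (auto simp: fun_eq_iff)

lemma diff_mem: "v \<in> X \<Longrightarrow> w \<in> X \<Longrightarrow> v - w \<in> X"
  unfolding diff_eq_lincomb by (rule lincomb)

lemma N_diff_le: "v \<in> X \<Longrightarrow> w \<in> X \<Longrightarrow> N (v - w) \<le> N v + N w"
  unfolding diff_eq_lincomb using N_lincomb[of v w 1 "-1"] by simp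

lemma N_zero: "N (\<lambda>x. 0) = 0"
  using N_lincomb[OF zero_mem zero_mem, of 0 0] N_nonneg[of "\<lambda>x. 0"] by simp

lemma N_diff_self: "v \<in> X \<Longrightarrow> N (v - v) = 0"
  using N_zero by (simp add: fun_diff_def)

lemma N_diff_commute: "v \<in> X \<Longrightarrow> w \<in> X \<Longrightarrow> N (v - w) = N (w - v)"
proof -
  have "N (v - w) \<le> N (w - v)" if "v \<in> X" "w \<in> X" for v w
  proof -
    have "v - w = (\<lambda>x. (- 1) * (w - v) x + 0 * (w - v) x)" by (auto simp: fun_eq_iff)
    then show ?thesis using N_lincomb[OF diff_mem diff_mem, OF that(2,1) that(2,1), of "-1" 0] by simp
  qed
  then show "v \<in> X \<Longrightarrow> w \<in> X \<Longrightarrow> N (v - w) = N (w - v)" by (simp add: antisym)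
qed

lemma N_reverse_triangle: "v \<in> X \<Longrightarrow> w \<in> X \<Longrightarrow> \<bar>N v - N w\<bar> \<le> N (v - w)"
proof -
  have *: "N v \<le> N w + N (v - w)" if "v \<in> X" "w \<in> X" for v w
  proof -
    have "v = (\<lambda>x. 1 * (v - w) x + 1 * w x)" by auto
    then show ?thesis using N_lincomb[OF diff_mem[OF that] that(2), of 1 1] by simp
  qed
  assume "v \<in> X" "w \<in> X"
  then show ?thesis using *[of v w] *[of w v] N_diff_commute[of v w] by linarith
qed

lemma dual_lincomb: "l \<in> X' \<Longrightarrow> v \<in> X \<Longrightarrow> w \<in> X \<Longrightarrow> l (\<lambda>x. a * v x + b * w x) = a * l v + b * l w"
  by (simp add: dual_space_def)

lemma dual_diff: "l \<in> X' \<Longrightarrow> v \<in> X \<Longrightarrow> w \<in> X \<Longrightarrow> l (v - w) = l v - l w"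
  unfolding diff_eq_lincomb using dual_lincomb[of l v w 1 "-1"] by simp

lemma dual_zero: "l \<in> X' \<Longrightarrow> l (\<lambda>x. 0) = 0"
  using dual_lincomb[OF _ zero_mem zero_mem, of l 0 0] by simp

lemma dual_norm_bound:
  assumes l: "l \<in> X'"
  shows "0 \<le> N' l" "v \<in> X \<Longrightarrow> \<bar>l v\<bar> \<le> N' l * N v"
proof -
  obtain K where K: "\<And>v. v \<in> X \<Longrightarrow> \<bar>l v\<bar> \<le> K * N v" using l unfolding dual_space_def by blast
  have bdd: "bdd_above {\<bar>l v\<bar> | v. v \<in> X \<and> N v \<le> 1}"
  proof (rule bdd_aboveI)
    fix y assume "y \<in> {\<bar>l v\<bar> | v. v \<in> X \<and> N v \<le> 1}"
    then obtain v where v: "y = \<bar>l v\<bar>" "v \<in> X" "N v \<le> 1" by blast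
    have "K * N v \<le> \<bar>K\<bar> * 1" using v N_nonneg[of v] by (intro mult_mono) auto
    then show "y \<le> \<bar>K\<bar>" using K[OF v(2)] v(1) by simp
  qed
  have up: "\<bar>l v\<bar> \<le> N' l" if "v \<in> X" "N v \<le> 1" for v
    unfolding dual_norm_def using that by (intro cSup_upper bdd) blast
  show "0 \<le> N' l" using up[OF zero_mem] N_zero by simp
  show "\<bar>l v\<bar> \<le> N' l * N v" if v: "v \<in> X"
  proof (cases "N v = 0")
    case True then show ?thesis using K[OF v] by simp
  next
    case False
    then have pos: "0 < N v" using N_nonneg[of v] by simp
    define z where "z = (\<lambda>x. (1 / N v) * v x + 0 * v x)"
    have z: "z \<in> X" unfolding z_def by (rule lincomb[OF v v])
    have "N z \<le> 1" using N_lincomb[OF v v, of "1 / N v" 0] pos by (simp add: z_def)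
    then have "\<bar>l z\<bar> \<le> N' l" by (rule up[OF z])
    moreover have "l z = l v / N v" unfolding z_def using dual_lincomb[OF l v v, of "1 / N v" 0] by simp
    ultimately show ?thesis using pos by (simp add: abs_divide field_simps)
  qed
qed

lemma dual_minus_mem: "l \<in> X' \<Longrightarrow> m \<in> X' \<Longrightarrow> l - m \<in> X'"
proof -
  assume l: "l \<in> X'" and m: "m \<in> X'"
  have "\<bar>(l - m) v\<bar> \<le> (N' l + N' m) * N v" if "v \<in> X" for v
  proof -
    have "\<bar>(l - m) v\<bar> \<le> \<bar>l v\<bar> + \<bar>m v\<bar>" by simp
    also have "\<dots> \<le> N' l * N v + N' m * N v"
      using dual_norm_bound(2)[OF l that] dual_norm_bound(2)[OF m that] by linarith
    finally show ?thesis by (simp add: distrib_right)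
  qed
  then show ?thesis
    using l m unfolding dual_space_def by (auto simp: algebra_simps intro!: exI[of _ "N' l + N' m"])
qed

text \<open>
  The norm of a Bochner measurable function is the almost everywhere limit of the norms of the
  simple approximations.
\<close>

lemma norm_measurable:
  assumes S: "S \<in> sets lebesgue" and v: "strongly_measurable X N S v"
  shows "(\<lambda>t. N (v t)) \<in> borel_measurable (lebesgue_on S)"
    and "AE t in lebesgue. t \<in> S \<longrightarrow> v t \<in> X"
proof -
  obtain s where s: "\<And>n. s n ` S \<subseteq> X" "\<And>n. simple_on S (s n)"
    and lim: "AE t in lebesgue. t \<in> S \<longrightarrow> v t \<in> X \<and> (\<lambda>n. N (s n t - v t)) \<longlonglongrightarrow> 0"
    using v unfolding strongly_measurable_iff by blast
  show "AE t in lebesgue. t \<in> S \<longrightarrow> v t \<in> X" using lim by eventually_elim auto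
  show "(\<lambda>t. N (v t)) \<in> borel_measurable (lebesgue_on S)"
  proof (rule borel_measurable_AE_limit[OF S])
    show "(\<lambda>t. N (s n t)) \<in> borel_measurable (lebesgue_on S)" for n
      by (rule simple_on_measurable[OF S s(2)]) simp
    show "AE t in lebesgue. t \<in> S \<longrightarrow> (\<lambda>n. N (s n t)) \<longlonglongrightarrow> N (v t)"
      using lim
    proof eventually_elim
      case (elim t)
      show ?case
      proof
        assume t: "t \<in> S"
        have "s n t \<in> X" for n using s(1)[of n] t by auto
        then have "norm (N (s n t) - N (v t)) \<le> N (s n t - v t)" for n
          using N_reverse_triangle[of "s n t" "v t"] elim t by simp
        then have "(\<lambda>n. N (s n t) - N (v t)) \<longlonglongrightarrow> 0"
          by (intro Lim_null_comparison[OF always_eventually conjunct2[OF elim[rule_format, OF t]]]) simp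
        then show "(\<lambda>n. N (s n t)) \<longlonglongrightarrow> N (v t)" by (simp add: LIM_zero_iff)
      qed
    qed
  qed
qed

text \<open>
  Both arguments are approximated by simple functions; the pairings of the approximations are simple and
  converge because the pairing is continuous.
\<close>

lemma pairing_measurable:
  assumes S: "S \<in> sets lebesgue" and w: "strongly_measurable X' N' S w" and v: "strongly_measurable X N S v"
  shows "(\<lambda>t. w t (v t)) \<in> borel_measurable (lebesgue_on S)"
    and "AE t in lebesgue. t \<in> S \<longrightarrow> w t \<in> X'"
proof -
  obtain s where s: "\<And>n. s n ` S \<subseteq> X" "\<And>n. simple_on S (s n)"
    and lim: "AE t in lebesgue. t \<in> S \<longrightarrow> v t \<in> X \<and> (\<lambda>n. N (s n t - v t)) \<longlonglongrightarrow> 0"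
    using v unfolding strongly_measurable_iff by blast
  obtain r where r: "\<And>n. r n ` S \<subseteq> X'" "\<And>n. simple_on S (r n)"
    and rlim: "AE t in lebesgue. t \<in> S \<longrightarrow> w t \<in> X' \<and> (\<lambda>n. N' (r n t - w t)) \<longlonglongrightarrow> 0"
    using w unfolding strongly_measurable_iff by blast
  show "AE t in lebesgue. t \<in> S \<longrightarrow> w t \<in> X'" using rlim by eventually_elim auto
  show "(\<lambda>t. w t (v t)) \<in> borel_measurable (lebesgue_on S)"
  proof (rule borel_measurable_AE_limit[OF S])
    show "(\<lambda>t. r n t (s n t)) \<in> borel_measurable (lebesgue_on S)" for n
      using simple_on_measurable[OF S simple_on_map2[OF S r(2) s(2), where h = Pair], where G = "\<lambda>t. case_prod (\<lambda>l x. l x)"] by simp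
    show "AE t in lebesgue. t \<in> S \<longrightarrow> (\<lambda>n. r n t (s n t)) \<longlonglongrightarrow> w t (v t)"
      using lim rlim
    proof eventually_elim
      case (elim t)
      show ?case
      proof
        assume t: "t \<in> S"
        have vX: "v t \<in> X" and wX: "w t \<in> X'" using elim t by auto
        have sX: "s n t \<in> X" and rX: "r n t \<in> X'" for n using s(1)[of n] r(1)[of n] t by auto
        have l1: "(\<lambda>n. N (s n t - v t)) \<longlonglongrightarrow> 0" and l2: "(\<lambda>n. N' (r n t - w t)) \<longlonglongrightarrow> 0"
          using elim t by auto
        have "(\<lambda>n. N' (r n t - w t) * (N (v t) + N (s n t - v t)) + N' (w t) * N (s n t - v t)) \<longlonglongrightarrow>
            0 * (N (v t) + 0) + N' (w t) * 0"
          by (intro tendsto_intros l1 l2)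
        then have l3: "(\<lambda>n. N' (r n t - w t) * (N (v t) + N (s n t - v t)) + N' (w t) * N (s n t - v t)) \<longlonglongrightarrow> 0" by simp
        have "(\<lambda>n. r n t (s n t) - w t (v t)) \<longlonglongrightarrow> 0"
        proof (rule Lim_null_comparison[OF always_eventually l3], rule allI)
          fix n
          have "r n t (s n t) - w t (v t) = (r n t - w t) (s n t) + w t (s n t - v t)"
            using dual_diff[OF wX sX vX] by simp
          moreover have "\<bar>(r n t - w t) (s n t)\<bar> \<le> N' (r n t - w t) * N (s n t)"
            by (rule dual_norm_bound(2)[OF dual_minus_mem[OF rX wX] sX])
          moreover have "N' (r n t - w t) * N (s n t) \<le> N' (r n t - w t) * (N (v t) + N (s n t - v t))"
            using N_reverse_triangle[OF sX vX, of n] dual_norm_bound(1)[OF dual_minus_mem[OF rX wX]]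
            by (intro mult_left_mono) auto
          moreover have "\<bar>w t (s n t - v t)\<bar> \<le> N' (w t) * N (s n t - v t)"
            by (rule dual_norm_bound(2)[OF wX diff_mem[OF sX vX]])
          ultimately show "norm (r n t (s n t) - w t (v t)) \<le>
             N' (r n t - w t) * (N (v t) + N (s n t - v t)) + N' (w t) * N (s n t - v t)"
            unfolding real_norm_def by linarith
        qed
        then show "(\<lambda>n. r n t (s n t)) \<longlonglongrightarrow> w t (v t)" by (simp add: LIM_zero_iff)
      qed
    qed
  qed
qed

lemma pairing_integrable:
  assumes S: "S \<in> sets lebesgue" and pq: "1 < p" "1 < q" "1 / p + 1 / q = 1"
    and w: "w \<in> bochner_Lp q S X' N'" and v: "v \<in> bochner_Lp p S X N"
  shows "(\<lambda>t. w t (v t)) absolutely_integrable_on S"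
proof -
  have ws: "strongly_measurable X' N' S w" and wi: "(\<lambda>t. N' (w t) powr q) absolutely_integrable_on S"
    and vs: "strongly_measurable X N S v" and vi: "(\<lambda>t. N (v t) powr p) absolutely_integrable_on S"
    using v w by (auto simp: bochner_Lp_def)
  have "integrable (lebesgue_on S) (\<lambda>t. w t (v t))"
  proof (rule Bochner_Integration.integrable_bound)
    show "integrable (lebesgue_on S) (\<lambda>t. N' (w t) powr q / q + N (v t) powr p / p)"
      using integral_lebesgue_on(1)[OF wi S] integral_lebesgue_on(1)[OF vi S] by auto
    show "(\<lambda>t. w t (v t)) \<in> borel_measurable (lebesgue_on S)" by (rule pairing_measurable(1)[OF S ws vs])
    show "AE t in lebesgue_on S. norm (w t (v t)) \<le> norm (N' (w t) powr q / q + N (v t) powr p / p)"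
      unfolding AE_lebesgue_on_iff[OF S] using pairing_measurable(2)[OF S ws vs] norm_measurable(2)[OF S vs]
    proof eventually_elim
      case (elim t)
      show ?case
      proof
        assume t: "t \<in> S"
        have "\<bar>w t (v t)\<bar> \<le> N' (w t) * N (v t)" using elim t by (intro dual_norm_bound) auto
        also have "\<dots> \<le> N' (w t) powr q / q + N (v t) powr p / p"
          using elim t pq by (intro Youngs_inequality dual_norm_bound N_nonneg) auto
        finally show "norm (w t (v t)) \<le> norm (N' (w t) powr q / q + N (v t) powr p / p)" by simp
      qed
    qed
  qed
  then show ?thesis using S by (simp add: absolutely_integrable_iff_integrable)
qed

lemma simple_bochner_Lp:
  assumes S: "S \<in> sets lebesgue" "S \<subseteq> {a..b}" and s: "simple_on S s" "s ` S \<subseteq> X" and p: "0 < p"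
  shows "s \<in> bochner_Lp p S X N"
proof -
  have "strongly_measurable X N S s"
    unfolding strongly_measurable_iff using s N_diff_self
    by (intro exI[of _ "\<lambda>n. s"]) (auto intro!: AE_I2)
  moreover have "integrable (lebesgue_on S) (\<lambda>t. N (s t) powr p)"
  proof (rule Bochner_Integration.integrable_bound)
    have "(\<lambda>t. Max ((\<lambda>v. N v powr p) ` s ` S)) absolutely_integrable_on {a..b}"
      by (intro absolutely_integrable_continuous_real) auto
    then have "(\<lambda>t. Max ((\<lambda>v. N v powr p) ` s ` S)) absolutely_integrable_on S"
      using S by (rule set_integrable_subset)
    then show "integrable (lebesgue_on S) (\<lambda>t. Max ((\<lambda>v. N v powr p) ` s ` S))"
      using S integral_lebesgue_on(1) by blast
    show "(\<lambda>t. N (s t) powr p) \<in> borel_measurable (lebesgue_on S)"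
      by (rule simple_on_measurable[OF S(1) s(1), of "\<lambda>t v. N v powr p"]) simp
    show "AE t in lebesgue_on S. norm (N (s t) powr p) \<le> norm (Max ((\<lambda>v. N v powr p) ` s ` S))"
    proof (intro AE_I2)
      fix t assume "t \<in> space (lebesgue_on S)"
      then have "N (s t) powr p \<le> Max ((\<lambda>v. N v powr p) ` s ` S)"
        using s by (intro Max_ge) (auto simp: simple_on_def)
      then show "norm (N (s t) powr p) \<le> norm (Max ((\<lambda>v. N v powr p) ` s ` S))" by simp
    qed
  qed
  ultimately show ?thesis
    using S by (simp add: bochner_Lp_def absolutely_integrable_iff_integrable)
qed

text \<open>
  The simple functions from the definition of measurability need not converge in \<open>L\<^sup>p\<close>. Replacing
  them by \<open>0\<close> wherever their norm exceeds twice the norm of \<open>v\<close> keeps the pointwise limit and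
  makes dominated convergence applicable.
\<close>

lemma simple_approximation:
  assumes S: "S \<in> sets lebesgue" and p: "1 \<le> p" and v: "v \<in> bochner_Lp p S X N"
  obtains s where "\<And>n. s n ` S \<subseteq> X" "\<And>n. simple_on S (s n)"
    "\<And>n. (\<lambda>t. N (s n t - v t) powr p) absolutely_integrable_on S"
    "(\<lambda>n. integral S (\<lambda>t. N (s n t - v t) powr p)) \<longlonglongrightarrow> 0"
proof -
  have vs: "strongly_measurable X N S v" and vi: "(\<lambda>t. N (v t) powr p) absolutely_integrable_on S"
    using v by (auto simp: bochner_Lp_def)
  obtain r where r: "\<And>n. r n ` S \<subseteq> X" "\<And>n. simple_on S (r n)"
    and lim: "AE t in lebesgue. t \<in> S \<longrightarrow> v t \<in> X \<and> (\<lambda>n. N (r n t - v t)) \<longlonglongrightarrow> 0"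
    using vs unfolding strongly_measurable_iff by blast
  define B where "B n = {t \<in> S. N (r n t) \<le> 2 * N (v t)}" for n
  have B: "B n \<in> sets lebesgue" for n
  proof -
    have [measurable]: "(\<lambda>t. N (r n t)) \<in> borel_measurable (lebesgue_on S)"
      by (rule simple_on_measurable[OF S r(2)]) simp
    have [measurable]: "(\<lambda>t. N (v t)) \<in> borel_measurable (lebesgue_on S)"
      by (rule norm_measurable(1)[OF S vs])
    have "{t \<in> space (lebesgue_on S). N (r n t) \<le> 2 * N (v t)} \<in> sets (lebesgue_on S)" by measurable
    then show ?thesis using S by (simp add: B_def sets_restrict_space_iff)
  qed
  define s where "s n t = (if t \<in> B n then r n t else (\<lambda>x. 0))" for n t
  have sX: "s n ` S \<subseteq> X" for n using r(1)[of n] zero_mem by (auto simp: s_def)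
  have ss: "simple_on S (s n)" for n
    unfolding s_def by (rule simple_on_if[OF S r(2) B])
  have bound: "N (s n t - v t) \<le> 3 * N (v t)" if "t \<in> S" "v t \<in> X" for n t
  proof -
    have "N (s n t) \<le> 2 * N (v t)" using N_zero N_nonneg[of "v t"] by (simp add: s_def B_def)
    then show ?thesis using N_diff_le[of "s n t" "v t"] sX that by fastforce
  qed
  have slim: "AE t in lebesgue. t \<in> S \<longrightarrow> v t \<in> X \<and> (\<lambda>n. N (s n t - v t)) \<longlonglongrightarrow> 0"
    using lim
  proof eventually_elim
    case (elim t)
    show ?case
    proof
      assume t: "t \<in> S"
      have vX: "v t \<in> X" and rl: "(\<lambda>n. N (r n t - v t)) \<longlonglongrightarrow> 0" using elim t by auto
      show "v t \<in> X \<and> (\<lambda>n. N (s n t - v t)) \<longlonglongrightarrow> 0"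
      proof (cases "N (v t) = 0")
        case True
        then have "N (s n t - v t) = 0" for n using bound[OF t vX, of n] N_nonneg[of "s n t - v t"] by simp
        then show ?thesis using vX by simp
      next
        case False
        then have pos: "0 < N (v t)" using N_nonneg[of "v t"] by simp
        have "eventually (\<lambda>n. N (r n t - v t) < N (v t)) sequentially"
          using rl pos by (rule order_tendstoD)
        then have "eventually (\<lambda>n. N (r n t - v t) = N (s n t - v t)) sequentially"
        proof eventually_elim
          case (elim n)
          have "r n t \<in> X" using r(1)[of n] t by auto
          then have "N (r n t) \<le> 2 * N (v t)" using N_reverse_triangle[of "r n t" "v t"] vX elim by simp
          then show ?case using t by (simp add: s_def B_def)
        qed
        from Lim_transform_eventually[OF rl this] show ?thesis using vX by simp
      qed
    qed
  qed
  have sv: "strongly_measurable X N S (\<lambda>t. s n t - v t)" for n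
    unfolding strongly_measurable_iff
  proof (intro exI[of _ "\<lambda>m t. s n t - s m t"] conjI allI)
    show "(\<lambda>t. s n t - s m t) ` S \<subseteq> X" for m using sX[of n] sX[of m] diff_mem by auto
    show "simple_on S (\<lambda>t. s n t - s m t)" for m by (rule simple_on_map2[OF S ss ss])
    show "AE t in lebesgue. t \<in> S \<longrightarrow> s n t - v t \<in> X \<and> (\<lambda>m. N (s n t - s m t - (s n t - v t))) \<longlonglongrightarrow> 0"
      using slim
    proof eventually_elim
      case (elim t)
      show ?case
      proof
        assume t: "t \<in> S"
        have vX: "v t \<in> X" and sX': "s k t \<in> X" for k using elim t sX by auto
        have "s n t - s m t - (s n t - v t) = v t - s m t" for m by (auto simp: fun_eq_iff)
        then show "s n t - v t \<in> X \<and> (\<lambda>m. N (s n t - s m t - (s n t - v t))) \<longlonglongrightarrow> 0"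
          using elim t diff_mem[OF sX' vX] N_diff_commute[OF vX sX'] by simp
      qed
    qed
  qed
  have em: "(\<lambda>t. N (s n t - v t) powr p) \<in> borel_measurable (lebesgue_on S)" for n
    using norm_measurable(1)[OF S sv[of n]] by measurable
  have dom: "integrable (lebesgue_on S) (\<lambda>t. 3 powr p * N (v t) powr p)"
    using integral_lebesgue_on(1)[OF vi S] by simp
  have bd: "AE t in lebesgue_on S. norm (N (s n t - v t) powr p) \<le> 3 powr p * N (v t) powr p" for n
    unfolding AE_lebesgue_on_iff[OF S] using slim
  proof eventually_elim
    case (elim t)
    show ?case
    proof
      assume t: "t \<in> S"
      have "N (s n t - v t) powr p \<le> (3 * N (v t)) powr p"
        using elim t p by (intro powr_mono2 bound N_nonneg) auto
      then show "norm (N (s n t - v t) powr p) \<le> 3 powr p * N (v t) powr p"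
        using N_nonneg[of "v t"] by (simp add: powr_mult)
    qed
  qed
  have li: "AE t in lebesgue_on S. (\<lambda>n. N (s n t - v t) powr p) \<longlonglongrightarrow> 0"
    unfolding AE_lebesgue_on_iff[OF S] using slim
  proof eventually_elim
    case (elim t)
    show ?case
    proof
      assume t: "t \<in> S"
      have "(\<lambda>n. N (s n t - v t) powr p) \<longlonglongrightarrow> 0 powr p"
        using elim t p N_nonneg by (intro tendsto_powr2) (auto intro!: always_eventually)
      then show "(\<lambda>n. N (s n t - v t) powr p) \<longlonglongrightarrow> 0" by simp
    qed
  qed
  have i: "integrable (lebesgue_on S) (\<lambda>t. N (s n t - v t) powr p)" for n
  proof (rule Bochner_Integration.integrable_bound[OF dom em])
    show "AE t in lebesgue_on S. norm (N (s n t - v t) powr p) \<le> norm (3 powr p * N (v t) powr p)"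
      using bd[of n] by eventually_elim (erule order_trans, simp only: real_norm_def abs_ge_self)
  qed
  have ai: "(\<lambda>t. N (s n t - v t) powr p) absolutely_integrable_on S" for n
    using i S by (simp add: absolutely_integrable_iff_integrable)
  have "(\<lambda>n. \<integral>t. N (s n t - v t) powr p \<partial>lebesgue_on S) \<longlonglongrightarrow> (\<integral>t. 0 \<partial>lebesgue_on S)"
    by (rule integral_dominated_convergence[OF _ em dom li bd]) simp
  then have "(\<lambda>n. integral S (\<lambda>t. N (s n t - v t) powr p)) \<longlonglongrightarrow> 0"
    by (simp add: integral_lebesgue_on(2)[OF ai S])
  from that[OF sX ss ai this] show ?thesis .
qed

end

section \<open>The chain rule for a convex energy\<close>

text \<open>
  A free weight \<open>d\<close> on Young's inequality: letting first the approximation error and then \<open>d\<close> tend to zero replaces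
  Hoelder's inequality and the computation of \<open>L\<^sup>p\<close>-norms.
\<close>

lemma young_weighted:
  fixes a b :: real
  assumes pq: "1 < p" "1 < q" "1 / p + 1 / q = 1" and d: "0 < d" and ab: "0 \<le> a" "0 \<le> b"
  shows "a * b \<le> d powr q * a powr q + d powr (- p) * b powr p"
proof -
  have "(b / d) * (d * a) \<le> (b / d) powr p / p + (d * a) powr q / q"
    using ab d by (intro Youngs_inequality pq) auto
  also have "\<dots> \<le> (b / d) powr p / 1 + (d * a) powr q / 1"
    using pq by (intro add_mono divide_left_mono) auto
  finally show ?thesis using d ab by (simp add: powr_mult powr_divide powr_minus_divide mult.commute)
qed

lemma window_jensen:
  assumes q: "1 < q" and m: "\<And>x. 0 \<le> m x" and M: "AC a b P m" and Q: "AC a b Q (\<lambda>x. m x powr q)"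
    and h: "0 < h" "a \<le> t - h" "t \<le> b"
  shows "((P t - P (t - h)) / h) powr q \<le> (Q t - Q (t - h)) / h"
proof -
  let ?M = "lebesgue_on {t-h..t}"
  have fin: "finite_measure ?M"
    by (rule finite_measureI) (use h in \<open>simp add: emeasure_restrict_space\<close>)
  have V: "measure ?M (space ?M) = h" using h by (simp add: measure_restrict_space)
  note i1 = integral_lebesgue_on[OF AC_integrable[OF M h(2,3)]]
  note i2 = integral_lebesgue_on[OF AC_integrable[OF Q h(2,3)]]
  have "LpM ?M q m" using i1(1) i2(1) m by (simp add: LpM_def)
  from finite_measure.jensen_powr[OF fin q this V h(1)]
  have "(P t - P (t - h)) powr q \<le> h powr (q - 1) * (Q t - Q (t - h))"
    using AC_diff[OF M h(2) _ h(3)] AC_diff[OF Q h(2) _ h(3)] h(1) m i1(2) i2(2) by simp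
  then have "(P t - P (t - h)) powr q / h powr q \<le> h powr (q - 1) * (Q t - Q (t - h)) / h powr q"
    by (rule divide_right_mono) simp
  moreover have "h powr (q - 1) * (Q t - Q (t - h)) / h powr q = (Q t - Q (t - h)) / h"
    using h(1) by (simp add: powr_diff)
  moreover have "0 \<le> P t - P (t - h)"
    using AC_diff[OF M h(2) _ h(3)] h(1) integral_nonneg[of m "{t-h..t}"] AC_integrable[OF M h(2,3)] m
    by (auto simp: absolutely_integrable_on_def)
  ultimately show ?thesis using h(1) by (simp add: powr_divide)
qed

context seminormed_space
begin

lemma pairing_difference_le:
  assumes pq: "1 < p" "1 < q" "1 / p + 1 / q = 1" and d: "0 < d"
    and l: "l \<in> X'" and x: "x \<in> X" and y: "y \<in> X"
  shows "l x \<le> l y + d powr q * N' l powr q + d powr (- p) * N (x - y) powr p"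
proof -
  have "l x - l y = l (x - y)" by (rule dual_diff[OF l x y, symmetric])
  also have "\<dots> \<le> N' l * N (x - y)" using dual_norm_bound(2)[OF l diff_mem[OF x y]] by linarith
  also have "\<dots> \<le> d powr q * N' l powr q + d powr (- p) * N (x - y) powr p"
    by (intro young_weighted pq d dual_norm_bound(1)[OF l] N_nonneg)
  finally show ?thesis by linarith
qed

text \<open>
  The integrated chain rule \<open>E(t) - E(s) \<le> \<integral> \<langle>w, v\<rangle>\<close> for a convex energy with subgradient \<open>v\<close>, where \<open>w\<close> is
  the time derivative of \<open>U\<close>. For fixed \<open>x\<close> the difference quotients of \<open>U(\<cdot>) x\<close> converge to
  \<open>w(\<cdot>) x\<close> in \<open>L\<^sup>1\<close>. Hence \<open>v\<close> is replaced by a simple function \<open>b\<^sub>n\<close>, which has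
  only finitely many values \<open>x\<close>; the error \<open>v - b\<^sub>n\<close> is paired with difference quotients of \<open>U\<close>, whose dual norms are
  bounded in \<open>L\<^sup>q\<close> uniformly in the step \<open>h\<close> by \<open>window_jensen\<close>. The limits are taken in the order
  \<open>h \<rightarrow> 0\<close>, \<open>n \<rightarrow> \<infinity>\<close>, \<open>d \<rightarrow> 0\<close>, with \<open>d\<close> the weight in \<open>young_weighted\<close>.
\<close>

lemma chain_rule_pairing:
  fixes E :: "real \<Rightarrow> real" and U :: "real \<Rightarrow> (real \<Rightarrow> real) \<Rightarrow> real"
  assumes pq: "1 < p" "1 < q" "1 / p + 1 / q = 1"
    and w: "w \<in> bochner_Lp q {0<..<T} X' N'" and v: "v \<in> bochner_Lp p {0<..<T} X N"
    and E: "continuous_on {0..T} E"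
    and Ulin: "\<And>t x y. t \<in> {0<..<T} \<Longrightarrow> x \<in> X \<Longrightarrow> y \<in> X \<Longrightarrow> U t (x - y) = U t x - U t y"
    and U: "\<And>x. x \<in> X \<Longrightarrow> AC 0 T (\<lambda>t. U t x) (\<lambda>t. w t x)"
    and conv: "AE t in lebesgue. t \<in> {0<..<T} \<longrightarrow> (\<forall>r\<in>{0<..<t}. E t - E r \<le> U t (v t) - U r (v t))"
    and st: "0 < s" "s \<le> t" "t < T"
  shows "E t - E s \<le> integral {s..t} (\<lambda>\<tau>. w \<tau> (v \<tau>))"
proof -
  let ?S = "{0<..<T}"
  have S: "?S \<in> sets lebesgue" by simp
  have ws: "strongly_measurable X' N' ?S w" and wi: "(\<lambda>t. N' (w t) powr q) absolutely_integrable_on ?S"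
    and vs: "strongly_measurable X N ?S v"
    using w v by (auto simp: bochner_Lp_def)
  obtain b where b: "\<And>n. b n ` ?S \<subseteq> X" "\<And>n. simple_on ?S (b n)"
    "\<And>n. (\<lambda>t. N (b n t - v t) powr p) absolutely_integrable_on ?S"
    "(\<lambda>n. integral ?S (\<lambda>t. N (b n t - v t) powr p)) \<longlonglongrightarrow> 0"
    using simple_approximation[OF S _ v] pq(1) by auto
  \<comment> \<open>\<open>P\<close> and \<open>Q\<close> are primitives of the dual norm of \<open>w\<close> and of its \<open>q\<close>-th power\<close>
  define m where "m \<tau> = \<bar>N' (w \<tau>)\<bar>" for \<tau>
  have mq: "(\<lambda>\<tau>. m \<tau> powr q) absolutely_integrable_on {0..T}"
  proof -
    have "AE t in lebesgue. t \<in> ?S \<longrightarrow> N' (w t) powr q = m t powr q"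
      using pairing_measurable(2)[OF S ws vs] by eventually_elim (auto simp: m_def dual_norm_bound(1))
    from absolutely_integrable_AE_cong(1)[OF wi this] show ?thesis
      by (simp add: absolutely_integrable_on_Icc_iff_Ioo)
  qed
  have m0: "0 \<le> m \<tau>" for \<tau> by (simp add: m_def)
  have mi: "m absolutely_integrable_on {0..T}"
  proof -
    have [measurable]: "(\<lambda>\<tau>. m \<tau> powr q) \<in> borel_measurable (lebesgue_on ?S)"
      using mq borel_measurable_integrable integrable_Om by blast
    have "(\<lambda>\<tau>. (m \<tau> powr q) powr (1 / q)) \<in> borel_measurable (lebesgue_on ?S)" by measurable
    then have "m \<in> borel_measurable (Om T)" using pq m0 by (simp add: powr_powr)
    moreover have "integrable (Om T) (\<lambda>\<tau>. m \<tau> powr q)" using mq by (simp add: integrable_Om)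
    ultimately have "LpM (Om T) q m" using m0 by (simp add: LpM_def)
    then show ?thesis using pq by (intro LpM_absolutely_integrable[of q]) auto
  qed
  define P where "P \<tau> = integral {0..\<tau>} m" for \<tau>
  define Q where "Q \<tau> = integral {0..\<tau>} (\<lambda>r. m r powr q)" for \<tau>
  have P: "AC 0 T P m" unfolding P_def[abs_def] by (rule AC_primitive[OF mi])
  have Q: "AC 0 T Q (\<lambda>\<tau>. m \<tau> powr q)" unfolding Q_def[abs_def] by (rule AC_primitive[OF mq])
  define Wq where "Wq = integral {0..T} (\<lambda>\<tau>. m \<tau> powr q)"
  have sub: "f absolutely_integrable_on {s..t}" if "f absolutely_integrable_on ?S" for f :: "real \<Rightarrow> real"
    using that by (rule absolutely_integrable_on_subinterval) (use st in auto)
  have sAE: "AE \<tau> in lebesgue. \<tau> \<in> {s..t} \<longrightarrow> A \<tau>" if "AE \<tau> in lebesgue. \<tau> \<in> ?S \<longrightarrow> A \<tau>" for A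
    using that by eventually_elim (use st in auto)
  have wv: "(\<lambda>\<tau>. w \<tau> (v \<tau>)) absolutely_integrable_on {s..t}"
    by (rule sub[OF pairing_integrable[OF S pq w v]])
  have mqst: "(\<lambda>\<tau>. m \<tau> powr q) absolutely_integrable_on {s..t}"
    using AC_integrable[OF Q, of s t] st by simp
  have Wst: "integral {s..t} (\<lambda>\<tau>. m \<tau> powr q) \<le> Wq"
    unfolding Wq_def using mqst mq st
    by (intro integral_subset_le) (auto simp: absolutely_integrable_on_def)
  have AEX: "AE \<tau> in lebesgue. \<tau> \<in> {s..t} \<longrightarrow> w \<tau> \<in> X' \<and> v \<tau> \<in> X"
    using sAE[OF pairing_measurable(2)[OF S ws vs]] sAE[OF norm_measurable(2)[OF S vs]]
    by eventually_elim auto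
  \<comment> \<open>the limit \<open>h \<rightarrow> 0\<close> for a fixed simple function; the factor 2 accounts for replacing \<open>v\<close> by it and back\<close>
  have bound: "E t - E s \<le> integral {s..t} (\<lambda>\<tau>. w \<tau> (v \<tau>)) +
      2 * (d powr q * Wq + d powr (- p) * integral ?S (\<lambda>\<tau>. N (b n \<tau> - v \<tau>) powr p))" if d: "0 < d" for d n
  proof -
    let ?e = "\<lambda>\<tau>. N (b n \<tau> - v \<tau>) powr p"
    have eq: "?e absolutely_integrable_on {s..t}" by (rule sub[OF b(3)])
    have elam: "integral {s..t} ?e \<le> integral ?S ?e"
      using sub[OF b(3)] b(3) st by (intro integral_subset_le) (auto simp: absolutely_integrable_on_def)
    have bX: "b n \<tau> \<in> X" if "\<tau> \<in> {s..t}" for \<tau> using b(1)[of n] that st by force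
    have bw: "(\<lambda>\<tau>. w \<tau> (b n \<tau>)) absolutely_integrable_on {s..t}"
    proof (rule sub[OF pairing_integrable[OF S pq w simple_bochner_Lp[OF S _ b(2,1)]]])
      show "?S \<subseteq> {0..T}" by auto
    qed (use pq in auto)
    define R where "R = b n ` {s..t}"
    have R: "finite R" "R \<subseteq> X"
    proof -
      have "R \<subseteq> b n ` ?S" using st by (auto simp: R_def)
      then show "finite R" "R \<subseteq> X" using b(1)[of n] b(2)[of n] by (auto simp: simple_on_def intro: finite_subset)
    qed
    \<comment> \<open>summing over all values of the simple function makes the error independent of which value is taken at \<open>\<tau>\<close>\<close>
    define \<rho> where "\<rho> h \<tau> = (\<Sum>x\<in>R. \<bar>(U \<tau> x - U (\<tau> - h) x) / h - w \<tau> x\<bar>)" for h \<tau>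
    have step: "integral {s..t} (\<lambda>\<tau>. (E \<tau> - E (\<tau> - h)) / h) \<le>
        integral {s..t} (\<lambda>\<tau>. w \<tau> (b n \<tau>)) + (\<Sum>x\<in>R. integral {s..t} (\<lambda>\<tau>. \<bar>(U \<tau> x - U (\<tau> - h) x) / h - w \<tau> x\<bar>))
        + (d powr q * Wq + d powr (- p) * integral ?S ?e)" if h: "0 < h" "h < s" for h
    proof -
      have cq: "continuous_on {s..t} (\<lambda>\<tau>. (F \<tau> - F (\<tau> - h)) / h)" if "continuous_on {0..T} F" for F
        using h st by (intro continuous_intros continuous_on_subset[OF that] continuous_on_compose2[OF that]) auto
      have Qh: "(\<lambda>\<tau>. (Q \<tau> - Q (\<tau> - h)) / h) absolutely_integrable_on {s..t}"
        by (intro absolutely_integrable_continuous_real cq AC_continuous_on[OF Q])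
      have Ux: "(\<lambda>\<tau>. \<bar>(U \<tau> x - U (\<tau> - h) x) / h - w \<tau> x\<bar>) absolutely_integrable_on {s..t}" if "x \<in> R" for x
      proof (intro set_integrable_abs set_integral_diff(1))
        have x: "x \<in> X" using that R by auto
        show "(\<lambda>\<tau>. (U \<tau> x - U (\<tau> - h) x) / h) absolutely_integrable_on {s..t}"
          by (intro absolutely_integrable_continuous_real cq[OF AC_continuous_on[OF U[OF x]]])
        show "(\<lambda>\<tau>. w \<tau> x) absolutely_integrable_on {s..t}"
          by (rule AC_integrable[OF U[OF x]]) (use st in auto)
      qed
      have \<rho>i: "\<rho> h absolutely_integrable_on {s..t}"
        unfolding \<rho>_def[abs_def] using Ux R(1) by (intro absolutely_integrable_sum) auto
      have ineq: "AE \<tau> in lebesgue. \<tau> \<in> {s..t} \<longrightarrow> (E \<tau> - E (\<tau> - h)) / h \<le>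
          w \<tau> (b n \<tau>) + \<rho> h \<tau> + (d powr q * ((Q \<tau> - Q (\<tau> - h)) / h) + d powr (- p) * ?e \<tau>)"
        using AEX sAE[OF conv] pairing_measurable(2)[OF S ws vs]
          norm_measurable(2)[OF S vs]
      proof eventually_elim
        case (elim \<tau>)
        show ?case
        proof
          assume \<tau>: "\<tau> \<in> {s..t}"
          have vX: "v \<tau> \<in> X" and \<tau>S: "\<tau> \<in> ?S" and \<tau>h: "\<tau> - h \<in> ?S" "\<tau> - h \<in> {0<..<\<tau>}"
            using elim \<tau> st h by auto
          let ?x = "b n \<tau>"
          have xX: "?x \<in> X" and xR: "?x \<in> R" using bX[OF \<tau>] \<tau> by (auto simp: R_def)
          have dX: "v \<tau> - ?x \<in> X" by (rule diff_mem[OF vX xX])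
          have "E \<tau> - E (\<tau> - h) \<le> U \<tau> (v \<tau>) - U (\<tau> - h) (v \<tau>)"
            using elim \<tau> \<tau>h by auto
          also have "\<dots> = (U \<tau> ?x - U (\<tau> - h) ?x) + (U \<tau> (v \<tau> - ?x) - U (\<tau> - h) (v \<tau> - ?x))"
            using Ulin[OF \<tau>S vX xX] Ulin[OF \<tau>h(1) vX xX] by simp
          also have "U \<tau> (v \<tau> - ?x) - U (\<tau> - h) (v \<tau> - ?x) \<le> (P \<tau> - P (\<tau> - h)) * N (v \<tau> - ?x)"
          proof -
            have bds: "0 \<le> \<tau> - h" "\<tau> - h \<le> \<tau>" "\<tau> \<le> T" using \<tau> st h by auto
            have "U \<tau> (v \<tau> - ?x) - U (\<tau> - h) (v \<tau> - ?x) = integral {\<tau>-h..\<tau>} (\<lambda>r. w r (v \<tau> - ?x))"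
              by (rule AC_diff[OF U[OF dX] bds])
            also have "\<dots> \<le> integral {\<tau>-h..\<tau>} (\<lambda>r. m r * N (v \<tau> - ?x))"
            proof (rule integral_le_AE)
              show "(\<lambda>r. w r (v \<tau> - ?x)) absolutely_integrable_on {\<tau>-h..\<tau>}"
                by (rule AC_integrable[OF U[OF dX] bds(1,3)])
              show "(\<lambda>r. m r * N (v \<tau> - ?x)) absolutely_integrable_on {\<tau>-h..\<tau>}"
                using AC_integrable[OF P bds(1,3)] by (rule set_integrable_mult_left) 
              show "AE r in lebesgue. r \<in> {\<tau>-h..\<tau>} \<longrightarrow> w r (v \<tau> - ?x) \<le> m r * N (v \<tau> - ?x)"
                using pairing_measurable(2)[OF S ws vs]
              proof eventually_elim
                case (elim r)
                show ?case
                proof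
                  assume r: "r \<in> {\<tau>-h..\<tau>}"
                  then have "w r \<in> X'" using elim \<tau> st h by auto
                  from dual_norm_bound[OF this] dX show "w r (v \<tau> - ?x) \<le> m r * N (v \<tau> - ?x)"
                    by (force simp: m_def)
                qed
              qed
            qed simp
            also have "\<dots> = (P \<tau> - P (\<tau> - h)) * N (v \<tau> - ?x)"
              using AC_diff[OF P bds] by simp
            finally show ?thesis .
          qed
          finally have "(E \<tau> - E (\<tau> - h)) / h \<le>
             ((U \<tau> ?x - U (\<tau> - h) ?x) + (P \<tau> - P (\<tau> - h)) * N (v \<tau> - ?x)) / h"
            using h by (intro divide_right_mono) auto
          also have "\<dots> = (U \<tau> ?x - U (\<tau> - h) ?x) / h + ((P \<tau> - P (\<tau> - h)) / h) * N (v \<tau> - ?x)"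
            by (simp add: add_divide_distrib)
          also have "(U \<tau> ?x - U (\<tau> - h) ?x) / h \<le> w \<tau> ?x + \<rho> h \<tau>"
          proof -
            have "\<bar>(U \<tau> ?x - U (\<tau> - h) ?x) / h - w \<tau> ?x\<bar> \<le> \<rho> h \<tau>"
              unfolding \<rho>_def using R(1) xR
              by (intro member_le_sum[where f = "\<lambda>x. \<bar>(U \<tau> x - U (\<tau> - h) x) / h - w \<tau> x\<bar>"]) auto
            then show ?thesis by linarith
          qed
          also have "((P \<tau> - P (\<tau> - h)) / h) * N (v \<tau> - ?x) \<le>
             d powr q * ((P \<tau> - P (\<tau> - h)) / h) powr q + d powr (- p) * N (v \<tau> - ?x) powr p"
          proof (intro young_weighted pq d N_nonneg divide_nonneg_pos h)
            show "0 \<le> P \<tau> - P (\<tau> - h)"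
              using AC_diff[OF P, of "\<tau> - h" \<tau>] AC_integrable[OF P, of "\<tau> - h" \<tau>] m0 \<tau> st h
              by (auto intro!: integral_nonneg simp: absolutely_integrable_on_def)
          qed
          also have "((P \<tau> - P (\<tau> - h)) / h) powr q \<le> (Q \<tau> - Q (\<tau> - h)) / h"
            using \<tau> st h by (intro window_jensen[OF pq(2) m0 P Q]) auto
          also have "N (v \<tau> - ?x) = N (?x - v \<tau>)" by (rule N_diff_commute[OF vX xX])
          finally show "(E \<tau> - E (\<tau> - h)) / h \<le>
            w \<tau> (b n \<tau>) + \<rho> h \<tau> + (d powr q * ((Q \<tau> - Q (\<tau> - h)) / h) + d powr (- p) * ?e \<tau>)"
            by (simp add: mult_left_mono)
        qed
      qed
      have "integral {s..t} (\<lambda>\<tau>. (E \<tau> - E (\<tau> - h)) / h) \<le> integral {s..t}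
         (\<lambda>\<tau>. w \<tau> (b n \<tau>) + \<rho> h \<tau> + (d powr q * ((Q \<tau> - Q (\<tau> - h)) / h) + d powr (- p) * ?e \<tau>))"
        by (intro integral_le_AE ineq absolutely_integrable_continuous_real cq[OF E] set_integral_add(1)
            bw \<rho>i set_integrable_mult_right Qh eq) auto
      also have "\<dots> = integral {s..t} (\<lambda>\<tau>. w \<tau> (b n \<tau>)) + integral {s..t} (\<rho> h) +
          (d powr q * integral {s..t} (\<lambda>\<tau>. (Q \<tau> - Q (\<tau> - h)) / h) + d powr (- p) * integral {s..t} ?e)"
      proof -
        have i: "(\<lambda>\<tau>. w \<tau> (b n \<tau>)) integrable_on {s..t}" "\<rho> h integrable_on {s..t}"
          "(\<lambda>\<tau>. (Q \<tau> - Q (\<tau> - h)) / h) integrable_on {s..t}" "?e integrable_on {s..t}"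
          using bw \<rho>i Qh eq by (auto simp: absolutely_integrable_on_def)
        show ?thesis
          unfolding integral_add[OF integrable_add[OF i(1,2)] integrable_add[OF integrable_on_mult_right[OF i(3)] integrable_on_mult_right[OF i(4)]]]
            integral_add[OF i(1,2)] integral_add[OF integrable_on_mult_right[OF i(3)] integrable_on_mult_right[OF i(4)]]
            integral_mult_right ..
      qed
      also have "integral {s..t} (\<rho> h) = (\<Sum>x\<in>R. integral {s..t} (\<lambda>\<tau>. \<bar>(U \<tau> x - U (\<tau> - h) x) / h - w \<tau> x\<bar>))"
        unfolding \<rho>_def[abs_def] using Ux R(1) by (intro integral_sum) (auto simp: absolutely_integrable_on_def)
      also have "integral {s..t} (\<lambda>\<tau>. (Q \<tau> - Q (\<tau> - h)) / h) \<le> Wq"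
        unfolding Wq_def using st h by (intro steklov_average_L1_bound[OF Q]) auto
      also note elam
      finally show ?thesis by (simp add: mult_left_mono)
    qed
    \<comment> \<open>the limit \<open>h \<rightarrow> 0\<close> in both sides of the preceding estimate\<close>
    have lim1: "((\<lambda>h. integral {s..t} (\<lambda>\<tau>. (E \<tau> - E (\<tau> - h)) / h)) \<longlongrightarrow> E t - E s) (at_right 0)"
      using st by (intro steklov_average_continuous[OF E]) auto
    have lim2: "((\<lambda>h. integral {s..t} (\<lambda>\<tau>. w \<tau> (b n \<tau>)) +
        (\<Sum>x\<in>R. integral {s..t} (\<lambda>\<tau>. \<bar>(U \<tau> x - U (\<tau> - h) x) / h - w \<tau> x\<bar>))
        + (d powr q * Wq + d powr (- p) * integral ?S ?e)) \<longlongrightarrow>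
        integral {s..t} (\<lambda>\<tau>. w \<tau> (b n \<tau>)) + (\<Sum>x\<in>R. 0) + (d powr q * Wq + d powr (- p) * integral ?S ?e)) (at_right 0)"
    proof (intro tendsto_intros)
      fix x assume "x \<in> R"
      then have "x \<in> X" using R by auto
      from steklov_average_L1[OF U[OF this], of s t] st
      show "((\<lambda>h. integral {s..t} (\<lambda>\<tau>. \<bar>(U \<tau> x - U (\<tau> - h) x) / h - w \<tau> x\<bar>)) \<longlongrightarrow> 0) (at_right 0)" by simp
    qed
    have "E t - E s \<le> integral {s..t} (\<lambda>\<tau>. w \<tau> (b n \<tau>)) + (\<Sum>x\<in>R. 0) + (d powr q * Wq + d powr (- p) * integral ?S ?e)"
    proof (rule tendsto_le[OF _ lim2 lim1])
      show "eventually (\<lambda>h. integral {s..t} (\<lambda>\<tau>. (E \<tau> - E (\<tau> - h)) / h) \<le> integral {s..t} (\<lambda>\<tau>. w \<tau> (b n \<tau>)) +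
        (\<Sum>x\<in>R. integral {s..t} (\<lambda>\<tau>. \<bar>(U \<tau> x - U (\<tau> - h) x) / h - w \<tau> x\<bar>))
        + (d powr q * Wq + d powr (- p) * integral ?S ?e)) (at_right 0)"
        using eventually_at_right_0_less[OF st(1)] by eventually_elim (use step in auto)
    qed simp
    moreover have "integral {s..t} (\<lambda>\<tau>. w \<tau> (b n \<tau>)) \<le> integral {s..t} (\<lambda>\<tau>. w \<tau> (v \<tau>))
        + (d powr q * Wq + d powr (- p) * integral ?S ?e)"
    proof -
      have "integral {s..t} (\<lambda>\<tau>. w \<tau> (b n \<tau>)) \<le> integral {s..t} (\<lambda>\<tau>. w \<tau> (v \<tau>) + (d powr q * m \<tau> powr q + d powr (- p) * ?e \<tau>))"
      proof (intro integral_le_AE bw set_integral_add(1) wv set_integrable_mult_right mqst eq)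
        show "AE \<tau> in lebesgue. \<tau> \<in> {s..t} \<longrightarrow> w \<tau> (b n \<tau>) \<le> w \<tau> (v \<tau>) + (d powr q * m \<tau> powr q + d powr (- p) * ?e \<tau>)"
          using AEX
        proof eventually_elim
          case (elim \<tau>)
          show ?case
          proof
            assume \<tau>: "\<tau> \<in> {s..t}"
            then show "w \<tau> (b n \<tau>) \<le> w \<tau> (v \<tau>) + (d powr q * m \<tau> powr q + d powr (- p) * ?e \<tau>)"
              using pairing_difference_le[OF pq d, of "w \<tau>" "b n \<tau>" "v \<tau>"] elim bX[OF \<tau>]
              by (auto simp: m_def dual_norm_bound(1))
          qed
        qed
      qed simp
      also have "\<dots> = integral {s..t} (\<lambda>\<tau>. w \<tau> (v \<tau>)) + (d powr q * integral {s..t} (\<lambda>\<tau>. m \<tau> powr q) + d powr (- p) * integral {s..t} ?e)"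
      proof -
        have i: "(\<lambda>\<tau>. w \<tau> (v \<tau>)) integrable_on {s..t}" "(\<lambda>\<tau>. m \<tau> powr q) integrable_on {s..t}" "?e integrable_on {s..t}"
          using wv mqst eq by (auto simp: absolutely_integrable_on_def)
        show ?thesis
          unfolding integral_add[OF i(1) integrable_add[OF integrable_on_mult_right[OF i(2)] integrable_on_mult_right[OF i(3)]]]
            integral_add[OF integrable_on_mult_right[OF i(2)] integrable_on_mult_right[OF i(3)]] integral_mult_right ..
      qed
      also have "\<dots> \<le> integral {s..t} (\<lambda>\<tau>. w \<tau> (v \<tau>)) + (d powr q * Wq + d powr (- p) * integral ?S ?e)"
        using Wst elam by (intro add_left_mono add_mono mult_left_mono) auto
      finally show ?thesis .
    qed
    ultimately show ?thesis by simp
  qed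
  \<comment> \<open>the limit \<open>n \<rightarrow> \<infinity>\<close>\<close>
  have bound2: "E t - E s \<le> integral {s..t} (\<lambda>\<tau>. w \<tau> (v \<tau>)) + 2 * (d powr q * Wq + d powr (- p) * 0)" if d: "0 < d" for d
  proof (rule tendsto_lowerbound[OF _ always_eventually])
    show "(\<lambda>n. integral {s..t} (\<lambda>\<tau>. w \<tau> (v \<tau>)) + 2 * (d powr q * Wq + d powr (- p) * integral ?S (\<lambda>\<tau>. N (b n \<tau> - v \<tau>) powr p)))
      \<longlonglongrightarrow> integral {s..t} (\<lambda>\<tau>. w \<tau> (v \<tau>)) + 2 * (d powr q * Wq + d powr (- p) * 0)"
      by (intro tendsto_intros b(4))
  qed (use bound[OF d] in auto)
  \<comment> \<open>the limit \<open>d \<rightarrow> 0\<close>\<close>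
  have "((\<lambda>d. integral {s..t} (\<lambda>\<tau>. w \<tau> (v \<tau>)) + 2 * (d powr q * Wq + d powr (- p) * 0)) \<longlongrightarrow>
      integral {s..t} (\<lambda>\<tau>. w \<tau> (v \<tau>)) + 2 * (0 powr q * Wq + 0)) (at_right 0)"
  proof -
    have "((\<lambda>d::real. d powr q) \<longlongrightarrow> 0 powr q) (at_right 0)"
      using pq by (intro tendsto_powr2 tendsto_intros) (auto simp: eventually_at_filter)
    then show ?thesis unfolding mult_zero_right by (intro tendsto_add tendsto_mult tendsto_const)
  qed
  then have "E t - E s \<le> integral {s..t} (\<lambda>\<tau>. w \<tau> (v \<tau>)) + 2 * (0 powr q * Wq + 0)"
  proof (rule tendsto_lowerbound)
    show "eventually (\<lambda>d. E t - E s \<le> integral {s..t} (\<lambda>\<tau>. w \<tau> (v \<tau>)) + 2 * (d powr q * Wq + d powr (- p) * 0)) (at_right 0)"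
      using eventually_at_right_less by eventually_elim (rule bound2)
  qed simp
  then show ?thesis by simp
qed

end

section \<open>Weak time derivatives and the dissipation\<close>

lemma sobolev_B_1: "0 < p \<Longrightarrow> sobolev_B L 1 p = sobolev L 1 p"
proof -
  assume "0 < p"
  then have "0 < 1 / p" by simp
  then have "\<not> 1 + 1 / p < real 1" "\<not> 3 + 1 / p < real 1" unfolding of_nat_1 by linarith+
  then show ?thesis unfolding sobolev_B_def by blast
qed

lemma sobolev_BD: "v \<in> sobolev_B L k p \<Longrightarrow> v \<in> sobolev L k p"
  by (simp add: sobolev_B_def)

lemma has_weak_deriv_zero: "has_weak_deriv L j (\<lambda>x. 0) (\<lambda>x. 0)"
  by (simp add: has_weak_deriv_def locally_integrable_def)

lemma wderiv_zero: "AE x in lebesgue. x \<in> {0<..<L} \<longrightarrow> wderiv L j (\<lambda>x. 0) x = 0"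
  by (rule wderiv_eq(2)[OF has_weak_deriv_zero])

lemma zero_mem_sobolev: "(\<lambda>x. 0) \<in> sobolev L k p"
  by (rule sobolev_I[OF has_weak_deriv_zero LpM_zero])

lemma sobolev_seminormed:
  assumes "1 \<le> p"
  shows "seminormed_space (sobolev L k p) (sobolev_norm L k p)"
proof
  show "(\<lambda>x. 0) \<in> sobolev L k p" by (rule zero_mem_sobolev)
  show "(\<lambda>x. a * v x + b * w x) \<in> sobolev L k p" if "v \<in> sobolev L k p" "w \<in> sobolev L k p" for v w a b
    using that assms by (intro sobolev_lincomb(1)) auto
  show "0 \<le> sobolev_norm L k p v" for v by (rule sobolev_norm_nonneg)
  show "sobolev_norm L k p (\<lambda>x. a * v x + b * w x) \<le> \<bar>a\<bar> * sobolev_norm L k p v + \<bar>b\<bar> * sobolev_norm L k p w"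
    if "v \<in> sobolev L k p" "w \<in> sobolev L k p" for v w a b
    using that assms by (intro sobolev_norm_triangle)
qed

text \<open>
  Cutting a test function off in time localises the weak formulation to a subinterval.
\<close>

lemma (in seminormed_space) bochner_restrict:
  assumes S: "S \<in> sets lebesgue" and A: "A \<in> sets lebesgue" and p: "0 < p" and v: "v \<in> bochner_Lp p S X N"
  shows "(\<lambda>t. if t \<in> A then v t else (\<lambda>x. 0)) \<in> bochner_Lp p S X N"
proof -
  have vs: "strongly_measurable X N S v" and vi: "(\<lambda>t. N (v t) powr p) absolutely_integrable_on S"
    using v by (auto simp: bochner_Lp_def)
  obtain s where s: "\<And>n. s n ` S \<subseteq> X" "\<And>n. simple_on S (s n)"
    and lim: "AE t in lebesgue. t \<in> S \<longrightarrow> v t \<in> X \<and> (\<lambda>n. N (s n t - v t)) \<longlonglongrightarrow> 0"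
    using vs unfolding strongly_measurable_iff by blast
  let ?v = "\<lambda>t. if t \<in> A then v t else (\<lambda>x. 0)"
  have m: "strongly_measurable X N S ?v"
    unfolding strongly_measurable_iff
  proof (intro exI[of _ "\<lambda>n t. if t \<in> A then s n t else (\<lambda>x. 0)"] conjI allI)
    show "(\<lambda>t. if t \<in> A then s n t else (\<lambda>x. 0)) ` S \<subseteq> X" for n using s(1)[of n] zero_mem by auto
    show "simple_on S (\<lambda>t. if t \<in> A then s n t else (\<lambda>x. 0))" for n by (rule simple_on_if[OF S s(2) A])
    have z: "N ((\<lambda>x. 0) - (\<lambda>x. 0)) = 0" by (rule N_diff_self[OF zero_mem])
    show "AE t in lebesgue. t \<in> S \<longrightarrow> ?v t \<in> X \<and> (\<lambda>n. N ((if t \<in> A then s n t else (\<lambda>x. 0)) - ?v t)) \<longlonglongrightarrow> 0"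
      using lim
    proof eventually_elim
      case (elim t)
      then show ?case using zero_mem z by (cases "t \<in> A") auto
    qed
  qed
  have "integrable (lebesgue_on S) (\<lambda>t. N (?v t) powr p)"
  proof (rule Bochner_Integration.integrable_bound[OF integral_lebesgue_on(1)[OF vi S]])
    show "(\<lambda>t. N (?v t) powr p) \<in> borel_measurable (lebesgue_on S)"
      using norm_measurable(1)[OF S m] by measurable
  qed (auto simp: N_zero intro!: AE_I2)
  then show ?thesis using m S by (simp add: bochner_Lp_def absolutely_integrable_iff_integrable)
qed

lemma functional_of_eq_integral:
  assumes g: "continuous_on {0..L} g" and x: "x absolutely_integrable_on {0..L}"
  shows "(\<lambda>y. g y * x y) absolutely_integrable_on {0..L}"
    and "functional_of L g x = integral {0..L} (\<lambda>y. g y * x y)"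
proof -
  show *: "(\<lambda>y. g y * x y) absolutely_integrable_on {0..L}"
    by (rule absolutely_integrable_continuous_mult[OF g x])
  then show "functional_of L g x = integral {0..L} (\<lambda>y. g y * x y)"
    unfolding functional_of_def
    by (subst set_lebesgue_integral_eq_integral)
       (auto simp: absolutely_integrable_on_Icc_iff_Ioo integral_open_interval_real)
qed

lemma functional_of_diff:
  assumes g: "continuous_on {0..L} g" and x: "x absolutely_integrable_on {0..L}" and y: "y absolutely_integrable_on {0..L}"
  shows "functional_of L g (x - y) = functional_of L g x - functional_of L g y"
proof -
  have xy: "(x - y) absolutely_integrable_on {0..L}"
    using set_integral_diff(1)[OF x y] by (simp add: fun_diff_def)
  show ?thesis
    unfolding functional_of_eq_integral(2)[OF g x] functional_of_eq_integral(2)[OF g y] functional_of_eq_integral(2)[OF g xy]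
    using functional_of_eq_integral(1)[OF g x] functional_of_eq_integral(1)[OF g y]
    by (subst integral_diff[symmetric]) (auto simp: absolutely_integrable_on_def algebra_simps)
qed

lemma C_H1_H1: "u \<in> C_H1 T L \<Longrightarrow> t \<in> {0..T} \<Longrightarrow> u t \<in> H1 L"
  by (simp add: C_H1_def)

lemma H1_continuous: "v \<in> H1 L \<Longrightarrow> continuous_on {0..L} v"
  by (simp add: H1_def)

lemma functional_of_continuous:
  assumes L: "0 < L" and u: "u \<in> C_H1 T L" and x: "x absolutely_integrable_on {0..L}"
  shows "continuous_on {0..T} (\<lambda>t. functional_of L (u t) x)"
  unfolding continuous_on_def
proof
  fix t assume t: "t \<in> {0..T}"
  define I where "I = integral {0..L} (\<lambda>y. \<bar>x y\<bar>)"
  have xi: "(\<lambda>y. \<bar>x y\<bar>) integrable_on {0..L}" using x by (simp add: absolutely_integrable_on_def)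
  have I: "0 \<le> I" unfolding I_def using xi by (intro integral_nonneg) auto
  show "((\<lambda>t. functional_of L (u t) x) \<longlongrightarrow> functional_of L (u t) x) (at t within {0..T})"
  proof (rule tendstoI)
    fix e :: real assume e: "0 < e"
    define d where "d = e / (I + 1)"
    have d: "0 < d" using e I by (simp add: d_def)
    have "eventually (\<lambda>s. s \<in> {0..T}) (at t within {0..T})" by (simp add: eventually_at_filter)
    with C_H1_continuous(2)[OF L u t d]
    show "eventually (\<lambda>s. dist (functional_of L (u s) x) (functional_of L (u t) x) < e) (at t within {0..T})"
    proof eventually_elim
      case (elim s)
      note cs = H1_continuous[OF C_H1_H1[OF u elim(2)]] and ct = H1_continuous[OF C_H1_H1[OF u t]]
      note is' = functional_of_eq_integral[OF cs x] and it = functional_of_eq_integral[OF ct x]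
      have i: "(\<lambda>y. u s y * x y) integrable_on {0..L}" "(\<lambda>y. u t y * x y) integrable_on {0..L}"
        using is'(1) it(1) by (auto simp: absolutely_integrable_on_def)
      have "norm (integral {0..L} (\<lambda>y. u s y * x y - u t y * x y)) \<le> integral {0..L} (\<lambda>y. d * \<bar>x y\<bar>)"
      proof (intro integral_norm_bound_integral integrable_diff i)
        show "(\<lambda>y. d * \<bar>x y\<bar>) integrable_on {0..L}" using xi by (intro integrable_on_mult_right)
        fix y assume "y \<in> {0..L}"
        then have "\<bar>u s y - u t y\<bar> < d" using elim(1) by blast
        then have "\<bar>u s y - u t y\<bar> * \<bar>x y\<bar> \<le> d * \<bar>x y\<bar>" by (intro mult_right_mono) auto
        then show "norm (u s y * x y - u t y * x y) \<le> d * \<bar>x y\<bar>" by (simp add: left_diff_distrib[symmetric] abs_mult)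
      qed
      then have "\<bar>functional_of L (u s) x - functional_of L (u t) x\<bar> \<le> d * I"
        unfolding is'(2) it(2) integral_diff[OF i] by (simp add: I_def)
      also have "\<dots> < e" using e I by (simp add: d_def field_simps)
      finally show ?case by (simp add: dist_real_def)
    qed
  qed
qed

text \<open>
  The distributional identity makes \<open>t \<mapsto> \<langle>u(t), x\<rangle>\<close> equal almost everywhere to a primitive of \<open>\<langle>w, x\<rangle>\<close>;
  as both are continuous, they agree everywhere, including at the end points.
\<close>

lemma weak_time_derivative_AC:
  assumes T: "0 < T" and L: "0 < L" and u: "u \<in> C_H1 T L"
    and x: "x \<in> X" "x absolutely_integrable_on {0..L}"
    and w: "(\<lambda>t. w t x) absolutely_integrable_on {0<..<T}"
    and tw: "has_weak_time_deriv T L X u w"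
  shows "AC 0 T (\<lambda>t. functional_of L (u t) x) (\<lambda>t. w t x)"
proof -
  let ?K = "\<lambda>t. functional_of L (u t) x"
  have cK: "continuous_on {0..T} ?K" by (rule functional_of_continuous[OF L u x(2)])
  have K: "?K absolutely_integrable_on {0..T}" by (rule absolutely_integrable_continuous_real[OF cK])
  have w': "(\<lambda>t. w t x) absolutely_integrable_on {0..T}" using w by (simp add: absolutely_integrable_on_Icc_iff_Ioo)
  have conv: "(LINT t:{0<..<T}|lebesgue. \<psi> t * k t) = integral {0..T} (\<lambda>t. k t * \<psi> t)"
    if "k absolutely_integrable_on {0..T}" "continuous_on {0..T} \<psi>" for k \<psi> :: "real \<Rightarrow> real"
    using absolutely_integrable_continuous_mult[OF that(2,1)]
    by (subst set_lebesgue_integral_eq_integral)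
       (auto simp: absolutely_integrable_on_Icc_iff_Ioo integral_open_interval_real mult.commute)
  obtain G where G: "AC 0 T G (\<lambda>t. w t x)" "AE t in lebesgue. t \<in> {0<..<T} \<longrightarrow> ?K t = G t"
  proof (rule weak_derivative_AC[OF T K w'])
    fix \<psi> assume \<psi>: "test_function 0 T \<psi>"
    have "(LINT t:{0<..<T}|lebesgue. deriv \<psi> t * ?K t) = - (LINT t:{0<..<T}|lebesgue. \<psi> t * w t x)"
      using tw \<psi> x(1) unfolding has_weak_time_deriv_def by blast
    then show "integral {0..T} (\<lambda>t. ?K t * deriv \<psi> t) = - integral {0..T} (\<lambda>t. w t x * \<psi> t)"
      using conv[OF K continuous_on_test_function[OF test_function_deriv[OF \<psi>]]]
        conv[OF w' continuous_on_test_function[OF \<psi>]] by simp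
  qed
  show ?thesis
    by (rule AC_cong[OF G(1) continuous_AE_eq[OF T cK AC_continuous_on[OF G(1)] G(2)]]) (use T in auto)
qed

text \<open>
  The dissipation as a real number. It agrees with \<open>dissipation\<close> for positive profiles of finite
  dissipation (see \<open>dissipation_eq\<close>).
\<close>

definition diss :: "real \<Rightarrow> real \<Rightarrow> (real \<Rightarrow> real) \<Rightarrow> real" where
  "diss L \<alpha> v = (\<integral>x. v x powr (\<alpha> + 2) * \<bar>wderiv L 3 v x\<bar> powr (\<alpha> + 1) \<partial>Om L)"

text \<open>
  The weight \<open>v\<^sup>\<beta>\<close> is bounded, so that it may be moved into the \<open>L\<^sup>p\<close> function as \<open>v\<^sup>\<beta>\<^sup>/\<^sup>p\<close>.
\<close>

lemma weighted_integrable: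
  assumes p: "1 \<le> p" and \<beta>: "0 \<le> \<beta>" and v: "continuous_on {0..L} v" "\<And>x. x \<in> {0..L} \<Longrightarrow> 0 < v x"
    and k: "LpM (Om L) p k"
  shows "integrable (Om L) (\<lambda>x. v x powr \<beta> * \<bar>k x\<bar> powr p)"
    and "LpM (Om L) p (\<lambda>x. v x powr (\<beta> / p) * k x)"
    and "(\<integral>x. \<bar>v x powr (\<beta> / p) * k x\<bar> powr p \<partial>Om L) = (\<integral>x. v x powr \<beta> * \<bar>k x\<bar> powr p \<partial>Om L)"
proof -
  have c: "continuous_on {0..L} (\<lambda>x. v x powr \<gamma>)" for \<gamma>
    using v by (intro continuous_on_powr continuous_on_const) force+
  have "(\<lambda>x. \<bar>k x\<bar> powr p) absolutely_integrable_on {0..L}"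
    using k by (simp add: LpM_def integrable_Om)
  from absolutely_integrable_continuous_mult[OF c this]
  show 1: "integrable (Om L) (\<lambda>x. v x powr \<beta> * \<bar>k x\<bar> powr p)" by (simp add: integrable_Om)
  have pt: "\<bar>v x powr (\<beta> / p) * k x\<bar> powr p = v x powr \<beta> * \<bar>k x\<bar> powr p" for x
    using p by (simp add: abs_mult powr_mult powr_powr)
  have "(\<lambda>x. v x powr (\<beta> / p)) absolutely_integrable_on {0..L}"
    by (rule absolutely_integrable_continuous_real[OF c])
  then have "(\<lambda>x. v x powr (\<beta> / p)) \<in> borel_measurable (Om L)" using integrable_Om by blast
  then show "LpM (Om L) p (\<lambda>x. v x powr (\<beta> / p) * k x)"
    using k 1 unfolding LpM_def pt by auto
  show "(\<integral>x. \<bar>v x powr (\<beta> / p) * k x\<bar> powr p \<partial>Om L) = (\<integral>x. v x powr \<beta> * \<bar>k x\<bar> powr p \<partial>Om L)"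
    by (simp add: pt)
qed

lemma C_H1_bounded:
  assumes L: "0 < L" and u: "u \<in> C_H1 T L"
  obtains M where "0 < M" "\<And>t x. t \<in> {0..T} \<Longrightarrow> x \<in> {0..L} \<Longrightarrow> \<bar>u t x\<bar> \<le> M"
proof -
  have one: "(\<lambda>y. 1::real) absolutely_integrable_on {0..L}" by (rule absolutely_integrable_continuous_real) auto
  have "compact ((\<lambda>t. deriv_norm2 L (u t)) ` {0..T})" "compact ((\<lambda>t. functional_of L (u t) (\<lambda>y. 1)) ` {0..T})"
    by (intro compact_continuous_image C_H1_continuous(1)[OF L u] functional_of_continuous[OF L u one]; simp)+
  then have "bounded ((\<lambda>t. deriv_norm2 L (u t)) ` {0..T})" "bounded ((\<lambda>t. functional_of L (u t) (\<lambda>y. 1)) ` {0..T})"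
    by (auto intro: compact_imp_bounded)
  then obtain A B where A: "\<And>t. t \<in> {0..T} \<Longrightarrow> \<bar>deriv_norm2 L (u t)\<bar> \<le> A"
    and B: "\<And>t. t \<in> {0..T} \<Longrightarrow> \<bar>functional_of L (u t) (\<lambda>y. 1)\<bar> \<le> B"
    unfolding bounded_iff by fastforce
  show ?thesis
  proof (rule that[of "\<bar>B\<bar> / L + sqrt L * \<bar>A\<bar> + 1"])
    show "0 < \<bar>B\<bar> / L + sqrt L * \<bar>A\<bar> + 1" using L by (intro add_nonneg_pos add_nonneg_nonneg) auto
    fix t x assume t: "t \<in> {0..T}" and x: "x \<in> {0..L}"
    have H: "u t \<in> H1 L" by (rule C_H1_H1[OF u t])
    have m: "mean_value L (u t) = functional_of L (u t) (\<lambda>y. 1) / L"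
      using functional_of_eq_integral(2)[OF H1_continuous[OF H] one] mean_value_eq[OF H1_continuous[OF H]] by simp
    have "\<bar>mean_value L (u t)\<bar> \<le> \<bar>B\<bar> / L"
      unfolding m using B[OF t] L by (simp add: abs_divide divide_right_mono)
    moreover have "sqrt L * deriv_norm2 L (u t) \<le> sqrt L * \<bar>A\<bar>"
      using A[OF t] L by (intro mult_left_mono) auto
    ultimately show "\<bar>u t x\<bar> \<le> \<bar>B\<bar> / L + sqrt L * \<bar>A\<bar> + 1"
      using H1_mean_bound[OF L H x] by linarith
  qed
qed

text \<open>
  The issue is measurability in time, since the weight \<open>u\<^sup>\<alpha>\<^sup>+\<^sup>2\<close> and the third derivative both depend on \<open>t\<close>.
  For a fixed profile \<open>a\<close> the weighted integral \<open>W t a\<close> is continuous in \<open>t\<close>. Its \<open>p\<close>-th root is a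
  seminorm in \<open>a\<close> dominated by the Sobolev norm, so it passes to the limit along simple
  functions approximating \<open>u\<close>.
\<close>

lemma dissipation_integrable:
  assumes L: "0 < L" and \<alpha>: "0 < \<alpha>" and u: "u \<in> C_H1 T L" "u \<in> Lp_sobolev_B (\<alpha> + 1) T L 3 (\<alpha> + 1)"
    and pos: "\<And>t x. t \<in> {0..T} \<Longrightarrow> x \<in> {0..L} \<Longrightarrow> 0 < u t x"
  shows "(\<lambda>t. diss L \<alpha> (u t)) absolutely_integrable_on {0<..<T}"
proof -
  let ?S = "{0<..<T}" let ?p = "\<alpha> + 1" let ?X = "sobolev_B L 3 (\<alpha> + 1)" let ?N = "sobolev_norm L 3 (\<alpha> + 1)"
  have S: "?S \<in> sets lebesgue" by simp
  have p: "1 \<le> ?p" using \<alpha> by simp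
  obtain M where M: "0 < M" "\<And>t x. t \<in> {0..T} \<Longrightarrow> x \<in> {0..L} \<Longrightarrow> \<bar>u t x\<bar> \<le> M"
    using C_H1_bounded[OF L u(1)] by blast
  have c: "continuous_on {0..L} (u t)" if "t \<in> {0..T}" for t
    by (rule H1_continuous[OF C_H1_H1[OF u(1) that]])
  have us: "strongly_measurable ?X ?N ?S u" and ui: "(\<lambda>t. ?N (u t) powr ?p) absolutely_integrable_on ?S"
    using u(2) by (auto simp: bochner_Lp_def)
  obtain s where s: "\<And>n. s n ` ?S \<subseteq> ?X" "\<And>n. simple_on ?S (s n)"
    and lim: "AE t in lebesgue. t \<in> ?S \<longrightarrow> u t \<in> ?X \<and> (\<lambda>n. ?N (s n t - u t)) \<longlonglongrightarrow> 0"
    using us unfolding strongly_measurable_iff by blast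
  define W where "W t a = (\<integral>x. u t x powr (\<alpha> + 2) * \<bar>wderiv L 3 a x\<bar> powr ?p \<partial>Om L)" for t a
  have l3: "LpM (Om L) ?p (wderiv L 3 a)" if "a \<in> ?X" for a
    using that by (intro sobolev_wderiv(2)) (auto simp: sobolev_B_def)
  \<comment> \<open>continuity of the weight in time, for a fixed profile\<close>
  have Wcont: "continuous_on ?S (\<lambda>t. W t a)" if a: "a \<in> ?X" for a
  proof (rule continuous_on_sequentially[THEN iffD2], intro allI ballI impI, elim conjE)
    fix \<tau> t assume t: "t \<in> ?S" and \<tau>: "\<forall>n. \<tau> n \<in> ?S" "\<tau> \<longlonglongrightarrow> t"
    have "(\<lambda>n. W (\<tau> n) a) \<longlonglongrightarrow> W t a"
      unfolding W_def
    proof (rule integral_dominated_convergence[where w = "\<lambda>x. M powr (\<alpha> + 2) * \<bar>wderiv L 3 a x\<bar> powr ?p"])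
      have "integrable (Om L) (\<lambda>x. u r x powr (\<alpha> + 2) * \<bar>wderiv L 3 a x\<bar> powr ?p)" if "r \<in> ?S" for r
        using that \<alpha> pos by (intro weighted_integrable(1)[OF p _ c _ l3[OF a]]) auto
      then show "(\<lambda>x. u t x powr (\<alpha> + 2) * \<bar>wderiv L 3 a x\<bar> powr ?p) \<in> borel_measurable (Om L)"
        "(\<lambda>x. u (\<tau> n) x powr (\<alpha> + 2) * \<bar>wderiv L 3 a x\<bar> powr ?p) \<in> borel_measurable (Om L)" for n
        using t \<tau> by blast+
      show "integrable (Om L) (\<lambda>x. M powr (\<alpha> + 2) * \<bar>wderiv L 3 a x\<bar> powr ?p)"
        using l3[OF a] by (simp add: LpM_def)
      show "AE x in Om L. (\<lambda>n. u (\<tau> n) x powr (\<alpha> + 2) * \<bar>wderiv L 3 a x\<bar> powr ?p) \<longlonglongrightarrow>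
          u t x powr (\<alpha> + 2) * \<bar>wderiv L 3 a x\<bar> powr ?p"
      proof (rule AE_I2)
        fix x assume "x \<in> space (Om L)"
        then have x: "x \<in> {0..L}" by simp
        have "(\<lambda>n. u (\<tau> n) x) \<longlonglongrightarrow> u t x"
        proof (rule tendstoI)
          fix e :: real assume "0 < e"
          then have "eventually (\<lambda>r. \<forall>x\<in>{0..L}. \<bar>u r x - u t x\<bar> < e) (at t within {0..T})"
            using t by (intro C_H1_continuous(2)[OF L u(1)]) auto
          then have "eventually (\<lambda>r. r \<noteq> t \<longrightarrow> r \<in> {0..T} \<longrightarrow> \<bar>u r x - u t x\<bar> < e) (nhds t)"
            unfolding eventually_at_filter by eventually_elim (use x in auto)
          then have "eventually (\<lambda>n. \<tau> n \<noteq> t \<longrightarrow> \<tau> n \<in> {0..T} \<longrightarrow> \<bar>u (\<tau> n) x - u t x\<bar> < e) sequentially"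
            using \<tau>(2) by (rule eventually_compose_filterlim)
          then show "eventually (\<lambda>n. dist (u (\<tau> n) x) (u t x) < e) sequentially"
          proof eventually_elim
            case (elim n)
            have "\<tau> n \<in> {0..T}" using \<tau>(1)[rule_format, of n] by auto
            then show ?case using elim \<open>0 < e\<close> by (cases "\<tau> n = t") (auto simp: dist_real_def)
          qed
        qed
        moreover have "0 < u t x" using pos[of t x] t x by auto
        ultimately show "(\<lambda>n. u (\<tau> n) x powr (\<alpha> + 2) * \<bar>wderiv L 3 a x\<bar> powr ?p) \<longlonglongrightarrow>
          u t x powr (\<alpha> + 2) * \<bar>wderiv L 3 a x\<bar> powr ?p"
          by (intro tendsto_intros) auto
      qed
      show "AE x in Om L. norm (u (\<tau> n) x powr (\<alpha> + 2) * \<bar>wderiv L 3 a x\<bar> powr ?p)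
          \<le> M powr (\<alpha> + 2) * \<bar>wderiv L 3 a x\<bar> powr ?p" for n
      proof (rule AE_I2)
        fix x assume "x \<in> space (Om L)"
        then have "0 < u (\<tau> n) x" "u (\<tau> n) x \<le> M"
          using pos[of "\<tau> n" x] M(2)[of "\<tau> n" x] \<tau>(1)[rule_format, of n] by auto
        then have "u (\<tau> n) x powr (\<alpha> + 2) \<le> M powr (\<alpha> + 2)" using \<alpha> by (intro powr_mono2) auto
        then show "norm (u (\<tau> n) x powr (\<alpha> + 2) * \<bar>wderiv L 3 a x\<bar> powr ?p)
          \<le> M powr (\<alpha> + 2) * \<bar>wderiv L 3 a x\<bar> powr ?p" by (simp add: mult_right_mono)
      qed
    qed
    then show "((\<lambda>t. W t a) \<circ> \<tau>) \<longlonglongrightarrow> W t a" by (simp add: o_def)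
  qed
  have Wbound: "W t a \<le> M powr (\<alpha> + 2) * ?N a powr ?p" if t: "t \<in> ?S" and a: "a \<in> ?X" for t a
  proof -
    have "W t a \<le> (\<integral>x. M powr (\<alpha> + 2) * \<bar>wderiv L 3 a x\<bar> powr ?p \<partial>Om L)"
      unfolding W_def
    proof (rule integral_mono_AE)
      show "integrable (Om L) (\<lambda>x. u t x powr (\<alpha> + 2) * \<bar>wderiv L 3 a x\<bar> powr ?p)"
        using t \<alpha> pos by (intro weighted_integrable(1)[OF p _ c _ l3[OF a]]) auto
      show "integrable (Om L) (\<lambda>x. M powr (\<alpha> + 2) * \<bar>wderiv L 3 a x\<bar> powr ?p)"
        using l3[OF a] by (simp add: LpM_def)
      show "AE x in Om L. u t x powr (\<alpha> + 2) * \<bar>wderiv L 3 a x\<bar> powr ?p \<le> M powr (\<alpha> + 2) * \<bar>wderiv L 3 a x\<bar> powr ?p"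
      proof (rule AE_I2)
        fix x assume "x \<in> space (Om L)"
        then have "0 < u t x" "u t x \<le> M" using pos[of t x] M(2)[of t x] t by auto
        then have "u t x powr (\<alpha> + 2) \<le> M powr (\<alpha> + 2)" using \<alpha> by (intro powr_mono2) auto
        then show "u t x powr (\<alpha> + 2) * \<bar>wderiv L 3 a x\<bar> powr ?p \<le> M powr (\<alpha> + 2) * \<bar>wderiv L 3 a x\<bar> powr ?p"
          by (rule mult_right_mono) simp
      qed
    qed
    also have "\<dots> = M powr (\<alpha> + 2) * (\<integral>x. \<bar>wderiv L 3 a x\<bar> powr ?p \<partial>Om L)" by simp
    also have "\<dots> \<le> M powr (\<alpha> + 2) * ?N a powr ?p"
      using \<alpha> by (intro mult_left_mono wderiv_Lp_le_sobolev_norm) auto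
    finally show ?thesis .
  qed
  \<comment> \<open>the reverse triangle inequality for the weighted seminorm\<close>
  have Wsn: "\<bar>W t a powr (1 / ?p) - W t b powr (1 / ?p)\<bar> \<le> (M powr (\<alpha> + 2) * ?N (a - b) powr ?p) powr (1 / ?p)"
    if t: "t \<in> ?S" and a: "a \<in> ?X" and b: "b \<in> ?X" and ab: "a - b \<in> sobolev L 3 ?p" for t a b
  proof -
    interpret seminormed_space "sobolev L 3 ?p" ?N by (rule sobolev_seminormed[OF p])
    have as: "a \<in> sobolev L 3 ?p" and bs: "b \<in> sobolev L 3 ?p" using a b by (auto simp: sobolev_B_def)
    have *: "W t a powr (1 / ?p) \<le> (M powr (\<alpha> + 2) * ?N (a - b) powr ?p) powr (1 / ?p) + W t b powr (1 / ?p)"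
      if as: "a \<in> sobolev L 3 ?p" and bs: "b \<in> sobolev L 3 ?p" for a b
    proof -
      have ds: "a - b \<in> sobolev L 3 ?p" by (rule diff_mem[OF as bs])
      note la = sobolev_wderiv(2)[OF as order_refl] and lb = sobolev_wderiv(2)[OF bs order_refl]
        and ld = sobolev_wderiv(2)[OF ds order_refl]
      let ?\<rho> = "\<lambda>x. u t x powr ((\<alpha> + 2) / ?p)"
      have wi: "LpM (Om L) ?p (\<lambda>x. ?\<rho> x * k x)"
        "(\<integral>x. \<bar>?\<rho> x * k x\<bar> powr ?p \<partial>Om L) = (\<integral>x. u t x powr (\<alpha> + 2) * \<bar>k x\<bar> powr ?p \<partial>Om L)"
        "integrable (Om L) (\<lambda>x. u t x powr (\<alpha> + 2) * \<bar>k x\<bar> powr ?p)"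
        if "LpM (Om L) ?p k" for k
        using t \<alpha> pos by (intro weighted_integrable[OF p _ c _ that]; auto)+
      let ?d = "\<lambda>x. wderiv L 3 a x - wderiv L 3 b x"
      have ldd: "LpM (Om L) ?p ?d" using p by (intro LpM_diff la lb) auto
      have ae: "AE x in lebesgue. x \<in> {0<..<L} \<longrightarrow> wderiv L 3 (a - b) x = ?d x"
        unfolding diff_eq_lincomb using sobolev_lincomb(2)[OF _ as bs order_refl, of 1 "-1"] p by simp
      have Wd: "(\<integral>x. u t x powr (\<alpha> + 2) * \<bar>?d x\<bar> powr ?p \<partial>Om L) \<le> M powr (\<alpha> + 2) * ?N (a - b) powr ?p"
      proof -
        have "(\<integral>x. u t x powr (\<alpha> + 2) * \<bar>?d x\<bar> powr ?p \<partial>Om L) \<le> (\<integral>x. M powr (\<alpha> + 2) * \<bar>?d x\<bar> powr ?p \<partial>Om L)"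
        proof (rule integral_mono_AE[OF wi(3)[OF ldd]])
          show "integrable (Om L) (\<lambda>x. M powr (\<alpha> + 2) * \<bar>?d x\<bar> powr ?p)" using ldd by (simp add: LpM_def)
          show "AE x in Om L. u t x powr (\<alpha> + 2) * \<bar>?d x\<bar> powr ?p \<le> M powr (\<alpha> + 2) * \<bar>?d x\<bar> powr ?p"
          proof (rule AE_I2)
            fix x assume "x \<in> space (Om L)"
            then have "0 < u t x" "u t x \<le> M" using pos[of t x] M(2)[of t x] t by auto
            then have "u t x powr (\<alpha> + 2) \<le> M powr (\<alpha> + 2)" using \<alpha> by (intro powr_mono2) auto
            then show "u t x powr (\<alpha> + 2) * \<bar>?d x\<bar> powr ?p \<le> M powr (\<alpha> + 2) * \<bar>?d x\<bar> powr ?p"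
              by (rule mult_right_mono) simp
          qed
        qed
        also have "\<dots> = M powr (\<alpha> + 2) * (\<integral>x. \<bar>wderiv L 3 (a - b) x\<bar> powr ?p \<partial>Om L)"
          using LpM_AE_cong(2)[OF ld ae] by simp
        also have "\<dots> \<le> M powr (\<alpha> + 2) * ?N (a - b) powr ?p"
          using \<alpha> by (intro mult_left_mono wderiv_Lp_le_sobolev_norm) auto
        finally show ?thesis .
      qed
      have "(\<Sum>j\<in>{0::nat}. \<integral>x. \<bar>?\<rho> x * ?d x + ?\<rho> x * wderiv L 3 b x\<bar> powr ?p \<partial>Om L) powr (1 / ?p)
         \<le> (\<Sum>j\<in>{0::nat}. \<integral>x. \<bar>?\<rho> x * ?d x\<bar> powr ?p \<partial>Om L) powr (1 / ?p)
          + (\<Sum>j\<in>{0::nat}. \<integral>x. \<bar>?\<rho> x * wderiv L 3 b x\<bar> powr ?p \<partial>Om L) powr (1 / ?p)"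
        by (rule minkowski_sum[OF p]) (auto intro: wi(1) ldd lb)
      moreover have "?\<rho> x * ?d x + ?\<rho> x * wderiv L 3 b x = ?\<rho> x * wderiv L 3 a x" for x by (simp add: algebra_simps)
      ultimately have "W t a powr (1 / ?p) \<le> (\<integral>x. u t x powr (\<alpha> + 2) * \<bar>?d x\<bar> powr ?p \<partial>Om L) powr (1 / ?p) + W t b powr (1 / ?p)"
        by (simp add: wi(2)[OF la] wi(2)[OF lb] wi(2)[OF ldd] W_def)
      also have "(\<integral>x. u t x powr (\<alpha> + 2) * \<bar>?d x\<bar> powr ?p \<partial>Om L) powr (1 / ?p) \<le> (M powr (\<alpha> + 2) * ?N (a - b) powr ?p) powr (1 / ?p)"
        using Wd \<alpha> by (intro powr_mono2 Bochner_Integration.integral_nonneg) auto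
      finally show ?thesis by simp
    qed
    show ?thesis using *[OF as bs] *[OF bs as] N_diff_commute[OF as bs] by simp
  qed
  have W0: "0 \<le> W t a" for t a unfolding W_def by (intro Bochner_Integration.integral_nonneg) auto
  have "(\<lambda>t. W t (u t) powr (1 / ?p)) \<in> borel_measurable (lebesgue_on ?S)"
  proof (rule borel_measurable_AE_limit[OF S])
    show "(\<lambda>t. W t (s n t) powr (1 / ?p)) \<in> borel_measurable (lebesgue_on ?S)" for n
    proof (rule simple_on_measurable[OF S s(2), where G = "\<lambda>t a. W t a powr (1 / ?p)"])
      fix a assume "a \<in> s n ` ?S"
      then have "a \<in> ?X" using s(1) by auto
      then have [measurable]: "(\<lambda>t. W t a) \<in> borel_measurable (lebesgue_on ?S)"
        by (intro continuous_imp_measurable_on_sets_lebesgue Wcont) auto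
      show "(\<lambda>t. W t a powr (1 / ?p)) \<in> borel_measurable (lebesgue_on ?S)" by measurable
    qed
    show "AE t in lebesgue. t \<in> ?S \<longrightarrow> (\<lambda>n. W t (s n t) powr (1 / ?p)) \<longlonglongrightarrow> W t (u t) powr (1 / ?p)"
      using lim
    proof eventually_elim
      case (elim t)
      show ?case
      proof
        assume t: "t \<in> ?S"
        interpret seminormed_space "sobolev L 3 ?p" ?N by (rule sobolev_seminormed[OF p])
        have uX: "u t \<in> ?X" and nl: "(\<lambda>n. ?N (s n t - u t)) \<longlonglongrightarrow> 0" using elim t by auto
        have sX: "s n t \<in> ?X" for n using s(1)[of n] t by auto
        have "(\<lambda>n. (M powr (\<alpha> + 2) * ?N (s n t - u t) powr ?p) powr (1 / ?p)) \<longlonglongrightarrow> (M powr (\<alpha> + 2) * 0 powr ?p) powr (1 / ?p)"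
          using \<alpha> N_nonneg by (intro tendsto_powr2 tendsto_mult tendsto_const nl) (auto intro!: always_eventually tendsto_powr2 nl)
        then have l0: "(\<lambda>n. (M powr (\<alpha> + 2) * ?N (s n t - u t) powr ?p) powr (1 / ?p)) \<longlonglongrightarrow> 0" by simp
        have "norm (W t (s n t) powr (1 / ?p) - W t (u t) powr (1 / ?p)) \<le> (M powr (\<alpha> + 2) * ?N (s n t - u t) powr ?p) powr (1 / ?p)" for n
          using Wsn[OF t sX uX diff_mem] sX[of n] uX by (auto simp: sobolev_B_def)
        then have "(\<lambda>n. W t (s n t) powr (1 / ?p) - W t (u t) powr (1 / ?p)) \<longlonglongrightarrow> 0"
          by (intro Lim_null_comparison[OF always_eventually l0]) blast
        then show "(\<lambda>n. W t (s n t) powr (1 / ?p)) \<longlonglongrightarrow> W t (u t) powr (1 / ?p)" by (simp add: LIM_zero_iff)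
      qed
    qed
  qed
  then have "(\<lambda>t. (W t (u t) powr (1 / ?p)) powr ?p) \<in> borel_measurable (lebesgue_on ?S)" by measurable
  then have m: "(\<lambda>t. W t (u t)) \<in> borel_measurable (lebesgue_on ?S)"
    using \<alpha> W0 by (simp add: powr_powr)
  have "integrable (lebesgue_on ?S) (\<lambda>t. W t (u t))"
  proof (rule Bochner_Integration.integrable_bound[OF _ m])
    show "integrable (lebesgue_on ?S) (\<lambda>t. M powr (\<alpha> + 2) * ?N (u t) powr ?p)"
      using integral_lebesgue_on(1)[OF ui S] by simp
    show "AE t in lebesgue_on ?S. norm (W t (u t)) \<le> norm (M powr (\<alpha> + 2) * ?N (u t) powr ?p)"
      unfolding AE_lebesgue_on_iff[OF S] using lim
      by eventually_elim (use Wbound W0 in auto)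
  qed
  then show ?thesis by (simp add: W_def diss_def absolutely_integrable_iff_integrable)
qed

text \<open>
  Taking \<open>-v\<^sub>x\<^sub>x\<close> is a bounded linear map between the two Sobolev spaces and preserves simple functions.
\<close>

lemma second_derivative_bochner:
  assumes p: "1 \<le> p" and u: "u \<in> Lp_sobolev_B p T L 3 p"
  shows "(\<lambda>t x. - wderiv L 2 (u t) x) \<in> bochner_Lp p {0<..<T} (sobolev L 1 p) (sobolev_norm L 1 p)"
proof -
  let ?S = "{0<..<T}" let ?N = "sobolev_norm L 1 p"
  let ?D = "\<lambda>a x. - wderiv L 2 a x"
  interpret A: seminormed_space "sobolev L 1 p" ?N by (rule sobolev_seminormed[OF p])
  interpret B: seminormed_space "sobolev L 3 p" "sobolev_norm L 3 p" by (rule sobolev_seminormed[OF p])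
  have S: "?S \<in> sets lebesgue" by simp
  have DX: "?D a \<in> sobolev L 1 p" if "a \<in> sobolev L 3 p" for a
    by (rule sobolev_minus_second_derivative(1)[OF p that])
  have DN: "?N (?D a) \<le> sobolev_norm L 3 p a" if a: "a \<in> sobolev L 3 p" for a
  proof -
    note d = sobolev_minus_second_derivative[OF p a]
    have i: "(\<integral>x. \<bar>- wderiv L 2 a x\<bar> powr p \<partial>Om L) = (\<integral>x. \<bar>wderiv L 0 (?D a) x\<bar> powr p \<partial>Om L)"
      "(\<integral>x. \<bar>- wderiv L 3 a x\<bar> powr p \<partial>Om L) = (\<integral>x. \<bar>wderiv L 1 (?D a) x\<bar> powr p \<partial>Om L)"
      using LpM_AE_cong(2)[OF sobolev_wderiv(2)[OF d(1)] d(2)] LpM_AE_cong(2)[OF sobolev_wderiv(2)[OF d(1)] d(3)] by auto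
    have "(\<Sum>j\<le>1. \<integral>x. \<bar>wderiv L j (?D a) x\<bar> powr p \<partial>Om L) =
        (\<integral>x. \<bar>wderiv L 2 a x\<bar> powr p \<partial>Om L) + (\<integral>x. \<bar>wderiv L 3 a x\<bar> powr p \<partial>Om L)"
      using i by simp
    also have "\<dots> = (\<Sum>j\<in>{2, 3}. \<integral>x. \<bar>wderiv L j a x\<bar> powr p \<partial>Om L)" by simp
    also have "\<dots> \<le> (\<Sum>j\<le>3. \<integral>x. \<bar>wderiv L j a x\<bar> powr p \<partial>Om L)"
      by (intro sum_mono2 Bochner_Integration.integral_nonneg) auto
    finally show ?thesis
      unfolding sobolev_norm_eq using p by (intro powr_mono2 sum_nonneg Bochner_Integration.integral_nonneg) auto
  qed
  have Ddiff: "?N (?D a - ?D b) \<le> sobolev_norm L 3 p (a - b)" if a: "a \<in> sobolev L 3 p" and b: "b \<in> sobolev L 3 p" for a b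
  proof -
    have "AE x in lebesgue. x \<in> {0<..<L} \<longrightarrow> wderiv L 2 (a - b) x = 1 * wderiv L 2 a x + (- 1) * wderiv L 2 b x"
      unfolding B.diff_eq_lincomb using p by (intro sobolev_lincomb(2)[OF _ a b]) auto
    then have "AE x in lebesgue. x \<in> {0<..<L} \<longrightarrow> (?D a - ?D b) x = ?D (a - b) x"
      by eventually_elim auto
    from wderiv_AE_cong[OF this] have e: "wderiv L j (?D a - ?D b) = wderiv L j (?D (a - b))" for j .
    have "?N (?D a - ?D b) = ?N (?D (a - b))" unfolding sobolev_norm_def e ..
    then show ?thesis using DN[OF B.diff_mem[OF a b]] by simp
  qed
  have us: "strongly_measurable (sobolev_B L 3 p) (sobolev_norm L 3 p) ?S u"
    and ui: "(\<lambda>t. sobolev_norm L 3 p (u t) powr p) absolutely_integrable_on ?S"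
    using u by (auto simp: bochner_Lp_def)
  obtain s where s: "\<And>n. s n ` ?S \<subseteq> sobolev_B L 3 p" "\<And>n. simple_on ?S (s n)"
    and lim: "AE t in lebesgue. t \<in> ?S \<longrightarrow> u t \<in> sobolev_B L 3 p \<and> (\<lambda>n. sobolev_norm L 3 p (s n t - u t)) \<longlonglongrightarrow> 0"
    using us unfolding strongly_measurable_iff by blast
  have m: "strongly_measurable (sobolev L 1 p) ?N ?S (\<lambda>t. ?D (u t))"
    unfolding strongly_measurable_iff
  proof (intro exI[of _ "\<lambda>n t. ?D (s n t)"] conjI allI)
    show "(\<lambda>t. ?D (s n t)) ` ?S \<subseteq> sobolev L 1 p" for n
      using s(1)[of n] DX by (auto simp: sobolev_B_def)
    show "simple_on ?S (\<lambda>t. ?D (s n t))" for n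
      using simple_on_map2[OF S s(2) s(2), where h = "\<lambda>a b. ?D a"] .
    show "AE t in lebesgue. t \<in> ?S \<longrightarrow> ?D (u t) \<in> sobolev L 1 p \<and> (\<lambda>n. ?N (?D (s n t) - ?D (u t))) \<longlonglongrightarrow> 0"
      using lim
    proof eventually_elim
      case (elim t)
      show ?case
      proof (intro impI conjI)
        assume t: "t \<in> ?S"
        have us: "u t \<in> sobolev L 3 p" using elim t by (auto simp: sobolev_B_def)
        have ss: "s n t \<in> sobolev L 3 p" for n using s(1)[of n] t sobolev_BD by blast
        show "?D (u t) \<in> sobolev L 1 p" by (rule DX[OF us])
        have nl: "(\<lambda>n. sobolev_norm L 3 p (s n t - u t)) \<longlonglongrightarrow> 0" using elim t by auto
        show "(\<lambda>n. ?N (?D (s n t) - ?D (u t))) \<longlonglongrightarrow> 0"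
          by (rule Lim_null_comparison[OF always_eventually nl])
            (use Ddiff[OF ss us] A.N_nonneg in \<open>simp del: minus_diff_minus\<close>)
      qed
    qed
  qed
  have "integrable (lebesgue_on ?S) (\<lambda>t. ?N (?D (u t)) powr p)"
  proof (rule Bochner_Integration.integrable_bound[OF integral_lebesgue_on(1)[OF ui S]])
    show "(\<lambda>t. ?N (?D (u t)) powr p) \<in> borel_measurable (lebesgue_on ?S)"
      using A.norm_measurable(1)[OF S m] by measurable
    show "AE t in lebesgue_on ?S. norm (?N (?D (u t)) powr p) \<le> norm (sobolev_norm L 3 p (u t) powr p)"
      unfolding AE_lebesgue_on_iff[OF S] using lim
    proof eventually_elim
      case (elim t)
      then show ?case using DN[of "u t"] p A.N_nonneg[of "?D (u t)"]
        by (auto simp: sobolev_B_def intro!: powr_mono2)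
    qed
  qed
  then show ?thesis using m S by (simp add: bochner_Lp_def absolutely_integrable_iff_integrable)
qed

section \<open>Measurability of the source norm\<close>

text \<open>
  The squared \<open>L\<^sup>2\<close>-norm of the derivative as a limit of expressions that do not mention derivatives. By Jensen's
  inequality these expressions never exceed their limit. For the lower bound \<open>k\<^sup>2\<close> is truncated at height \<open>m\<close>, where convergence of the
  difference quotients in \<open>L\<^sup>1\<close> suffices.
\<close>

lemma difference_quotient_L2_limit:
  assumes L: "0 < L" and G: "AC 0 L G k" and k: "LpM (Om L) 2 k"
  shows "(\<lambda>n. integral {L / (real n + 2)..L} (\<lambda>x. ((G x - G (x - L / (real n + 2))) / (L / (real n + 2)))\<^sup>2))
    \<longlonglongrightarrow> (\<integral>x. (k x)\<^sup>2 \<partial>Om L)"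
proof -
  define h where "h n = L / (real n + 2)" for n
  have h: "0 < h n" "h n < L" for n
    using L divide_strict_left_mono[of 1 "real n + 2" L] by (auto simp: h_def)
  have hlim: "filterlim h (at_right 0) sequentially"
    unfolding filterlim_at
  proof
    show "h \<longlonglongrightarrow> 0" unfolding h_def by real_asymp
    show "eventually (\<lambda>n. h n \<in> {0<..} \<and> h n \<noteq> 0) sequentially"
      using h by (intro always_eventually) (simp add: less_imp_neq[symmetric])
  qed
  define z where "z n = integral {h n..L} (\<lambda>x. ((G x - G (x - h n)) / h n)\<^sup>2)" for n
  define Z where "Z = (\<integral>x. (k x)\<^sup>2 \<partial>Om L)"
  have kk: "integrable (Om L) (\<lambda>x. (k x)\<^sup>2)" using k by (simp add: LpM_def)
  then have k2: "(\<lambda>x. (k x)\<^sup>2) absolutely_integrable_on {0..L}" by (simp add: integrable_Om)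
  have Zi: "Z = integral {0..L} (\<lambda>x. (k x)\<^sup>2)" unfolding Z_def by (rule integral_Om[OF k2])
  have km[measurable]: "k \<in> borel_measurable (Om L)" using k by (simp add: LpM_def)
  have cG: "continuous_on {s..L} (\<lambda>x. (G x - G (x - h n)) / h n)" if "h n \<le> s" for s n
    using that h[of n]
    by (intro continuous_intros continuous_on_subset[OF AC_continuous_on[OF G]] continuous_on_compose2[OF AC_continuous_on[OF G]]) auto
  have absk: "AC 0 L (\<lambda>x. integral {0..x} (\<lambda>y. \<bar>k y\<bar>)) (\<lambda>y. \<bar>k y\<bar>)"
    using G by (intro AC_primitive set_integrable_abs) (simp add: AC_def)
  define Q where "Q x = integral {0..x} (\<lambda>y. \<bar>k y\<bar> powr 2)" for x
  have Q: "AC 0 L Q (\<lambda>y. \<bar>k y\<bar> powr 2)"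
    unfolding Q_def[abs_def] using k2 by (intro AC_primitive) simp
  have upper: "z n \<le> Z" for n
  proof -
    have "z n \<le> integral {h n..L} (\<lambda>x. (Q x - Q (x - h n)) / h n)"
      unfolding z_def
    proof (rule integral_le)
      show "(\<lambda>x. ((G x - G (x - h n)) / h n)\<^sup>2) integrable_on {h n..L}"
        by (intro integrable_continuous_real continuous_on_power cG) auto
      show "(\<lambda>x. (Q x - Q (x - h n)) / h n) integrable_on {h n..L}"
        using h[of n]
        by (intro integrable_continuous_real continuous_intros continuous_on_subset[OF AC_continuous_on[OF Q]]
            continuous_on_compose2[OF AC_continuous_on[OF Q]]) auto
      fix x assume x: "x \<in> {h n..L}"
      let ?P = "\<lambda>x. integral {0..x} (\<lambda>y. \<bar>k y\<bar>)"
      have "\<bar>G x - G (x - h n)\<bar> \<le> ?P x - ?P (x - h n)"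
        using AC_abs_bound[OF G, of "x - h n" x] AC_diff[OF absk, of "x - h n" x] x h[of n] by auto
      then have "\<bar>(G x - G (x - h n)) / h n\<bar> \<le> (?P x - ?P (x - h n)) / h n"
        using h[of n] by (simp add: abs_divide divide_right_mono)
      then have "\<bar>(G x - G (x - h n)) / h n\<bar> powr 2 \<le> ((?P x - ?P (x - h n)) / h n) powr 2"
        by (intro powr_mono2) auto
      also have "\<dots> \<le> (Q x - Q (x - h n)) / h n"
        using x h[of n] by (intro window_jensen[OF _ _ absk Q]) auto
      finally show "((G x - G (x - h n)) / h n)\<^sup>2 \<le> (Q x - Q (x - h n)) / h n" by (simp add: power_divide)
    qed
    also have "\<dots> \<le> integral {0..L} (\<lambda>y. \<bar>k y\<bar> powr 2)"
      using h[of n] by (intro steklov_average_L1_bound[OF Q]) auto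
    finally show ?thesis by (simp add: Zi)
  qed
  \<comment> \<open>besides the height, the truncation also removes a neighbourhood of \<open>0\<close>, where the difference quotients are not defined\<close>
  define tr where "tr m x = (if 1 / real (Suc m) \<le> x \<and> \<bar>k x\<bar> \<le> real m then (k x)\<^sup>2 else 0)" for m x
  have trm: "tr m \<in> borel_measurable (Om L)" for m
  proof -
    have [measurable]: "(\<lambda>x. x) \<in> borel_measurable (Om L)"
      using id_borel_measurable_lebesgue_on[of "{0<..<L}"] by (simp add: id_def)
    have "(\<lambda>x. indicator {1 / real (Suc m)..} x * (indicator {..real m} \<bar>k x\<bar> * (k x)\<^sup>2)) \<in> borel_measurable (Om L)"
      by measurable
    also have "(\<lambda>x. indicator {1 / real (Suc m)..} x * (indicator {..real m} \<bar>k x\<bar> * (k x)\<^sup>2)) = tr m"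
      by (auto simp: tr_def fun_eq_iff indicator_def)
    finally show ?thesis .
  qed
  have trlim: "(\<lambda>m. \<integral>x. tr m x \<partial>Om L) \<longlonglongrightarrow> Z"
    unfolding Z_def
  proof (rule integral_dominated_convergence[OF _ _ kk])
    show "tr m \<in> borel_measurable (Om L)" for m by (rule trm)
    show "AE x in Om L. (\<lambda>m. tr m x) \<longlonglongrightarrow> (k x)\<^sup>2"
    proof (rule AE_I2)
      fix x assume "x \<in> space (Om L)"
      then have x: "0 < x" by simp
      obtain n0 where n0: "1 / real (Suc n0) < x" using nat_approx_posE[OF x] by blast
      have "eventually (\<lambda>m. tr m x = (k x)\<^sup>2) sequentially"
        using eventually_ge_at_top[of "max n0 (nat \<lceil>\<bar>k x\<bar>\<rceil>)"]
      proof eventually_elim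
        case (elim m)
        have "1 / real (Suc m) \<le> 1 / real (Suc n0)" using elim by (intro divide_left_mono) auto
        then show ?case using n0 elim by (auto simp: tr_def nat_ceiling_le_eq)
      qed
      then show "(\<lambda>m. tr m x) \<longlonglongrightarrow> (k x)\<^sup>2" by (rule tendsto_eventually)
    qed
    show "AE x in Om L. norm (tr m x) \<le> (k x)\<^sup>2" for m by (auto simp: tr_def)
  qed measurable
  have tri: "tr m absolutely_integrable_on {0..L}" for m
  proof -
    have "integrable (Om L) (tr m)"
      by (rule Bochner_Integration.integrable_bound[OF kk]) (use trm in \<open>auto simp: tr_def\<close>)
    then show ?thesis by (simp add: integrable_Om)
  qed
  have "z \<longlonglongrightarrow> Z"
  proof (rule order_tendstoI)
    fix a assume "Z < a"
    then show "eventually (\<lambda>n. z n < a) sequentially"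
      using upper by (intro always_eventually allI) (meson le_less_trans)
  next
    fix a assume a: "a < Z"
    define e where "e = (Z - a) / 2"
    have e: "0 < e" "a = Z - 2 * e" using a by (auto simp: e_def field_simps)
    have "eventually (\<lambda>m. Z - e < (\<integral>x. tr m x \<partial>Om L)) sequentially"
      using trlim e by (intro order_tendstoD) auto
    then obtain m where m: "Z - e < (\<integral>x. tr m x \<partial>Om L)"
      using eventually_happens'[OF sequentially_bot] by blast
    show "eventually (\<lambda>n. a < z n) sequentially"
    proof (cases "1 / real (Suc m) \<le> L")
      case False
      have "(\<integral>x. tr m x \<partial>Om L) = (\<integral>x. 0 \<partial>Om L)"
        using False by (intro Bochner_Integration.integral_cong) (auto simp: tr_def)
      moreover have "0 \<le> z n" for n
        unfolding z_def by (intro integral_nonneg integrable_continuous_real continuous_on_power cG) auto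
      ultimately show ?thesis using m e by (intro always_eventually allI) (smt (verit) integral_zero)
    next
      case True
      define s where "s = 1 / real (Suc m)"
      have s: "0 < s" "s \<le> L" using True by (auto simp: s_def)
      have trs: "(\<integral>x. tr m x \<partial>Om L) = integral {s..L} (tr m)"
      proof -
        have "integral {0..s} (tr m) + integral {s..L} (tr m) = integral {0..L} (tr m)"
          using s tri by (intro Henstock_Kurzweil_Integration.integral_combine) (auto simp: absolutely_integrable_on_def)
        moreover have "integral {0..s} (tr m) = integral {0..s} (\<lambda>x. 0)"
          by (rule integral_spike[of "{s}"]) (auto simp: tr_def s_def)
        ultimately show ?thesis using integral_Om[OF tri] by simp
      qed
      have "((\<lambda>h. integral {s..L} (\<lambda>x. \<bar>(G x - G (x - h)) / h - k x\<bar>)) \<longlongrightarrow> 0) (at_right 0)"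
        using s by (intro steklov_average_L1[OF G]) auto
      from filterlim_compose[OF this hlim]
      have "(\<lambda>n. 2 * real m * integral {s..L} (\<lambda>x. \<bar>(G x - G (x - h n)) / h n - k x\<bar>)) \<longlonglongrightarrow> 2 * real m * 0"
        by (intro tendsto_mult_left)
      then have "eventually (\<lambda>n. 2 * real m * integral {s..L} (\<lambda>x. \<bar>(G x - G (x - h n)) / h n - k x\<bar>) < e) sequentially"
        using e by (intro order_tendstoD) auto
      moreover have "eventually (\<lambda>n. h n < s) sequentially"
      proof -
        have "h \<longlonglongrightarrow> 0" unfolding h_def by real_asymp
        then show ?thesis using s by (intro order_tendstoD) auto
      qed
      ultimately show ?thesis
      proof eventually_elim
        case (elim n)
        have i1: "(\<lambda>x. \<bar>(G x - G (x - h n)) / h n - k x\<bar>) absolutely_integrable_on {s..L}"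
          using elim s
          by (intro set_integrable_abs set_integral_diff(1)[OF absolutely_integrable_continuous_real[OF cG] AC_integrable[OF G]]) auto
        have i2: "(\<lambda>x. ((G x - G (x - h n)) / h n)\<^sup>2) integrable_on {r..L}" if "h n \<le> r" for r
          by (intro integrable_continuous_real continuous_on_power cG that)
        have "integral {s..L} (tr m) \<le> integral {s..L} (\<lambda>x. 2 * real m * \<bar>(G x - G (x - h n)) / h n - k x\<bar> + ((G x - G (x - h n)) / h n)\<^sup>2)"
        proof (rule integral_le)
          show "tr m integrable_on {s..L}"
            using absolutely_integrable_on_subinterval[OF tri, of s L m] s by (auto simp: absolutely_integrable_on_def)
          show "(\<lambda>x. 2 * real m * \<bar>(G x - G (x - h n)) / h n - k x\<bar> + ((G x - G (x - h n)) / h n)\<^sup>2) integrable_on {s..L}"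
            using i1 i2[of s] elim by (intro integrable_add integrable_on_mult_right) (auto simp: absolutely_integrable_on_def)
          fix x assume "x \<in> {s..L}"
          define A where "A = (G x - G (x - h n)) / h n"
          show "tr m x \<le> 2 * real m * \<bar>A - k x\<bar> + A\<^sup>2"
          proof (cases "\<bar>k x\<bar> \<le> real m")
            case True
            have "(k x)\<^sup>2 = 2 * (k x * (k x - A)) + A\<^sup>2 - (k x - A)\<^sup>2" by (simp add: power2_eq_square algebra_simps)
            also have "\<dots> \<le> 2 * (k x * (k x - A)) + A\<^sup>2" by simp
            also have "k x * (k x - A) \<le> real m * \<bar>k x - A\<bar>" by (rule mult_le_bound_abs[OF True])
            finally show ?thesis by (auto simp: tr_def abs_minus_commute)
          qed (auto simp: tr_def)
        qed
        also have "\<dots> = 2 * real m * integral {s..L} (\<lambda>x. \<bar>(G x - G (x - h n)) / h n - k x\<bar>) + integral {s..L} (\<lambda>x. ((G x - G (x - h n)) / h n)\<^sup>2)"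
          using integral_add[OF integrable_on_mult_right[where c = "2 * real m"] i2[of s]] i1 elim
          by (simp add: absolutely_integrable_on_def)
        also have "integral {s..L} (\<lambda>x. ((G x - G (x - h n)) / h n)\<^sup>2) \<le> z n"
          unfolding z_def using elim i2[of s] i2[of "h n"] by (intro integral_subset_le) auto
        finally show ?case using m elim e unfolding trs by linarith
      qed
    qed
  qed
  then show ?thesis unfolding z_def Z_def h_def .
qed

lemma AE_lebesgue_shift:
  assumes "AE x in lebesgue. P x"
  shows "AE x in lebesgue. P (x - h :: real)"
proof -
  have "negligible {x. \<not> P x}"
    using assms by (simp add: completion.AE_iff_null_sets negligible_iff_null_sets)
  then have "negligible ((+) h ` {x. \<not> P x})" by (rule negligible_translation)
  moreover have "(+) h ` {x. \<not> P x} = {x. \<not> P (x - h)}"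
    by (auto simp: image_iff intro!: exI[of _ "_ - h"])
  ultimately show ?thesis
    by (simp add: completion.AE_iff_null_sets negligible_iff_null_sets)
qed

text \<open>
  Both claims are about measurability in \<open>t\<close>: the function \<open>f\<close> is jointly measurable, but its weak derivative in \<open>x\<close> is
  chosen separately for every \<open>t\<close>. So \<open>f\<close> is replaced by a Borel representative \<open>b\<close>, to which Fubini's theorem
  applies, and the norm of \<open>f\<^sub>x\<close> is the limit of norms of difference quotients of \<open>b\<close>.
\<close>

lemma source_integrable:
  fixes f :: "real \<Rightarrow> real \<Rightarrow> real"
  assumes L: "0 < L" and f1: "(\<lambda>(t, x). f t x) \<in> Lp 1 ({0<..} \<times> {0<..<L})"
    and fs: "\<And>t. 0 < t \<Longrightarrow> f t \<in> sobolev L 1 2"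
  shows "(\<lambda>t. LINT x:{0<..<L}|lebesgue. f t x) absolutely_integrable_on {0<..}"
    and "(\<lambda>t. deriv_norm2 L (f t)) \<in> borel_measurable (lebesgue_on {0<..})"
proof -
  define \<Phi> where "\<Phi> = (\<lambda>z. indicat_real ({0<..} \<times> {0<..<L}) z *\<^sub>R (case z of (t, x) \<Rightarrow> f t x))"
  have \<Phi>m: "\<Phi> \<in> borel_measurable lebesgue" and "integrable lebesgue (\<lambda>z. \<bar>\<Phi> z\<bar>)"
  proof -
    show m: "\<Phi> \<in> borel_measurable lebesgue"
      using f1 by (simp add: Lp_def set_borel_measurable_def \<Phi>_def)
    have "integrable lebesgue (\<lambda>z. indicat_real ({0<..} \<times> {0<..<L}) z *\<^sub>R \<bar>case z of (t, x) \<Rightarrow> f t x\<bar> powr 1)"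
      using f1 by (simp add: Lp_def set_integrable_def)
    also have "(\<lambda>z. indicat_real ({0<..} \<times> {0<..<L}) z *\<^sub>R \<bar>case z of (t, x) \<Rightarrow> f t x\<bar> powr 1) = (\<lambda>z. \<bar>\<Phi> z\<bar>)"
      by (auto simp: \<Phi>_def fun_eq_iff indicator_def)
    finally show "integrable lebesgue (\<lambda>z. \<bar>\<Phi> z\<bar>)" .
  qed
  then have \<Phi>i: "integrable lebesgue \<Phi>" using integrable_abs_iff by blast
  obtain b where bm: "b \<in> borel_measurable lborel" and b: "AE z in lborel. \<Phi> z = b z"
    using completion_ex_borel_measurable_real[OF \<Phi>m] by blast
  have "integrable lebesgue b"
    using \<Phi>i b bm by (subst integrable_cong_AE[of b lebesgue \<Phi>]) (auto intro: AE_completion measurable_completion \<Phi>m)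
  then have bi: "integrable (lborel \<Otimes>\<^sub>M lborel) b"
    using integrable_completion[OF bm] by (simp add: lborel_prod)
  have bm': "b \<in> borel_measurable (lborel \<Otimes>\<^sub>M lborel)" using bm by (simp add: lborel_prod)
  have "AE z in lborel \<Otimes>\<^sub>M lborel. \<Phi> z = b z" unfolding lborel_prod by (rule b)
  from lborel_pair.AE_pair[OF this]
  have AEt: "AE t in lborel. AE x in lborel. \<Phi> (t, x) = b (t, x)" .
  have S: "{0<..} \<in> sets (lebesgue :: real measure)" by simp
  have good: "AE t in lebesgue. t \<in> {0<..} \<longrightarrow> (AE x in lebesgue. x \<in> {0<..<L} \<longrightarrow> f t x = b (t, x))"
    using AE_completion[OF AEt]
  proof eventually_elim
    case (elim t)
    show ?case
    proof
      assume t: "t \<in> {0<..}"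
      show "AE x in lebesgue. x \<in> {0<..<L} \<longrightarrow> f t x = b (t, x)"
        using AE_completion[OF elim] by eventually_elim (use t in \<open>auto simp: \<Phi>_def\<close>)
    qed
  qed
  have good2: "AE t in lebesgue. t \<in> {0<..} \<longrightarrow> (AE x in lebesgue. x \<notin> {0<..<L} \<longrightarrow> b (t, x) = 0)"
    using AE_completion[OF AEt]
  proof eventually_elim
    case (elim t)
    show ?case
    proof
      show "AE x in lebesgue. x \<notin> {0<..<L} \<longrightarrow> b (t, x) = 0"
        using AE_completion[OF elim] by eventually_elim (auto simp: \<Phi>_def)
    qed
  qed
  have bt: "(\<lambda>x. b (t, x)) \<in> borel_measurable borel" for t
    using bm' by simp
  show "(\<lambda>t. LINT x:{0<..<L}|lebesgue. f t x) absolutely_integrable_on {0<..}"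
  proof (rule absolutely_integrable_AE_cong(1))
    have "integrable lborel (\<lambda>t. \<integral>x. b (t, x) \<partial>lborel)" by (rule lborel_pair.integrable_fst'[OF bi])
    then have "integrable lebesgue (\<lambda>t. \<integral>x. b (t, x) \<partial>lborel)"
      using integrable_completion[OF borel_measurable_integrable] by blast
    then show "(\<lambda>t. \<integral>x. b (t, x) \<partial>lborel) absolutely_integrable_on {0<..}"
      unfolding set_integrable_def by (intro integrable_mult_indicator[OF S])
    show "AE t in lebesgue. t \<in> {0<..} \<longrightarrow> (\<integral>x. b (t, x) \<partial>lborel) = (LINT x:{0<..<L}|lebesgue. f t x)"
      using good good2
    proof eventually_elim
      case (elim t)
      show ?case
      proof
        assume t: "t \<in> {0<..}"
        have fi: "f t absolutely_integrable_on {0..L}"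
          using LpM_absolutely_integrable[OF _ sobolev_wderiv_0(2)[OF fs]] t by auto
        have "(\<integral>x. b (t, x) \<partial>lborel) = (\<integral>x. b (t, x) \<partial>lebesgue)"
          using integral_completion[of "\<lambda>x. b (t, x)" lborel] bt by simp
        also have "\<dots> = (\<integral>x. indicator {0<..<L} x *\<^sub>R f t x \<partial>lebesgue)"
        proof (rule integral_cong_AE)
          show "(\<lambda>x. b (t, x)) \<in> borel_measurable lebesgue" using bt by (intro measurable_completion) simp
          show "(\<lambda>x. indicator {0<..<L} x *\<^sub>R f t x) \<in> borel_measurable lebesgue"
            by (rule borel_measurable_integrable[OF fi[unfolded absolutely_integrable_on_Icc_iff_Ioo, unfolded set_integrable_def]])
          have "AE x in lebesgue. x \<in> {0<..<L} \<longrightarrow> f t x = b (t, x)" "AE x in lebesgue. x \<notin> {0<..<L} \<longrightarrow> b (t, x) = 0"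
            using elim t by auto
          then show "AE x in lebesgue. b (t, x) = indicator {0<..<L} x *\<^sub>R f t x"
            by eventually_elim (auto simp: indicator_def)
        qed
        finally show "(\<integral>x. b (t, x) \<partial>lborel) = (LINT x:{0<..<L}|lebesgue. f t x)"
          by (simp add: set_lebesgue_integral_def)
      qed
    qed
  qed
  define h where "h n = L / (real n + 2)" for n
  have h: "0 < h n" "h n < L" for n
    using L divide_strict_left_mono[of 1 "real n + 2" L] by (auto simp: h_def)
  \<comment> \<open>squared norms of difference quotients: measurable in \<open>t\<close> by Fubini, since they involve \<open>b\<close> only\<close>
  define \<zeta> where "\<zeta> n t = (\<integral>x. indicator {h n..L} x * ((b (t, x) - b (t, x - h n)) / h n)\<^sup>2 \<partial>lborel)" for n t
  have \<zeta>m: "\<zeta> n \<in> borel_measurable lborel" for n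
    unfolding \<zeta>_def
  proof (rule lborel.borel_measurable_lebesgue_integral)
    have [measurable]: "(\<lambda>z. b (fst z, snd z - h n)) \<in> borel_measurable (lborel \<Otimes>\<^sub>M lborel)"
      by (rule measurable_compose[OF _ bm']) measurable
    have [measurable]: "(\<lambda>z. b (fst z, snd z)) \<in> borel_measurable (lborel \<Otimes>\<^sub>M lborel)"
      using bm' by simp
    show "(\<lambda>(t, x). indicator {h n..L} x * ((b (t, x) - b (t, x - h n)) / h n)\<^sup>2) \<in> borel_measurable (lborel \<Otimes>\<^sub>M lborel)"
      unfolding case_prod_beta by measurable
  qed
  have "AE t in lebesgue. t \<in> {0<..} \<longrightarrow> (\<lambda>n. \<zeta> n t) \<longlonglongrightarrow> (deriv_norm2 L (f t))\<^sup>2"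
    using good
  proof eventually_elim
    case (elim t)
    show ?case
    proof
      assume t: "t \<in> {0<..}"
      then have ft: "f t \<in> sobolev L 1 2" using fs by auto
      obtain G where G: "AC 0 L G (wderiv L 1 (f t))" "AE x in lebesgue. x \<in> {0<..<L} \<longrightarrow> f t x = G x"
        using sobolev_AC[OF L _ ft] by auto
      have "AE x in lebesgue. x \<in> {0<..<L} \<longrightarrow> f t x = b (t, x)" using elim t by auto
      with G(2) have bG: "AE x in lebesgue. x \<in> {0<..<L} \<longrightarrow> b (t, x) = G x" by eventually_elim auto
      have eq: "\<zeta> n t = integral {h n..L} (\<lambda>x. ((G x - G (x - h n)) / h n)\<^sup>2)" for n
      proof -
        have c: "continuous_on {h n..L} (\<lambda>x. ((G x - G (x - h n)) / h n)\<^sup>2)"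
          using h[of n]
          by (intro continuous_intros continuous_on_subset[OF AC_continuous_on[OF G(1)]] continuous_on_compose2[OF AC_continuous_on[OF G(1)]]) auto
        have ai: "(\<lambda>x. ((G x - G (x - h n)) / h n)\<^sup>2) absolutely_integrable_on {h n..L}"
          by (rule absolutely_integrable_continuous_real[OF c])
        have m1: "(\<lambda>x. indicator {h n..L} x * ((b (t, x) - b (t, x - h n)) / h n)\<^sup>2) \<in> borel_measurable borel"
        proof -
          have [measurable]: "(\<lambda>x. b (t, x)) \<in> borel_measurable borel" by (rule bt)
          have [measurable]: "(\<lambda>x. b (t, x - h n)) \<in> borel_measurable borel"
            by (rule measurable_compose[OF _ bt]) measurable
          show ?thesis by measurable
        qed
        have "\<zeta> n t = (\<integral>x. indicator {h n..L} x * ((b (t, x) - b (t, x - h n)) / h n)\<^sup>2 \<partial>lebesgue)"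
          unfolding \<zeta>_def by (rule integral_completion[symmetric]) (use m1 in simp)
        also have "\<dots> = (\<integral>x. indicator {h n..L} x *\<^sub>R ((G x - G (x - h n)) / h n)\<^sup>2 \<partial>lebesgue)"
        proof (rule integral_cong_AE)
          show "(\<lambda>x. indicator {h n..L} x * ((b (t, x) - b (t, x - h n)) / h n)\<^sup>2) \<in> borel_measurable lebesgue"
            using m1 by (intro measurable_completion) simp
          show "(\<lambda>x. indicator {h n..L} x *\<^sub>R ((G x - G (x - h n)) / h n)\<^sup>2) \<in> borel_measurable lebesgue"
            using ai by (intro borel_measurable_integrable) (simp add: set_integrable_def)
          have "AE x in lebesgue. x \<notin> {h n, L}"
            using negligible_finite[of "{h n, L}"] unfolding negligible_iff_null_sets by (intro AE_not_in) auto
          with bG AE_lebesgue_shift[OF bG, of "h n"]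
          show "AE x in lebesgue. indicator {h n..L} x * ((b (t, x) - b (t, x - h n)) / h n)\<^sup>2 =
             indicator {h n..L} x *\<^sub>R ((G x - G (x - h n)) / h n)\<^sup>2"
            by eventually_elim (use h[of n] in \<open>auto simp: indicator_def\<close>)
        qed
        also have "\<dots> = integral {h n..L} (\<lambda>x. ((G x - G (x - h n)) / h n)\<^sup>2)"
          using set_lebesgue_integral_eq_integral(2)[OF ai] by (simp add: set_lebesgue_integral_def)
        finally show ?thesis .
      qed
      show "(\<lambda>n. \<zeta> n t) \<longlonglongrightarrow> (deriv_norm2 L (f t))\<^sup>2"
        unfolding eq deriv_norm2_squared unfolding h_def
        by (rule difference_quotient_L2_limit[OF L G(1) sobolev_wderiv(2)[OF ft order_refl]])
    qed
  qed
  from borel_measurable_AE_limit[OF S _ this]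
  have "(\<lambda>t. (deriv_norm2 L (f t))\<^sup>2) \<in> borel_measurable (lebesgue_on {0<..})"
    using \<zeta>m by (simp add: measurable_completion measurable_restrict_space1)
  then have "(\<lambda>t. sqrt ((deriv_norm2 L (f t))\<^sup>2)) \<in> borel_measurable (lebesgue_on {0<..})" by measurable
  then show "(\<lambda>t. deriv_norm2 L (f t)) \<in> borel_measurable (lebesgue_on {0<..})"
    by (simp add: deriv_norm2_nonneg)
qed

text \<open>
  The norm of \<open>f\<^sub>x\<close> is dominated by a multiple of the integrable function \<open>t \<mapsto> \<integral> f(t, x) dx\<close>.
\<close>

lemma source_norm_integrable:
  fixes f :: "real \<Rightarrow> real \<Rightarrow> real"
  assumes L: "0 < L" and f1: "(\<lambda>(t, x). f t x) \<in> Lp 1 ({0<..} \<times> {0<..<L})"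
    and fs: "\<And>t. 0 < t \<Longrightarrow> f t \<in> sobolev L 1 2"
    and fx: "\<And>t. 0 < t \<Longrightarrow> deriv_norm2 L (f t) \<le> L powr (- 3 / 2) * (LINT x:{0<..<L}|lebesgue. f t x)"
  shows "(\<lambda>t. deriv_norm2 L (f t)) absolutely_integrable_on {0<..}"
proof -
  have S: "{0<..} \<in> sets (lebesgue :: real measure)" by simp
  have "integrable (lebesgue_on {0<..}) (\<lambda>t. deriv_norm2 L (f t))"
  proof (rule Bochner_Integration.integrable_bound)
    show "integrable (lebesgue_on {0<..}) (\<lambda>t. L powr (- 3 / 2) * (LINT x:{0<..<L}|lebesgue. f t x))"
      using integral_lebesgue_on(1)[OF source_integrable(1)[OF L f1 fs] S] by simp
    show "(\<lambda>t. deriv_norm2 L (f t)) \<in> borel_measurable (lebesgue_on {0<..})"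
      by (rule source_integrable(2)[OF L f1 fs])
    show "AE t in lebesgue_on {0<..}. norm (deriv_norm2 L (f t)) \<le> norm (L powr (- 3 / 2) * (LINT x:{0<..<L}|lebesgue. f t x))"
    proof (rule AE_I2)
      fix t :: real assume "t \<in> space (lebesgue_on {0<..})"
      then have "deriv_norm2 L (f t) \<le> L powr (- 3 / 2) * (LINT x:{0<..<L}|lebesgue. f t x)" using fx by simp
      then show "norm (deriv_norm2 L (f t)) \<le> norm (L powr (- 3 / 2) * (LINT x:{0<..<L}|lebesgue. f t x))"
        using deriv_norm2_nonneg[of L "f t"] by simp
    qed
  qed
  then show ?thesis by (simp add: absolutely_integrable_iff_integrable)
qed

section \<open>The energy inequality and the mass identity\<close>

lemma set_nn_integral_eq:
  assumes S: "S \<in> sets lebesgue" and h: "h absolutely_integrable_on S" "\<And>t. t \<in> S \<Longrightarrow> 0 \<le> h t"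
    and F: "AE t in lebesgue. t \<in> S \<longrightarrow> F t = ennreal (h t)"
  shows "(\<integral>\<^sup>+t\<in>S. F t \<partial>lebesgue) = ennreal (integral S h)"
proof -
  have "(\<integral>\<^sup>+t\<in>S. F t \<partial>lebesgue) = (\<integral>\<^sup>+t. ennreal (indicator S t *\<^sub>R h t) \<partial>lebesgue)"
    using F by (intro nn_integral_cong_AE) (auto elim!: AE_mp intro!: AE_I2 simp: indicator_def)
  also have "\<dots> = ennreal (\<integral>t. indicator S t *\<^sub>R h t \<partial>lebesgue)"
    using h by (intro nn_integral_eq_integral) (auto simp: set_integrable_def indicator_def)
  finally show ?thesis
    using set_lebesgue_integral_eq_integral(2)[OF h(1)] by (simp add: set_lebesgue_integral_def)
qed

lemma energy_eq:
  assumes v: "v \<in> sobolev L 1 2"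
  shows "energy L v = ennreal ((deriv_norm2 L v)\<^sup>2 / 2)"
proof -
  have k: "(\<lambda>x. (wderiv L 1 v x)\<^sup>2) absolutely_integrable_on {0..L}"
    using sobolev_wderiv(2)[OF v order_refl] by (simp add: LpM_def integrable_Om)
  have "(\<integral>\<^sup>+x\<in>{0<..<L}. ennreal (\<bar>wderiv L 1 v x\<bar>\<^sup>2) \<partial>lebesgue) = ennreal (integral {0<..<L} (\<lambda>x. (wderiv L 1 v x)\<^sup>2))"
    using k by (intro set_nn_integral_eq) (auto simp: absolutely_integrable_on_Icc_iff_Ioo)
  also have "integral {0<..<L} (\<lambda>x. (wderiv L 1 v x)\<^sup>2) = (deriv_norm2 L v)\<^sup>2"
    by (simp only: deriv_norm2_squared integral_Om[OF k] integral_open_interval_real)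
  finally show ?thesis
    unfolding energy_def using ennreal_mult[of "1 / 2" "(deriv_norm2 L v)\<^sup>2"] by simp
qed

lemma dissipation_eq:
  assumes \<alpha>: "0 < \<alpha>" and v: "v \<in> sobolev_B L 3 (\<alpha> + 1)" "continuous_on {0..L} v" "\<And>x. x \<in> {0..L} \<Longrightarrow> 0 < v x"
  shows "dissipation L \<alpha> v = ennreal (diss L \<alpha> v)"
    and "(\<lambda>x. v x powr (\<alpha> + 2) * \<bar>wderiv L 3 v x\<bar> powr (\<alpha> + 1)) absolutely_integrable_on {0..L}"
proof -
  have l: "LpM (Om L) (\<alpha> + 1) (wderiv L 3 v)"
    by (rule sobolev_wderiv(2)[OF sobolev_BD[OF v(1)] order_refl])
  show k: "(\<lambda>x. v x powr (\<alpha> + 2) * \<bar>wderiv L 3 v x\<bar> powr (\<alpha> + 1)) absolutely_integrable_on {0..L}"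
    using weighted_integrable(1)[OF _ _ v(2,3) l, of "\<alpha> + 2"] \<alpha> by (simp add: integrable_Om)
  have "dissipation L \<alpha> v = ennreal (integral {0<..<L} (\<lambda>x. v x powr (\<alpha> + 2) * \<bar>wderiv L 3 v x\<bar> powr (\<alpha> + 1)))"
    unfolding dissipation_def using k by (intro set_nn_integral_eq) (auto simp: absolutely_integrable_on_Icc_iff_Ioo)
  then show "dissipation L \<alpha> v = ennreal (diss L \<alpha> v)"
    by (simp only: diss_def integral_Om[OF k] integral_open_interval_real)
qed

lemma diss_nonneg: "0 \<le> diss L \<alpha> v"
  unfolding diss_def by (intro Bochner_Integration.integral_nonneg) auto

locale positive_weak_solution =
  fixes \<alpha> L T :: real and u0 :: "real \<Rightarrow> real" and f u :: "real \<Rightarrow> real \<Rightarrow> real"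
  assumes L: "0 < L" and \<alpha>: "0 < \<alpha>"
    and solution: "weak_solution \<alpha> L T u0 (\<lambda>t. functional_of L (f t)) u"
    and positive: "\<And>t x. t \<in> {0..T} \<Longrightarrow> x \<in> {0..L} \<Longrightarrow> 0 < u t x"
    and source: "\<And>t. 0 < t \<Longrightarrow> f t \<in> sobolev L 1 2"
begin

abbreviation "p \<equiv> \<alpha> + 1"
abbreviation "q \<equiv> (\<alpha> + 1) / \<alpha>"

lemma exponents: "1 < p" "1 < q" "1 / p + 1 / q = 1" "1 \<le> p" "0 < p"
  using \<alpha> by (auto simp: add_divide_distrib[symmetric])

lemma T: "0 < T" using solution by (simp add: weak_solution_def)
lemma uC: "u \<in> C_H1 T L" using solution by (simp add: weak_solution_def)
lemma uB: "u \<in> Lp_sobolev_B p T L 3 p" using solution by (simp add: weak_solution_def)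

lemma sourceF: "(\<lambda>t. functional_of L (f t)) \<in> bochner_Lp q {0<..<T}
    (dual_space (sobolev L 1 p) (sobolev_norm L 1 p)) (dual_norm (sobolev L 1 p) (sobolev_norm L 1 p))"
  using solution by (simp add: weak_solution_def sobolev_B_1[OF exponents(5)] del: One_nat_def)

lemma uX: "AE t in lebesgue. t \<in> {0<..<T} \<longrightarrow> u t \<in> sobolev_B L 3 p"
proof -
  have "strongly_measurable (sobolev_B L 3 p) (sobolev_norm L 3 p) {0<..<T} u"
    using uB by (simp add: bochner_Lp_def)
  then obtain s :: "nat \<Rightarrow> real \<Rightarrow> real \<Rightarrow> real" where
    "AE t in lebesgue. t \<in> {0<..<T} \<longrightarrow> u t \<in> sobolev_B L 3 p \<and> (\<lambda>n. sobolev_norm L 3 p (s n t - u t)) \<longlonglongrightarrow> 0"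
    unfolding strongly_measurable_def by blast
  then show ?thesis by eventually_elim auto
qed

lemma uH1: "t \<in> {0..T} \<Longrightarrow> u t \<in> H1 L" by (rule C_H1_H1[OF uC])

lemma norm_continuous: "continuous_on {0..T} (\<lambda>t. deriv_norm2 L (u t))"
  by (rule C_H1_continuous(1)[OF L uC])

lemma diss_integrable: "(\<lambda>t. diss L \<alpha> (u t)) absolutely_integrable_on {0..T}"
  using dissipation_integrable[OF L \<alpha> uC uB positive] by (simp add: absolutely_integrable_on_Icc_iff_Ioo)

text \<open>
  The weak formulation localised to a time interval \<open>(s, t)\<close>, with the time derivative in
  integrated form. Test functions of order one carry no boundary
  condition, so that cutting them off in time and inserting constants is admissible.
\<close>

lemma weak_form:
  obtains w where "w \<in> bochner_Lp q {0<..<T} (dual_space (sobolev L 1 p) (sobolev_norm L 1 p)) (dual_norm (sobolev L 1 p) (sobolev_norm L 1 p))"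
    "\<And>x. x \<in> sobolev L 1 p \<Longrightarrow> AC 0 T (\<lambda>t. functional_of L (u t) x) (\<lambda>t. w t x)"
    "\<And>\<phi> s t. \<phi> \<in> bochner_Lp p {0<..<T} (sobolev L 1 p) (sobolev_norm L 1 p) \<Longrightarrow> 0 < s \<Longrightarrow> s \<le> t \<Longrightarrow> t < T \<Longrightarrow>
       integral {s..t} (\<lambda>\<tau>. w \<tau> (\<phi> \<tau>)) =
       (LINT \<tau>:{s..t}|lebesgue. LINT x:{0<..<L}|lebesgue. u \<tau> x powr (\<alpha> + 2) * \<bar>wderiv L 3 (u \<tau>) x\<bar> powr (\<alpha> - 1)
          * wderiv L 3 (u \<tau>) x * wderiv L 1 (\<phi> \<tau>) x)
       + integral {s..t} (\<lambda>\<tau>. functional_of L (f \<tau>) (\<phi> \<tau>))"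
    "\<And>\<phi> s t. \<phi> \<in> bochner_Lp p {0<..<T} (sobolev L 1 p) (sobolev_norm L 1 p) \<Longrightarrow> 0 \<le> s \<Longrightarrow> t \<le> T \<Longrightarrow>
       (\<lambda>\<tau>. functional_of L (f \<tau>) (\<phi> \<tau>)) absolutely_integrable_on {s..t}"
proof -
  let ?X = "sobolev L 1 p" let ?N = "sobolev_norm L 1 p" let ?S = "{0<..<T}"
  interpret seminormed_space ?X ?N by (rule sobolev_seminormed[OF exponents(4)])
  have S: "?S \<in> sets lebesgue" by simp
  obtain w where w: "w \<in> bochner_Lp q ?S X' N'"
    and tw: "has_weak_time_deriv T L ?X u w"
    and weak: "\<And>\<phi>. \<phi> \<in> bochner_Lp p ?S ?X ?N \<Longrightarrow>
         (LINT t:?S|lebesgue. w t (\<phi> t)) =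
         (LINT t:?S|lebesgue. LINT x:{0<..<L}|lebesgue.
              u t x powr (\<alpha> + 2) * \<bar>wderiv L 3 (u t) x\<bar> powr (\<alpha> - 1) * wderiv L 3 (u t) x * wderiv L 1 (\<phi> t) x) +
         (LINT t:?S|lebesgue. functional_of L (f t) (\<phi> t))"
    using solution unfolding weak_solution_def sobolev_B_1[OF exponents(5)] by blast
  have sub: "h absolutely_integrable_on {s..t}" if "h absolutely_integrable_on ?S" "0 \<le> s" "t \<le> T" for h :: "real \<Rightarrow> real" and s t
    by (rule absolutely_integrable_on_subinterval[where S = "{0..T}"])
       (use that in \<open>auto simp: absolutely_integrable_on_Icc_iff_Ioo\<close>)
  show ?thesis
  proof (rule that[OF w])
    fix x assume x: "x \<in> ?X"
    have "(\<lambda>t. x) \<in> bochner_Lp p ?S ?X ?N"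
      using x exponents by (intro simple_bochner_Lp[OF S, of 0 T] simple_on_const) auto
    from pairing_integrable[OF S exponents(1-3) w this]
    show "AC 0 T (\<lambda>t. functional_of L (u t) x) (\<lambda>t. w t x)"
      by (intro weak_time_derivative_AC[OF T L uC x LpM_absolutely_integrable[OF exponents(4) sobolev_wderiv_0(2)[OF x]] _ tw])
  next
    fix \<phi> and s t :: real assume \<phi>: "\<phi> \<in> bochner_Lp p ?S ?X ?N" and "0 \<le> s" "t \<le> T"
    then show "(\<lambda>\<tau>. functional_of L (f \<tau>) (\<phi> \<tau>)) absolutely_integrable_on {s..t}"
      by (intro sub pairing_integrable[OF S exponents(1-3) sourceF \<phi>])
  next
    fix \<phi> and s t :: real
    assume \<phi>: "\<phi> \<in> bochner_Lp p ?S ?X ?N" and st: "0 < s" "s \<le> t" "t < T"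
    define \<psi> where "\<psi> \<tau> = (if \<tau> \<in> {s..t} then \<phi> \<tau> else (\<lambda>x. 0))" for \<tau>
    have \<psi>: "\<psi> \<in> bochner_Lp p ?S ?X ?N"
      unfolding \<psi>_def using exponents by (intro bochner_restrict[OF S _ _ \<phi>]) auto
    have restr: "(LINT \<tau>:?S|lebesgue. l \<tau> (\<psi> \<tau>)) = integral {s..t} (\<lambda>\<tau>. l \<tau> (\<phi> \<tau>))"
      if l: "l \<in> bochner_Lp q ?S X' N'" for l
    proof -
      have li: "(\<lambda>\<tau>. l \<tau> (\<psi> \<tau>)) absolutely_integrable_on ?S"
        by (rule pairing_integrable[OF S exponents(1-3) l \<psi>])
      have ls: "strongly_measurable X' N' ?S l" and ps: "strongly_measurable ?X ?N ?S \<phi>"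
        using l \<phi> by (auto simp: bochner_Lp_def)
      have "AE \<tau> in lebesgue. \<tau> \<in> ?S \<longrightarrow> l \<tau> (\<psi> \<tau>) = (if \<tau> \<in> {s..t} then l \<tau> (\<phi> \<tau>) else 0)"
        using pairing_measurable(2)[OF S ls ps]
        by eventually_elim (auto simp: \<psi>_def dual_zero)
      from absolutely_integrable_AE_cong(2)[OF li this]
      have "(LINT \<tau>:?S|lebesgue. l \<tau> (\<psi> \<tau>)) = integral ?S (\<lambda>\<tau>. if \<tau> \<in> {s..t} then l \<tau> (\<phi> \<tau>) else 0)"
        using set_lebesgue_integral_eq_integral(2)[OF li] by simp
      also have "\<dots> = integral ({s..t} \<inter> ?S) (\<lambda>\<tau>. l \<tau> (\<phi> \<tau>))"
        by (rule Henstock_Kurzweil_Integration.integral_restrict_Int)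
      also have "{s..t} \<inter> ?S = {s..t}" using st by auto
      finally show ?thesis .
    qed
    define A where "A \<tau> x = u \<tau> x powr (\<alpha> + 2) * \<bar>wderiv L 3 (u \<tau>) x\<bar> powr (\<alpha> - 1) * wderiv L 3 (u \<tau>) x" for \<tau> x
    have "(LINT \<tau>:?S|lebesgue. LINT x:{0<..<L}|lebesgue. A \<tau> x * wderiv L 1 (\<psi> \<tau>) x) =
        (LINT \<tau>:{s..t}|lebesgue. LINT x:{0<..<L}|lebesgue. A \<tau> x * wderiv L 1 (\<phi> \<tau>) x)"
      unfolding set_lebesgue_integral_def[of lebesgue ?S] set_lebesgue_integral_def[of lebesgue "{s..t}"]
    proof (rule Bochner_Integration.integral_cong)
      fix \<tau>
      have "(LINT x:{0<..<L}|lebesgue. A \<tau> x * wderiv L 1 (\<lambda>x. 0) x) = 0"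
        unfolding set_lebesgue_integral_def
        by (rule integral_eq_zero_AE) (use wderiv_zero[of L 1] in \<open>eventually_elim, auto simp: indicator_def\<close>)
      then show "indicator ?S \<tau> *\<^sub>R (LINT x:{0<..<L}|lebesgue. A \<tau> x * wderiv L 1 (\<psi> \<tau>) x) =
         indicator {s..t} \<tau> *\<^sub>R (LINT x:{0<..<L}|lebesgue. A \<tau> x * wderiv L 1 (\<phi> \<tau>) x)"
        using st by (auto simp: \<psi>_def indicator_def)
    qed simp
    with weak[OF \<psi>] restr[OF w] restr[OF sourceF]
    show "integral {s..t} (\<lambda>\<tau>. w \<tau> (\<phi> \<tau>)) =
       (LINT \<tau>:{s..t}|lebesgue. LINT x:{0<..<L}|lebesgue. u \<tau> x powr (\<alpha> + 2) * \<bar>wderiv L 3 (u \<tau>) x\<bar> powr (\<alpha> - 1)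
          * wderiv L 3 (u \<tau>) x * wderiv L 1 (\<phi> \<tau>) x)
       + integral {s..t} (\<lambda>\<tau>. functional_of L (f \<tau>) (\<phi> \<tau>))"
      unfolding A_def by simp
  qed
qed

text \<open>
  The localised weak formulation is available for \<open>s > 0\<close> only; continuity adds the initial time.
\<close>

lemma monotone_extends_to_0:
  fixes M :: "real \<Rightarrow> real"
  assumes c: "continuous_on {0..T} M" and m: "\<And>s t. 0 < s \<Longrightarrow> s \<le> t \<Longrightarrow> t < T \<Longrightarrow> M t \<le> M s"
    and st: "0 \<le> s" "s \<le> t" "t < T"
  shows "M t \<le> M s"
proof (cases "s = 0 \<and> 0 < t")
  case False
  then show ?thesis using m[of s t] st by (cases "s = t") auto
next
  case True
  have "(M \<longlongrightarrow> M 0) (at 0 within {0..T})" using c T by (simp add: continuous_on_def)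
  moreover have "at_right 0 \<le> at 0 within {0..T}"
    using T by (metis at_within_Icc_at_right order_refl)
  ultimately have lim: "(M \<longlongrightarrow> M 0) (at_right 0)" by (rule tendsto_mono[rotated])
  have "eventually (\<lambda>r. M t \<le> M r) (at_right 0)"
    using eventually_at_right_0_less[OF conjunct2[OF True]] by eventually_elim (use m st in auto)
  from tendsto_lowerbound[OF lim this] show ?thesis using True by simp
qed

text \<open>
  The chain rule for the test function \<open>v = -u\<^sub>x\<^sub>x\<close>. The weak formulation turns the pairing into minus the dissipation plus the
  pairing of \<open>f\<close> with \<open>-u\<^sub>x\<^sub>x\<close>, which is \<open>\<integral> f\<^sub>x u\<^sub>x\<close> after integration by parts.
\<close>

theorem energy_inequality:
  assumes g: "(\<lambda>t. deriv_norm2 L (f t)) absolutely_integrable_on {0..T}"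
    and st: "0 \<le> s" "s \<le> t" "t < T"
  shows "(deriv_norm2 L (u t))\<^sup>2 / 2 - (deriv_norm2 L (u s))\<^sup>2 / 2 + integral {s..t} (\<lambda>\<tau>. diss L \<alpha> (u \<tau>))
     \<le> integral {s..t} (\<lambda>\<tau>. deriv_norm2 L (u \<tau>) * deriv_norm2 L (f \<tau>))"
proof -
  let ?X = "sobolev L 1 p" let ?N = "sobolev_norm L 1 p" let ?S = "{0<..<T}"
  interpret seminormed_space ?X ?N by (rule sobolev_seminormed[OF exponents(4)])
  define E where "E t = (deriv_norm2 L (u t))\<^sup>2 / 2" for t
  define v where "v t = (\<lambda>x. - wderiv L 2 (u t) x)" for t
  have cE: "continuous_on {0..T} E" unfolding E_def by (intro continuous_intros norm_continuous) simp
  have v: "v \<in> bochner_Lp p ?S ?X ?N"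
    unfolding v_def[abs_def] by (rule second_derivative_bochner[OF exponents(4) uB])
  have gy: "(\<lambda>\<tau>. deriv_norm2 L (u \<tau>) * deriv_norm2 L (f \<tau>)) absolutely_integrable_on {0..T}"
    by (rule absolutely_integrable_continuous_mult[OF norm_continuous g])
  obtain w where w: "w \<in> bochner_Lp q ?S X' N'"
    and wAC: "\<And>x. x \<in> ?X \<Longrightarrow> AC 0 T (\<lambda>t. functional_of L (u t) x) (\<lambda>t. w t x)"
    and weak: "\<And>\<phi> s t. \<phi> \<in> bochner_Lp p ?S ?X ?N \<Longrightarrow> 0 < s \<Longrightarrow> s \<le> t \<Longrightarrow> t < T \<Longrightarrow>
       integral {s..t} (\<lambda>\<tau>. w \<tau> (\<phi> \<tau>)) =
       (LINT \<tau>:{s..t}|lebesgue. LINT x:{0<..<L}|lebesgue. u \<tau> x powr (\<alpha> + 2) * \<bar>wderiv L 3 (u \<tau>) x\<bar> powr (\<alpha> - 1)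
          * wderiv L 3 (u \<tau>) x * wderiv L 1 (\<phi> \<tau>) x)
       + integral {s..t} (\<lambda>\<tau>. functional_of L (f \<tau>) (\<phi> \<tau>))"
    and Fi: "\<And>\<phi> s t. \<phi> \<in> bochner_Lp p ?S ?X ?N \<Longrightarrow> 0 \<le> s \<Longrightarrow> t \<le> T \<Longrightarrow>
       (\<lambda>\<tau>. functional_of L (f \<tau>) (\<phi> \<tau>)) absolutely_integrable_on {s..t}"
    by (rule weak_form) (rule that, assumption+)
  have interior: "E t - E s + integral {s..t} (\<lambda>\<tau>. diss L \<alpha> (u \<tau>))
     \<le> integral {s..t} (\<lambda>\<tau>. deriv_norm2 L (u \<tau>) * deriv_norm2 L (f \<tau>))" if st: "0 < s" "s \<le> t" "t < T" for s t
  proof -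
    have "E t - E s \<le> integral {s..t} (\<lambda>\<tau>. w \<tau> (v \<tau>))"
    proof (rule chain_rule_pairing[OF exponents(1-3) w v cE _ wAC _ st])
      fix r x y assume r: "r \<in> ?S" and x: "x \<in> ?X" and y: "y \<in> ?X"
      show "functional_of L (u r) (x - y) = functional_of L (u r) x - functional_of L (u r) y"
        using r by (intro functional_of_diff H1_continuous uH1
            LpM_absolutely_integrable[OF exponents(4) sobolev_wderiv_0(2)[OF x]]
            LpM_absolutely_integrable[OF exponents(4) sobolev_wderiv_0(2)[OF y]]) auto
    next
      show "AE t in lebesgue. t \<in> ?S \<longrightarrow> (\<forall>r\<in>{0<..<t}. E t - E r \<le> functional_of L (u t) (v t) - functional_of L (u r) (v t))"
        using uX
      proof eventually_elim
        case (elim t)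
        show ?case
        proof (intro impI ballI)
          fix r assume t: "t \<in> ?S" and r: "r \<in> {0<..<t}"
          show "E t - E r \<le> functional_of L (u t) (v t) - functional_of L (u r) (v t)"
            unfolding E_def v_def
            by (rule energy_convexity[OF L exponents(4) _ uH1 uH1]) (use elim t r in auto)
        qed
      qed
    qed
    also have "\<dots> = (LINT \<tau>:{s..t}|lebesgue. LINT x:{0<..<L}|lebesgue. u \<tau> x powr (\<alpha> + 2) * \<bar>wderiv L 3 (u \<tau>) x\<bar> powr (\<alpha> - 1)
          * wderiv L 3 (u \<tau>) x * wderiv L 1 (v \<tau>) x)
       + integral {s..t} (\<lambda>\<tau>. functional_of L (f \<tau>) (v \<tau>))" by (rule weak[OF v st])
    also have "(LINT \<tau>:{s..t}|lebesgue. LINT x:{0<..<L}|lebesgue. u \<tau> x powr (\<alpha> + 2) * \<bar>wderiv L 3 (u \<tau>) x\<bar> powr (\<alpha> - 1)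
          * wderiv L 3 (u \<tau>) x * wderiv L 1 (v \<tau>) x) = - integral {s..t} (\<lambda>\<tau>. diss L \<alpha> (u \<tau>))"
    proof -
      have di: "(\<lambda>\<tau>. diss L \<alpha> (u \<tau>)) absolutely_integrable_on {s..t}"
        by (rule absolutely_integrable_on_subinterval[OF diss_integrable]) (use st in auto)
      have ndi: "(\<lambda>\<tau>. - diss L \<alpha> (u \<tau>)) absolutely_integrable_on {s..t}"
        using set_integrable_mult_right[OF di, of "-1"] by simp
      have "AE \<tau> in lebesgue. \<tau> \<in> {s..t} \<longrightarrow> - diss L \<alpha> (u \<tau>) =
         (LINT x:{0<..<L}|lebesgue. u \<tau> x powr (\<alpha> + 2) * \<bar>wderiv L 3 (u \<tau>) x\<bar> powr (\<alpha> - 1)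
          * wderiv L 3 (u \<tau>) x * wderiv L 1 (v \<tau>) x)"
        using uX
      proof eventually_elim
        case (elim \<tau>)
        show ?case
        proof
          assume "\<tau> \<in> {s..t}"
          then have \<tau>: "\<tau> \<in> ?S" "\<tau> \<in> {0..T}" using st by auto
          then have uB: "u \<tau> \<in> sobolev_B L 3 p" using elim by auto
          note k = dissipation_eq(2)[OF \<alpha> uB H1_continuous[OF uH1[OF \<tau>(2)]] positive[OF \<tau>(2)]]
          have dk: "diss L \<alpha> (u \<tau>) = integral {0<..<L} (\<lambda>x. u \<tau> x powr (\<alpha> + 2) * \<bar>wderiv L 3 (u \<tau>) x\<bar> powr p)"
            by (simp only: diss_def integral_Om[OF k] integral_open_interval_real)
          have "(\<lambda>x. - (u \<tau> x powr (\<alpha> + 2) * \<bar>wderiv L 3 (u \<tau>) x\<bar> powr p)) absolutely_integrable_on {0<..<L}"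
            using set_integrable_mult_right[OF k, of "-1"] by (simp add: absolutely_integrable_on_Icc_iff_Ioo)
          moreover have "AE x in lebesgue. x \<in> {0<..<L} \<longrightarrow> - (u \<tau> x powr (\<alpha> + 2) * \<bar>wderiv L 3 (u \<tau>) x\<bar> powr p) =
             u \<tau> x powr (\<alpha> + 2) * \<bar>wderiv L 3 (u \<tau>) x\<bar> powr (\<alpha> - 1) * wderiv L 3 (u \<tau>) x * wderiv L 1 (v \<tau>) x"
            using sobolev_minus_second_derivative(3)[OF exponents(4) sobolev_BD[OF uB]]
          proof eventually_elim
            case (elim x)
            have pw: "\<bar>z\<bar> powr (\<alpha> - 1) * z * z = \<bar>z\<bar> powr p" for z :: real
            proof (cases "z = 0")
              case False
              have "\<bar>z\<bar> powr (\<alpha> - 1) * z * z = \<bar>z\<bar> powr (\<alpha> - 1) * \<bar>z\<bar> powr 2"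
                using False by (simp add: power2_eq_square)
              also have "\<dots> = \<bar>z\<bar> powr (\<alpha> - 1 + 2)" by (rule powr_add[symmetric])
              also have "\<alpha> - 1 + 2 = p" by simp
              finally show ?thesis .
            qed simp
            show ?case
            proof
              assume "x \<in> {0<..<L}"
              then have "wderiv L 1 (v \<tau>) x = - wderiv L 3 (u \<tau>) x" using elim unfolding v_def by blast
              then show "- (u \<tau> x powr (\<alpha> + 2) * \<bar>wderiv L 3 (u \<tau>) x\<bar> powr p) =
                u \<tau> x powr (\<alpha> + 2) * \<bar>wderiv L 3 (u \<tau>) x\<bar> powr (\<alpha> - 1) * wderiv L 3 (u \<tau>) x * wderiv L 1 (v \<tau>) x"
                by (simp add: pw[symmetric] mult.assoc)
            qed
          qed
          ultimately have ai: "(\<lambda>x. u \<tau> x powr (\<alpha> + 2) * \<bar>wderiv L 3 (u \<tau>) x\<bar> powr (\<alpha> - 1) * wderiv L 3 (u \<tau>) x * wderiv L 1 (v \<tau>) x)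
              absolutely_integrable_on {0<..<L}"
            and "integral {0<..<L} (\<lambda>x. u \<tau> x powr (\<alpha> + 2) * \<bar>wderiv L 3 (u \<tau>) x\<bar> powr (\<alpha> - 1) * wderiv L 3 (u \<tau>) x * wderiv L 1 (v \<tau>) x)
              = integral {0<..<L} (\<lambda>x. - (u \<tau> x powr (\<alpha> + 2) * \<bar>wderiv L 3 (u \<tau>) x\<bar> powr p))"
            by (rule absolutely_integrable_AE_cong)+
          then show "- diss L \<alpha> (u \<tau>) = (LINT x:{0<..<L}|lebesgue. u \<tau> x powr (\<alpha> + 2) * \<bar>wderiv L 3 (u \<tau>) x\<bar> powr (\<alpha> - 1)
            * wderiv L 3 (u \<tau>) x * wderiv L 1 (v \<tau>) x)"
            unfolding set_lebesgue_integral_eq_integral(2)[OF ai] dk by simp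
        qed
      qed
      from absolutely_integrable_AE_cong[OF ndi this]
      show ?thesis by (simp add: set_lebesgue_integral_eq_integral)
    qed
    also have "integral {s..t} (\<lambda>\<tau>. functional_of L (f \<tau>) (v \<tau>)) \<le> integral {s..t} (\<lambda>\<tau>. deriv_norm2 L (u \<tau>) * deriv_norm2 L (f \<tau>))"
    proof (rule integral_le_AE)
      show "(\<lambda>\<tau>. functional_of L (f \<tau>) (v \<tau>)) absolutely_integrable_on {s..t}" using st by (intro Fi[OF v]) auto
      show "(\<lambda>\<tau>. deriv_norm2 L (u \<tau>) * deriv_norm2 L (f \<tau>)) absolutely_integrable_on {s..t}"
        by (rule absolutely_integrable_on_subinterval[OF gy]) (use st in auto)
      show "AE \<tau> in lebesgue. \<tau> \<in> {s..t} \<longrightarrow> functional_of L (f \<tau>) (v \<tau>) \<le> deriv_norm2 L (u \<tau>) * deriv_norm2 L (f \<tau>)"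
        using uX
      proof eventually_elim
        case (elim \<tau>)
        show ?case
        proof
          assume "\<tau> \<in> {s..t}"
          then have \<tau>: "\<tau> \<in> ?S" "0 < \<tau>" using st by auto
          then have uB: "u \<tau> \<in> sobolev_B L 3 p" using elim by auto
          have fs: "f \<tau> \<in> sobolev L 1 2" using source \<tau> by auto
          note parts = functional_of_minus_second_derivative[OF L exponents(4) uB fs]
          have "functional_of L (f \<tau>) (v \<tau>) = (\<integral>x. wderiv L 1 (f \<tau>) x * wderiv L 1 (u \<tau>) x \<partial>Om L)"
            unfolding v_def by (rule parts(1))
          also have "\<dots> \<le> deriv_norm2 L (f \<tau>) * deriv_norm2 L (u \<tau>)"
            using Cauchy_Schwarz_LpM(2)[OF sobolev_wderiv(2)[OF fs order_refl] parts(2)]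
            unfolding deriv_norm2_eq by linarith
          finally show "functional_of L (f \<tau>) (v \<tau>) \<le> deriv_norm2 L (u \<tau>) * deriv_norm2 L (f \<tau>)"
            by (simp add: mult.commute)
        qed
      qed
    qed simp
    finally show ?thesis by simp
  qed
  \<comment> \<open>all terms are increments, so the inequality says that one function is nonincreasing; it extends to \<open>s = 0\<close> by continuity\<close>
  define B where "B s = integral {0..s} (\<lambda>\<tau>. diss L \<alpha> (u \<tau>))" for s
  define H where "H s = integral {0..s} (\<lambda>\<tau>. deriv_norm2 L (u \<tau>) * deriv_norm2 L (f \<tau>))" for s
  have B: "AC 0 T B (\<lambda>\<tau>. diss L \<alpha> (u \<tau>))" unfolding B_def[abs_def] by (rule AC_primitive[OF diss_integrable])
  have H: "AC 0 T H (\<lambda>\<tau>. deriv_norm2 L (u \<tau>) * deriv_norm2 L (f \<tau>))" unfolding H_def[abs_def] by (rule AC_primitive[OF gy])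
  have d: "B t - B s = integral {s..t} (\<lambda>\<tau>. diss L \<alpha> (u \<tau>))"
    "H t - H s = integral {s..t} (\<lambda>\<tau>. deriv_norm2 L (u \<tau>) * deriv_norm2 L (f \<tau>))" if "0 \<le> s" "s \<le> t" "t < T" for s t
    using AC_diff[OF B, of s t] AC_diff[OF H, of s t] that by auto
  have "E t + B t - H t \<le> E s + B s - H s"
  proof (rule monotone_extends_to_0[OF _ _ st])
    show "continuous_on {0..T} (\<lambda>t. E t + B t - H t)"
      by (intro continuous_intros cE AC_continuous_on[OF B] AC_continuous_on[OF H])
    fix s t :: real assume a: "0 < s" "s \<le> t" "t < T"
    show "E t + B t - H t \<le> E s + B s - H s"
      using interior[OF a] d[of s t] a by linarith
  qed
  then show ?thesis using d[OF st] by (simp add: E_def)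
qed

text \<open>
  The constant function \<open>1\<close> is an admissible test function, for which the flux term vanishes.
\<close>

theorem mass_identity:
  assumes J: "(\<lambda>t. LINT x:{0<..<L}|lebesgue. f t x) absolutely_integrable_on {0..T}"
    and t: "0 \<le> t" "t < T"
  shows "integral {0..L} (u t) - integral {0..L} (u 0) = integral {0..t} (\<lambda>\<tau>. LINT x:{0<..<L}|lebesgue. f \<tau> x)"
proof -
  let ?X = "sobolev L 1 p" let ?N = "sobolev_norm L 1 p" let ?S = "{0<..<T}"
  interpret seminormed_space ?X ?N by (rule sobolev_seminormed[OF exponents(4)])
  obtain w where w: "w \<in> bochner_Lp q ?S X' N'"
    and wAC: "\<And>x. x \<in> ?X \<Longrightarrow> AC 0 T (\<lambda>t. functional_of L (u t) x) (\<lambda>t. w t x)"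
    and weak: "\<And>\<phi> s t. \<phi> \<in> bochner_Lp p ?S ?X ?N \<Longrightarrow> 0 < s \<Longrightarrow> s \<le> t \<Longrightarrow> t < T \<Longrightarrow>
       integral {s..t} (\<lambda>\<tau>. w \<tau> (\<phi> \<tau>)) =
       (LINT \<tau>:{s..t}|lebesgue. LINT x:{0<..<L}|lebesgue. u \<tau> x powr (\<alpha> + 2) * \<bar>wderiv L 3 (u \<tau>) x\<bar> powr (\<alpha> - 1)
          * wderiv L 3 (u \<tau>) x * wderiv L 1 (\<phi> \<tau>) x)
       + integral {s..t} (\<lambda>\<tau>. functional_of L (f \<tau>) (\<phi> \<tau>))"
    and Fi: "\<And>\<phi> s t. \<phi> \<in> bochner_Lp p ?S ?X ?N \<Longrightarrow> 0 \<le> s \<Longrightarrow> t \<le> T \<Longrightarrow>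
       (\<lambda>\<tau>. functional_of L (f \<tau>) (\<phi> \<tau>)) absolutely_integrable_on {s..t}"
    by (rule weak_form) (rule that, assumption+)
  let ?one = "\<lambda>x::real. 1::real"
  have one: "?one absolutely_integrable_on {0..L}" by (rule absolutely_integrable_continuous_real) auto
  have l1: "LpM (Om L) p ?one" "LpM (Om L) p (\<lambda>x. 0)"
    using finite_measure.integrable_const[OF finite_measure_Om] by (auto simp: LpM_def)
  have d1: "has_weak_deriv L 1 ?one (\<lambda>x. 0)"
    unfolding has_weak_deriv_def
  proof (intro conjI allI impI)
    show "locally_integrable L ?one" by (rule LpM_locally_integrable[OF exponents(4) l1(1)])
    show "locally_integrable L (\<lambda>x. 0)" by (simp add: locally_integrable_def)
    fix \<phi> assume \<phi>: "test_function 0 L \<phi>"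
    have c: "continuous_on {0..L} (deriv \<phi>)" by (rule continuous_on_test_function[OF test_function_deriv[OF \<phi>]])
    have "AC 0 L \<phi> (deriv \<phi>)"
      using \<phi> c by (intro AC_of_derivative smooth_has_derivative) (auto simp: test_function_iff)
    from AC_diff[OF this, of 0 L] have "integral {0..L} (deriv \<phi>) = \<phi> L - \<phi> 0" using L by simp
    also have "\<dots> = 0" using \<phi> unfolding test_function_iff by force
    finally have "integral {0<..<L} (deriv \<phi>) = 0" by (simp add: integral_open_interval_real)
    moreover have "deriv \<phi> absolutely_integrable_on {0<..<L}"
      using absolutely_integrable_continuous_real[OF c] by (simp add: absolutely_integrable_on_Icc_iff_Ioo)
    ultimately show "(LINT x:{0<..<L}|lebesgue. 1 * (deriv ^^ 1) \<phi> x) = (- 1) ^ 1 * (LINT x:{0<..<L}|lebesgue. 0 * \<phi> x)"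
      by (simp add: set_lebesgue_integral_eq_integral)
  qed
  have oneX: "?one \<in> ?X"
    using has_weak_deriv_0[OF LpM_locally_integrable[OF exponents(4) l1(1)]] d1 l1
    by (intro sobolev_I[where h = "\<lambda>j. if j = 0 then ?one else (\<lambda>x. 0)"]) (auto simp: le_Suc_eq)
  have \<phi>: "(\<lambda>t. ?one) \<in> bochner_Lp p ?S ?X ?N"
    using oneX exponents by (intro simple_bochner_Lp[of ?S 0 T] simple_on_const) auto
  define m where "m t = functional_of L (u t) ?one" for t
  have m: "AC 0 T m (\<lambda>t. w t ?one)" unfolding m_def[abs_def] by (rule wAC[OF oneX])
  have meq: "m t = integral {0..L} (u t)" if "t \<in> {0..T}" for t
    using functional_of_eq_integral(2)[OF H1_continuous[OF uH1[OF that]] one] by (simp add: m_def)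
  have Fone: "functional_of L (f \<tau>) ?one = (LINT x:{0<..<L}|lebesgue. f \<tau> x)" for \<tau> by (simp add: functional_of_def)
  have interior: "m t - m s = integral {s..t} (\<lambda>\<tau>. LINT x:{0<..<L}|lebesgue. f \<tau> x)" if st: "0 < s" "s \<le> t" "t < T" for s t
  proof -
    have z: "(LINT x:{0<..<L}|lebesgue. u \<tau> x powr (\<alpha> + 2) * \<bar>wderiv L 3 (u \<tau>) x\<bar> powr (\<alpha> - 1)
          * wderiv L 3 (u \<tau>) x * wderiv L 1 ?one x) = 0" for \<tau>
      unfolding set_lebesgue_integral_def
      by (rule integral_eq_zero_AE) (use wderiv_eq(2)[OF d1] in \<open>eventually_elim, auto simp: indicator_def\<close>)
    show ?thesis
      using AC_diff[OF m, of s t] weak[OF \<phi> st] st unfolding z Fone by simp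
  qed
  define P where "P t = integral {0..t} (\<lambda>\<tau>. LINT x:{0<..<L}|lebesgue. f \<tau> x)" for t
  have P: "AC 0 T P (\<lambda>\<tau>. LINT x:{0<..<L}|lebesgue. f \<tau> x)" unfolding P_def[abs_def] by (rule AC_primitive[OF J])
  have c: "continuous_on {0..T} (\<lambda>t. m t - P t)" "continuous_on {0..T} (\<lambda>t. - (m t - P t))"
    by (intro continuous_intros AC_continuous_on[OF m] AC_continuous_on[OF P])+
  have eq: "m t - P t = m s - P s" if "0 < s" "s \<le> t" "t < T" for s t
    using interior[OF that] AC_diff[OF P, of s t] that by simp
  have "m t - P t \<le> m 0 - P 0"
    by (rule monotone_extends_to_0[OF c(1) _ order_refl t]) (rule eq_refl[OF eq])
  moreover have "- (m t - P t) \<le> - (m 0 - P 0)"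
    by (rule monotone_extends_to_0[OF c(2) _ order_refl t]) (rule eq_refl, simp only: neg_equal_iff_equal, rule eq)
  ultimately have "m t - P t = m 0 - P 0" by simp
  then show ?thesis using meq[of 0] meq[of t] t T by (simp add: P_def)
qed

end

section \<open>Gronwall inequalities\<close>

lemma AC_mult:
  assumes F: "AC a b F f" and G: "AC a b G g"
  shows "AC a b (\<lambda>x. F x * G x) (\<lambda>x. F x * g x + f x * G x)"
proof (rule AC_I)
  have i: "(\<lambda>x. F x * g x) absolutely_integrable_on {a..b}" "(\<lambda>x. f x * G x) absolutely_integrable_on {a..b}"
    using absolutely_integrable_continuous_mult[OF AC_continuous_on[OF F], of g] F G
      absolutely_integrable_continuous_mult[OF AC_continuous_on[OF G], of f]
    by (auto simp: AC_def mult.commute)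
  then show "(\<lambda>x. F x * g x + f x * G x) absolutely_integrable_on {a..b}" by (rule set_integral_add(1))
  fix x assume x: "a \<le> x" "x \<le> b"
  have sub: "AC a x H k" if "AC a b H k" for H k
    using AC_integrable[OF that, of a x] AC_diff[OF that, of a] x by (intro AC_I) auto
  have "(\<lambda>x. F x * g x) integrable_on {a..x}" "(\<lambda>x. f x * G x) integrable_on {a..x}"
    using i[THEN absolutely_integrable_on_subinterval, of a x] x by (auto simp: absolutely_integrable_on_def)
  then show "F x * G x - F a * G a = integral {a..x} (\<lambda>x. F x * g x + f x * G x)"
    using AC_integration_by_parts[OF x(1) sub[OF F] sub[OF G]] by (simp add: integral_add)
qed

lemma ennsqrt_ennreal: "0 \<le> a \<Longrightarrow> ennsqrt (ennreal a) = ennreal (sqrt a)"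
  by (simp add: ennsqrt_def)

text \<open>
  In the extended nonnegative reals \<open>0 \<sqdot> \<infinity> = 0\<close>; the case distinction checks that this convention does no harm.
\<close>

lemma le_ennsqrt_mult:
  assumes "(ennreal a)\<^sup>2 \<le> A * B" "0 \<le> a"
  shows "ennreal a \<le> ennsqrt A * ennsqrt B"
proof -
  consider "A = \<infinity>" "B = 0" | "A = 0" "B = \<infinity>" | "A = \<infinity>" "B \<noteq> 0" | "A \<noteq> 0" "B = \<infinity>" | "A < \<infinity>" "B < \<infinity>"
    by (metis infinity_ennreal_def less_top)
  then show ?thesis
  proof cases
    case 1 then show ?thesis using assms by (simp add: ennreal_power)
  next
    case 2 then show ?thesis using assms by (simp add: ennreal_power)
  next
    case 3
    have "ennsqrt B \<noteq> 0"
      using 3(2) by (cases B) (auto simp: ennsqrt_def ennreal_eq_0_iff less_le)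
    then show ?thesis using 3 by (simp add: ennsqrt_def ennreal_top_mult)
  next
    case 4
    have "ennsqrt A \<noteq> 0"
      using 4(1) by (cases A) (auto simp: ennsqrt_def ennreal_eq_0_iff less_le)
    then show ?thesis using 4 by (simp add: ennsqrt_def ennreal_mult_top)
  next
    case 5
    then obtain x y where xy: "A = ennreal x" "B = ennreal y" "0 \<le> x" "0 \<le> y"
      by (metis ennreal_cases infinity_ennreal_def less_irrefl)
    have "ennreal (a\<^sup>2) \<le> ennreal (x * y)" using assms xy by (simp add: ennreal_power ennreal_mult)
    then have "a\<^sup>2 \<le> x * y" using xy by (simp add: ennreal_le_iff)
    then have "a \<le> sqrt x * sqrt y" using real_le_rsqrt by (simp add: real_sqrt_mult flip: real_sqrt_mult)
    then show ?thesis using xy by (simp add: ennsqrt_ennreal ennreal_leI flip: ennreal_mult)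
  qed
qed

lemma Cauchy_Schwarz_set_nn:
  fixes g h :: "real \<Rightarrow> real"
  assumes S: "S \<in> sets lebesgue" and g: "g absolutely_integrable_on S" "\<And>t. t \<in> S \<Longrightarrow> 0 \<le> g t"
    and h: "h absolutely_integrable_on S" "\<And>t. t \<in> S \<Longrightarrow> 0 \<le> h t"
    and gh: "(\<lambda>t. g t * h t) absolutely_integrable_on S"
  shows "ennreal (integral S (\<lambda>t. g t * h t)) \<le>
    ennsqrt (\<integral>\<^sup>+t\<in>S. ennreal ((g t)\<^sup>2) \<partial>lebesgue) * ennsqrt (\<integral>\<^sup>+t\<in>S. ennreal ((h t)\<^sup>2) \<partial>lebesgue)"
proof (rule le_ennsqrt_mult)
  show "0 \<le> integral S (\<lambda>t. g t * h t)"
    using gh g h by (intro integral_nonneg) (auto simp: absolutely_integrable_on_def)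
  have m: "(\<lambda>t. ennreal (indicator S t *\<^sub>R k t)) \<in> borel_measurable lebesgue"
    if "k absolutely_integrable_on S" for k :: "real \<Rightarrow> real"
    using that unfolding set_integrable_def by (intro measurable_compose[OF borel_measurable_integrable measurable_ennreal])
  have "ennreal (integral S (\<lambda>t. g t * h t)) = (\<integral>\<^sup>+t\<in>S. ennreal (g t * h t) \<partial>lebesgue)"
    using g h by (intro set_nn_integral_eq[OF S gh, symmetric]) auto
  also have "\<dots> = (\<integral>\<^sup>+t. ennreal (indicator S t *\<^sub>R g t) * ennreal (indicator S t *\<^sub>R h t) \<partial>lebesgue)"
    using g(2) h(2) by (intro nn_integral_cong) (auto simp: indicator_def ennreal_mult)
  finally have "(ennreal (integral S (\<lambda>t. g t * h t)))\<^sup>2 =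
     (\<integral>\<^sup>+t. ennreal (indicator S t *\<^sub>R g t) * ennreal (indicator S t *\<^sub>R h t) \<partial>lebesgue)\<^sup>2" by simp
  also have "\<dots> \<le> (\<integral>\<^sup>+t. (ennreal (indicator S t *\<^sub>R g t))\<^sup>2 \<partial>lebesgue) * (\<integral>\<^sup>+t. (ennreal (indicator S t *\<^sub>R h t))\<^sup>2 \<partial>lebesgue)"
    by (intro Cauchy_Schwarz_nn_integral m g h)
  also have "(\<integral>\<^sup>+t. (ennreal (indicator S t *\<^sub>R g t))\<^sup>2 \<partial>lebesgue) = (\<integral>\<^sup>+t\<in>S. ennreal ((g t)\<^sup>2) \<partial>lebesgue)"
    using g(2) by (intro nn_integral_cong) (auto simp: indicator_def ennreal_power)
  also have "(\<integral>\<^sup>+t. (ennreal (indicator S t *\<^sub>R h t))\<^sup>2 \<partial>lebesgue) = (\<integral>\<^sup>+t\<in>S. ennreal ((h t)\<^sup>2) \<partial>lebesgue)"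
    using h(2) by (intro nn_integral_cong) (auto simp: indicator_def ennreal_power)
  finally show "(ennreal (integral S (\<lambda>t. g t * h t)))\<^sup>2 \<le>
    (\<integral>\<^sup>+t\<in>S. ennreal ((g t)\<^sup>2) \<partial>lebesgue) * (\<integral>\<^sup>+t\<in>S. ennreal ((h t)\<^sup>2) \<partial>lebesgue)" .
qed

text \<open>
  The integrating factor \<open>e\<^sup>l\<^sup>x\<close>. As \<open>y\<close> is only known through its increments, the product rule is
  applied in the local form of \<open>local_to_global_inequality\<close>.
\<close>

lemma gronwall_exponential:
  fixes y g :: "real \<Rightarrow> real"
  assumes ab: "a \<le> b" and y: "continuous_on {a..b} y" "\<And>x. x \<in> {a..b} \<Longrightarrow> 0 \<le> y x"
    and g: "g absolutely_integrable_on {a..b}" "\<And>x. 0 \<le> g x" and l: "0 \<le> l"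
    and ineq: "\<And>u v. a \<le> u \<Longrightarrow> u \<le> v \<Longrightarrow> v \<le> b \<Longrightarrow> y v - y u \<le> integral {u..v} (\<lambda>x. g x - l * y x)"
  shows "y b \<le> exp (- (l * (b - a))) * y a + integral {a..b} (\<lambda>x. g x * exp (- (l * (b - x))))"
proof -
  define c where "c x = exp (l * x)" for x
  have cmono: "c u \<le> c v" if "u \<le> v" for u v using that l by (simp add: c_def mult_left_mono)
  have cpos: "0 < c x" for x by (simp add: c_def)
  have cc: "continuous_on A c" for A unfolding c_def by (intro continuous_intros)
  have sub: "k absolutely_integrable_on {u..v}" if "k absolutely_integrable_on {a..b}" "a \<le> u" "v \<le> b" for k :: "real \<Rightarrow> real" and u v
    by (rule absolutely_integrable_on_subinterval[OF that(1)]) (use that in auto)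
  have cg: "(\<lambda>x. c x * g x) absolutely_integrable_on {a..b}"
    by (rule absolutely_integrable_continuous_mult[OF cc g(1)])
  have g1: "(\<lambda>x. g x + 1) absolutely_integrable_on {a..b}"
    by (intro set_integral_add(1)[OF g(1)] absolutely_integrable_continuous_real) auto
  have "c b * y b - c a * y a \<le> integral {a..b} (\<lambda>x. c x * g x)"
  proof (rule local_to_global_inequality[OF ab, where \<mu> = "\<lambda>x. g x + 1" and Q = "\<lambda>x. c x * y x"])
    show "(\<lambda>x. c x * g x) integrable_on {a..b}" "(\<lambda>x. g x + 1) integrable_on {a..b}"
      using cg g1 by (auto simp: absolutely_integrable_on_def)
    fix e x :: real assume e: "0 < e" and x: "x \<in> {a..b}"
    \<comment> \<open>the tolerance for the oscillation of \<open>y\<close> is chosen so that \<open>l c(b) \<eta> \<le> e\<close>\<close>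
    define \<eta> where "\<eta> = e / (l * c b + 1)"
    have \<eta>: "0 < \<eta>" using e l cpos[of b] by (auto simp: \<eta>_def intro!: divide_pos_pos add_nonneg_pos)
    have \<eta>e: "l * c b * \<eta> \<le> e"
    proof -
      have "l * c b * e \<le> (l * c b + 1) * e" using e by (simp add: algebra_simps)
      moreover have "0 < l * c b + 1" using l cpos[of b] by (intro add_nonneg_pos) auto
      ultimately show ?thesis by (simp add: \<eta>_def divide_le_eq mult.commute)
    qed
    obtain d1 where d1: "d1 > 0" "\<And>r. r \<in> {a..b} \<Longrightarrow> dist r x < d1 \<Longrightarrow> dist (y r) (y x) < \<eta> / 2"
      using y(1) x \<eta> unfolding continuous_on_iff by (metis half_gt_zero)
    obtain d2 where d2: "d2 > 0" "\<And>r. r \<in> {a..b} \<Longrightarrow> dist r x < d2 \<Longrightarrow> dist (c r) (c x) < e / 2"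
      using cc[of "{a..b}"] x e unfolding continuous_on_iff by (metis half_gt_zero)
    show "\<exists>d>0. \<forall>u v. a \<le> u \<and> u \<le> x \<and> x \<le> v \<and> v \<le> b \<and> v - u < d \<longrightarrow>
      c v * y v - c u * y u \<le> integral {u..v} (\<lambda>x. c x * g x) + e * integral {u..v} (\<lambda>x. g x + 1)"
    proof (intro exI[of _ "min d1 d2"] conjI allI impI, goal_cases)
      case (2 u v)
      then have uv: "a \<le> u" "u \<le> x" "x \<le> v" "v \<le> b" "v - u < d1" "v - u < d2" by auto
      have near: "\<bar>y r - y r'\<bar> \<le> \<eta>" "\<bar>c r - c r'\<bar> \<le> e" if "r \<in> {u..v}" "r' \<in> {u..v}" for r r'
      proof -
        have dr: "dist r x < d1" "dist r' x < d1" "dist r x < d2" "dist r' x < d2" "r \<in> {a..b}" "r' \<in> {a..b}"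
          using that uv by (auto simp: dist_real_def)
        from dist_triangle_half_l[OF d1(2)[OF dr(5,1)] d1(2)[OF dr(6,2)]] show "\<bar>y r - y r'\<bar> \<le> \<eta>" by (simp add: dist_real_def)
        from dist_triangle_half_l[OF d2(2)[OF dr(5,3)] d2(2)[OF dr(6,4)]] show "\<bar>c r - c r'\<bar> \<le> e" by (simp add: dist_real_def)
      qed
      have "AC u v c (\<lambda>r. l * c r)"
        by (rule AC_of_derivative) (auto simp: c_def[abs_def] intro!: derivative_eq_intros continuous_intros)
      from AC_diff[OF this order_refl _ order_refl]
      have cd: "c v - c u = integral {u..v} (\<lambda>r. l * c r)" using uv by auto
      have i: "(\<lambda>r. g r - l * y r) integrable_on {u..v}" "(\<lambda>r. l * c r) integrable_on {u..v}"
        "(\<lambda>r. c r * g r) integrable_on {u..v}" "(\<lambda>r. g r + 1) integrable_on {u..v}"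
      proof -
        have gi: "g integrable_on {u..v}" "(\<lambda>r. c r * g r) integrable_on {u..v}" "(\<lambda>r. g r + 1) integrable_on {u..v}"
          using sub[OF g(1), of u v] sub[OF cg, of u v] sub[OF g1, of u v] uv
          by (auto simp: absolutely_integrable_on_def)
        have "y integrable_on {u..v}"
          using uv by (intro integrable_continuous_real continuous_on_subset[OF y(1)]) auto
        then show "(\<lambda>r. g r - l * y r) integrable_on {u..v}"
          by (intro integrable_diff gi(1) integrable_on_mult_right)
        show "(\<lambda>r. l * c r) integrable_on {u..v}"
          by (intro integrable_on_mult_right integrable_continuous_real cc)
        show "(\<lambda>r. c r * g r) integrable_on {u..v}" "(\<lambda>r. g r + 1) integrable_on {u..v}" by (rule gi)+
      qed
      have "c v * y v - c u * y u = c v * (y v - y u) + (c v - c u) * y u" by (simp add: algebra_simps)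
      also have "\<dots> \<le> c v * integral {u..v} (\<lambda>r. g r - l * y r) + (c v - c u) * y u"
        using ineq[of u v] uv cpos[of v] by (intro add_right_mono mult_left_mono) auto
      also have "\<dots> = integral {u..v} (\<lambda>r. c v * (g r - l * y r) + (l * c r) * y u)"
        unfolding cd integral_add[OF integrable_on_mult_right[OF i(1)] integrable_on_mult_left[OF i(2)]] by simp
      also have "\<dots> \<le> integral {u..v} (\<lambda>r. c r * g r + e * (g r + 1))"
      proof (rule integral_le)
        show "(\<lambda>r. c v * (g r - l * y r) + (l * c r) * y u) integrable_on {u..v}"
          by (intro integrable_add integrable_on_mult_right integrable_on_mult_left i)
        show "(\<lambda>r. c r * g r + e * (g r + 1)) integrable_on {u..v}"
          by (intro integrable_add integrable_on_mult_right i)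
        fix r assume r: "r \<in> {u..v}"
        have "(c v - c r) * g r \<le> e * g r" using near(2)[of v r] r uv g(2) by (intro mult_right_mono) auto
        moreover have "l * (c r * y u - c v * y r) \<le> e"
        proof -
          have "c r * y r \<le> c v * y r" using r uv y(2) by (intro mult_right_mono cmono) auto
          then have "l * (c r * y u - c v * y r) \<le> l * (c r * (y u - y r))"
            using l by (intro mult_left_mono) (auto simp: algebra_simps)
          also have "\<dots> \<le> l * (c b * \<eta>)"
          proof (intro mult_left_mono l)
            have "c r * (y u - y r) \<le> c r * \<eta>" using near(1)[of u r] r uv cpos[of r] by (intro mult_left_mono) auto
            also have "\<dots> \<le> c b * \<eta>" using r uv \<eta> by (intro mult_right_mono cmono) auto
            finally show "c r * (y u - y r) \<le> c b * \<eta>" .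
          qed
          finally show ?thesis using \<eta>e by (simp add: mult.assoc)
        qed
        ultimately show "c v * (g r - l * y r) + (l * c r) * y u \<le> c r * g r + e * (g r + 1)"
          by (simp add: algebra_simps)
      qed
      also have "\<dots> = integral {u..v} (\<lambda>x. c x * g x) + e * integral {u..v} (\<lambda>x. g x + 1)"
        unfolding integral_add[OF i(3) integrable_on_mult_right[OF i(4)]] by simp
      finally show ?case .
    qed (use d1 d2 in simp)
  qed
  then have "c b * y b \<le> c a * y a + integral {a..b} (\<lambda>x. c x * g x)" by simp
  then have "y b \<le> (c a * y a + integral {a..b} (\<lambda>x. c x * g x)) / c b"
    using cpos[of b] by (simp add: pos_le_divide_eq mult.commute)
  also have "\<dots> = c a / c b * y a + integral {a..b} (\<lambda>x. c x * g x) / c b" by (simp add: add_divide_distrib)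
  also have "integral {a..b} (\<lambda>x. c x * g x) / c b = integral {a..b} (\<lambda>x. c x * g x / c b)" by simp
  also have "(\<lambda>x. c x * g x / c b) = (\<lambda>x. g x * exp (- (l * (b - x))))"
    by (auto simp: c_def fun_eq_iff exp_minus exp_diff field_simps right_diff_distrib)
  also have "c a / c b = exp (- (l * (b - a)))"
    by (simp add: c_def exp_diff[symmetric] algebra_simps)
  finally show ?thesis .
qed

text \<open>
  Subtracting the integral of \<open>g\<close> leaves \<open>z = y - \<integral> g\<close> with \<open>z' \<le> -\<kappa> y\<^sup>\<alpha> \<le> -\<kappa> z\<^sup>\<alpha>\<close> as long as \<open>z > 0\<close>;
  \<open>z\<close> is nonincreasing, so it either has become nonpositive, and there is nothing to prove, or is positive throughout.
  In the second case \<open>z\<^sup>1\<^sup>-\<^sup>\<alpha>\<close> grows at least linearly.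
\<close>

lemma gronwall_power:
  fixes y g :: "real \<Rightarrow> real"
  assumes \<alpha>: "1 < \<alpha>" and ab: "a \<le> b" and y: "continuous_on {a..b} y" "\<And>x. x \<in> {a..b} \<Longrightarrow> 0 \<le> y x"
    and g: "g absolutely_integrable_on {a..b}" "\<And>x. 0 \<le> g x" and \<kappa>: "0 \<le> \<kappa>" and M: "y a \<le> M" "0 < M"
    and ineq: "\<And>u v. a \<le> u \<Longrightarrow> u \<le> v \<Longrightarrow> v \<le> b \<Longrightarrow> y v - y u \<le> integral {u..v} g - \<kappa> * integral {u..v} (\<lambda>x. y x powr \<alpha>)"
  shows "y b \<le> M * (1 + (\<alpha> - 1) * \<kappa> * M powr (\<alpha> - 1) * (b - a)) powr (1 / (1 - \<alpha>)) + integral {a..b} g"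
proof -
  define h where "h x = integral {a..x} g" for x
  have h: "AC a b h g" unfolding h_def[abs_def] by (rule AC_primitive[OF g(1)])
  have h0: "0 \<le> h x" if "x \<in> {a..b}" for x
    unfolding h_def using that AC_integrable[OF h, of a x] g(2) by (intro integral_nonneg) (auto simp: absolutely_integrable_on_def)
  have ha: "h a = 0" by (simp add: h_def)
  define z where "z x = y x - h x" for x
  have cz: "continuous_on {a..b} z" unfolding z_def by (intro continuous_intros y AC_continuous_on[OF h])
  have cy: "continuous_on {a..b} (\<lambda>x. y x powr \<alpha>)"
    using y \<alpha> by (intro continuous_on_powr' continuous_on_const) auto
  have iy: "(\<lambda>x. y x powr \<alpha>) integrable_on {u..v}" if "a \<le> u" "v \<le> b" for u v
    using that by (intro integrable_continuous_real continuous_on_subset[OF cy]) auto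
  have zin: "z v - z u \<le> - (\<kappa> * integral {u..v} (\<lambda>x. y x powr \<alpha>))" if "a \<le> u" "u \<le> v" "v \<le> b" for u v
    using ineq[OF that] AC_diff[OF h that] by (simp add: z_def)
  have zmono: "z v \<le> z u" if "a \<le> u" "u \<le> v" "v \<le> b" for u v
    using zin[OF that] \<kappa> integral_nonneg[OF iy, of u v] that
    by (smt (verit, best) mult_nonneg_nonneg powr_ge_zero)
  show ?thesis
  proof (cases "z b \<le> 0")
    case True
    have "0 \<le> M * (1 + (\<alpha> - 1) * \<kappa> * M powr (\<alpha> - 1) * (b - a)) powr (1 / (1 - \<alpha>))" using M by simp
    then show ?thesis using True by (simp add: z_def h_def)
  next
    case False
    have zpos: "0 < z x" if "x \<in> {a..b}" for x using zmono[of x b] that False by auto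
    have cz': "continuous_on {a..b} (\<lambda>x. z x powr \<alpha>)"
      using zpos by (intro continuous_on_powr cz continuous_on_const) force
    have zy: "z x powr \<alpha> \<le> y x powr \<alpha>" if "x \<in> {a..b}" for x
      using that zpos[OF that] h0[OF that] \<alpha> by (intro powr_mono2) (auto simp: z_def)
    have "- (z b powr (1 - \<alpha>)) - - (z a powr (1 - \<alpha>)) \<le>
        integral {a..b} (\<lambda>x. (\<alpha> - 1) * z x powr (- \<alpha>) * (- \<kappa> * z x powr \<alpha>))"
    proof (rule chain_rule_inequality[OF ab cz, where I = "{0<..}" and \<phi> = "\<lambda>w. - (w powr (1 - \<alpha>))" and \<phi>' = "\<lambda>w. (\<alpha> - 1) * w powr (- \<alpha>)"])
      show "(\<lambda>x. - \<kappa> * z x powr \<alpha>) absolutely_integrable_on {a..b}"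
        by (intro absolutely_integrable_continuous_real continuous_intros cz')
      show "z v - z u \<le> integral {u..v} (\<lambda>x. - \<kappa> * z x powr \<alpha>)" if "a \<le> u" "u \<le> v" "v \<le> b" for u v
      proof -
        have "integral {u..v} (\<lambda>x. z x powr \<alpha>) \<le> integral {u..v} (\<lambda>x. y x powr \<alpha>)"
          using that zy by (intro integral_le iy integrable_continuous_real continuous_on_subset[OF cz']) auto
        then have "\<kappa> * integral {u..v} (\<lambda>x. z x powr \<alpha>) \<le> \<kappa> * integral {u..v} (\<lambda>x. y x powr \<alpha>)"
          using \<kappa> by (rule mult_left_mono)
        then show ?thesis using zin[OF that] by simp
      qed
      show "((\<lambda>w. - (w powr (1 - \<alpha>))) has_real_derivative (\<alpha> - 1) * w powr (- \<alpha>)) (at w)" if "w \<in> {0<..}" for w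
        using that by (auto intro!: derivative_eq_intros simp: algebra_simps)
      show "continuous_on {0<..} (\<lambda>w. (\<alpha> - 1) * w powr (- \<alpha>))"
        by (intro continuous_intros) auto
    qed (use \<alpha> zpos in auto)
    also have "integral {a..b} (\<lambda>x. (\<alpha> - 1) * z x powr (- \<alpha>) * (- \<kappa> * z x powr \<alpha>)) = integral {a..b} (\<lambda>x. - ((\<alpha> - 1) * \<kappa>))"
    proof (rule integral_cong)
      fix x assume "x \<in> {a..b}"
      then have "0 < z x" by (rule zpos)
      then show "(\<alpha> - 1) * z x powr (- \<alpha>) * (- \<kappa> * z x powr \<alpha>) = - ((\<alpha> - 1) * \<kappa>)" by (simp add: powr_minus field_simps)
    qed
    also have "\<dots> = - ((\<alpha> - 1) * \<kappa> * (b - a))" using ab by simp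
    finally have 1: "z a powr (1 - \<alpha>) + (\<alpha> - 1) * \<kappa> * (b - a) \<le> z b powr (1 - \<alpha>)" by simp
    have za: "z a = y a" by (simp add: z_def ha)
    have "M powr (1 - \<alpha>) \<le> z a powr (1 - \<alpha>)"
      using M zpos[of a] ab \<alpha> by (intro powr_mono2') (auto simp: za)
    with 1 have 2: "M powr (1 - \<alpha>) + (\<alpha> - 1) * \<kappa> * (b - a) \<le> z b powr (1 - \<alpha>)" by simp
    have Mp: "0 < M powr (1 - \<alpha>)" using M by simp
    have pos: "0 < M powr (1 - \<alpha>) + (\<alpha> - 1) * \<kappa> * (b - a)"
      using Mp \<alpha> \<kappa> ab by (intro add_pos_nonneg) auto
    have "z b = (z b powr (1 - \<alpha>)) powr (1 / (1 - \<alpha>))"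
      using False \<alpha> by (simp add: powr_powr)
    also have "\<dots> \<le> (M powr (1 - \<alpha>) + (\<alpha> - 1) * \<kappa> * (b - a)) powr (1 / (1 - \<alpha>))"
      using 2 pos \<alpha> by (intro powr_mono2') auto
    also have "M powr (1 - \<alpha>) + (\<alpha> - 1) * \<kappa> * (b - a) = M powr (1 - \<alpha>) * (1 + (\<alpha> - 1) * \<kappa> * M powr (\<alpha> - 1) * (b - a))"
    proof -
      have "M powr (1 - \<alpha>) * M powr (\<alpha> - 1) = 1" using M by (simp flip: powr_add)
      then have "M powr (1 - \<alpha>) * ((\<alpha> - 1) * \<kappa> * M powr (\<alpha> - 1) * (b - a)) = (\<alpha> - 1) * \<kappa> * (b - a)"
        by (metis (no_types, opaque_lifting) mult.assoc mult.commute mult.right_neutral)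
      then show ?thesis by (simp only: distrib_left mult_1_right)
    qed
    also have "\<dots> powr (1 / (1 - \<alpha>)) = M * (1 + (\<alpha> - 1) * \<kappa> * M powr (\<alpha> - 1) * (b - a)) powr (1 / (1 - \<alpha>))"
      using M \<alpha> by (simp add: powr_mult powr_powr)
    finally show ?thesis by (simp add: z_def h_def)
  qed
qed

text \<open>
  All that is needed from the equation: \<open>y\<close> stands for the norm of \<open>u\<^sub>x\<close>, \<open>D\<close> for the dissipation and \<open>g\<close>
  for the norm of \<open>f\<^sub>x\<close>.
\<close>

locale energy_decay =
  fixes y D g :: "real \<Rightarrow> real"
  assumes yc: "\<And>t. continuous_on {0..t} y" and y0: "\<And>t. 0 \<le> y t"
    and Di: "\<And>t. D absolutely_integrable_on {0..t}" and D0: "\<And>t. 0 \<le> D t"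
    and gi: "\<And>t. g absolutely_integrable_on {0..t}" and g0: "\<And>t. 0 \<le> g t"
    and energy: "\<And>s t. 0 \<le> s \<Longrightarrow> s \<le> t \<Longrightarrow>
       (y t)\<^sup>2 / 2 - (y s)\<^sup>2 / 2 + integral {s..t} D \<le> integral {s..t} (\<lambda>\<tau>. y \<tau> * g \<tau>)"
begin

lemma y_continuous: "0 \<le> s \<Longrightarrow> continuous_on {s..t} y"
  by (rule continuous_on_subset[OF yc[of t]]) auto

lemma g_integrable: "0 \<le> s \<Longrightarrow> g absolutely_integrable_on {s..t}"
  by (rule absolutely_integrable_on_subinterval[OF gi[of t]]) auto

lemma D_integrable: "0 \<le> s \<Longrightarrow> D absolutely_integrable_on {s..t}"
  by (rule absolutely_integrable_on_subinterval[OF Di[of t]]) auto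

lemma yg_integrable: "0 \<le> s \<Longrightarrow> (\<lambda>\<tau>. y \<tau> * g \<tau>) absolutely_integrable_on {s..t}"
  by (rule absolutely_integrable_continuous_mult[OF y_continuous g_integrable])

text \<open>
  Division of the energy inequality by \<open>y\<close>, which may vanish: the chain rule is applied to
  \<open>w \<mapsto> \<surd>(w + \<epsilon>)\<close> at \<open>w = y\<^sup>2\<close>, and \<open>\<epsilon> \<rightarrow> 0\<close> by dominated convergence.
\<close>

lemma norm_inequality:
  assumes \<alpha>: "0 < \<alpha>" and \<kappa>: "0 \<le> \<kappa>" and coercive: "AE \<tau> in lebesgue. 0 < \<tau> \<longrightarrow> \<kappa> * y \<tau> powr (\<alpha> + 1) \<le> D \<tau>"
    and st: "0 \<le> s" "s \<le> t"
  shows "y t - y s \<le> integral {s..t} g - \<kappa> * integral {s..t} (\<lambda>\<tau>. y \<tau> powr \<alpha>)"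
proof -
  define k where "k \<tau> = 2 * (y \<tau> * g \<tau> - \<kappa> * y \<tau> powr (\<alpha> + 1))" for \<tau>
  have cp: "continuous_on {u..v} (\<lambda>\<tau>. y \<tau> powr \<beta>)" if "0 < \<beta>" "0 \<le> u" for u v \<beta>
    using y0 that by (intro continuous_on_powr' y_continuous continuous_on_const) auto
  have ki: "(\<lambda>\<tau>. \<kappa> * y \<tau> powr (\<alpha> + 1)) absolutely_integrable_on {u..v}" if "0 \<le> u" for u v
    using \<alpha> that by (intro absolutely_integrable_continuous_real continuous_on_mult_left cp) auto
  have k: "k absolutely_integrable_on {s..t}"
    unfolding k_def using st by (intro set_integrable_mult_right set_integral_diff(1) yg_integrable ki)
  have Fk: "(y v)\<^sup>2 - (y u)\<^sup>2 \<le> integral {u..v} k" if uv: "s \<le> u" "u \<le> v" "v \<le> t" for u v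
  proof -
    have u0: "0 \<le> u" using uv st by simp
    have "AE \<tau> in lebesgue. \<tau> \<noteq> (0::real)" by (rule AE_lebesgue_neq)
    with coercive have "AE \<tau> in lebesgue. \<tau> \<in> {u..v} \<longrightarrow> \<kappa> * y \<tau> powr (\<alpha> + 1) \<le> D \<tau>"
      by eventually_elim (use u0 in auto)
    then have "integral {u..v} (\<lambda>\<tau>. \<kappa> * y \<tau> powr (\<alpha> + 1)) \<le> integral {u..v} D"
      by (intro integral_le_AE ki D_integrable u0) auto
    moreover have "integral {u..v} k = 2 * (integral {u..v} (\<lambda>\<tau>. y \<tau> * g \<tau>) - integral {u..v} (\<lambda>\<tau>. \<kappa> * y \<tau> powr (\<alpha> + 1)))"
      unfolding k_def integral_mult_right
      using yg_integrable[OF u0, of v] ki[OF u0, of v] by (subst integral_diff) (auto simp: absolutely_integrable_on_def)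
    ultimately show ?thesis using energy[OF u0 uv(2)] by simp
  qed
  define e where "e n = 1 / real (Suc n)" for n
  have e: "0 < e n" for n by (simp add: e_def)
  have e0: "e \<longlonglongrightarrow> 0" unfolding e_def using LIMSEQ_inverse_real_of_nat by (simp add: inverse_eq_divide)
  \<comment> \<open>the regularised norm\<close>
  define r where "r n \<tau> = sqrt ((y \<tau>)\<^sup>2 + e n)" for n \<tau>
  have r: "0 < r n \<tau>" "y \<tau> \<le> r n \<tau>" for n \<tau>
    using e[of n] by (auto simp: r_def add_nonneg_pos intro!: real_le_rsqrt)
  have nz: "2 * sqrt (w + e n) \<noteq> 0" "sqrt (w + e n) \<noteq> 0" if "0 \<le> w" for w n
    using that e[of n] by auto
  have q: "(\<lambda>\<tau>. y \<tau> powr (\<alpha> + 1) / r n \<tau>) integrable_on {s..t}" for n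
    unfolding r_def using \<alpha> st e[of n]
    by (intro integrable_continuous_real continuous_intros cp y_continuous ballI nz(2)) auto
  have step: "r n t - r n s \<le> integral {s..t} g - \<kappa> * integral {s..t} (\<lambda>\<tau>. y \<tau> powr (\<alpha> + 1) / r n \<tau>)" for n
  proof -
    have gi': "g integrable_on {s..t}" using g_integrable[OF st(1), of t] by (simp add: absolutely_integrable_on_def)
    have "sqrt ((y t)\<^sup>2 + e n) - sqrt ((y s)\<^sup>2 + e n) \<le> integral {s..t} (\<lambda>\<tau>. 1 / (2 * sqrt ((y \<tau>)\<^sup>2 + e n)) * k \<tau>)"
    proof (rule chain_rule_inequality[OF st(2), where F = "\<lambda>\<tau>. (y \<tau>)\<^sup>2" and I = "{0..}" and \<phi> = "\<lambda>w. sqrt (w + e n)" and \<phi>' = "\<lambda>w. 1 / (2 * sqrt (w + e n))"])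
      show "continuous_on {s..t} (\<lambda>\<tau>. (y \<tau>)\<^sup>2)" using st by (intro continuous_on_power y_continuous)
      show "((\<lambda>w. sqrt (w + e n)) has_real_derivative 1 / (2 * sqrt (w + e n))) (at w)" if "w \<in> {0..}" for w
      proof -
        have pos: "0 < w + e n" using that e[of n] by auto
        have "((\<lambda>w. w + e n) has_real_derivative 1) (at w)" by (auto intro!: derivative_eq_intros)
        from DERIV_chain'[OF this DERIV_real_sqrt[OF pos]] show ?thesis
          by (rule DERIV_cong) (simp add: inverse_eq_divide)
      qed
      show "continuous_on {0..} (\<lambda>w. 1 / (2 * sqrt (w + e n)))"
        by (intro continuous_intros ballI nz(1)) auto
      show "0 \<le> 1 / (2 * sqrt (w + e n))" if "w \<in> {0..}" for w using that e[of n] by simp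
    qed (use k Fk in auto)
    also have "\<dots> \<le> integral {s..t} (\<lambda>\<tau>. g \<tau> - \<kappa> * (y \<tau> powr (\<alpha> + 1) / r n \<tau>))"
    proof (rule integral_le)
      have "continuous_on {s..t} (\<lambda>\<tau>. 1 / (2 * sqrt ((y \<tau>)\<^sup>2 + e n)))"
        using st by (intro continuous_intros y_continuous ballI nz(1)) auto
      from absolutely_integrable_continuous_mult[OF this k]
      show "(\<lambda>\<tau>. 1 / (2 * sqrt ((y \<tau>)\<^sup>2 + e n)) * k \<tau>) integrable_on {s..t}" by (simp add: absolutely_integrable_on_def)
      show "(\<lambda>\<tau>. g \<tau> - \<kappa> * (y \<tau> powr (\<alpha> + 1) / r n \<tau>)) integrable_on {s..t}"
        by (intro integrable_diff integrable_on_mult_right q gi')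
      fix \<tau>
      have "1 / (2 * r n \<tau>) * k \<tau> = y \<tau> / r n \<tau> * g \<tau> - \<kappa> * (y \<tau> powr (\<alpha> + 1) / r n \<tau>)"
        using r(1)[of n \<tau>] by (simp add: k_def field_simps)
      moreover have "y \<tau> / r n \<tau> * g \<tau> \<le> 1 * g \<tau>"
        using r(1)[of n \<tau>] r(2)[of \<tau> n] g0[of \<tau>] by (intro mult_right_mono) auto
      ultimately show "1 / (2 * sqrt ((y \<tau>)\<^sup>2 + e n)) * k \<tau> \<le> g \<tau> - \<kappa> * (y \<tau> powr (\<alpha> + 1) / r n \<tau>)"
        by (simp add: r_def)
    qed
    also have "\<dots> = integral {s..t} g - \<kappa> * integral {s..t} (\<lambda>\<tau>. y \<tau> powr (\<alpha> + 1) / r n \<tau>)"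
      unfolding integral_diff[OF gi' integrable_on_mult_right[OF q]] integral_mult_right ..
    finally show ?thesis by (simp add: r_def)
  qed
  have rlim: "(\<lambda>n. r n \<tau>) \<longlonglongrightarrow> y \<tau>" for \<tau>
  proof -
    have "(\<lambda>n. sqrt ((y \<tau>)\<^sup>2 + e n)) \<longlonglongrightarrow> sqrt ((y \<tau>)\<^sup>2 + 0)" by (intro tendsto_intros e0)
    then show ?thesis using y0[of \<tau>] by (simp add: r_def)
  qed
  have "(\<lambda>n. integral {s..t} (\<lambda>\<tau>. y \<tau> powr (\<alpha> + 1) / r n \<tau>)) \<longlonglongrightarrow> integral {s..t} (\<lambda>\<tau>. y \<tau> powr \<alpha>)"
  proof (rule dominated_convergence(2)[OF q, where h = "\<lambda>\<tau>. y \<tau> powr \<alpha>"])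
    show "(\<lambda>\<tau>. y \<tau> powr \<alpha>) integrable_on {s..t}" using \<alpha> st by (intro integrable_continuous_real cp)
    fix \<tau>
    have split: "y \<tau> powr (\<alpha> + 1) = y \<tau> powr \<alpha> * y \<tau>" using y0[of \<tau>] by (simp add: powr_add)
    show "norm (y \<tau> powr (\<alpha> + 1) / r n \<tau>) \<le> y \<tau> powr \<alpha>" for n
    proof -
      have "y \<tau> powr \<alpha> * (y \<tau> / r n \<tau>) \<le> y \<tau> powr \<alpha> * 1"
        using r(1)[of n \<tau>] r(2)[of \<tau> n] by (intro mult_left_mono) auto
      then show ?thesis using r(1)[of n \<tau>] y0[of \<tau>] by (simp add: split)
    qed
    show "(\<lambda>n. y \<tau> powr (\<alpha> + 1) / r n \<tau>) \<longlonglongrightarrow> y \<tau> powr \<alpha>"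
    proof (cases "y \<tau> = 0")
      case False
      have "(\<lambda>n. y \<tau> powr (\<alpha> + 1) / r n \<tau>) \<longlonglongrightarrow> y \<tau> powr (\<alpha> + 1) / y \<tau>"
        by (intro tendsto_intros rlim False)
      then show ?thesis using False by (simp add: split)
    qed simp
  qed
  then have "(\<lambda>n. integral {s..t} g - \<kappa> * integral {s..t} (\<lambda>\<tau>. y \<tau> powr (\<alpha> + 1) / r n \<tau>))
    \<longlonglongrightarrow> integral {s..t} g - \<kappa> * integral {s..t} (\<lambda>\<tau>. y \<tau> powr \<alpha>)"
    by (intro tendsto_intros)
  moreover have "(\<lambda>n. r n t - r n s) \<longlonglongrightarrow> y t - y s" by (intro tendsto_intros rlim)
  ultimately show ?thesis using step by (intro LIMSEQ_le) auto
qed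

lemma norm_bound:
  assumes "0 \<le> s" "s \<le> t"
  shows "y t \<le> y s + integral {s..t} g"
proof -
  have "AE \<tau> in lebesgue. 0 < \<tau> \<longrightarrow> 0 * y \<tau> powr (1 + 1) \<le> D \<tau>" using D0 by simp
  from norm_inequality[OF _ _ this assms] show ?thesis by simp
qed

end

section \<open>Decay of the averaged dissipation\<close>

text \<open>
  Absorbs the factor \<open>\<surd>t\<close> of the Cauchy-Schwarz inequality into half of the exponential rate.
\<close>

lemma sqrt_le_exp: "0 \<le> x \<Longrightarrow> sqrt x * exp (- x) \<le> (1::real)"
proof -
  assume x: "0 \<le> x"
  have "x \<le> (1 + x)\<^sup>2" using x by (simp add: power2_eq_square algebra_simps)
  then have "sqrt x \<le> 1 + x" using x by (intro real_le_lsqrt) auto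
  also have "\<dots> \<le> exp x" by (rule exp_ge_add_one_self)
  finally show ?thesis by (simp add: exp_minus field_simps)
qed

context energy_decay
begin

text \<open>
  For every \<open>s\<close> in \<open>(t/4, t/2)\<close> the energy inequality from \<open>s\<close> to \<open>t\<close> bounds the same quantity by
  \<open>y(s)\<^sup>2 / 2\<close>; the average over \<open>s\<close> has the weight \<open>4 / t\<close>.
\<close>

lemma averaged_dissipation:
  assumes t: "0 < t"
  shows "integral {t/2..t} D \<le> 4 / t * integral {t/4..t/2} (\<lambda>s. (y s)\<^sup>2 / 2) + integral {t/4..t} (\<lambda>\<tau>. y \<tau> * g \<tau>)"
proof -
  define X where "X = integral {t/2..t} D"
  define Y where "Y = integral {t/4..t} (\<lambda>\<tau>. y \<tau> * g \<tau>)"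
  have pt: "X - Y \<le> (y s)\<^sup>2 / 2" if s: "s \<in> {t/4..t/2}" for s
  proof -
    have "X \<le> integral {s..t} D"
      unfolding X_def using s t D0 D_integrable[of s t] D_integrable[of "t/2" t]
      by (intro integral_subset_le) (auto simp: absolutely_integrable_on_def)
    moreover have "integral {s..t} (\<lambda>\<tau>. y \<tau> * g \<tau>) \<le> Y"
      unfolding Y_def using s t y0 g0 yg_integrable[of s t] yg_integrable[of "t/4" t]
      by (intro integral_subset_le) (auto simp: absolutely_integrable_on_def)
    moreover have "(y t)\<^sup>2 / 2 - (y s)\<^sup>2 / 2 + integral {s..t} D \<le> integral {s..t} (\<lambda>\<tau>. y \<tau> * g \<tau>)"
      using s t by (intro energy) auto
    ultimately show ?thesis using zero_le_power2[of "y t"] by linarith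
  qed
  have "integral {t/4..t/2} (\<lambda>s. X - Y) \<le> integral {t/4..t/2} (\<lambda>s. (y s)\<^sup>2 / 2)"
    using t pt by (intro integral_le integrable_continuous_real continuous_intros y_continuous) auto
  then have "(t / 4) * (X - Y) \<le> integral {t/4..t/2} (\<lambda>s. (y s)\<^sup>2 / 2)" using t by simp
  then have "X - Y \<le> 4 / t * integral {t/4..t/2} (\<lambda>s. (y s)\<^sup>2 / 2)" using t by (simp add: field_simps)
  then show ?thesis by (simp add: X_def Y_def)
qed

text \<open>
  The contribution of the source to \<open>y(r)\<close> since time \<open>r / 2\<close>, damped at rate \<open>l\<close>. The rate \<open>l = 0\<close> serves the
  case of algebraic decay.
\<close>

definition memory :: "real \<Rightarrow> real \<Rightarrow> real" where
  "memory l r = integral {r/2..r} (\<lambda>\<tau>. g \<tau> * exp (- (l * (r - \<tau>))))"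

text \<open>
  Up to the factor \<open>e\<^sup>-\<^sup>l\<^sup>r\<close>, damped integrals of \<open>g\<close> are increments of this nondecreasing function.
\<close>

definition weighted_source :: "real \<Rightarrow> real \<Rightarrow> real" where
  "weighted_source l r = integral {0..r} (\<lambda>\<tau>. exp (l * \<tau>) * g \<tau>)"

lemma weighted_source_AC: "AC 0 T (weighted_source l) (\<lambda>\<tau>. exp (l * \<tau>) * g \<tau>)"
  unfolding weighted_source_def[abs_def]
  by (intro AC_primitive absolutely_integrable_continuous_mult gi continuous_intros)

lemma exp_shift: "g \<tau> * exp (- (l * (r - \<tau>))) = exp (- (l * r)) * (exp (l * \<tau>) * g \<tau>)"
  by (simp add: right_diff_distrib exp_diff exp_minus field_simps)

lemma weighted_source_integral:
  assumes "0 \<le> u" "u \<le> r"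
  shows "integral {u..r} (\<lambda>\<tau>. g \<tau> * exp (- (l * (r - \<tau>)))) = exp (- (l * r)) * (weighted_source l r - weighted_source l u)"
  unfolding exp_shift integral_mult_right using AC_diff[OF weighted_source_AC[where T = r and l = l], of u r] assms by simp

lemma weighted_source_mono:
  assumes "0 \<le> u" "u \<le> r"
  shows "weighted_source l u \<le> weighted_source l r"
proof -
  have "0 \<le> integral {u..r} (\<lambda>\<tau>. exp (l * \<tau>) * g \<tau>)"
    using AC_integrable[OF weighted_source_AC[where T = r and l = l], of u r] g0 assms
    by (intro integral_nonneg) (auto simp: absolutely_integrable_on_def)
  then show ?thesis using AC_diff[OF weighted_source_AC[where T = r and l = l], of u r] assms by simp
qed

lemma weighted_source_integrable:
  "0 \<le> u \<Longrightarrow> (\<lambda>\<tau>. g \<tau> * exp (- (l * (r - \<tau>)))) absolutely_integrable_on {u..r}"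
  unfolding exp_shift using AC_integrable[OF weighted_source_AC[where T = r and l = l], of u r] by (intro set_integrable_mult_right) auto

lemma memory_continuous: "continuous_on {0..T} (memory l)"
proof -
  let ?Q = "weighted_source l"
  have Q: "continuous_on {0..T} ?Q" by (rule AC_continuous_on[OF weighted_source_AC])
  have "continuous_on {0..T} (\<lambda>r. exp (- (l * r)) * (?Q r - ?Q (r / 2)))"
    by (intro continuous_intros Q continuous_on_compose2[OF Q]) auto
  then show ?thesis
    by (rule continuous_on_eq) (auto simp: memory_def weighted_source_integral)
qed

lemma memory_nonneg: "0 \<le> r \<Longrightarrow> 0 \<le> memory l r"
  unfolding memory_def using weighted_source_integrable[where u = "r/2" and l = l and r = r] g0
  by (intro integral_nonneg) (auto simp: absolutely_integrable_on_def)

lemma g_memory_integrable: "0 \<le> s \<Longrightarrow> (\<lambda>\<tau>. g \<tau> * memory l \<tau>) absolutely_integrable_on {s..t}"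
proof -
  assume s: "0 \<le> s"
  have "continuous_on {s..t} (memory l)" by (rule continuous_on_subset[OF memory_continuous[of t]]) (use s in auto)
  from absolutely_integrable_continuous_mult[OF this g_integrable[OF s]] show ?thesis by (simp add: mult.commute)
qed

text \<open>
  Let \<open>h(r)\<close> be the damped integral of \<open>g\<close> over \<open>(t/4, r)\<close>. Then \<open>h' = g - l h\<close>, so \<open>(h\<^sup>2)' \<le> 2 g h\<close>, and
  \<open>h \<le> memory l\<close> for \<open>r \<le> t/2\<close> because then \<open>r/2 \<le> t/4\<close>. This produces \<open>\<integral> g m\<close> in place of the square of an integral
  of \<open>g\<close> over an interval on which the target estimate has no such term.
\<close>

lemma source_squared_le_memory:
  assumes t: "0 < t" and l: "0 \<le> l"
  shows "(integral {t/4..t/2} (\<lambda>\<tau>. g \<tau> * exp (- (l * (t/2 - \<tau>)))))\<^sup>2 \<le> 2 * integral {t/4..t/2} (\<lambda>\<tau>. g \<tau> * memory l \<tau>)"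
proof -
  define Q where "Q = weighted_source l"
  note Q_AC = weighted_source_AC[where l = l and T = "t/2", folded Q_def]
  define h where "h r = exp (- (l * r)) * (Q r - Q (t/4))" for r
  have Qt: "AC (t/4) (t/2) (\<lambda>r. Q r - Q (t/4)) (\<lambda>\<tau>. exp (l * \<tau>) * g \<tau>)"
    using t AC_integrable[OF Q_AC, of "t/4" "t/2"] AC_diff[OF Q_AC, of "t/4"]
    by (intro AC_I) auto
  have F: "AC (t/4) (t/2) (\<lambda>r. exp (- (l * r))) (\<lambda>r. - l * exp (- (l * r)))"
    by (rule AC_of_derivative) (auto intro!: derivative_eq_intros continuous_intros)
  have "AC (t/4) (t/2) h (\<lambda>r. exp (- (l * r)) * (exp (l * r) * g r) + - l * exp (- (l * r)) * (Q r - Q (t/4)))"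
    unfolding h_def[abs_def] by (rule AC_mult[OF F Qt])
  also have "(\<lambda>r. exp (- (l * r)) * (exp (l * r) * g r) + - l * exp (- (l * r)) * (Q r - Q (t/4))) = (\<lambda>r. g r - l * h r)"
    by (auto simp: h_def fun_eq_iff mult.assoc[symmetric] mult_exp_exp)
  finally have h: "AC (t/4) (t/2) h (\<lambda>r. g r - l * h r)" .
  note hh = AC_mult[OF h h]
  have h0: "0 \<le> h r" if "t/4 \<le> r" for r
    using weighted_source_mono[where l = l, folded Q_def, of "t/4" r] that t by (simp add: h_def)
  have "(h (t/2))\<^sup>2 = integral {t/4..t/2} (\<lambda>r. h r * (g r - l * h r) + (g r - l * h r) * h r)"
    using AC_diff[OF hh, of "t/4" "t/2"] t by (simp add: h_def power2_eq_square)
  also have "\<dots> \<le> integral {t/4..t/2} (\<lambda>r. 2 * (g r * memory l r))"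
  proof (rule integral_le)
    show "(\<lambda>r. h r * (g r - l * h r) + (g r - l * h r) * h r) integrable_on {t/4..t/2}"
      using hh by (simp add: AC_def absolutely_integrable_on_def)
    show "(\<lambda>r. 2 * (g r * memory l r)) integrable_on {t/4..t/2}"
      using g_memory_integrable[where s = "t/4" and l = l and t = "t/2"] t by (intro integrable_on_mult_right) (auto simp: absolutely_integrable_on_def)
    fix r assume r: "r \<in> {t/4..t/2}"
    have "h r \<le> memory l r"
      using weighted_source_integral[where l = l, folded Q_def, of "r/2" r] weighted_source_mono[where l = l, folded Q_def, of "r/2" "t/4"] r t by (simp add: memory_def h_def)
    then have "g r * h r \<le> g r * memory l r" using g0 by (intro mult_left_mono)
    moreover have "0 \<le> l * h r * h r" using l h0[of r] r by simp
    ultimately show "h r * (g r - l * h r) + (g r - l * h r) * h r \<le> 2 * (g r * memory l r)"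
      by (simp add: algebra_simps)
  qed
  finally show ?thesis using weighted_source_integral[where l = l, folded Q_def, of "t/4" "t/2"] t by (simp add: h_def)
qed

text \<open>
  The energy inequality on \<open>(t/2, t)\<close> with \<open>y \<le> a + memory l\<close> inserted both in \<open>y(t/2)\<^sup>2\<close> and in \<open>\<integral> y g\<close>.
\<close>

lemma dissipation_split:
  assumes t: "0 < t" and l: "0 \<le> l" and a: "0 \<le> a"
    and half: "y (t/2) \<le> a + integral {t/4..t/2} (\<lambda>\<tau>. g \<tau> * exp (- (l * (t/2 - \<tau>))))"
    and late: "\<And>r. r \<in> {t/2..t} \<Longrightarrow> y r \<le> a + memory l r"
  shows "integral {t/2..t} D \<le> a\<^sup>2 + a * integral {t/2..t} g + 2 * integral {t/4..t} (\<lambda>\<tau>. g \<tau> * memory l \<tau>)"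
proof -
  let ?m = "\<lambda>\<tau>. g \<tau> * memory l \<tau>"
  define b where "b = integral {t/4..t/2} (\<lambda>\<tau>. g \<tau> * exp (- (l * (t/2 - \<tau>))))"
  have mi: "?m integrable_on {s..r}" if "0 \<le> s" for s r
    using g_memory_integrable[OF that] by (simp add: absolutely_integrable_on_def)
  have gi': "g integrable_on {t/2..t}" using g_integrable[of "t/2" t] t by (simp add: absolutely_integrable_on_def)
  have "(y (t/2))\<^sup>2 \<le> (a + b)\<^sup>2" using half y0 by (intro power_mono) (auto simp: b_def)
  also have "\<dots> \<le> 2 * a\<^sup>2 + 2 * b\<^sup>2"
  proof -
    have "0 \<le> (a - b)\<^sup>2" by simp
    then show ?thesis by (simp add: power2_eq_square algebra_simps)
  qed
  also have "b\<^sup>2 \<le> 2 * integral {t/4..t/2} ?m" unfolding b_def by (rule source_squared_le_memory[OF t l])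
  finally have y2: "(y (t/2))\<^sup>2 / 2 \<le> a\<^sup>2 + 2 * integral {t/4..t/2} ?m" by simp
  have "integral {t/2..t} (\<lambda>\<tau>. y \<tau> * g \<tau>) \<le> integral {t/2..t} (\<lambda>\<tau>. a * g \<tau> + ?m \<tau>)"
  proof (rule integral_le)
    show "(\<lambda>\<tau>. y \<tau> * g \<tau>) integrable_on {t/2..t}" using yg_integrable[of "t/2" t] t by (simp add: absolutely_integrable_on_def)
    show "(\<lambda>\<tau>. a * g \<tau> + ?m \<tau>) integrable_on {t/2..t}" using t by (intro integrable_add integrable_on_mult_right gi' mi) auto
    fix r assume "r \<in> {t/2..t}"
    then have "y r * g r \<le> (a + memory l r) * g r" using late g0 by (intro mult_right_mono)
    then show "y r * g r \<le> a * g r + ?m r" by (simp add: algebra_simps)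
  qed
  also have "\<dots> = a * integral {t/2..t} g + integral {t/2..t} ?m"
    using t integral_add[OF integrable_on_mult_right[OF gi'] mi[of "t/2" t]] by simp
  finally have yg: "integral {t/2..t} (\<lambda>\<tau>. y \<tau> * g \<tau>) \<le> a * integral {t/2..t} g + integral {t/2..t} ?m" .
  have "integral {t/4..t/2} ?m + integral {t/2..t} ?m = integral {t/4..t} ?m"
    using t by (intro Henstock_Kurzweil_Integration.integral_combine mi) auto
  moreover have "0 \<le> integral {t/2..t} ?m"
    using t mi g0 memory_nonneg by (intro integral_nonneg) auto
  moreover have "(y t)\<^sup>2 / 2 - (y (t/2))\<^sup>2 / 2 + integral {t/2..t} D \<le> integral {t/2..t} (\<lambda>\<tau>. y \<tau> * g \<tau>)"
    using t by (intro energy) auto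
  ultimately show ?thesis using y2 yg zero_le_power2[of "y t"] by linarith
qed

lemma power_decay:
  assumes \<alpha>: "1 < \<alpha>" and \<kappa>: "0 < \<kappa>" and coercive: "AE \<tau> in lebesgue. 0 < \<tau> \<longrightarrow> \<kappa> * y \<tau> powr (\<alpha> + 1) \<le> D \<tau>"
    and M: "\<And>t. 0 \<le> t \<Longrightarrow> y t \<le> M" "0 < M" and t: "0 < t"
  shows "integral {t/2..t} D \<le> 3/2 * (M * (1 + (\<alpha> - 1) * \<kappa> / 4 * M powr (\<alpha> - 1) * t) powr (1 / (1 - \<alpha>)))\<^sup>2
     + 1/2 * (integral {t/2..t} g)\<^sup>2 + 2 * integral {t/4..t} (\<lambda>\<tau>. g \<tau> * memory 0 \<tau>)"
proof -
  have a0: "0 < \<alpha>" using \<alpha> by simp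
  define c where "c = (\<alpha> - 1) * \<kappa> * M powr (\<alpha> - 1)"
  have c: "0 \<le> c" using \<alpha> \<kappa> by (simp add: c_def)
  define a where "a = M * (1 + c * (t/4)) powr (1 / (1 - \<alpha>))"
  \<comment> \<open>the decay restarts at time \<open>s\<close> from the bound \<open>M\<close>, which holds at all times\<close>
  have bound: "y r \<le> M * (1 + c * (r - s)) powr (1 / (1 - \<alpha>)) + integral {s..r} g" if s: "0 \<le> s" "s \<le> r" for s r
    unfolding c_def
  proof (rule gronwall_power[OF \<alpha> s(2) y_continuous[OF s(1)] y0 g_integrable[OF s(1)] g0 less_imp_le[OF \<kappa>] M(1)[OF s(1)] M(2)])
    show "y v - y u \<le> integral {u..v} g - \<kappa> * integral {u..v} (\<lambda>x. y x powr \<alpha>)" if "s \<le> u" "u \<le> v" "v \<le> r" for u v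
      using s that by (intro norm_inequality[OF a0 less_imp_le[OF \<kappa>] coercive]) auto
  qed
  have "y (t/2) \<le> a + integral {t/4..t/2} (\<lambda>\<tau>. g \<tau> * exp (- (0 * (t/2 - \<tau>))))"
    using bound[of "t/4" "t/2"] t by (simp add: a_def)
  moreover have "y r \<le> a + memory 0 r" if r: "r \<in> {t/2..t}" for r
  proof -
    have "(1 + c * (r/2)) powr (1 / (1 - \<alpha>)) \<le> (1 + c * (t/4)) powr (1 / (1 - \<alpha>))"
      using r t c \<alpha> mult_left_mono[of "t/4" "r/2" c]
      by (intro powr_mono2') (auto intro!: add_pos_nonneg mult_nonneg_nonneg)
    then have "M * (1 + c * (r/2)) powr (1 / (1 - \<alpha>)) \<le> a" unfolding a_def using M by (intro mult_left_mono) auto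
    moreover have "r - r/2 = r/2" by simp
    ultimately show ?thesis using bound[of "r/2" r] r t by (simp add: memory_def)
  qed
  moreover have "0 \<le> a" using M by (simp add: a_def)
  ultimately have "integral {t/2..t} D \<le> a\<^sup>2 + a * integral {t/2..t} g + 2 * integral {t/4..t} (\<lambda>\<tau>. g \<tau> * memory 0 \<tau>)"
    by (intro dissipation_split[OF t order_refl]) auto
  moreover have "a * integral {t/2..t} g \<le> 1/2 * a\<^sup>2 + 1/2 * (integral {t/2..t} g)\<^sup>2"
  proof -
    have "0 \<le> (a - integral {t/2..t} g)\<^sup>2" by simp
    then show ?thesis by (simp add: power2_eq_square algebra_simps)
  qed
  moreover have "a = M * (1 + (\<alpha> - 1) * \<kappa> / 4 * M powr (\<alpha> - 1) * t) powr (1 / (1 - \<alpha>))"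
    by (simp add: a_def c_def mult_ac)
  ultimately show ?thesis by simp
qed

lemma exponential_decay:
  assumes \<alpha>: "0 < \<alpha>" "\<alpha> \<le> 1" and \<kappa>: "0 < \<kappa>" and coercive: "AE \<tau> in lebesgue. 0 < \<tau> \<longrightarrow> \<kappa> * y \<tau> powr (\<alpha> + 1) \<le> D \<tau>"
    and M: "\<And>t. 0 \<le> t \<Longrightarrow> y t \<le> M" "0 < M" and t: "0 < t"
    and l: "l = \<kappa> * M powr (\<alpha> - 1)"
  shows "integral {t/2..t} D \<le> (M * exp (- (l * t / 4)))\<^sup>2 + M * exp (- (l * t / 4)) * integral {t/2..t} g
     + 2 * integral {t/4..t} (\<lambda>\<tau>. g \<tau> * memory l \<tau>)"
proof -
  have l0: "0 \<le> l" using \<kappa> by (simp add: l)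
  \<comment> \<open>as \<open>\<alpha> \<le> 1\<close>, the power \<open>y\<^sup>\<alpha>\<^sup>-\<^sup>1\<close> is smallest where \<open>y\<close> is largest\<close>
  have lin: "l * y r \<le> \<kappa> * y r powr \<alpha>" if "0 \<le> r" for r
  proof (cases "y r = 0")
    case False
    then have pos: "0 < y r" using y0[of r] by simp
    have "M powr (\<alpha> - 1) \<le> y r powr (\<alpha> - 1)" using pos M(1)[OF that] \<alpha> by (intro powr_mono2') auto
    then have "\<kappa> * (M powr (\<alpha> - 1) * y r) \<le> \<kappa> * (y r powr (\<alpha> - 1) * y r)"
      using \<kappa> pos by (intro mult_left_mono mult_right_mono) auto
    also have "y r powr (\<alpha> - 1) * y r = y r powr \<alpha>" using pos by (simp add: powr_diff)
    finally show ?thesis by (simp add: l mult.assoc)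
  qed simp
  have bound: "y r \<le> M * exp (- (l * (r - s))) + integral {s..r} (\<lambda>\<tau>. g \<tau> * exp (- (l * (r - \<tau>))))" if s: "0 \<le> s" "s \<le> r" for s r
  proof -
    have "y r \<le> exp (- (l * (r - s))) * y s + integral {s..r} (\<lambda>\<tau>. g \<tau> * exp (- (l * (r - \<tau>))))"
    proof (rule gronwall_exponential[OF s(2) y_continuous[OF s(1)] y0 g_integrable[OF s(1)] g0 l0])
      fix u v assume uv: "s \<le> u" "u \<le> v" "v \<le> r"
      have u0: "0 \<le> u" using uv s by simp
      have gi': "g integrable_on {u..v}" using g_integrable[OF u0, of v] by (simp add: absolutely_integrable_on_def)
      have yi: "y integrable_on {u..v}" by (intro integrable_continuous_real y_continuous u0)
      have ya: "(\<lambda>x. y x powr \<alpha>) integrable_on {u..v}"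
        using y0 \<alpha> by (intro integrable_continuous_real continuous_on_powr' y_continuous u0 continuous_on_const) auto
      have "integral {u..v} (\<lambda>x. l * y x) \<le> integral {u..v} (\<lambda>x. \<kappa> * y x powr \<alpha>)"
        using u0 by (intro integral_le integrable_on_mult_right yi ya lin) auto
      moreover have "y v - y u \<le> integral {u..v} g - \<kappa> * integral {u..v} (\<lambda>x. y x powr \<alpha>)"
        by (rule norm_inequality[OF \<alpha>(1) less_imp_le[OF \<kappa>] coercive u0 uv(2)])
      ultimately show "y v - y u \<le> integral {u..v} (\<lambda>x. g x - l * y x)"
        using integral_diff[OF gi' integrable_on_mult_right[OF yi, of l]] by simp
    qed
    moreover have "exp (- (l * (r - s))) * y s \<le> exp (- (l * (r - s))) * M" using M(1)[OF s(1)] by (intro mult_left_mono) auto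
    moreover have "exp (- (l * (r - s))) * M = M * exp (- (l * (r - s)))" by (rule mult.commute)
    ultimately show ?thesis by linarith
  qed
  have "y (t/2) \<le> M * exp (- (l * t / 4)) + integral {t/4..t/2} (\<lambda>\<tau>. g \<tau> * exp (- (l * (t/2 - \<tau>))))"
    using bound[of "t/4" "t/2"] t by simp
  moreover have "y r \<le> M * exp (- (l * t / 4)) + memory l r" if r: "r \<in> {t/2..t}" for r
  proof -
    have "l * (t / 4) \<le> l * (r / 2)" using r l0 by (intro mult_left_mono) auto
    then have "M * exp (- (l * (r / 2))) \<le> M * exp (- (l * t / 4))" using M by (intro mult_left_mono) auto
    moreover have "r - r/2 = r/2" by simp
    ultimately show ?thesis using bound[of "r/2" r] r t by (simp add: memory_def)
  qed
  moreover have "0 \<le> M * exp (- (l * t / 4))" using M by simp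
  ultimately show ?thesis by (intro dissipation_split[OF t l0]) auto
qed

end

section \<open>Lower bound and coercivity for global positive solutions\<close>

locale positive_global_solution =
  fixes \<alpha> L :: real and u0 :: "real \<Rightarrow> real" and f u :: "real \<Rightarrow> real \<Rightarrow> real"
  assumes L: "0 < L" and \<alpha>: "0 < \<alpha>"
    and source_L1: "(\<lambda>(t, x). f t x) \<in> Lp 1 ({0<..} \<times> {0<..<L})"
    and small: "deriv_norm2 L u0 < L powr (- 1 / 2) * mean_value L u0"
    and source_H1: "\<And>t. 0 < t \<Longrightarrow> f t \<in> sobolev L 1 2"
    and source_small: "\<And>t. 0 < t \<Longrightarrow>
           deriv_norm2 L (f t) \<le> L powr (- 3 / 2) * (LINT x:{0<..<L}|lebesgue. f t x)"
    and solution: "global_weak_solution \<alpha> L u0 (\<lambda>t. functional_of L (f t)) u"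
    and positive: "positive_on L u"
begin

lemma on_interval: "0 < T \<Longrightarrow> positive_weak_solution \<alpha> L T u0 f u"
  using L \<alpha> solution positive source_H1
  by unfold_locales (auto simp: global_weak_solution_def positive_on_def)

lemma integrable_Icc_of_Ioi: "h absolutely_integrable_on {0<..} \<Longrightarrow> h absolutely_integrable_on {0..t}" for h :: "real \<Rightarrow> real"
  unfolding absolutely_integrable_on_Icc_iff_Ioo
  by (rule set_integrable_subset[where A = "{0<..}"]) auto

lemma source_norm: "(\<lambda>t. deriv_norm2 L (f t)) absolutely_integrable_on {0<..}"
  by (rule source_norm_integrable[OF L source_L1 source_H1 source_small])

lemma source_mass: "(\<lambda>t. LINT x:{0<..<L}|lebesgue. f t x) absolutely_integrable_on {0<..}"
  by (rule source_integrable(1)[OF L source_L1 source_H1])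

sublocale energy_decay "\<lambda>t. deriv_norm2 L (u t)" "\<lambda>t. diss L \<alpha> (u t)" "\<lambda>t. deriv_norm2 L (f t)"
proof unfold_locales
  fix t :: real
  show "continuous_on {0..t} (\<lambda>t. deriv_norm2 L (u t))"
    by (rule continuous_on_subset[OF positive_weak_solution.norm_continuous[OF on_interval, of "max t 1"]]) auto
  show "(\<lambda>t. diss L \<alpha> (u t)) absolutely_integrable_on {0..t}"
    by (rule absolutely_integrable_on_subinterval[OF positive_weak_solution.diss_integrable[OF on_interval, of "max t 1"]]) auto
  show "(\<lambda>t. deriv_norm2 L (f t)) absolutely_integrable_on {0..t}"
    by (rule integrable_Icc_of_Ioi[OF source_norm])
next
  fix s t :: real assume "0 \<le> s" "s \<le> t"
  then show "(deriv_norm2 L (u t))\<^sup>2 / 2 - (deriv_norm2 L (u s))\<^sup>2 / 2 + integral {s..t} (\<lambda>\<tau>. diss L \<alpha> (u \<tau>))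
     \<le> integral {s..t} (\<lambda>\<tau>. deriv_norm2 L (u \<tau>) * deriv_norm2 L (f \<tau>))"
    by (intro positive_weak_solution.energy_inequality[OF on_interval[of "t + 1"] integrable_Icc_of_Ioi[OF source_norm]]) auto
qed (auto simp: deriv_norm2_nonneg diss_nonneg)

lemma u_H1: "0 \<le> t \<Longrightarrow> u t \<in> H1 L"
  using positive_weak_solution.uH1[OF on_interval[of "t + 1"], of t] by simp

lemma initial: "deriv_norm2 L (u 0) = deriv_norm2 L u0" "mean_value L (u 0) = mean_value L u0"
proof -
  have e: "x \<in> {0..L} \<Longrightarrow> u 0 x = u0 x" for x
    using solution by (auto simp: global_weak_solution_def weak_solution_def dest!: spec[of _ 1])
  then have "wderiv L 1 (u 0) = wderiv L 1 u0" by (intro wderiv_AE_cong AE_I2) auto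
  then show "deriv_norm2 L (u 0) = deriv_norm2 L u0" by (simp add: deriv_norm2_def)
  have "(LINT x:{0<..<L}|lebesgue. u 0 x) = (LINT x:{0<..<L}|lebesgue. u0 x)"
    using e by (intro set_lebesgue_integral_cong) auto
  then show "mean_value L (u 0) = mean_value L u0" by (simp add: mean_value_def)
qed

text \<open>
  The lower bound of the solution that is propagated from the initial datum.
\<close>

definition positive_floor :: real where
  "positive_floor = mean_value L u0 - sqrt L * deriv_norm2 L u0"

lemma positive_floor_pos: "0 < positive_floor"
proof -
  have "sqrt L * deriv_norm2 L u0 < sqrt L * (L powr (- 1 / 2) * mean_value L u0)"
    using small L by simp
  also have "\<dots> = mean_value L u0" using L by (simp add: powr_minus powr_half_sqrt)
  finally show ?thesis by (simp add: positive_floor_def)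
qed

text \<open>
  The mean value gains \<open>\<integral> \<integral> f / L\<close>, the oscillation bound \<open>\<surd>L y\<close> loses at most \<open>\<surd>L \<integral> g\<close>, and the
  hypothesis on the source says precisely that the gain is at least the loss.
\<close>

lemma positive_floor_le:
  assumes t: "0 \<le> t" and x: "x \<in> {0..L}"
  shows "positive_floor \<le> u t x"
proof -
  let ?J = "\<lambda>t. LINT x:{0<..<L}|lebesgue. f t x" and ?g = "\<lambda>t. deriv_norm2 L (f t)"
  have J: "?J absolutely_integrable_on {0..t}" by (rule integrable_Icc_of_Ioi[OF source_mass])
  have "integral {0..t} ?g = integral {0<..<t} ?g" by (simp add: integral_open_interval_real)
  also have "\<dots> \<le> integral {0<..<t} (\<lambda>t. L powr (- 3 / 2) * ?J t)"
    using J g_integrable[OF order_refl, of t] source_small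
    by (intro integral_le integrable_on_mult_right) (auto simp: integrable_on_open_interval_real absolutely_integrable_on_def)
  also have "\<dots> = L powr (- 3 / 2) * integral {0..t} ?J" by (simp add: integral_open_interval_real)
  finally have "sqrt L * integral {0..t} ?g \<le> sqrt L * (L powr (- 3 / 2) * integral {0..t} ?J)"
    using L by (intro mult_left_mono) auto
  moreover have "sqrt L * L powr (- 3 / 2) = 1 / L"
  proof -
    have "L powr (1 / 2) * L powr (- 3 / 2) = L powr - 1" by (simp flip: powr_add)
    then show ?thesis using L by (simp add: powr_half_sqrt powr_minus inverse_eq_divide)
  qed
  ultimately have 1: "sqrt L * integral {0..t} ?g \<le> integral {0..t} ?J / L"
    unfolding mult.assoc[symmetric] by simp
  have "sqrt L * deriv_norm2 L (u t) \<le> sqrt L * (deriv_norm2 L (u 0) + integral {0..t} ?g)"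
    using norm_bound[OF order_refl t] L by (intro mult_left_mono) auto
  then have 2: "sqrt L * deriv_norm2 L (u t) \<le> sqrt L * deriv_norm2 L u0 + sqrt L * integral {0..t} ?g"
    by (simp add: initial distrib_left)
  have "integral {0..L} (u t) - integral {0..L} (u 0) = integral {0..t} ?J"
    using t by (intro positive_weak_solution.mass_identity[OF on_interval[of "t + 1"] integrable_Icc_of_Ioi[OF source_mass]]) auto
  then have 3: "mean_value L (u t) = mean_value L u0 + integral {0..t} ?J / L"
    unfolding initial(2)[symmetric] mean_value_eq[OF H1_continuous[OF u_H1[OF t]]] mean_value_eq[OF H1_continuous[OF u_H1[OF order_refl]]]
    using L by (simp add: field_simps)
  show ?thesis using 1 2 3 H1_mean_bound[OF L u_H1[OF t] x] by (simp add: positive_floor_def abs_le_iff)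
qed

text \<open>
  The lower bound on \<open>u\<close> removes the degenerate weight from the dissipation, and the Poincare inequality
  bounds what remains from below.
\<close>

lemma coercive:
  obtains \<kappa> where "0 < \<kappa>" "AE \<tau> in lebesgue. 0 < \<tau> \<longrightarrow> \<kappa> * deriv_norm2 L (u \<tau>) powr (\<alpha> + 1) \<le> diss L \<alpha> (u \<tau>)"
proof
  let ?p = "\<alpha> + 1" let ?K = "(L * sqrt L) powr (\<alpha> + 1) * L powr (\<alpha> + 1 - 1)"
  have K: "0 < ?K" using L by simp
  have c: "0 < positive_floor powr (\<alpha> + 2)" using positive_floor_pos by simp
  show "0 < positive_floor powr (\<alpha> + 2) / ?K" by (rule divide_pos_pos[OF c K])
  have "AE \<tau> in lebesgue. \<tau> \<in> {0<..<real n + 1} \<longrightarrow> u \<tau> \<in> sobolev_B L 3 ?p" for n :: nat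
    by (rule positive_weak_solution.uX[OF on_interval]) simp
  then have "AE \<tau> in lebesgue. \<forall>n::nat. \<tau> \<in> {0<..<real n + 1} \<longrightarrow> u \<tau> \<in> sobolev_B L 3 ?p"
    unfolding AE_all_countable by blast
  then show "AE \<tau> in lebesgue. 0 < \<tau> \<longrightarrow> positive_floor powr (\<alpha> + 2) / ?K * deriv_norm2 L (u \<tau>) powr ?p \<le> diss L \<alpha> (u \<tau>)"
  proof eventually_elim
    case (elim \<tau>)
    show ?case
    proof
      assume \<tau>: "0 < \<tau>"
      obtain n :: nat where "\<tau> < real n" using reals_Archimedean2 by blast
      then have v: "u \<tau> \<in> sobolev_B L 3 ?p" using elim \<tau> by (auto dest!: spec[of _ n])
      let ?I = "\<integral>x. \<bar>wderiv L 3 (u \<tau>) x\<bar> powr ?p \<partial>Om L"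
      have "deriv_norm2 L (u \<tau>) powr ?p \<le> ?K * ?I"
        by (rule poincare_third_derivative[OF L _ v]) (use \<alpha> in simp)
      then have "positive_floor powr (\<alpha> + 2) / ?K * deriv_norm2 L (u \<tau>) powr ?p \<le> positive_floor powr (\<alpha> + 2) / ?K * (?K * ?I)"
        using c K by (intro mult_left_mono) auto
      also have "\<dots> = positive_floor powr (\<alpha> + 2) * ?I" using K by simp
      also have "\<dots> = (\<integral>x. positive_floor powr (\<alpha> + 2) * \<bar>wderiv L 3 (u \<tau>) x\<bar> powr ?p \<partial>Om L)" by simp
      also have "\<dots> \<le> diss L \<alpha> (u \<tau>)"
        unfolding diss_def
      proof (rule integral_mono)
        show "integrable (Om L) (\<lambda>x. positive_floor powr (\<alpha> + 2) * \<bar>wderiv L 3 (u \<tau>) x\<bar> powr ?p)"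
          using sobolev_wderiv(2)[OF sobolev_BD[OF v] order_refl] by (simp add: LpM_def)
        show "integrable (Om L) (\<lambda>x. u \<tau> x powr (\<alpha> + 2) * \<bar>wderiv L 3 (u \<tau>) x\<bar> powr ?p)"
          using dissipation_eq(2)[OF \<alpha> v H1_continuous[OF u_H1]] \<tau> positive
          by (simp add: integrable_Om positive_on_def)
        fix x assume "x \<in> space (Om L)"
        then have "positive_floor powr (\<alpha> + 2) \<le> u \<tau> x powr (\<alpha> + 2)"
          using positive_floor_le[of \<tau> x] positive_floor_pos \<tau> \<alpha> by (intro powr_mono2) (auto simp: space_restrict_space)
        then show "positive_floor powr (\<alpha> + 2) * \<bar>wderiv L 3 (u \<tau>) x\<bar> powr ?p \<le> u \<tau> x powr (\<alpha> + 2) * \<bar>wderiv L 3 (u \<tau>) x\<bar> powr ?p"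
          by (rule mult_right_mono) simp
      qed
      finally show "positive_floor powr (\<alpha> + 2) / ?K * deriv_norm2 L (u \<tau>) powr ?p \<le> diss L \<alpha> (u \<tau>)" .
    qed
  qed
qed

lemma norm_le_M0: "0 \<le> t \<Longrightarrow> deriv_norm2 L (u t) \<le> M0 L u0 f"
proof -
  assume t: "0 \<le> t"
  let ?g = "\<lambda>t. deriv_norm2 L (f t)"
  have "integral {0..t} ?g = integral {0<..<t} ?g" by (simp add: integral_open_interval_real)
  also have "\<dots> \<le> integral {0<..} ?g"
    using g_integrable[OF order_refl, of t] source_norm g0
    by (intro integral_subset_le) (auto simp: integrable_on_open_interval_real absolutely_integrable_on_def)
  finally have "integral {0..t} ?g \<le> (LINT s:{0<..}|lebesgue. ?g s)"
    by (simp add: set_lebesgue_integral_eq_integral(2)[OF source_norm])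
  then show ?thesis using norm_bound[OF order_refl t] by (simp add: M0_def initial)
qed

lemma dissipation_nn_integral:
  assumes "0 \<le> s"
  shows "(\<integral>\<^sup>+\<tau>\<in>{s..t}. dissipation L \<alpha> (u \<tau>) \<partial>lebesgue) = ennreal (integral {s..t} (\<lambda>\<tau>. diss L \<alpha> (u \<tau>)))"
proof (rule set_nn_integral_eq[OF _ D_integrable[OF assms] D0])
  have "AE \<tau> in lebesgue. \<tau> \<in> {0<..<max t 0 + 1} \<longrightarrow> u \<tau> \<in> sobolev_B L 3 (\<alpha> + 1)"
    by (rule positive_weak_solution.uX[OF on_interval]) simp
  moreover have "AE \<tau> in lebesgue. \<tau> \<noteq> (0::real)" by (rule AE_lebesgue_neq)
  ultimately show "AE \<tau> in lebesgue. \<tau> \<in> {s..t} \<longrightarrow> dissipation L \<alpha> (u \<tau>) = ennreal (diss L \<alpha> (u \<tau>))"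
  proof eventually_elim
    case (elim \<tau>)
    then show ?case
      using assms positive by (auto intro!: dissipation_eq(1)[OF \<alpha>] H1_continuous u_H1 simp: positive_on_def)
  qed
qed simp

lemma energy_nn_integral:
  assumes "0 \<le> s"
  shows "(\<integral>\<^sup>+\<tau>\<in>{s..t}. energy L (u \<tau>) \<partial>lebesgue) = ennreal (integral {s..t} (\<lambda>\<tau>. (deriv_norm2 L (u \<tau>))\<^sup>2 / 2))"
proof (rule set_nn_integral_eq)
  show "(\<lambda>\<tau>. (deriv_norm2 L (u \<tau>))\<^sup>2 / 2) absolutely_integrable_on {s..t}"
    using assms by (intro absolutely_integrable_continuous_real continuous_intros y_continuous) auto
  show "AE \<tau> in lebesgue. \<tau> \<in> {s..t} \<longrightarrow> energy L (u \<tau>) = ennreal ((deriv_norm2 L (u \<tau>))\<^sup>2 / 2)"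
    using assms u_H1 by (intro AE_I2) (auto simp: H1_def intro!: energy_eq)
qed auto

end

section \<open>The decay estimates\<close>

lemma ennsqrt_mono: "a \<le> b \<Longrightarrow> ennsqrt a \<le> ennsqrt b"
  by (auto simp: ennsqrt_def top_unique less_top intro!: ennreal_leI enn2real_mono)

context energy_decay
begin

lemma source_nn_integral:
  assumes "0 \<le> s"
  shows "(\<integral>\<^sup>+\<tau>\<in>{s..t}. ennreal (g \<tau>) \<partial>lebesgue) = ennreal (integral {s..t} g)"
  by (rule set_nn_integral_eq[OF _ g_integrable[OF assms] g0]) auto

lemma memory_nn_integral:
  assumes "0 \<le> s"
  shows "(\<integral>\<^sup>+\<tau>\<in>{s/2..s}. ennreal (g \<tau> * exp (- (l * (s - \<tau>)))) \<partial>lebesgue) = ennreal (memory l s)"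
  unfolding memory_def
  by (rule set_nn_integral_eq[OF _ weighted_source_integrable]) (use assms g0 in auto)

lemma source_memory_Cauchy_Schwarz:
  assumes t: "0 < t"
  shows "ennreal (integral {t/4..t} (\<lambda>\<tau>. g \<tau> * memory l \<tau>)) \<le> ennsqrt (\<integral>\<^sup>+s\<in>{t/4..t}. ennreal ((g s)\<^sup>2) \<partial>lebesgue)
     * ennsqrt (\<integral>\<^sup>+s\<in>{t/4..t}. (\<integral>\<^sup>+\<tau>\<in>{s/2..s}. ennreal (g \<tau> * exp (- (l * (s - \<tau>)))) \<partial>lebesgue)\<^sup>2 \<partial>lebesgue)"
proof -
  have "(\<integral>\<^sup>+s\<in>{t/4..t}. (\<integral>\<^sup>+\<tau>\<in>{s/2..s}. ennreal (g \<tau> * exp (- (l * (s - \<tau>)))) \<partial>lebesgue)\<^sup>2 \<partial>lebesgue)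
      = (\<integral>\<^sup>+s\<in>{t/4..t}. ennreal ((memory l s)\<^sup>2) \<partial>lebesgue)"
  proof (rule nn_integral_cong)
    fix s
    show "(\<integral>\<^sup>+\<tau>\<in>{s/2..s}. ennreal (g \<tau> * exp (- (l * (s - \<tau>)))) \<partial>lebesgue)\<^sup>2 * indicator {t/4..t} s
      = ennreal ((memory l s)\<^sup>2) * indicator {t/4..t} s"
    proof (cases "s \<in> {t/4..t}")
      case True
      then have "0 \<le> s" using t by auto
      then show ?thesis by (simp only: memory_nn_integral ennreal_power memory_nonneg)
    qed simp
  qed
  moreover have "continuous_on {t/4..t} (memory l)"
    by (rule continuous_on_subset[OF memory_continuous[of t]]) (use t in auto)
  ultimately show ?thesis
    using t g0 memory_nonneg[of _ l]
    by (simp only:) (intro Cauchy_Schwarz_set_nn g_integrable g_memory_integrable absolutely_integrable_continuous_real, auto)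
qed

lemma source_Cauchy_Schwarz:
  assumes t: "0 < t"
  shows "ennreal (integral {t/2..t} g) \<le> ennsqrt (\<integral>\<^sup>+s\<in>{t/4..t}. ennreal ((g s)\<^sup>2) \<partial>lebesgue) * ennreal (sqrt (t / 2))"
proof -
  have g: "g absolutely_integrable_on {t/2..t}" using t by (intro g_integrable) auto
  have "ennreal (integral {t/2..t} (\<lambda>s. g s * 1)) \<le>
      ennsqrt (\<integral>\<^sup>+s\<in>{t/2..t}. ennreal ((g s)\<^sup>2) \<partial>lebesgue) * ennsqrt (\<integral>\<^sup>+s\<in>{t/2..t}. ennreal (1\<^sup>2) \<partial>lebesgue)"
    using g g0 by (intro Cauchy_Schwarz_set_nn) (auto intro: absolutely_integrable_continuous_real)
  also have "(\<integral>\<^sup>+s\<in>{t/2..t}. ennreal (1\<^sup>2) \<partial>lebesgue) = ennreal (integral {t/2..t} (\<lambda>s. 1))"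
    by (rule set_nn_integral_eq) (auto intro: absolutely_integrable_continuous_real)
  also have "ennsqrt \<dots> = ennreal (sqrt (t / 2))" using t by (simp add: ennsqrt_ennreal)
  also have "ennsqrt (\<integral>\<^sup>+s\<in>{t/2..t}. ennreal ((g s)\<^sup>2) \<partial>lebesgue) \<le> ennsqrt (\<integral>\<^sup>+s\<in>{t/4..t}. ennreal ((g s)\<^sup>2) \<partial>lebesgue)"
    using t by (intro ennsqrt_mono nn_integral_mono) (auto simp: indicator_def)
  finally show ?thesis by (simp add: mult_right_mono)
qed

end

context positive_global_solution
begin

lemma dissipation_by_energy:
  assumes t: "0 < t"
  shows "(\<integral>\<^sup>+s\<in>{t/2..t}. dissipation L \<alpha> (u s) \<partial>lebesgue)
      \<le> ennreal (4 / t) * (\<integral>\<^sup>+s\<in>{t/4..t/2}. energy L (u s) \<partial>lebesgue)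
        + ennreal 4 * ennsqrt (\<integral>\<^sup>+s\<in>{t/4..t}. ennreal ((deriv_norm2 L (f s))\<^sup>2) \<partial>lebesgue)
            * ennsqrt (\<integral>\<^sup>+s\<in>{t/4..t}. energy L (u s) \<partial>lebesgue)"
proof -
  let ?y = "\<lambda>t. deriv_norm2 L (u t)" and ?g = "\<lambda>t. deriv_norm2 L (f t)"
  let ?G = "ennsqrt (\<integral>\<^sup>+s\<in>{t/4..t}. ennreal ((?g s)\<^sup>2) \<partial>lebesgue)"
  define e where "e = integral {t/4..t} (\<lambda>s. (?y s)\<^sup>2 / 2)"
  have yi: "?y absolutely_integrable_on {t/4..t}" "(\<lambda>s. (?y s)\<^sup>2) absolutely_integrable_on {t/4..t}"
    using t by (auto intro!: absolutely_integrable_continuous_real continuous_intros y_continuous)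
  have e2: "integral {t/4..t} (\<lambda>s. (?y s)\<^sup>2) = 2 * e" by (simp add: e_def)
  have e0: "0 \<le> e"
    using yi(2) unfolding e_def
    by (intro Henstock_Kurzweil_Integration.integral_nonneg) (auto simp: absolutely_integrable_on_def)
  have E0: "0 \<le> integral {t/4..t/2} (\<lambda>s. (?y s)\<^sup>2 / 2)"
    using t by (intro Henstock_Kurzweil_Integration.integral_nonneg integrable_continuous_real continuous_intros y_continuous) auto
  have Y0: "0 \<le> integral {t/4..t} (\<lambda>\<tau>. ?y \<tau> * ?g \<tau>)"
    using t yg_integrable[of "t/4" t] y0 g0
    by (intro Henstock_Kurzweil_Integration.integral_nonneg) (auto simp: absolutely_integrable_on_def)
  have "ennreal (integral {t/4..t} (\<lambda>\<tau>. ?y \<tau> * ?g \<tau>)) = ennreal (integral {t/4..t} (\<lambda>\<tau>. ?g \<tau> * ?y \<tau>))"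
    by (simp add: mult.commute)
  also have "\<dots> \<le> ?G * ennsqrt (\<integral>\<^sup>+s\<in>{t/4..t}. ennreal ((?y s)\<^sup>2) \<partial>lebesgue)"
    using t yi(1) g_integrable[of "t/4" t] yg_integrable[of "t/4" t] y0 g0
    by (intro Cauchy_Schwarz_set_nn) (auto simp: mult.commute)
  also have "(\<integral>\<^sup>+s\<in>{t/4..t}. ennreal ((?y s)\<^sup>2) \<partial>lebesgue) = ennreal (2 * e)"
    unfolding e2[symmetric] using yi(2) by (intro set_nn_integral_eq) auto
  also have "ennsqrt (ennreal (2 * e)) \<le> ennreal (4 * sqrt e)"
  proof -
    have "sqrt 2 \<le> (4::real)" by (intro real_le_lsqrt) auto
    then show ?thesis using e0 by (simp add: ennsqrt_ennreal real_sqrt_mult ennreal_leI mult_right_mono)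
  qed
  also have "?G * ennreal (4 * sqrt e) = ennreal 4 * ?G * ennsqrt (ennreal e)"
    using e0 by (simp add: ennsqrt_ennreal ennreal_mult mult_ac)
  finally have Y: "ennreal (integral {t/4..t} (\<lambda>\<tau>. ?y \<tau> * ?g \<tau>)) \<le> ennreal 4 * ?G * ennsqrt (ennreal e)"
    by (simp add: mult_left_mono)
  have "(\<integral>\<^sup>+s\<in>{t/2..t}. dissipation L \<alpha> (u s) \<partial>lebesgue) = ennreal (integral {t/2..t} (\<lambda>s. diss L \<alpha> (u s)))"
    using t by (intro dissipation_nn_integral) auto
  also have "\<dots> \<le> ennreal (4 / t * integral {t/4..t/2} (\<lambda>s. (?y s)\<^sup>2 / 2) + integral {t/4..t} (\<lambda>\<tau>. ?y \<tau> * ?g \<tau>))"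
    by (rule ennreal_leI[OF averaged_dissipation[OF t]])
  also have "\<dots> = ennreal (4 / t) * ennreal (integral {t/4..t/2} (\<lambda>s. (?y s)\<^sup>2 / 2)) + ennreal (integral {t/4..t} (\<lambda>\<tau>. ?y \<tau> * ?g \<tau>))"
    using t E0 Y0 by (subst ennreal_plus) (auto simp flip: ennreal_mult)
  also have "\<dots> \<le> ennreal (4 / t) * ennreal (integral {t/4..t/2} (\<lambda>s. (?y s)\<^sup>2 / 2)) + ennreal 4 * ?G * ennsqrt (ennreal e)"
    by (rule add_left_mono[OF Y])
  finally show ?thesis using t by (simp add: energy_nn_integral e_def)
qed

lemma dissipation_power_decay:
  assumes a: "1 < \<alpha>" and M: "0 < M0 L u0 f"
    and \<kappa>: "0 < \<kappa>" "AE \<tau> in lebesgue. 0 < \<tau> \<longrightarrow> \<kappa> * deriv_norm2 L (u \<tau>) powr (\<alpha> + 1) \<le> diss L \<alpha> (u \<tau>)"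
    and t: "0 < t"
  shows "(\<integral>\<^sup>+s\<in>{t/2..t}. dissipation L \<alpha> (u s) \<partial>lebesgue)
            \<le> ennreal (3/2 * (M0 L u0 f)\<^sup>2
                  * (1 + (\<alpha> - 1) * \<kappa> / 4 * M0 L u0 f powr (\<alpha> - 1) * t) powr (2 / (1 - \<alpha>)))
              + ennreal (1/2) * (\<integral>\<^sup>+s\<in>{t/2..t}. ennreal (deriv_norm2 L (f s)) \<partial>lebesgue)\<^sup>2
              + ennreal 2
                * ennsqrt (\<integral>\<^sup>+s\<in>{t/4..t}. ennreal ((deriv_norm2 L (f s))\<^sup>2) \<partial>lebesgue)
                * ennsqrt (\<integral>\<^sup>+s\<in>{t/4..t}.
                    (\<integral>\<^sup>+\<tau>\<in>{s/2..s}. ennreal (deriv_norm2 L (f \<tau>)) \<partial>lebesgue)\<^sup>2 \<partial>lebesgue)"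
proof -
  let ?M = "M0 L u0 f" and ?g = "\<lambda>t. deriv_norm2 L (f t)"
  define P where "P = 1 + (\<alpha> - 1) * \<kappa> / 4 * ?M powr (\<alpha> - 1) * t"
  define I where "I = integral {t/4..t} (\<lambda>\<tau>. ?g \<tau> * memory 0 \<tau>)"
  have P: "(?M * P powr (1 / (1 - \<alpha>)))\<^sup>2 = ?M\<^sup>2 * P powr (2 / (1 - \<alpha>))"
    by (simp add: power_mult_distrib power2_eq_square flip: powr_add)
  have I0: "0 \<le> I"
    unfolding I_def using t g_memory_integrable[where s = "t/4" and l = 0 and t = t] g0 memory_nonneg[of _ 0]
    by (intro Henstock_Kurzweil_Integration.integral_nonneg) (auto simp: absolutely_integrable_on_def)
  have g: "0 \<le> integral {t/2..t} ?g"
    using t g_integrable[of "t/2" t] g0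
    by (intro Henstock_Kurzweil_Integration.integral_nonneg) (auto simp: absolutely_integrable_on_def)
  have "(\<integral>\<^sup>+s\<in>{t/2..t}. dissipation L \<alpha> (u s) \<partial>lebesgue) = ennreal (integral {t/2..t} (\<lambda>s. diss L \<alpha> (u s)))"
    using t by (intro dissipation_nn_integral) auto
  also have "\<dots> \<le> ennreal (3/2 * (?M\<^sup>2 * P powr (2 / (1 - \<alpha>))) + 1/2 * (integral {t/2..t} ?g)\<^sup>2 + 2 * I)"
    using power_decay[OF a \<kappa> norm_le_M0 M t] unfolding P_def[symmetric] I_def[symmetric] P by (rule ennreal_leI)
  also have "\<dots> = ennreal (3/2 * ?M\<^sup>2 * P powr (2 / (1 - \<alpha>))) + ennreal (1/2) * (ennreal (integral {t/2..t} ?g))\<^sup>2 + ennreal 2 * ennreal I"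
  proof -
    have "ennreal (1/2 * (integral {t/2..t} ?g)\<^sup>2) = ennreal (1/2) * (ennreal (integral {t/2..t} ?g))\<^sup>2"
      using ennreal_mult[of "1/2" "(integral {t/2..t} ?g)\<^sup>2"] g by (simp only: ennreal_power) simp
    moreover have "ennreal (2 * I) = ennreal 2 * ennreal I" using I0 by (intro ennreal_mult) auto
    moreover have "ennreal (a + b + c) = ennreal a + ennreal b + ennreal c" if "0 \<le> a" "0 \<le> b" "0 \<le> c" for a b c :: real
      using that by (simp add: ennreal_plus)
    ultimately show ?thesis using I0 by (simp only: mult.assoc) simp
  qed
  also have "ennreal 2 * ennreal I \<le> ennreal 2 * (ennsqrt (\<integral>\<^sup>+s\<in>{t/4..t}. ennreal ((?g s)\<^sup>2) \<partial>lebesgue)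
                * ennsqrt (\<integral>\<^sup>+s\<in>{t/4..t}. (\<integral>\<^sup>+\<tau>\<in>{s/2..s}. ennreal (?g \<tau>) \<partial>lebesgue)\<^sup>2 \<partial>lebesgue))"
    unfolding I_def using source_memory_Cauchy_Schwarz[OF t, of 0] by (intro mult_left_mono) auto
  finally show ?thesis using t by (simp only: P_def mult.assoc source_nn_integral add_left_mono)
qed

lemma dissipation_exponential_decay:
  assumes a: "\<alpha> \<le> 1" and M: "0 < M0 L u0 f"
    and \<kappa>: "0 < \<kappa>" "AE \<tau> in lebesgue. 0 < \<tau> \<longrightarrow> \<kappa> * deriv_norm2 L (u \<tau>) powr (\<alpha> + 1) \<le> diss L \<alpha> (u \<tau>)"
    and t: "0 < t"
  shows "(\<integral>\<^sup>+s\<in>{t/2..t}. dissipation L \<alpha> (u s) \<partial>lebesgue)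
            \<le> ennreal (1 * (M0 L u0 f)\<^sup>2 * exp (- (\<kappa> / 2 * M0 L u0 f powr (\<alpha> - 1) * t)))
              + ennreal (2 / sqrt (\<kappa> * M0 L u0 f powr (\<alpha> - 1)) * M0 L u0 f * exp (- (\<kappa> / 8 * M0 L u0 f powr (\<alpha> - 1) * t)))
                * ennsqrt (\<integral>\<^sup>+s\<in>{t/4..t}. ennreal ((deriv_norm2 L (f s))\<^sup>2) \<partial>lebesgue)
              + ennreal 2
                * ennsqrt (\<integral>\<^sup>+s\<in>{t/4..t}. ennreal ((deriv_norm2 L (f s))\<^sup>2) \<partial>lebesgue)
                * ennsqrt (\<integral>\<^sup>+s\<in>{t/4..t}.
                    (\<integral>\<^sup>+\<tau>\<in>{s/2..s}. ennreal (deriv_norm2 L (f \<tau>)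
                      * exp (- (\<kappa> * M0 L u0 f powr (\<alpha> - 1) * (s - \<tau>)))) \<partial>lebesgue)\<^sup>2 \<partial>lebesgue)"
proof -
  let ?M = "M0 L u0 f" and ?g = "\<lambda>t. deriv_norm2 L (f t)"
  let ?G = "ennsqrt (\<integral>\<^sup>+s\<in>{t/4..t}. ennreal ((?g s)\<^sup>2) \<partial>lebesgue)"
  define l where "l = \<kappa> * ?M powr (\<alpha> - 1)"
  have l: "0 < l" using \<kappa> M by (simp add: l_def)
  define I where "I = integral {t/4..t} (\<lambda>\<tau>. ?g \<tau> * memory l \<tau>)"
  have I0: "0 \<le> I"
    unfolding I_def using t g_memory_integrable[where s = "t/4" and l = l and t = t] g0 memory_nonneg[of _ l]
    by (intro Henstock_Kurzweil_Integration.integral_nonneg) (auto simp: absolutely_integrable_on_def)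
  have g: "0 \<le> integral {t/2..t} ?g"
    using t g_integrable[of "t/2" t] g0
    by (intro Henstock_Kurzweil_Integration.integral_nonneg) (auto simp: absolutely_integrable_on_def)
  have sq: "(?M * exp (- (l * t / 4)))\<^sup>2 = ?M\<^sup>2 * exp (- (\<kappa> / 2 * ?M powr (\<alpha> - 1) * t))"
    by (simp add: power_mult_distrib l_def flip: exp_double)
  \<comment> \<open>half of the rate \<open>l / 4\<close> is spent on the factor \<open>\<surd>(t / 2)\<close>\<close>
  have e: "?M * exp (- (l * t / 4)) * sqrt (t / 2) \<le> 2 / sqrt l * ?M * exp (- (\<kappa> / 8 * ?M powr (\<alpha> - 1) * t))"
  proof -
    define x where "x = l * t / 8"
    have x: "0 \<le> x" "l * t / 4 = x + x" "\<kappa> / 8 * ?M powr (\<alpha> - 1) * t = x" "t / 2 = 4 / l * x"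
      using l t by (auto simp: x_def l_def)
    have "sqrt (t / 2) = 2 / sqrt l * sqrt x" unfolding x(4) real_sqrt_mult real_sqrt_divide by simp
    then have "?M * exp (- (l * t / 4)) * sqrt (t / 2) = (2 / sqrt l * ?M * exp (- x)) * (sqrt x * exp (- x))"
      using exp_add[of "- x" "- x"] unfolding x(2) by (simp add: mult_ac)
    also have "\<dots> \<le> (2 / sqrt l * ?M * exp (- x)) * 1"
      using sqrt_le_exp[OF x(1)] l M by (intro mult_left_mono) auto
    finally show ?thesis by (simp only: x(3) mult_1_right)
  qed
  have "(\<integral>\<^sup>+s\<in>{t/2..t}. dissipation L \<alpha> (u s) \<partial>lebesgue) = ennreal (integral {t/2..t} (\<lambda>s. diss L \<alpha> (u s)))"
    using t by (intro dissipation_nn_integral) auto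
  also have "\<dots> \<le> ennreal ((?M * exp (- (l * t / 4)))\<^sup>2 + ?M * exp (- (l * t / 4)) * integral {t/2..t} ?g + 2 * I)"
    using exponential_decay[OF \<alpha> a \<kappa> norm_le_M0 M t l_def] unfolding I_def[symmetric] by (rule ennreal_leI)
  also have "\<dots> = ennreal ((?M * exp (- (l * t / 4)))\<^sup>2) + ennreal (?M * exp (- (l * t / 4))) * ennreal (integral {t/2..t} ?g) + ennreal 2 * ennreal I"
    using I0 g M by (simp add: ennreal_plus ennreal_mult)
  also have "ennreal (?M * exp (- (l * t / 4))) * ennreal (integral {t/2..t} ?g) \<le>
      ennreal (2 / sqrt l * ?M * exp (- (\<kappa> / 8 * ?M powr (\<alpha> - 1) * t))) * ?G"
  proof -
    have "ennreal (?M * exp (- (l * t / 4))) * ennreal (integral {t/2..t} ?g) \<le> ennreal (?M * exp (- (l * t / 4))) * (?G * ennreal (sqrt (t / 2)))"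
      using source_Cauchy_Schwarz[OF t] by (intro mult_left_mono) auto
    also have "\<dots> = ennreal (?M * exp (- (l * t / 4)) * sqrt (t / 2)) * ?G"
      using M t by (simp add: ennreal_mult mult_ac)
    also have "\<dots> \<le> ennreal (2 / sqrt l * ?M * exp (- (\<kappa> / 8 * ?M powr (\<alpha> - 1) * t))) * ?G"
      by (intro mult_right_mono ennreal_leI e) auto
    finally show ?thesis .
  qed
  also have "ennreal 2 * ennreal I \<le> ennreal 2 * (?G
      * ennsqrt (\<integral>\<^sup>+s\<in>{t/4..t}. (\<integral>\<^sup>+\<tau>\<in>{s/2..s}. ennreal (?g \<tau> * exp (- (l * (s - \<tau>)))) \<partial>lebesgue)\<^sup>2 \<partial>lebesgue))"
    unfolding I_def using source_memory_Cauchy_Schwarz[OF t, of l] by (intro mult_left_mono) auto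
  finally show ?thesis
    unfolding sq unfolding l_def mult_1 mult.assoc[of "ennreal 2"] by (simp only: add_left_mono add_right_mono)
qed

end

lemma add_middle_mono: "x \<le> A + B \<Longrightarrow> x \<le> A + C + (B::ennreal)"
  by (metis (no_types, lifting) add.commute add.left_commute add_increasing zero_le)

theorem theorem4p3:
  fixes \<alpha> L :: real and u0 :: "real \<Rightarrow> real" and f u :: "real \<Rightarrow> real \<Rightarrow> real"
  assumes "0 < L" and "0 < \<alpha>"
    and "u0 \<in> H1 L" and "\<And>x. x \<in> {0<..<L} \<Longrightarrow> 0 < u0 x"
    and "(\<lambda>(t, x). f t x) \<in> Lp ((\<alpha> + 1) / \<alpha>) ({0<..} \<times> {0<..<L})"
    and "(\<lambda>(t, x). f t x) \<in> Lp 1 ({0<..} \<times> {0<..<L})"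
    and "deriv_norm2 L u0 < L powr (- 1 / 2) * mean_value L u0"
    and "\<And>t. 0 < t \<Longrightarrow> f t \<in> sobolev L 1 2"
    and "\<And>t. 0 < t \<Longrightarrow>
           deriv_norm2 L (f t) \<le> L powr (- 3 / 2) * (LINT x:{0<..<L}|lebesgue. f t x)"
    and "global_weak_solution \<alpha> L u0 (\<lambda>t. functional_of L (f t)) u"
    and "positive_on L u"
  shows "(\<exists>C>0. \<forall>t>0.
      (\<integral>\<^sup>+s\<in>{t/2..t}. dissipation L \<alpha> (u s) \<partial>lebesgue)
      \<le> ennreal (C / t) * (\<integral>\<^sup>+s\<in>{t/4..t/2}. energy L (u s) \<partial>lebesgue)
        + ennreal C * ennsqrt (\<integral>\<^sup>+s\<in>{t/4..t}. ennreal ((deriv_norm2 L (f s))\<^sup>2) \<partial>lebesgue)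
            * ennsqrt (\<integral>\<^sup>+s\<in>{t/4..t}. energy L (u s) \<partial>lebesgue))
    \<and> set_integrable lebesgue {0<..} (\<lambda>s. deriv_norm2 L (f s))
    \<and> (0 < M0 L u0 f \<longrightarrow>
        (1 < \<alpha> \<longrightarrow>
          (\<exists>C1>0. \<exists>C2>0. \<exists>C3>0. \<exists>C4>0. \<exists>C5>0. \<exists>C6>0. \<forall>t>0.
            (\<integral>\<^sup>+s\<in>{t/2..t}. dissipation L \<alpha> (u s) \<partial>lebesgue)
            \<le> ennreal (C1 * (M0 L u0 f)\<^sup>2
                  * (1 + C2 * M0 L u0 f powr (\<alpha> - 1) * t) powr (2 / (1 - \<alpha>)))
              + ennreal C3 * (\<integral>\<^sup>+s\<in>{t/2..t}. ennreal (deriv_norm2 L (f s)) \<partial>lebesgue)\<^sup>2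
              + ennreal (C4 * M0 L u0 f
                  * (1 + C5 * M0 L u0 f powr (\<alpha> - 1) * t) powr ((3 - \<alpha>) / (1 - \<alpha>)))
                * ennsqrt (\<integral>\<^sup>+s\<in>{t/4..t}. ennreal ((deriv_norm2 L (f s))\<^sup>2) \<partial>lebesgue)
              + ennreal C6
                * ennsqrt (\<integral>\<^sup>+s\<in>{t/4..t}. ennreal ((deriv_norm2 L (f s))\<^sup>2) \<partial>lebesgue)
                * ennsqrt (\<integral>\<^sup>+s\<in>{t/4..t}.
                    (\<integral>\<^sup>+\<tau>\<in>{s/2..s}. ennreal (deriv_norm2 L (f \<tau>)) \<partial>lebesgue)\<^sup>2 \<partial>lebesgue)))
      \<and> (\<alpha> \<le> 1 \<longrightarrow>
          (\<exists>C1>0. \<exists>C2>0. \<exists>C3>0. \<exists>C4>0. \<exists>C5>0. \<exists>C6>0. \<exists>C7>0. \<exists>C8>0. \<forall>t>0.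
            (\<integral>\<^sup>+s\<in>{t/2..t}. dissipation L \<alpha> (u s) \<partial>lebesgue)
            \<le> ennreal (C1 * (M0 L u0 f)\<^sup>2 * exp (- (C2 * M0 L u0 f powr (\<alpha> - 1) * t)))
              + ennreal C3 * (\<integral>\<^sup>+s\<in>{t/2..t}. ennreal (deriv_norm2 L (f s)
                  * exp (- (C4 * M0 L u0 f powr (\<alpha> - 1) * (t - s)))) \<partial>lebesgue)\<^sup>2
              + ennreal (C5 * M0 L u0 f * exp (- (C6 * M0 L u0 f powr (\<alpha> - 1) * t)))
                * ennsqrt (\<integral>\<^sup>+s\<in>{t/4..t}. ennreal ((deriv_norm2 L (f s))\<^sup>2) \<partial>lebesgue)
              + ennreal C7
                * ennsqrt (\<integral>\<^sup>+s\<in>{t/4..t}. ennreal ((deriv_norm2 L (f s))\<^sup>2) \<partial>lebesgue)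
                * ennsqrt (\<integral>\<^sup>+s\<in>{t/4..t}.
                    (\<integral>\<^sup>+\<tau>\<in>{s/2..s}. ennreal (deriv_norm2 L (f \<tau>)
                      * exp (- (C8 * M0 L u0 f powr (\<alpha> - 1) * (s - \<tau>)))) \<partial>lebesgue)\<^sup>2 \<partial>lebesgue))))"
    (is "?averaged \<and> ?integrable \<and> (?nontrivial \<longrightarrow> (1 < \<alpha> \<longrightarrow> ?power) \<and> (\<alpha> \<le> 1 \<longrightarrow> ?exponential))")
proof -
  interpret positive_global_solution \<alpha> L u0 f u
    using assms by unfold_locales
  obtain \<kappa> where \<kappa>: "0 < \<kappa>" "AE \<tau> in lebesgue. 0 < \<tau> \<longrightarrow> \<kappa> * deriv_norm2 L (u \<tau>) powr (\<alpha> + 1) \<le> diss L \<alpha> (u \<tau>)"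
    by (rule coercive)
  have ?averaged using dissipation_by_energy by (intro exI[of _ 4]) auto
  moreover have ?integrable by (rule source_norm)
  moreover have ?power if M: "0 < M0 L u0 f" and a: "1 < \<alpha>"
  proof (intro exI conjI allI impI)
    fix t :: real assume "0 < t"
    from dissipation_power_decay[OF a M \<kappa> this] show
      "(\<integral>\<^sup>+s\<in>{t/2..t}. dissipation L \<alpha> (u s) \<partial>lebesgue)
            \<le> ennreal (3/2 * (M0 L u0 f)\<^sup>2
                  * (1 + (\<alpha> - 1) * \<kappa> / 4 * M0 L u0 f powr (\<alpha> - 1) * t) powr (2 / (1 - \<alpha>)))
              + ennreal (1/2) * (\<integral>\<^sup>+s\<in>{t/2..t}. ennreal (deriv_norm2 L (f s)) \<partial>lebesgue)\<^sup>2
              + ennreal (1 * M0 L u0 f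
                  * (1 + 1 * M0 L u0 f powr (\<alpha> - 1) * t) powr ((3 - \<alpha>) / (1 - \<alpha>)))
                * ennsqrt (\<integral>\<^sup>+s\<in>{t/4..t}. ennreal ((deriv_norm2 L (f s))\<^sup>2) \<partial>lebesgue)
              + ennreal 2
                * ennsqrt (\<integral>\<^sup>+s\<in>{t/4..t}. ennreal ((deriv_norm2 L (f s))\<^sup>2) \<partial>lebesgue)
                * ennsqrt (\<integral>\<^sup>+s\<in>{t/4..t}.
                    (\<integral>\<^sup>+\<tau>\<in>{s/2..s}. ennreal (deriv_norm2 L (f \<tau>)) \<partial>lebesgue)\<^sup>2 \<partial>lebesgue)"
      by (rule add_middle_mono)
  qed (use a \<kappa> in auto)
  moreover have ?exponential if M: "0 < M0 L u0 f" and a: "\<alpha> \<le> 1"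
  proof (intro exI conjI allI impI)
    fix t :: real assume "0 < t"
    from dissipation_exponential_decay[OF a M \<kappa> this] show
      "(\<integral>\<^sup>+s\<in>{t/2..t}. dissipation L \<alpha> (u s) \<partial>lebesgue)
            \<le> ennreal (1 * (M0 L u0 f)\<^sup>2 * exp (- (\<kappa> / 2 * M0 L u0 f powr (\<alpha> - 1) * t)))
              + ennreal 1 * (\<integral>\<^sup>+s\<in>{t/2..t}. ennreal (deriv_norm2 L (f s)
                  * exp (- (1 * M0 L u0 f powr (\<alpha> - 1) * (t - s)))) \<partial>lebesgue)\<^sup>2
              + ennreal (2 / sqrt (\<kappa> * M0 L u0 f powr (\<alpha> - 1)) * M0 L u0 f * exp (- (\<kappa> / 8 * M0 L u0 f powr (\<alpha> - 1) * t)))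
                * ennsqrt (\<integral>\<^sup>+s\<in>{t/4..t}. ennreal ((deriv_norm2 L (f s))\<^sup>2) \<partial>lebesgue)
              + ennreal 2
                * ennsqrt (\<integral>\<^sup>+s\<in>{t/4..t}. ennreal ((deriv_norm2 L (f s))\<^sup>2) \<partial>lebesgue)
                * ennsqrt (\<integral>\<^sup>+s\<in>{t/4..t}.
                    (\<integral>\<^sup>+\<tau>\<in>{s/2..s}. ennreal (deriv_norm2 L (f \<tau>)
                      * exp (- (\<kappa> * M0 L u0 f powr (\<alpha> - 1) * (s - \<tau>)))) \<partial>lebesgue)\<^sup>2 \<partial>lebesgue)"
      by (rule order_trans[OF _ add_right_mono[OF add_middle_mono[OF order_refl]]])
  qed (use M \<kappa> in auto)
  ultimately show ?thesis by blast
qed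

end
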